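(* Let $\gamma$ be a Jordan curve of $\mathbb{R}^2$ of class $\mathcal{C}_1$ enclosing a connected, compact and bounded set $\Omega$, let $s\in\gamma$, let $r>0$ be sufficiently small that $\partial B(s,r)\cap\gamma$ contains exactly two points $x_0,x_1$ ($x_0,s,x_1$ arranged counterclockwise), let $\theta_0,\theta_1\in[0,2\pi]$ be the corresponding angles, and let $\nu_N$ be probability measures on initial configurations $\sigma$, all as in the initial condition described in the context (Hausdorff convergence in probability near $s$, and monotonicity near $s$). Suppose that for $r$ sufficiently small and for $k=0,1$ the following limits exist and coincide: $$\lim_{\delta\to0}\liminf_{N\to+\infty}\frac1{\delta N}\nu_N(C_N(x_k,\delta))=\lim_{\delta\to0}\limsup_{N\to+\infty}\frac1{\delta N}\nu_N(C_N(x_k,\delta))=C(\theta_k).$$ Then $$\lim_{\delta\to0}\liminf_{N\to+\infty}\nu_N\big(\mathbf{A}_N^{\sigma,\gamma}(s,r,\delta)\big)=\lim_{\delta\to0}\limsup_{N\to+\infty}\nu_N\big(\mathbf{A}_N^{\sigma,\gamma}(s,r,\delta)\big),$$ and the common value is $$-\tfrac12\,\mathrm{sgn}(\tan\theta_0)\Big(\cos^2\theta_0+C(\theta_0)\big(|\sin\theta_0|-|\cos\theta_0|\big)\Big)+\tfrac12\,\mathrm{sgn}(\tan\theta_1)\Big(\cos^2\theta_1+C(\theta_1)\big(|\sin\theta_1|-|\cos\theta_1|\big)\Big)$$ $$+\ \mathbf{1}_{\sin\theta_0\sin\theta_1>0}\Big(\mathrm{sgn}(\theta_1-\theta_0)\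,\mathbf{1}_{\cos\theta_0\cos\theta_1>0}+\mathrm{sgn}(\tan\theta_0)\,\mathbf{1}_{\cos\theta_0\cos\theta_1<0}\Big).$$
   Context: Boxes. For $N\ge1$ and $x=(x_1,x_2)\in\mathbb{Z}^2$, $\Lambda_{x/N}=\{(u_1,u_2)\in\mathbb{R}^2: -\frac1{2N}\le u_i-\frac{x_i}{N}<\frac1{2N},\ i=1,2\}$. For a bounded set $S\subset\mathbb{R}^2$, $S_N$ is the union of all boxes $\Lambda_{x/N}$, $x\in\mathbb{Z}^2$, with $\Lambda_{x/N}\cap S\ne\emptyset$. Dynamics. $(\sigma_t)_{t\ge0}$ is the zero-temperature 2D stochastic Ising model: the continuous-time Markov process on $\{-1,+1\}^{\mathbb{Z}^2}$ with generator $(Lf)(\sigma)=\sum_{x\in\mathbb{Z}^2}c(x,\sigma)(f(\sigma^x)-f(\sigma))$ on local functions, where $\sigma^x$ is $\sigma$ with the spin at $x$ flipped, and $c(x,\sigma)$ equals $1$ if more than 2 of the 4 nearest neighbours of $x$ have spin opposite to $\sigma(x)$, $\frac12$ if exactly 2 do, and $0$ otherwise. $\mathbb{E}_\sigma$ is the expectation for the process started from $\sigma$. Droplet. $\mathcal{A}^{\sigma}_N=\bigcup_{x\in\mathbb{Z}^2,\ \sigma(x)=+1}\Lambda_{x/N}$; $\mathrm{vol}$ is planar Lebesgue measure. Averaged drift. $B(p,\rho)$ is the closed Euclidean ball. For $s\in\gamma$ and $r>0$ so small that $\partial B(s,r)\cap\gamma$ consists of exactly two points $x_0,x_1$ ($x_0,s,x_1$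 arranged counterclockwise), put $\mathcal{S}(s,r,\alpha_1,\alpha_2)=B(s,r)\cup B(x_0,\alpha_1)\cup B(x_1,\alpha_2)$, $\mathcal{S}_N=(\mathcal{S}(s,r,\alpha_1,\alpha_2))_N$, $$L_N^{\sigma,\gamma}(s,r,\alpha_1,\alpha_2)=\lim_{t\to0}\frac1t\Big(\mathbb{E}_\sigma\big(\mathrm{vol}(\mathcal{A}_N^{\sigma_{tN^2}}\cap\mathcal{S}_N)\big)-\mathrm{vol}(\mathcal{A}_N^\sigma\cap\mathcal{S}_N)\Big),$$ $$\mathbf{A}_N^{\sigma,\gamma}(s,r,\delta)=\frac1{\delta^2}\int_0^\delta\int_0^\delta L_N^{\sigma,\gamma}(s,r,\alpha_1,\alpha_2)\,d\alpha_1\,d\alpha_2.$$ Angles. $\theta_0$ (resp. $\theta_1$) $\in[0,2\pi]$ is the oriented angle between the half horizontal axis $[0,+\infty[$ and the tangent $T_{x_0}\gamma$ (resp. $T_{x_1}\gamma$) to $\gamma$ at $x_0$ (resp. $x_1$), the tangent being directed away from $s$ along the arc: clockwise along $\gamma$ at $x_0$, counterclockwise at $x_1$. Initial condition. $\sigma$ is random with law $\nu_N$ ($\nu_N(X)$ also denotes the expectation of $X$). There is a neighbourhood $V_s$ of $s$ such that: (1) for all $\varepsilon>0$, $\lim_{N\to+\infty}\nu_N\big(d_H(\mathcal{A}_N^\sigma\cap V_s,\Omega\cap V_s)\ge\varepsilon\big)=0$, where $d_H(A,B)=\max(\sup_{a\in A}d(a,B),\sup_{b\in B}d(b,A))$ is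 the Hausdorff distance and $d(a,B)=\inf_{b\in B}|a-b|$; (2) with probability one, the boundaries $\gamma$ and $\partial\mathcal{A}_N^\sigma$ are, in $V_s$, either both non-increasing or both non-decreasing. Corners. For $\sigma$ and $y\in\mathbb{Z}^2$, $n(\sigma,y)$ is the number of nearest neighbours of $y$ whose spin is opposite to $\sigma(y)$. For $x\in\gamma\cap V_s$ and $\delta>0$, $C_N(x,\delta)$ is the number of $y\in\mathbb{Z}^2$ with $\frac yN\in(B(x,\delta))_N\setminus B(s,|x-s|)$, $\sigma(y)=+1$ and $n(\sigma,y)=2$. $\mathrm{sgn}$ denotes the sign.
   Formalization: Two conditions are added because the claim fails without them: for small r and δ the averaged drifts A_N are uniformly ν_N-integrable in N, and the conclusion is asserted only when sin θ_k and cos θ_k are nonzero for k=0,1 (tan θ_k defined and nonzero). *)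

theory Defs
  imports "HOL-Probability.Probability" "HOL-Complex_Analysis.Complex_Analysis"
begin

text \<open>The plane is identified with \<^typ>\<open>complex\<close>. In a configuration, \<^term>\<open>True\<close> stands for
  the spin +1 and \<^term>\<open>False\<close> for the spin -1.\<close>

type_synonym config = "int \<times> int \<Rightarrow> bool"

definition nbrs :: "int \<times> int \<Rightarrow> (int \<times> int) set" where
  "nbrs x = {(fst x + 1, snd x), (fst x - 1, snd x), (fst x, snd x + 1), (fst x, snd x - 1)}"

definition opposite :: "config \<Rightarrow> int \<times> int \<Rightarrow> nat" where
  "opposite \<sigma> x = card {y \<in> nbrs x. \<sigma> y \<noteq> \<sigma> x}"

definition rate :: "int \<times> int \<Rightarrow> config \<Rightarrow> real" where
  "rate x \<sigma> = (if opposite \<sigma> x > 2 then 1 else if opposite \<sigma> x = 2 then 1/2 else 0)"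

definition flip :: "config \<Rightarrow> int \<times> int \<Rightarrow> config" where
  "flip \<sigma> x = \<sigma>(x := \<not> \<sigma> x)"

definition local_fun :: "(config \<Rightarrow> real) \<Rightarrow> bool" where
  "local_fun f \<longleftrightarrow> (\<exists>F. finite F \<and> (\<forall>\<sigma> \<eta>. (\<forall>x\<in>F. \<sigma> x = \<eta> x) \<longrightarrow> f \<sigma> = f \<eta>))"

text \<open>For local functions the sum has only finitely many nonzero terms.\<close>

definition generator :: "(config \<Rightarrow> real) \<Rightarrow> config \<Rightarrow> real" where
  "generator f \<sigma> = (\<Sum>\<^sub>\<infinity>x. rate x \<sigma> * (f (flip \<sigma> x) - f \<sigma>))"

definition config_M :: "config measure" where
  "config_M = Pi\<^sub>M UNIV (\<lambda>_. count_space UNIV)"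

text \<open>A Feller process with cadlag paths: \<open>P \<sigma>\<close> is the law of the process started from \<open>\<sigma>\<close>. The
  topology on configurations in \<open>feller\<close> is the product of the discrete topologies. Since the
  local functions are a core, \<open>generator_local\<close> determines the transition semigroup.\<close>

locale zero_temp_ising =
  fixes P :: "config \<Rightarrow> 'w measure"
    and X :: "real \<Rightarrow> 'w \<Rightarrow> config"
  assumes prob: "\<And>\<sigma>. prob_space (P \<sigma>)"
    and same_sets: "\<And>\<sigma> \<eta>. sets (P \<sigma>) = sets (P \<eta>)"
    and random_variable: "\<And>\<sigma> t. 0 \<le> t \<Longrightarrow> X t \<in> P \<sigma> \<rightarrow>\<^sub>M config_M"
    and initial: "\<And>\<sigma>. AE w in P \<sigma>. X 0 w = \<sigma>"
    and right_continuous: "\<And>\<sigma> w t x. w \<in> space (P \<sigma>) \<Longrightarrow> 0 \<le> t \<Longrightarrow>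
          \<forall>\<^sub>F u in at_right t. X u w x = X t w x"
    and left_limits: "\<And>\<sigma> w t x. w \<in> space (P \<sigma>) \<Longrightarrow> 0 < t \<Longrightarrow>
          \<exists>b. \<forall>\<^sub>F u in at_left t. X u w x = b"
    and feller: "\<And>f :: config \<Rightarrow> real. \<And>t. continuous_on UNIV f \<Longrightarrow> 0 \<le> t \<Longrightarrow>
          continuous_on UNIV (\<lambda>\<sigma>. \<integral>w. f (X t w) \<partial>P \<sigma>)"
    and markov: "\<And>\<sigma> t u A. \<And>f :: config \<Rightarrow> real.
          0 \<le> t \<Longrightarrow> 0 \<le> u \<Longrightarrow> continuous_on UNIV f \<Longrightarrow>
          A \<in> sigma_sets (space (P \<sigma>))
                {X v -` B \<inter> space (P \<sigma>) | v B. 0 \<le> v \<and> v \<le> u \<and> B \<in> sets config_M} \<Longrightarrow>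
          (\<integral>w. indicator A w * f (X (u + t) w) \<partial>P \<sigma>) =
          (\<integral>w. indicator A w * (\<integral>w'. f (X t w') \<partial>P (X u w)) \<partial>P \<sigma>)"
    and generator_local: "\<And>f. local_fun f \<Longrightarrow>
          uniform_limit UNIV (\<lambda>t \<sigma>. ((\<integral>w. f (X t w) \<partial>P \<sigma>) - f \<sigma>) / t) (generator f) (at_right 0)"

definition site :: "nat \<Rightarrow> int \<times> int \<Rightarrow> complex" where
  "site N x = Complex (real_of_int (fst x) / real N) (real_of_int (snd x) / real N)"

definition cell :: "nat \<Rightarrow> int \<times> int \<Rightarrow> complex set" where
  "cell N x = {u. - 1 / (2 * real N) \<le> Re u - Re (site N x) \<and> Re u - Re (site N x) < 1 / (2 * real N) \<and>
                  - 1 / (2 * real N) \<le> Im u - Im (site N x) \<and> Im u - Im (site N x) < 1 / (2 * real N)}"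

definition cover :: "nat \<Rightarrow> complex set \<Rightarrow> complex set" where
  "cover N S = (\<Union>x\<in>{x. cell N x \<inter> S \<noteq> {}}. cell N x)"

definition droplet :: "nat \<Rightarrow> config \<Rightarrow> complex set" where
  "droplet N \<sigma> = (\<Union>x\<in>{x. \<sigma> x}. cell N x)"

definition vol :: "complex set \<Rightarrow> real" where
  "vol A = measure lborel A"

text \<open>With values in \<^typ>\<open>ennreal\<close>, so that the distance to the empty set is infinite.\<close>

definition hausdorff_dist :: "complex set \<Rightarrow> complex set \<Rightarrow> ennreal" where
  "hausdorff_dist A B = max (SUP a\<in>A. INF b\<in>B. ennreal (dist a b)) (SUP b\<in>B. INF a\<in>A. ennreal (dist b a))"

text \<open>Vertical pieces are allowed: the boundary of a droplet is a staircase.\<close>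

definition nonincreasing_in :: "complex set \<Rightarrow> complex set \<Rightarrow> bool" where
  "nonincreasing_in V S \<longleftrightarrow> (\<forall>p\<in>S \<inter> V. \<forall>q\<in>S \<inter> V. Re p < Re q \<longrightarrow> Im q \<le> Im p)"

definition nondecreasing_in :: "complex set \<Rightarrow> complex set \<Rightarrow> bool" where
  "nondecreasing_in V S \<longleftrightarrow> (\<forall>p\<in>S \<inter> V. \<forall>q\<in>S \<inter> V. Re p < Re q \<longrightarrow> Im p \<le> Im q)"

text \<open>A regular, 1-periodic, counterclockwise parametrization of a Jordan curve of class C1; being
  periodic, it is also C1 at the base point.\<close>

definition C1_jordan_param :: "(real \<Rightarrow> complex) \<Rightarrow> bool" where
  "C1_jordan_param g \<longleftrightarrow>
     (\<forall>t. g (t + 1) = g t) \<and> inj_on g {0..<1} \<and>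
     g C1_differentiable_on UNIV \<and> (\<forall>t. vector_derivative g (at t) \<noteq> 0) \<and>
     (\<forall>z\<in>inside (range g). winding_number g z = 1)"

text \<open>The circle of radius \<open>r\<close> around \<open>s = g a\<close> meets the curve in exactly the two points
  \<open>x\<^sub>0 = g t0\<close> and \<open>x\<^sub>1 = g t1\<close>. The inequalities say that \<open>x\<^sub>0, s, x\<^sub>1\<close> are in counterclockwise
  cyclic order; they determine \<open>t0\<close> and \<open>t1\<close>.\<close>

definition arc_ends :: "(real \<Rightarrow> complex) \<Rightarrow> real \<Rightarrow> real \<Rightarrow> real \<Rightarrow> real \<Rightarrow> bool" where
  "arc_ends g a r t0 t1 \<longleftrightarrow>
     t0 < a \<and> a < t1 \<and> t1 < t0 + 1 \<and> sphere (g a) r \<inter> range g = {g t0, g t1}"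

text \<open>The tangents point away from \<open>s\<close>. Angles are normalized to \<open>[0, 2 * pi[\<close>.\<close>

definition angle0 :: "(real \<Rightarrow> complex) \<Rightarrow> real \<Rightarrow> real" where
  "angle0 g t0 = Arg2pi (- vector_derivative g (at t0))"

definition angle1 :: "(real \<Rightarrow> complex) \<Rightarrow> real \<Rightarrow> real" where
  "angle1 g t1 = Arg2pi (vector_derivative g (at t1))"

definition region :: "complex \<Rightarrow> complex \<Rightarrow> complex \<Rightarrow> real \<Rightarrow> real \<Rightarrow> real \<Rightarrow> complex set" where
  "region s x0 x1 r \<alpha>1 \<alpha>2 = cball s r \<union> cball x0 \<alpha>1 \<union> cball x1 \<alpha>2"

definition drift ::
  "(config \<Rightarrow> 'w measure) \<Rightarrow> (real \<Rightarrow> 'w \<Rightarrow> config) \<Rightarrow>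
    complex \<Rightarrow> complex \<Rightarrow> complex \<Rightarrow> real \<Rightarrow> real \<Rightarrow> real \<Rightarrow> nat \<Rightarrow> config \<Rightarrow> real" where
  "drift P X s x0 x1 r \<alpha>1 \<alpha>2 N \<sigma> =
     (let S = cover N (region s x0 x1 r \<alpha>1 \<alpha>2) in
      Lim (at_right 0) (\<lambda>t. 1 / t *
        ((\<integral>w. vol (droplet N (X (t * (real N)\<^sup>2) w) \<inter> S) \<partial>P \<sigma>) - vol (droplet N \<sigma> \<inter> S))))"

definition avg_drift ::
  "(config \<Rightarrow> 'w measure) \<Rightarrow> (real \<Rightarrow> 'w \<Rightarrow> config) \<Rightarrow>
    complex \<Rightarrow> complex \<Rightarrow> complex \<Rightarrow> real \<Rightarrow> real \<Rightarrow> nat \<Rightarrow> config \<Rightarrow> real" where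
  "avg_drift P X s x0 x1 r \<delta> N \<sigma> =
     1 / \<delta>\<^sup>2 * (LBINT \<alpha>1:{0..\<delta>}. LBINT \<alpha>2:{0..\<delta>}. drift P X s x0 x1 r \<alpha>1 \<alpha>2 N \<sigma>)"

definition corners :: "complex \<Rightarrow> complex \<Rightarrow> real \<Rightarrow> nat \<Rightarrow> config \<Rightarrow> nat" where
  "corners s x \<delta> N \<sigma> =
     card {y. site N y \<in> cover N (cball x \<delta>) - cball s (dist x s) \<and> \<sigma> y \<and> opposite \<sigma> y = 2}"

definition corner_density ::
  "(nat \<Rightarrow> config measure) \<Rightarrow> complex \<Rightarrow> complex \<Rightarrow> real \<Rightarrow> bool" where
  "corner_density \<nu> s x c \<longleftrightarrow>
     ((\<lambda>\<delta>. liminf (\<lambda>N. ereal (1 / (\<delta> * real N) * (\<integral>\<sigma>. real (corners s x \<delta> N \<sigma>) \<partial>\<nu> N))))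
        \<longlongrightarrow> ereal c) (at_right 0) \<and>
     ((\<lambda>\<delta>. limsup (\<lambda>N. ereal (1 / (\<delta> * real N) * (\<integral>\<sigma>. real (corners s x \<delta> N \<sigma>) \<partial>\<nu> N))))
        \<longlongrightarrow> ereal c) (at_right 0)"

text \<open>Convergence in probability of the droplet does not control the expectation of the drift: with a
  probability tending slowly to 0, a monotone staircase may follow the circle of radius \<open>r\<close> around
  \<open>s\<close>, and the drift is then of order \<open>N\<close>. Uniform integrability of the averaged drift rules this out
  and is automatic when the averaged drift is bounded uniformly in \<open>N\<close>.\<close>

definition uniformly_integrable_seq ::
  "(nat \<Rightarrow> config measure) \<Rightarrow> (nat \<Rightarrow> config \<Rightarrow> real) \<Rightarrow> bool" where
  "uniformly_integrable_seq \<nu> Y \<longleftrightarrow>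
     (\<forall>e>0. \<exists>K. \<forall>N\<ge>1. (\<integral>\<^sup>+\<sigma>. ennreal (\<bar>Y N \<sigma>\<bar> * indicator {\<sigma>. \<bar>Y N \<sigma>\<bar> > K} \<sigma>) \<partial>\<nu> N) \<le> ennreal e)"

definition limit_drift :: "(real \<Rightarrow> real) \<Rightarrow> real \<Rightarrow> real \<Rightarrow> real" where
  "limit_drift C \<theta>0 \<theta>1 =
     - (1/2) * sgn (tan \<theta>0) * ((cos \<theta>0)\<^sup>2 + C \<theta>0 * (\<bar>sin \<theta>0\<bar> - \<bar>cos \<theta>0\<bar>))
     + 1/2 * sgn (tan \<theta>1) * ((cos \<theta>1)\<^sup>2 + C \<theta>1 * (\<bar>sin \<theta>1\<bar> - \<bar>cos \<theta>1\<bar>))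
     + of_bool (sin \<theta>0 * sin \<theta>1 > 0) *
         (sgn (\<theta>1 - \<theta>0) * of_bool (cos \<theta>0 * cos \<theta>1 > 0)
          + sgn (tan \<theta>0) * of_bool (cos \<theta>0 * cos \<theta>1 < 0))"

text \<open>Angles for which \<open>sgn (tan \<theta>)\<close> is a genuine sign. Without this restriction the value given by
  \<^const>\<open>limit_drift\<close> is wrong: if the curve is horizontal on one side of \<open>s\<close> and bends down on the
  other, the drift is the limit of the formula for \<open>\<theta>0\<close> tending to \<open>0\<close> from above, and not its value
  with \<open>sgn (tan 0) = 0\<close>.\<close>

definition oblique :: "real \<Rightarrow> bool" where
  "oblique \<theta> \<longleftrightarrow> sin \<theta> \<noteq> 0 \<and> cos \<theta> \<noteq> 0"

end

theory Submission
  imports Defs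
begin

text \<open>Let \<open>S\<close> be the set of sites whose cells meet the region. The generator turns the drift into the
  sum over \<open>S\<close> of the rate at which a site becomes plus minus the rate at which it becomes minus
  (\<open>drift_eq_sum\<close>). A site enters the discretization of the disc around \<open>x\<^sub>k\<close> when the radius exceeds
  its distance to \<open>x\<^sub>k\<close>, so averaging over the radii replaces the indicator of \<open>S\<close> by a weight \<open>w\<close>
  that is \<open>1\<close> on the disc around \<open>s\<close> and decreases linearly to \<open>0\<close> as the distance to \<open>x\<^sub>k\<close> grows
  from \<open>0\<close> to \<open>\<delta>\<close> (\<open>avg_drift_eq_sum\<close>).

  Where the interface is a staircase that descends to the right, with the plus spins below it, only
  its corners can flip, at rate \<open>1/2\<close>: plus spins at convex corners, minus spins at concave ones.
  The two kinds alternate, and summation by parts (\<open>staircase_sum\<close>) expresses twice the averaged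
  drift by increments of \<open>w\<close>: the sum of \<open>w (x + (1,1)) - w x\<close> over the convex corners \<open>x\<close> minus the
  sum of \<open>w (x + (1,1)) - w (x + (1,0))\<close> over the vertical edges. These vanish except near \<open>x\<^sub>0\<close> and
  \<open>x\<^sub>1\<close>, where the interface lies in a thin strip around the tangent. There the distance to \<open>x\<^sub>k\<close> is
  nearly the tangential coordinate, so a step by \<open>v\<close> changes \<open>w\<close> by nearly \<open>- (v \<bullet> u) / \<delta>\<close>, with \<open>u\<close>
  the unit tangent. If \<open>u = \<phi> (A, - B)\<close>, where \<open>A = \<bar>cos \<theta>\<^sub>k\<bar>\<close> and \<open>B = \<bar>sin \<theta>\<^sub>k\<bar>\<close>, each convex corner
  contributes \<open>- \<phi> (A - B) / (\<delta> N)\<close>, which produces the corner density, and each of the about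
  \<open>B \<delta> N\<close> vertical edges contributes \<open>\<phi> B / (\<delta> N)\<close>, which produces \<open>sin\<^sup>2\<close>
  (\<open>corner_sum\<close>, \<open>edge_sum\<close>). The two ends have opposite signs \<open>\<phi>\<close>, and \<open>cos\<^sup>2 = 1 - sin\<^sup>2\<close> turns the
  result into the stated form. The two tangents, both directed away from \<open>s\<close>, lie in opposite
  quadrants, so the last term of the limit is \<open>0\<close> (\<open>limit_drift_opposite\<close>).

  It remains to see that a configuration close to \<open>\<Omega>\<close> with monotone frontier has such an interface.
  Near each of its points a counterclockwise regular Jordan curve has its inside on the left and its
  outside on the right of a thin double cone around the tangent, because the winding number jumps
  across the curve (\<open>winding_jump\<close>, \<open>local_sides\<close>). Hence Hausdorff closeness puts a plus spin
  close to every point of \<open>\<Omega>\<close> and only minus spins far from \<open>\<Omega>\<close>. A minus spin directly between a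
  plus spin and the inside would give two points of the frontier that are ordered against the
  monotonicity (\<open>descends_reflect\<close>), so plus spins propagate towards the inside. Reflections reduce the four orientations to one. This proves the
  estimate of \<open>pathwise\<close>: the averaged drift of one configuration is determined, up to a small error,
  by its numbers of corners.

  Finally, expectations are compared. The configurations that are not close to \<open>\<Omega>\<close> have small
  probability; there the drift is controlled by uniform integrability, and the corners by the fact
  that a monotone interface has boundedly many of them per row (\<open>corners_bound\<close>).\<close>

section \<open>The discretized droplet and its drift\<close>

text \<open>Cells are half-open, so rounding each coordinate half up gives the only site whose cell
  contains the point.\<close>
definition site_of :: "nat \<Rightarrow> complex \<Rightarrow> int \<times> int" where
  "site_of N u = (\<lfloor>real N * Re u + 1/2\<rfloor>, \<lfloor>real N * Im u + 1/2\<rfloor>)"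

lemma Re_site [simp]: "Re (site N x) = real_of_int (fst x) / real N"
  and Im_site [simp]: "Im (site N x) = real_of_int (snd x) / real N"
  by (simp_all add: site_def)

lemma floor_half_iff:
  assumes "N \<ge> 1"
  shows "- 1 / (2 * real N) \<le> y - real_of_int i / real N \<and> y - real_of_int i / real N < 1 / (2 * real N)
    \<longleftrightarrow> i = \<lfloor>real N * y + 1/2\<rfloor>"
proof -
  have N: "real N > 0" using assms by simp
  have "i = \<lfloor>real N * y + 1/2\<rfloor> \<longleftrightarrow> real_of_int i \<le> real N * y + 1/2 \<and> real N * y + 1/2 < real_of_int i + 1"
    by (metis floor_eq_iff)
  moreover have "- 1 / (2 * real N) \<le> y - real_of_int i / real N \<longleftrightarrow> real_of_int i \<le> real N * y + 1/2"
    using N by (simp add: field_simps)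
  moreover have "y - real_of_int i / real N < 1 / (2 * real N) \<longleftrightarrow> real N * y + 1/2 < real_of_int i + 1"
  proof -
    have "y - real_of_int i / real N < 1 / (2 * real N) \<longleftrightarrow>
        real N * (y - real_of_int i / real N) < real N * (1 / (2 * real N))"
      using N by (simp only: mult_less_cancel_left_pos)
    also have "real N * (y - real_of_int i / real N) = real N * y - real_of_int i"
      using N by (simp add: right_diff_distrib)
    also have "real N * (1 / (2 * real N)) = 1/2" using N by simp
    finally show ?thesis by linarith
  qed
  ultimately show ?thesis by blast
qed

lemma mem_cell_iff:
  assumes "N \<ge> 1"
  shows "u \<in> cell N x \<longleftrightarrow> x = site_of N u"
  using floor_half_iff[OF assms, of "Re u" "fst x"] floor_half_iff[OF assms, of "Im u" "snd x"]
  unfolding cell_def site_of_def by (auto simp: prod_eq_iff)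

lemma site_in_cell: "N \<ge> 1 \<Longrightarrow> site N x \<in> cell N x"
  by (simp add: cell_def)

lemma site_of_site: "N \<ge> 1 \<Longrightarrow> site_of N (site N x) = x"
  using mem_cell_iff[of N "site N x" x] site_in_cell by simp

text \<open>The discretization \<open>cover N S\<close> is the union of the cells of these sites.\<close>
definition touched :: "nat \<Rightarrow> complex set \<Rightarrow> (int \<times> int) set" where
  "touched N S = {x. cell N x \<inter> S \<noteq> {}}"

lemma touched_eq: "N \<ge> 1 \<Longrightarrow> touched N S = site_of N ` S"
  by (auto simp: touched_def mem_cell_iff)

lemma cover_eq: "N \<ge> 1 \<Longrightarrow> cover N S = {u. site_of N u \<in> touched N S}"
  by (auto simp: cover_def touched_def mem_cell_iff)

lemma droplet_eq: "N \<ge> 1 \<Longrightarrow> droplet N \<sigma> = {u. \<sigma> (site_of N u)}"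
  by (auto simp: droplet_def mem_cell_iff)

lemma touched_Un: "touched N (S \<union> T) = touched N S \<union> touched N T"
  by (auto simp: touched_def)

lemma touched_mono: "S \<subseteq> T \<Longrightarrow> touched N S \<subseteq> touched N T"
  by (auto simp: touched_def)

lemma finite_touched:
  assumes N: "N \<ge> 1" and S: "bounded S"
  shows "finite (touched N S)"
proof -
  obtain b where b: "\<And>u. u \<in> S \<Longrightarrow> norm u \<le> b"
    using S by (auto simp: bounded_iff)
  define c where "c = \<lceil>real N * b\<rceil> + 1"
  have fl: "\<lfloor>real N * y + 1/2\<rfloor> \<in> {-c..c}" if "\<bar>y\<bar> \<le> b" for y
  proof -
    have "\<bar>real N * y\<bar> \<le> real N * b" using that by (simp add: abs_mult mult_left_mono)
    moreover have "real N * b \<le> of_int \<lceil>real N * b\<rceil>" by simp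
    ultimately show ?thesis unfolding c_def by (simp add: le_floor_iff floor_le_iff) linarith
  qed
  have "site_of N ` S \<subseteq> {-c..c} \<times> {-c..c}"
  proof (rule image_subsetI)
    fix u assume "u \<in> S"
    hence "\<bar>Re u\<bar> \<le> b" "\<bar>Im u\<bar> \<le> b"
      using b[of u] abs_Re_le_cmod[of u] abs_Im_le_cmod[of u] by linarith+
    from fl[OF this(1)] fl[OF this(2)] show "site_of N u \<in> {-c..c} \<times> {-c..c}"
      unfolding site_of_def by blast
  qed
  thus ?thesis unfolding touched_eq[OF N] by (rule finite_subset) simp
qed

lemma cell_measure:
  assumes "N \<ge> 1"
  shows "cell N x \<in> sets lborel" "emeasure lborel (cell N x) = ennreal (1 / (real N)\<^sup>2)"
proof -
  define h where "h = 1 / (2 * real N)"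
  have h: "h > 0" using assms by (simp add: h_def)
  define l where "l = site N x - Complex h h"
  define u where "u = site N x + Complex h h"
  have cell: "cell N x = {z. -h \<le> Re z - Re (site N x) \<and> Re z - Re (site N x) < h \<and>
                  -h \<le> Im z - Im (site N x) \<and> Im z - Im (site N x) < h}"
    unfolding cell_def h_def by simp
  show sets: "cell N x \<in> sets lborel" unfolding cell by measurable
  have B: "Basis = {1, \<i>}" by (simp add: Basis_complex_def)
  have sub: "box l u \<subseteq> cell N x" "cell N x \<subseteq> cbox l u"
    unfolding cell l_def u_def by (auto simp: box_def cbox_def B inner_complex_def)
  have lu: "\<And>b. b \<in> Basis \<Longrightarrow> l \<bullet> b \<le> u \<bullet> b"
    using h by (auto simp: l_def u_def B inner_complex_def)
  have p: "(\<Prod>b\<in>Basis. (u - l) \<bullet> b) = 1 / (real N)\<^sup>2"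
    by (simp add: B l_def u_def inner_complex_def h_def power2_eq_square)
  have "emeasure lborel (box l u) = ennreal (1 / (real N)\<^sup>2)"
    using emeasure_lborel_box[OF lu] p by simp
  moreover have "emeasure lborel (cbox l u) = ennreal (1 / (real N)\<^sup>2)"
    using emeasure_lborel_cbox[OF lu] p by simp
  ultimately show "emeasure lborel (cell N x) = ennreal (1 / (real N)\<^sup>2)"
    using emeasure_mono[OF sub(1), of lborel] emeasure_mono[OF sub(2), of lborel] sets
    by (simp add: antisym)
qed

lemma vol_droplet_cover:
  assumes N: "N \<ge> 1" and S: "bounded S"
  shows "vol (droplet N \<sigma> \<inter> cover N S) = (\<Sum>x\<in>touched N S. of_bool (\<sigma> x) / (real N)\<^sup>2)"
proof -
  have fin: "finite (touched N S)" by (rule finite_touched[OF N S])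
  have eq: "droplet N \<sigma> \<inter> cover N S = (\<Union>x\<in>{x\<in>touched N S. \<sigma> x}. cell N x)"
    by (auto simp: droplet_eq[OF N] cover_eq[OF N] mem_cell_iff[OF N])
  have "vol (droplet N \<sigma> \<inter> cover N S) = (\<Sum>x\<in>{x\<in>touched N S. \<sigma> x}. measure lborel (cell N x))"
    unfolding vol_def eq
  proof (rule measure_finite_Union)
    show "disjoint_family_on (cell N) {x \<in> touched N S. \<sigma> x}"
      unfolding disjoint_family_on_def disjoint_iff mem_cell_iff[OF N] by metis
  qed (use fin cell_measure[OF N] in auto)
  also have "\<dots> = (\<Sum>x\<in>{x\<in>touched N S. \<sigma> x}. 1 / (real N)\<^sup>2)"
    by (intro sum.cong) (auto simp: measure_def cell_measure[OF N])
  also have "\<dots> = (\<Sum>x\<in>touched N S. of_bool (\<sigma> x) / (real N)\<^sup>2)"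
    using fin by (intro sum.mono_neutral_cong_left) auto
  finally show ?thesis .
qed

text \<open>The expected rate of change of the indicator of a plus spin.\<close>
definition spin_drift :: "config \<Rightarrow> int \<times> int \<Rightarrow> real" where
  "spin_drift \<sigma> x = rate x \<sigma> * (if \<sigma> x then -1 else 1)"

lemma generator_sum_spins:
  assumes "finite I"
  shows "generator (\<lambda>\<sigma>. \<Sum>x\<in>I. of_bool (\<sigma> x) * c) \<sigma> = c * (\<Sum>x\<in>I. spin_drift \<sigma> x)"
proof -
  let ?f = "\<lambda>\<sigma>. \<Sum>x\<in>I. of_bool (\<sigma> x) * c"
  have diff: "?f (flip \<sigma> x) - ?f \<sigma> = of_bool (x \<in> I) * (if \<sigma> x then -1 else 1) * c" for x
  proof -
    have "?f (flip \<sigma> x) - ?f \<sigma> = (\<Sum>y\<in>I. of_bool (flip \<sigma> x y) * c - of_bool (\<sigma> y) * c)"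
      by (simp only: sum_subtractf)
    also have "\<dots> = (\<Sum>y\<in>I. if y = x then (if \<sigma> x then -1 else 1) * c else 0)"
      by (rule sum.cong) (auto simp: flip_def)
    finally show ?thesis using assms by simp
  qed
  have "generator ?f \<sigma> = (\<Sum>\<^sub>\<infinity>x. rate x \<sigma> * (of_bool (x \<in> I) * (if \<sigma> x then -1 else 1) * c))"
    unfolding generator_def diff ..
  also have "\<dots> = (\<Sum>\<^sub>\<infinity>x\<in>I. c * spin_drift \<sigma> x)"
    by (intro infsum_cong_neutral) (auto simp: spin_drift_def)
  also have "\<dots> = c * (\<Sum>x\<in>I. spin_drift \<sigma> x)"
    using assms by (simp add: sum_distrib_left)
  finally show ?thesis .
qed

lemma bounded_region: "bounded (region s x0 x1 r a b)"
  by (simp add: region_def)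

text \<open>A cell has area \<open>1 / N\<^sup>2\<close>, and this factor cancels against the acceleration of time by \<open>N\<^sup>2\<close>.\<close>
lemma drift_eq_sum:
  assumes "zero_temp_ising P X" and N: "N \<ge> 1"
  shows "drift P X s x0 x1 r a b N \<sigma> = (\<Sum>x\<in>touched N (region s x0 x1 r a b). spin_drift \<sigma> x)"
proof -
  interpret zero_temp_ising P X by fact
  let ?I = "touched N (region s x0 x1 r a b)"
  let ?f = "\<lambda>\<sigma>. \<Sum>x\<in>?I. of_bool (\<sigma> x) * (1 / (real N)\<^sup>2)"
  have fin: "finite ?I" by (rule finite_touched[OF N bounded_region])
  have vol: "vol (droplet N \<eta> \<inter> cover N (region s x0 x1 r a b)) = ?f \<eta>" for \<eta>
    using vol_droplet_cover[OF N bounded_region] by simp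
  have loc: "local_fun ?f"
    unfolding local_fun_def
  proof (intro exI conjI allI impI)
    fix \<sigma> \<eta> :: config assume "\<forall>x\<in>?I. \<sigma> x = \<eta> x"
    thus "?f \<sigma> = ?f \<eta>" by (intro sum.cong) auto
  qed (rule fin)
  have N2: "(real N)\<^sup>2 > 0" using N by simp
  have lim: "((\<lambda>t. ((\<integral>w. ?f (X t w) \<partial>P \<sigma>) - ?f \<sigma>) / t) \<longlongrightarrow> generator ?f \<sigma>) (at_right 0)"
    using tendsto_uniform_limitI[OF generator_local[OF loc], of \<sigma>] by simp
  have "filterlim (\<lambda>t::real. t * (real N)\<^sup>2) (at_right 0) (at_right 0)"
    unfolding filterlim_at
  proof
    show "\<forall>\<^sub>F t in at_right 0. t * (real N)\<^sup>2 \<in> {0<..} \<and> t * (real N)\<^sup>2 \<noteq> 0"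
      using N2 eventually_at_right_less[of "0::real"] by (auto elim!: eventually_mono)
    have "((\<lambda>t::real. t * (real N)\<^sup>2) \<longlongrightarrow> 0 * (real N)\<^sup>2) (at_right 0)"
      by (intro tendsto_intros)
    thus "((\<lambda>t::real. t * (real N)\<^sup>2) \<longlongrightarrow> 0) (at_right 0)" by simp
  qed
  note lim' = filterlim_compose[OF lim this]
  have cancel: "(real N)\<^sup>2 * (u / (t * (real N)\<^sup>2)) = 1 / t * u" for t u :: real
    using N2 by (cases "t = 0") (auto simp: field_simps)
  from tendsto_mult[OF tendsto_const[of "(real N)\<^sup>2"] lim']
  have "((\<lambda>t. 1 / t * ((\<integral>w. ?f (X (t * (real N)\<^sup>2) w) \<partial>P \<sigma>) - ?f \<sigma>)) \<longlongrightarrow>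
      (real N)\<^sup>2 * generator ?f \<sigma>) (at_right 0)"
    unfolding cancel .
  hence LIM: "Lim (at_right 0) (\<lambda>t. 1 / t * ((\<integral>w. ?f (X (t * (real N)\<^sup>2) w) \<partial>P \<sigma>) - ?f \<sigma>)) =
      (real N)\<^sup>2 * generator ?f \<sigma>"
    by (rule tendsto_Lim[OF trivial_limit_at_right_real])
  note LIM
  also have "\<dots> = (\<Sum>x\<in>?I. spin_drift \<sigma> x)"
    unfolding generator_sum_spins[OF fin] using N2 by (simp only: mult.assoc[symmetric]) simp
  finally show ?thesis
    unfolding drift_def Let_def vol .
qed

section \<open>Averaging over the radii\<close>

definition ramp :: "real \<Rightarrow> real \<Rightarrow> real" where
  "ramp \<delta> d = max 0 (1 - d / \<delta>)"

text \<open>Whether the endpoint belongs to the ray depends on which sides of the half-open cell are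
  closest to the centre.\<close>
lemma touched_cball_ray:
  fixes y :: complex and x :: "int \<times> int"
  assumes N: "N \<ge> 1"
  defines "d \<equiv> infdist y (cell N x)"
  shows "{\<alpha>. x \<in> touched N (cball y \<alpha>)} = {d<..} \<or> {\<alpha>. x \<in> touched N (cball y \<alpha>)} = {d..}"
proof -
  let ?A = "{\<alpha>. x \<in> touched N (cball y \<alpha>)}"
  have ne: "cell N x \<noteq> {}" using site_in_cell[OF N] by blast
  have 1: "\<alpha> \<in> ?A" if "d < \<alpha>" for \<alpha>
  proof -
    have "(INF u\<in>cell N x. dist y u) < \<alpha>" using that ne by (simp add: d_def infdist_notempty)
    then obtain u where "u \<in> cell N x" "dist y u < \<alpha>"
      using ne by (subst (asm) cINF_less_iff) auto
    thus ?thesis by (auto simp: touched_def intro!: less_imp_le)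
  qed
  have 2: "d \<le> \<alpha>" if "\<alpha> \<in> ?A" for \<alpha>
  proof -
    obtain u where "u \<in> cell N x" "dist y u \<le> \<alpha>" using \<open>\<alpha> \<in> ?A\<close> by (auto simp: touched_def)
    thus ?thesis using infdist_le[of u "cell N x" y] unfolding d_def by linarith
  qed
  show ?thesis
  proof (cases "d \<in> ?A")
    case True
    hence "?A = {d..}" using 1 2 by force
    thus ?thesis ..
  next
    case False
    hence "?A = {d<..}" using 1 2 by (force simp: less_le)
    thus ?thesis ..
  qed
qed

text \<open>A cell is reached once the radius exceeds its distance to the centre, so averaging over the
  radius replaces the indicator of the discretized disc by a linear ramp.\<close>
lemma has_integral_touched:
  assumes N: "N \<ge> 1" and \<delta>: "\<delta> > 0"
  shows "has_bochner_integral lborel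
    (\<lambda>\<alpha>. indicator {0..\<delta>} \<alpha> * of_bool (x \<in> touched N (cball y \<alpha>)) :: real)
    (\<delta> * ramp \<delta> (infdist y (cell N x)))"
proof -
  define d where "d = infdist y (cell N x)"
  define A where "A = {\<alpha>. x \<in> touched N (cball y \<alpha>)}"
  have d: "d \<ge> 0" by (simp add: d_def infdist_nonneg)
  have A: "A = {d<..} \<or> A = {d..}" using touched_cball_ray[OF N] unfolding A_def d_def .
  have eq: "indicator {0..\<delta>} \<alpha> * of_bool (x \<in> touched N (cball y \<alpha>)) = (indicator ({0..\<delta>} \<inter> A) \<alpha> :: real)" for \<alpha>
    by (auto simp: A_def indicator_def)
  have "has_bochner_integral lborel (indicator ({0..\<delta>} \<inter> A)) (measure lborel ({0..\<delta>} \<inter> A))"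
  proof (rule has_bochner_integral_real_indicator)
    show "{0..\<delta>} \<inter> A \<in> sets lborel" using A by auto
    have "emeasure lborel ({0..\<delta>} \<inter> A) \<le> emeasure lborel {0..\<delta>}" using A by (intro emeasure_mono) auto
    also have "\<dots> < \<infinity>" using \<delta> by simp
    finally show "emeasure lborel ({0..\<delta>} \<inter> A) < \<infinity>" .
  qed
  moreover have "measure lborel ({0..\<delta>} \<inter> A) = \<delta> * ramp \<delta> d"
  proof -
    have r: "\<delta> * ramp \<delta> d = (if d \<le> \<delta> then \<delta> - d else 0)"
      using \<delta> d by (auto simp: ramp_def max_def field_simps)
    have "{0..\<delta>} \<inter> {d<..} = {d<..\<delta>}" "{0..\<delta>} \<inter> {d..} = {d..\<delta>}" using d by auto
    hence "{0..\<delta>} \<inter> A = {d<..\<delta>} \<or> {0..\<delta>} \<inter> A = {d..\<delta>}" using A by metis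
    thus ?thesis unfolding r by (elim disjE) simp_all
  qed
  ultimately show ?thesis by (simp add: eq d_def)
qed

lemma integral_sum_touched:
  assumes N: "N \<ge> 1" and \<delta>: "\<delta> > 0" and fin: "finite J"
  shows "(LBINT \<alpha>:{0..\<delta>}. \<Sum>x\<in>J. a x + b x * of_bool (x \<in> touched N (cball y \<alpha>))) =
    \<delta> * (\<Sum>x\<in>J. a x + b x * ramp \<delta> (infdist y (cell N x)))"
proof -
  have c: "has_bochner_integral lborel (indicator {0..\<delta>} :: real \<Rightarrow> real) \<delta>"
    using has_bochner_integral_real_indicator[of "{0..\<delta>}" lborel] \<delta> by simp
  have "has_bochner_integral lborel
    (\<lambda>\<alpha>. \<Sum>x\<in>J. a x * indicator {0..\<delta>} \<alpha> + b x * (indicator {0..\<delta>} \<alpha> * of_bool (x \<in> touched N (cball y \<alpha>))))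
    (\<Sum>x\<in>J. a x * \<delta> + b x * (\<delta> * ramp \<delta> (infdist y (cell N x))))"
    by (intro has_bochner_integral_sum has_bochner_integral_add has_bochner_integral_mult_right
      has_integral_touched[OF N \<delta>] c)
  hence "(LBINT \<alpha>. \<Sum>x\<in>J. a x * indicator {0..\<delta>} \<alpha> + b x * (indicator {0..\<delta>} \<alpha> * of_bool (x \<in> touched N (cball y \<alpha>))))
    = (\<Sum>x\<in>J. a x * \<delta> + b x * (\<delta> * ramp \<delta> (infdist y (cell N x))))"
    by (rule has_bochner_integral_integral_eq)
  moreover have eq: "(\<Sum>x\<in>J. a x * indicator {0..\<delta>} \<alpha> + b x * (indicator {0..\<delta>} \<alpha> * of_bool (x \<in> touched N (cball y \<alpha>))))
     = indicator {0..\<delta>} \<alpha> *\<^sub>R (\<Sum>x\<in>J. a x + b x * of_bool (x \<in> touched N (cball y \<alpha>)))" for \<alpha>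
    by (simp add: sum_distrib_left algebra_simps)
  moreover have "(\<Sum>x\<in>J. a x * \<delta> + b x * (\<delta> * ramp \<delta> (infdist y (cell N x)))) =
      \<delta> * (\<Sum>x\<in>J. a x + b x * ramp \<delta> (infdist y (cell N x)))"
    unfolding sum_distrib_left by (rule sum.cong) (simp_all add: algebra_simps)
  ultimately show ?thesis
    unfolding set_lebesgue_integral_def by (simp only: eq)
qed

text \<open>The average of the indicator of the discretized region over both radii: the radii vary
  independently, so the complement of the union becomes a product.\<close>
definition weight :: "complex \<Rightarrow> complex \<Rightarrow> complex \<Rightarrow> real \<Rightarrow> real \<Rightarrow> nat \<Rightarrow> int \<times> int \<Rightarrow> real" where
  "weight s x0 x1 r \<delta> N x = 1 - (1 - of_bool (x \<in> touched N (cball s r))) *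
     (1 - ramp \<delta> (infdist x0 (cell N x))) * (1 - ramp \<delta> (infdist x1 (cell N x)))"

lemma avg_drift_eq_sum:
  assumes Z: "zero_temp_ising P X" and N: "N \<ge> 1" and \<delta>: "\<delta> > 0"
  shows "avg_drift P X s x0 x1 r \<delta> N \<sigma> =
    (\<Sum>x\<in>touched N (region s x0 x1 r \<delta> \<delta>). weight s x0 x1 r \<delta> N x * spin_drift \<sigma> x)"
proof -
  define J where "J = touched N (region s x0 x1 r \<delta> \<delta>)"
  have fin: "finite J" unfolding J_def by (rule finite_touched[OF N bounded_region])
  let ?c = "\<lambda>y \<alpha> x. of_bool (x \<in> touched N (cball y \<alpha>)) :: real"
  let ?r = "\<lambda>y x. ramp \<delta> (infdist y (cell N x))"
  let ?m = "spin_drift \<sigma>"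
  have drift: "drift P X s x0 x1 r a b N \<sigma> =
      (\<Sum>x\<in>J. (?m x * (1 - (1 - ?c s r x) * (1 - ?c x0 a x))) + (?m x * (1 - ?c s r x) * (1 - ?c x0 a x)) * ?c x1 b x)"
    if "a \<in> {0..\<delta>}" "b \<in> {0..\<delta>}" for a b
  proof -
    have sub: "touched N (region s x0 x1 r a b) \<subseteq> J"
      unfolding J_def region_def using that by (intro touched_mono Un_mono subset_cball) auto
    have "drift P X s x0 x1 r a b N \<sigma> = (\<Sum>x\<in>touched N (region s x0 x1 r a b). ?m x)"
      by (rule drift_eq_sum[OF Z N])
    also have "\<dots> = (\<Sum>x\<in>J. ?m x * of_bool (x \<in> touched N (region s x0 x1 r a b)))"
      using sub fin by (intro sum.mono_neutral_cong_left) auto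
    also have "\<dots> = (\<Sum>x\<in>J. (?m x * (1 - (1 - ?c s r x) * (1 - ?c x0 a x))) + (?m x * (1 - ?c s r x) * (1 - ?c x0 a x)) * ?c x1 b x)"
      by (rule sum.cong) (auto simp: region_def touched_Un)
    finally show ?thesis .
  qed
  have inner: "(LBINT b:{0..\<delta>}. drift P X s x0 x1 r a b N \<sigma>) =
      (\<Sum>x\<in>J. (\<delta> * ?m x * (1 - (1 - ?c s r x) * (1 - ?r x1 x))) + (\<delta> * ?m x * (1 - ?c s r x) * (1 - ?r x1 x)) * ?c x0 a x)"
    if "a \<in> {0..\<delta>}" for a
  proof -
    have "(LBINT b:{0..\<delta>}. drift P X s x0 x1 r a b N \<sigma>) =
      (LBINT b:{0..\<delta>}. \<Sum>x\<in>J. (?m x * (1 - (1 - ?c s r x) * (1 - ?c x0 a x))) + (?m x * (1 - ?c s r x) * (1 - ?c x0 a x)) * ?c x1 b x)"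
      by (rule set_lebesgue_integral_cong) (use drift that in auto)
    also have "\<dots> = \<delta> * (\<Sum>x\<in>J. (?m x * (1 - (1 - ?c s r x) * (1 - ?c x0 a x))) + (?m x * (1 - ?c s r x) * (1 - ?c x0 a x)) * ?r x1 x)"
      by (rule integral_sum_touched[OF N \<delta> fin])
    also have "\<dots> = (\<Sum>x\<in>J. (\<delta> * ?m x * (1 - (1 - ?c s r x) * (1 - ?r x1 x))) + (\<delta> * ?m x * (1 - ?c s r x) * (1 - ?r x1 x)) * ?c x0 a x)"
      unfolding sum_distrib_left by (rule sum.cong) (auto simp: algebra_simps)
    finally show ?thesis .
  qed
  have "(LBINT a:{0..\<delta>}. LBINT b:{0..\<delta>}. drift P X s x0 x1 r a b N \<sigma>) =
    (LBINT a:{0..\<delta>}. \<Sum>x\<in>J. (\<delta> * ?m x * (1 - (1 - ?c s r x) * (1 - ?r x1 x))) + (\<delta> * ?m x * (1 - ?c s r x) * (1 - ?r x1 x)) * ?c x0 a x)"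
    by (rule set_lebesgue_integral_cong) (use inner in auto)
  also have "\<dots> = \<delta> * (\<Sum>x\<in>J. (\<delta> * ?m x * (1 - (1 - ?c s r x) * (1 - ?r x1 x))) + (\<delta> * ?m x * (1 - ?c s r x) * (1 - ?r x1 x)) * ?r x0 x)"
    by (rule integral_sum_touched[OF N \<delta> fin])
  also have "\<dots> = \<delta>\<^sup>2 * (\<Sum>x\<in>J. weight s x0 x1 r \<delta> N x * ?m x)"
    unfolding sum_distrib_left by (rule sum.cong) (auto simp: weight_def algebra_simps power2_eq_square)
  finally show ?thesis unfolding avg_drift_def J_def using \<delta> by simp
qed

section \<open>Functions of finitely many spins\<close>

text \<open>A finite combination of indicators of cylinders, from which measurability and boundedness
  are read off.\<close>
lemma local_fun_sum:
  assumes "local_fun f"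
  obtains F where "finite F" "\<And>\<sigma>. f \<sigma> = (\<Sum>A\<in>Pow F. f (\<lambda>x. x \<in> A) * of_bool (\<forall>x\<in>F. \<sigma> x = (x \<in> A)))"
proof -
  obtain F where fin: "finite F" and F: "\<And>\<sigma> \<eta>. (\<forall>x\<in>F. \<sigma> x = \<eta> x) \<Longrightarrow> f \<sigma> = f \<eta>"
    using assms unfolding local_fun_def by blast
  have "f \<sigma> = (\<Sum>A\<in>Pow F. f (\<lambda>x. x \<in> A) * of_bool (\<forall>x\<in>F. \<sigma> x = (x \<in> A)))" for \<sigma>
  proof -
    define B where "B = {x\<in>F. \<sigma> x}"
    have "(\<Sum>A\<in>Pow F. f (\<lambda>x. x \<in> A) * of_bool (\<forall>x\<in>F. \<sigma> x = (x \<in> A))) =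
        (\<Sum>A\<in>{B}. f (\<lambda>x. x \<in> A) * of_bool (\<forall>x\<in>F. \<sigma> x = (x \<in> A)))"
      using fin by (intro sum.mono_neutral_right) (auto simp: B_def)
    also have "\<dots> = f (\<lambda>x. x \<in> B)" by (auto simp: B_def)
    also have "\<dots> = f \<sigma>" by (rule F) (auto simp: B_def)
    finally show ?thesis by simp
  qed
  thus thesis using that fin by blast
qed

lemma spin_measurable [measurable]: "(\<lambda>\<sigma>. \<sigma> x) \<in> config_M \<rightarrow>\<^sub>M count_space UNIV"
  unfolding config_M_def by (rule measurable_component_singleton) simp

lemma space_config_M [simp]: "space config_M = UNIV"
  by (simp add: config_M_def space_PiM PiE_def extensional_def)

lemma local_fun_measurable:
  assumes "local_fun f"
  shows "f \<in> borel_measurable config_M"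
proof -
  obtain F where fin: "finite F" and f: "\<And>\<sigma>. f \<sigma> = (\<Sum>A\<in>Pow F. f (\<lambda>x. x \<in> A) * of_bool (\<forall>x\<in>F. \<sigma> x = (x \<in> A)))"
    using local_fun_sum[OF assms] by blast
  have "(\<lambda>\<sigma>. \<Sum>A\<in>Pow F. f (\<lambda>x. x \<in> A) * of_bool (\<forall>x\<in>F. \<sigma> x = (x \<in> A))) \<in> borel_measurable config_M"
    using fin by measurable
  moreover have "(\<lambda>\<sigma>. \<Sum>A\<in>Pow F. f (\<lambda>x. x \<in> A) * of_bool (\<forall>x\<in>F. \<sigma> x = (x \<in> A))) = f"
    by (rule ext, rule f[symmetric])
  ultimately show ?thesis by (simp only:)
qed

lemma local_fun_bounded:
  assumes "local_fun f"
  obtains B where "\<And>\<sigma>. \<bar>f \<sigma>\<bar> \<le> B"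
proof -
  obtain F where fin: "finite F" and f: "\<And>\<sigma>. f \<sigma> = (\<Sum>A\<in>Pow F. f (\<lambda>x. x \<in> A) * of_bool (\<forall>x\<in>F. \<sigma> x = (x \<in> A)))"
    using local_fun_sum[OF assms] by blast
  have "\<bar>f \<sigma>\<bar> \<le> (\<Sum>A\<in>Pow F. \<bar>f (\<lambda>x. x \<in> A)\<bar>)" for \<sigma>
  proof -
    have "\<bar>f \<sigma>\<bar> = \<bar>\<Sum>A\<in>Pow F. f (\<lambda>x. x \<in> A) * of_bool (\<forall>x\<in>F. \<sigma> x = (x \<in> A))\<bar>"
      by (rule arg_cong[OF f])
    also have "\<dots> \<le> (\<Sum>A\<in>Pow F. \<bar>f (\<lambda>x. x \<in> A)\<bar>)"
      by (rule order_trans[OF sum_abs], rule sum_mono) (auto simp: abs_mult)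
    finally show ?thesis .
  qed
  thus thesis by (rule that)
qed

lemma local_fun_integrable:
  assumes "local_fun f" "prob_space M" "sets M = sets config_M"
  shows "integrable M f"
proof -
  interpret prob_space M by fact
  obtain B where "\<And>\<sigma>. \<bar>f \<sigma>\<bar> \<le> B" by (rule local_fun_bounded[OF assms(1)]) blast
  moreover have "f \<in> borel_measurable M"
    using local_fun_measurable[OF assms(1)] measurable_cong_sets[OF assms(3) refl] by blast
  ultimately show ?thesis by (intro integrable_const_bound[of _ B]) auto
qed

lemma finite_nbrs [simp]: "finite (nbrs x)"
  by (simp add: nbrs_def)

lemma opposite_cong:
  assumes "\<And>y. y \<in> insert x (nbrs x) \<Longrightarrow> \<sigma> y = \<eta> y"
  shows "opposite \<sigma> x = opposite \<eta> x"
  unfolding opposite_def by (rule arg_cong[of _ _ card]) (use assms in auto)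

lemma local_fun_avg_drift:
  assumes Z: "zero_temp_ising P X" and N: "N \<ge> 1" and \<delta>: "\<delta> > 0"
  shows "local_fun (avg_drift P X s x0 x1 r \<delta> N)"
  unfolding local_fun_def
proof (intro exI conjI allI impI)
  let ?J = "touched N (region s x0 x1 r \<delta> \<delta>)"
  show "finite (\<Union>x\<in>?J. insert x (nbrs x))"
    using finite_touched[OF N bounded_region] by auto
  fix \<sigma> \<eta> :: config assume *: "\<forall>x\<in>(\<Union>x\<in>?J. insert x (nbrs x)). \<sigma> x = \<eta> x"
  have "spin_drift \<sigma> x = spin_drift \<eta> x" if "x \<in> ?J" for x
  proof -
    have eq: "\<sigma> y = \<eta> y" if "y \<in> insert x (nbrs x)" for y
      using *[rule_format, OF UN_I[of x ?J y "\<lambda>x. insert x (nbrs x)", OF \<open>x \<in> ?J\<close> that]] .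
    have "opposite \<sigma> x = opposite \<eta> x" by (rule opposite_cong) (rule eq)
    moreover have "\<sigma> x = \<eta> x" by (rule eq) simp
    ultimately show ?thesis by (simp add: spin_drift_def rate_def)
  qed
  thus "avg_drift P X s x0 x1 r \<delta> N \<sigma> = avg_drift P X s x0 x1 r \<delta> N \<eta>"
    unfolding avg_drift_eq_sum[OF Z N \<delta>] by (auto intro: sum.cong)
qed

lemma local_fun_corners:
  assumes N: "N \<ge> 1"
  shows "local_fun (\<lambda>\<sigma>. real (corners s x \<delta> N \<sigma>))"
  unfolding local_fun_def
proof (intro exI conjI allI impI)
  let ?J = "touched N (cball x \<delta>)"
  show "finite (\<Union>x\<in>?J. insert x (nbrs x))"
    using finite_touched[OF N, of "cball x \<delta>"] by auto
  fix \<sigma> \<eta> :: config assume *: "\<forall>x\<in>(\<Union>x\<in>?J. insert x (nbrs x)). \<sigma> x = \<eta> x"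
  have same: "opposite \<sigma> y = opposite \<eta> y \<and> \<sigma> y = \<eta> y" if "y \<in> ?J" for y
  proof -
    have eq: "\<sigma> z = \<eta> z" if "z \<in> insert y (nbrs y)" for z
      using *[rule_format, OF UN_I[of y ?J z "\<lambda>x. insert x (nbrs x)", OF \<open>y \<in> ?J\<close> that]] .
    have "opposite \<sigma> y = opposite \<eta> y" by (rule opposite_cong) (rule eq)
    moreover have "\<sigma> y = \<eta> y" by (rule eq) simp
    ultimately show ?thesis ..
  qed
  have J: "site N y \<in> cover N (cball x \<delta>) \<Longrightarrow> y \<in> ?J" for y
    by (simp add: cover_eq[OF N] site_of_site[OF N])
  have "{y. site N y \<in> cover N (cball x \<delta>) - cball s (dist x s) \<and> \<sigma> y \<and> opposite \<sigma> y = 2} =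
      {y. site N y \<in> cover N (cball x \<delta>) - cball s (dist x s) \<and> \<eta> y \<and> opposite \<eta> y = 2}"
    by (rule Collect_cong) (use same J in auto)
  thus "real (corners s x \<delta> N \<sigma>) = real (corners s x \<delta> N \<eta>)"
    unfolding corners_def by simp
qed

section \<open>Summation by parts along a staircase\<close>

definition convex_corner :: "config \<Rightarrow> int \<times> int \<Rightarrow> bool" where
  "convex_corner \<sigma> x \<longleftrightarrow> \<sigma> x \<and> \<not> \<sigma> (x + (1,0)) \<and> \<not> \<sigma> (x + (0,1))"

definition concave_corner :: "config \<Rightarrow> int \<times> int \<Rightarrow> bool" where
  "concave_corner \<sigma> x \<longleftrightarrow> \<not> \<sigma> x \<and> \<sigma> (x - (1,0)) \<and> \<sigma> (x - (0,1))"

definition vertical_edge :: "config \<Rightarrow> int \<times> int \<Rightarrow> bool" where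
  "vertical_edge \<sigma> x \<longleftrightarrow> \<sigma> x \<and> \<not> \<sigma> (x + (1,0))"

definition descends :: "config \<Rightarrow> int \<times> int \<Rightarrow> bool" where
  "descends \<sigma> x \<longleftrightarrow> (\<sigma> (x + (1,0)) \<longrightarrow> \<sigma> x) \<and> (\<sigma> (x + (0,1)) \<longrightarrow> \<sigma> x)"

lemma nbrs_eq: "nbrs x = {x + (1,0), x - (1,0), x + (0,1), x - (0,1)}"
  by (cases x) (simp add: nbrs_def)

lemma opposite_eq_sum: "opposite \<sigma> x = (\<Sum>y\<in>nbrs x. of_bool (\<sigma> y \<noteq> \<sigma> x))"
  unfolding opposite_def card_eq_sum sum.inter_filter[OF finite_nbrs] of_bool_def ..

lemma opposite_explicit:
  "opposite \<sigma> x = of_bool (\<sigma> (x + (1,0)) \<noteq> \<sigma> x) + of_bool (\<sigma> (x - (1,0)) \<noteq> \<sigma> x)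
     + of_bool (\<sigma> (x + (0,1)) \<noteq> \<sigma> x) + of_bool (\<sigma> (x - (0,1)) \<noteq> \<sigma> x)"
proof -
  have "x + (1,0) \<noteq> x - (1,0)" "x + (1,0) \<noteq> x + (0,1)" "x + (1,0) \<noteq> x - (0,1)"
     "x - (1,0) \<noteq> x + (0,1)" "x - (1,0) \<noteq> x - (0,1)" "x + (0,1) \<noteq> x - (0,1)"
    by (cases x, simp)+
  thus ?thesis unfolding opposite_eq_sum nbrs_eq by simp
qed

lemma descends_diff:
  assumes "descends \<sigma> (x - (1,0))" "descends \<sigma> (x - (0,1))" "\<sigma> x"
  shows "\<sigma> (x - (1,0))" "\<sigma> (x - (0,1))"
  using assms by (auto simp: descends_def)

text \<open>Plus spins propagate down and to the left, one step at a time.\<close>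
lemma descend_rectangle:
  assumes "\<sigma> y" "fst x \<le> fst y" "snd x \<le> snd y"
    and "\<And>i j. fst x \<le> i \<Longrightarrow> i \<le> fst y \<Longrightarrow> snd x \<le> j \<Longrightarrow> j \<le> snd y \<Longrightarrow> descends \<sigma> (i, j)"
  shows "\<sigma> x"
  using assms(2-4)
proof (induction "nat (fst y - fst x) + nat (snd y - snd x)" arbitrary: x rule: less_induct)
  case less
  have d: "descends \<sigma> x" using less.prems(3)[of "fst x" "snd x"] less.prems(1,2) by simp
  consider "fst x < fst y" | "fst x = fst y" "snd x < snd y" | "x = y" using less.prems(1,2) by (fastforce simp: prod_eq_iff)
  thus ?case
  proof cases
    case 1
    have "\<sigma> (x + (1,0))" by (rule less.hyps) (use 1 less.prems in auto)
    thus ?thesis using d by (simp add: descends_def)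
  next
    case 2
    have "\<sigma> (x + (0,1))" by (rule less.hyps) (use 2 less.prems in auto)
    thus ?thesis using d by (simp add: descends_def)
  next
    case 3
    thus ?thesis using assms(1) by simp
  qed
qed

lemma opposite_two_iff:
  assumes "descends \<sigma> (x - (1,0))" "descends \<sigma> (x - (0,1))" "\<sigma> x"
  shows "opposite \<sigma> x = 2 \<longleftrightarrow> convex_corner \<sigma> x"
  using descends_diff[OF assms] assms(3) by (simp add: opposite_explicit convex_corner_def)

text \<open>Where plus spins propagate down and to the left, a plus spin has plus neighbours below and to
  the left, and a minus spin has minus neighbours above and to the right. So at most two neighbours
  disagree, and exactly two at the corners.\<close>
lemma spin_drift_corners:
  assumes "descends \<sigma> x" "descends \<sigma> (x - (1,0))" "descends \<sigma> (x - (0,1))"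
  shows "spin_drift \<sigma> x = 1/2 * of_bool (concave_corner \<sigma> x) - 1/2 * of_bool (convex_corner \<sigma> x)"
proof (cases "\<sigma> x")
  case True
  thus ?thesis using descends_diff[OF assms(2,3) True]
    by (simp add: spin_drift_def rate_def opposite_explicit convex_corner_def concave_corner_def)
next
  case False
  hence "\<not> \<sigma> (x + (1,0))" "\<not> \<sigma> (x + (0,1))" using assms(1) by (auto simp: descends_def)
  thus ?thesis using False
    by (simp add: spin_drift_def rate_def opposite_explicit convex_corner_def concave_corner_def)
qed

text \<open>Both sides are the mixed second difference of the spins on a unit square.\<close>
lemma corner_difference:
  assumes "descends \<sigma> x" "descends \<sigma> (x + (1,0))" "descends \<sigma> (x + (0,1))"
  shows "of_bool (convex_corner \<sigma> x) - of_bool (concave_corner \<sigma> (x + (1,1))) =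
    (of_bool (vertical_edge \<sigma> x) - of_bool (vertical_edge \<sigma> (x + (0,1))) :: real)"
proof -
  have *: "x + (1,0) + (0,1) = x + (1,1)" "x + (0,1) + (1,0) = x + (1,1)"
    "x + (1,1) - (1,0) = x + (0,1)" "x + (1,1) - (0,1) = x + (1,0)"
    by (cases x, simp)+
  show ?thesis
    using assms unfolding descends_def convex_corner_def concave_corner_def vertical_edge_def *
    by (cases "\<sigma> x"; cases "\<sigma> (x + (1,0))"; cases "\<sigma> (x + (0,1))"; cases "\<sigma> (x + (1,1))") simp_all
qed

lemma sum_shift:
  fixes f :: "int \<times> int \<Rightarrow> real"
  assumes "finite T" "\<And>x. f x \<noteq> 0 \<Longrightarrow> x \<in> T \<and> x - a \<in> T"
  shows "(\<Sum>x\<in>T. f (x + a)) = (\<Sum>x\<in>T. f x)"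
proof -
  have "(\<Sum>x\<in>T. f x) = (\<Sum>x | f x \<noteq> 0. f x)"
    using assms by (intro sum.mono_neutral_right) auto
  also have "\<dots> = (\<Sum>x | f (x + a) \<noteq> 0. f (x + a))"
    by (rule sum.reindex_bij_witness[of _ "\<lambda>x. x + a" "\<lambda>x. x - a"]) auto
  also have "\<dots> = (\<Sum>x\<in>T. f (x + a))"
    using assms(1) assms(2)[of "_ + a"] by (intro sum.mono_neutral_left) auto
  finally show ?thesis by simp
qed

text \<open>Concave and convex corners alternate along a staircase, so that their contributions to the
  drift nearly cancel. Summation by parts turns the sum over corners into sums of increments of
  the weight.\<close>
lemma staircase_sum:
  fixes w :: "int \<times> int \<Rightarrow> real"
  assumes fin: "finite T"
    and supp: "\<And>x b. w x \<noteq> 0 \<Longrightarrow> b \<in> {0, (1,0), (0,1), (1,1)} \<Longrightarrow> x - b \<in> T"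
    and desc: "\<And>x b. x \<in> T \<Longrightarrow> b \<in> {0, (1,0), (0,1), - (1,0), - (0,1)} \<Longrightarrow> descends \<sigma> (x + b)"
  shows "2 * (\<Sum>x\<in>T. w x * spin_drift \<sigma> x) =
    (\<Sum>x | x \<in> T \<and> convex_corner \<sigma> x. w (x + (1,1)) - w x)
    - (\<Sum>x | x \<in> T \<and> vertical_edge \<sigma> x. w (x + (1,1)) - w (x + (1,0)))"
proof -
  let ?v = "\<lambda>x. of_bool (convex_corner \<sigma> x) :: real"
  let ?c = "\<lambda>x. of_bool (concave_corner \<sigma> x) :: real"
  let ?h = "\<lambda>x. of_bool (vertical_edge \<sigma> x) :: real"
  have drift: "spin_drift \<sigma> x = 1/2 * ?c x - 1/2 * ?v x" if "x \<in> T" for x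
    using desc[OF that, of 0] desc[OF that, of "- (1,0)"] desc[OF that, of "- (0,1)"]
    by (intro spin_drift_corners) (simp_all only: add_0_right add_uminus_conv_diff insert_iff simp_thms)
  have corner: "?v x - ?c (x + (1,1)) = ?h x - ?h (x + (0,1))" if "x \<in> T" for x
    using desc[OF that, of 0] desc[OF that, of "(1,0)"] desc[OF that, of "(0,1)"]
    by (intro corner_difference) (simp_all only: add_0_right insert_iff simp_thms)
  have s1: "(\<Sum>x\<in>T. w x * ?c x) = (\<Sum>x\<in>T. w (x + (1,1)) * ?c (x + (1,1)))"
    by (rule sum_shift[OF fin, of "\<lambda>x. w x * ?c x" "(1,1)", symmetric])
       (use supp[of _ 0] supp[of _ "(1,1)"] in auto)
  have T': "x \<in> T \<and> x - (0,1) \<in> T" if "w (x + (1,0)) \<noteq> 0" for x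
  proof -
    have "x + (1,0) - (1,0) \<in> T" "x + (1,0) - (1,1) \<in> T" using supp[OF that] by blast+
    moreover have "x + (1,0) - (1,0) = x" "x + (1,0) - (1,1) = x - (0,1)" by (cases x, simp)+
    ultimately show ?thesis by simp
  qed
  have E: "x + (0,1) + (1,0) = x + (1,1)" for x :: "int \<times> int" by (cases x) simp
  have s2: "(\<Sum>x\<in>T. w (x + (1,1)) * ?h (x + (0,1))) = (\<Sum>x\<in>T. w (x + (1,0)) * ?h x)"
    using sum_shift[OF fin, of "\<lambda>x. w (x + (1,0)) * ?h x" "(0,1)"] T' by (simp add: E)
  have "2 * (\<Sum>x\<in>T. w x * spin_drift \<sigma> x) = (\<Sum>x\<in>T. w x * ?c x - w x * ?v x)"
    unfolding sum_distrib_left by (rule sum.cong) (auto simp: drift algebra_simps)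
  also have "\<dots> = (\<Sum>x\<in>T. w (x + (1,1)) * ?c (x + (1,1))) - (\<Sum>x\<in>T. w x * ?v x)"
    by (simp only: sum_subtractf s1)
  also have "(\<Sum>x\<in>T. w (x + (1,1)) * ?c (x + (1,1))) =
      (\<Sum>x\<in>T. w (x + (1,1)) * ?v x - w (x + (1,1)) * ?h x + w (x + (1,1)) * ?h (x + (0,1)))"
  proof (rule sum.cong[OF refl])
    fix x assume "x \<in> T"
    hence c: "?c (x + (1,1)) = ?v x - ?h x + ?h (x + (0,1))" using corner[of x] by linarith
    show "w (x + (1,1)) * ?c (x + (1,1)) =
        w (x + (1,1)) * ?v x - w (x + (1,1)) * ?h x + w (x + (1,1)) * ?h (x + (0,1))"
      unfolding c by (simp only: distrib_left right_diff_distrib)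
  qed
  also have "\<dots> - (\<Sum>x\<in>T. w x * ?v x) =
      (\<Sum>x\<in>T. (w (x + (1,1)) - w x) * ?v x) - (\<Sum>x\<in>T. (w (x + (1,1)) - w (x + (1,0))) * ?h x)"
    by (simp only: sum.distrib sum_subtractf s2 left_diff_distrib)
  also have "(\<Sum>x\<in>T. (w (x + (1,1)) - w x) * ?v x) = (\<Sum>x | x \<in> T \<and> convex_corner \<sigma> x. w (x + (1,1)) - w x)"
    using fin by (intro sum.mono_neutral_cong_right) auto
  also have "(\<Sum>x\<in>T. (w (x + (1,1)) - w (x + (1,0))) * ?h x) =
     (\<Sum>x | x \<in> T \<and> vertical_edge \<sigma> x. w (x + (1,1)) - w (x + (1,0)))"
    using fin by (intro sum.mono_neutral_cong_right) auto
  finally show ?thesis .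
qed

lemma card_int_interval:
  fixes S :: "int set"
  assumes "finite S" "\<And>i j. i \<in> S \<Longrightarrow> j \<in> S \<Longrightarrow> real_of_int \<bar>i - j\<bar> \<le> L" "L \<ge> 0"
  shows "real (card S) \<le> L + 1"
proof (cases "S = {}")
  case False
  define m where "m = Min S"
  have m: "m \<in> S" "\<And>i. i \<in> S \<Longrightarrow> m \<le> i" using False assms(1) by (auto simp: m_def)
  have "S \<subseteq> {m..m + \<lfloor>L\<rfloor>}"
  proof
    fix i assume i: "i \<in> S"
    have "real_of_int (i - m) \<le> L" using assms(2)[OF i m(1)] m(2)[OF i] by simp
    hence "i - m \<le> \<lfloor>L\<rfloor>" by (simp only: le_floor_iff)
    thus "i \<in> {m..m + \<lfloor>L\<rfloor>}" using m(2)[OF i] by simp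
  qed
  hence "card S \<le> card {m..m + \<lfloor>L\<rfloor>}" by (intro card_mono) auto
  also have "\<dots> = nat (\<lfloor>L\<rfloor> + 1)" by simp
  finally have "real (card S) \<le> real (nat (\<lfloor>L\<rfloor> + 1))" by simp
  also have "\<dots> = of_int \<lfloor>L\<rfloor> + 1" using assms(3) by simp
  finally show ?thesis by linarith
qed (use assms in simp)

lemma site_add: "site N (x + b) = site N x + site N b"
  by (simp add: site_def complex_eq_iff add_divide_distrib)

text \<open>The gradient of the norm at \<open>z\<close> is \<open>z / norm z\<close>, which is within \<open>2 * \<eta> / t\<close> of the unit vector
  \<open>u\<close> if \<open>z\<close> lies at distance at most \<open>\<eta>\<close> from the axis \<open>u\<close>; the last term is the second order of
  the expansion.\<close>
lemma norm_step_le: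
  fixes z e u :: complex
  assumes u: "norm u = 1" and t: "0 < t" "t \<le> z \<bullet> u" and \<eta>: "norm (z - (z \<bullet> u) *\<^sub>R u) \<le> \<eta>"
    and e: "norm e \<le> t"
  shows "norm (z + e) - norm z \<le> e \<bullet> u + 2 * \<eta> * norm e / t + (norm e)\<^sup>2 / (2 * t)"
proof -
  have zt: "t \<le> norm z" using t(2) norm_cauchy_schwarz[of z u] u by simp
  hence z0: "norm z > 0" using t(1) by linarith
  define c where "c = (z \<bullet> e) / norm z + (norm e)\<^sup>2 / (2 * norm z)"
  have "\<bar>z \<bullet> e\<bar> \<le> norm z * norm e" by (rule Cauchy_Schwarz_ineq2)
  hence ze: "\<bar>z \<bullet> e\<bar> / norm z \<le> norm e" using z0 by (simp add: field_simps)
  have c0: "norm z + c \<ge> 0"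
  proof -
    have "- norm e \<le> (z \<bullet> e) / norm z" using ze z0 by (simp add: field_simps abs_le_iff)
    moreover have "(norm e)\<^sup>2 / (2 * norm z) \<ge> 0" by simp
    ultimately show ?thesis using e zt unfolding c_def by linarith
  qed
  have "(norm (z + e))\<^sup>2 = (norm z)\<^sup>2 + 2 * (z \<bullet> e) + (norm e)\<^sup>2"
    by (simp add: power2_norm_eq_inner inner_add_left inner_add_right inner_commute)
  also have "\<dots> = (norm z)\<^sup>2 + 2 * norm z * c" using z0 by (simp add: c_def field_simps)
  also have "\<dots> \<le> (norm z + c)\<^sup>2" by (simp add: power2_sum)
  finally have "norm (z + e) \<le> norm z + c" using c0 by (rule power2_le_imp_le)
  moreover have "(z \<bullet> e) / norm z \<le> e \<bullet> u + 2 * \<eta> * norm e / t"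
  proof -
    have "norm (z - norm z *\<^sub>R u) \<le> norm (z - (z \<bullet> u) *\<^sub>R u) + norm ((z \<bullet> u - norm z) *\<^sub>R u)"
      using norm_triangle_ineq[of "z - (z \<bullet> u) *\<^sub>R u" "(z \<bullet> u - norm z) *\<^sub>R u"]
      by (simp add: scaleR_left_diff_distrib)
    also have "norm ((z \<bullet> u - norm z) *\<^sub>R u) = norm z - z \<bullet> u"
      using norm_cauchy_schwarz[of z u] u by simp
    also have "norm z \<le> norm (z - (z \<bullet> u) *\<^sub>R u) + norm ((z \<bullet> u) *\<^sub>R u)"
      using norm_triangle_ineq[of "z - (z \<bullet> u) *\<^sub>R u" "(z \<bullet> u) *\<^sub>R u"] by simp
    also have "norm ((z \<bullet> u) *\<^sub>R u) = z \<bullet> u" using u t by simp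
    finally have n: "norm (z - norm z *\<^sub>R u) \<le> 2 * \<eta>" using \<eta> by linarith
    have "z \<bullet> e = (z - norm z *\<^sub>R u) \<bullet> e + norm z * (u \<bullet> e)"
      by (simp add: inner_diff_left)
    also have "\<dots> \<le> 2 * \<eta> * norm e + norm z * (u \<bullet> e)"
      using norm_cauchy_schwarz[of "z - norm z *\<^sub>R u" e] mult_right_mono[OF n, of "norm e"] by simp
    finally have "(z \<bullet> e) / norm z \<le> (2 * \<eta> * norm e + norm z * (u \<bullet> e)) / norm z"
      using z0 by (simp add: divide_right_mono)
    also have "\<dots> = 2 * \<eta> * norm e / norm z + e \<bullet> u" using z0 by (simp add: field_simps inner_commute)
    also have "2 * \<eta> * norm e / norm z \<le> 2 * \<eta> * norm e / t"
    proof (rule divide_left_mono[OF zt])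
      have "\<eta> \<ge> 0" using \<eta> norm_ge_zero order_trans by blast
      thus "0 \<le> 2 * \<eta> * norm e" by simp
    qed (use z0 t in simp)
    finally show ?thesis by simp
  qed
  moreover have "(norm e)\<^sup>2 / (2 * norm z) \<le> (norm e)\<^sup>2 / (2 * t)"
    using zt t z0 by (intro divide_left_mono) auto
  ultimately show ?thesis unfolding c_def by linarith
qed

section \<open>One end of the arc\<close>

text \<open>One end of the arc, in the orientation in which the droplet lies below and to the left. The unit
  vector \<open>\<phi> * (A, - B)\<close> is the tangent at the end \<open>x0\<close>, directed away from \<open>s\<close>. The number \<open>k\<close> is the
  relative precision: outside a strip of half-width \<open>k\<^sup>2 * \<delta>\<close> around the tangent the spins are
  prescribed, and the lattice spacing is much smaller than this width. The choice \<open>k\<^sup>2\<close> makes the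
  strip thin even at distance \<open>k * \<delta>\<close> from \<open>x0\<close>. The set \<open>I\<close> stands for the sites of the discretized
  disc around \<open>s\<close>, and \<open>Q\<close> for a cell around the origin. The bound \<open>c\<close> keeps \<open>x0 - s\<close> away from the
  coordinate axes.\<close>
locale staircase_end =
  fixes N :: nat and \<sigma> :: config and x0 s :: complex and r \<delta> k A B \<phi> c :: real
    and I :: "(int \<times> int) set" and Q :: "complex set" and w :: "int \<times> int \<Rightarrow> real"
  assumes N: "N \<ge> 1" and N_large: "100 \<le> k\<^sup>2 * \<delta> * real N"
    and k: "0 < k" "k \<le> 1/100" "k \<le> B / 100"
    and \<delta>: "0 < \<delta>" "\<delta> \<le> k * r / 100" "8 * \<delta> \<le> c"
    and AB: "A > 0" "B > 0" "A\<^sup>2 + B\<^sup>2 = 1" and \<phi>: "\<phi> = 1 \<or> \<phi> = -1"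
    and r: "norm (x0 - s) = r"
    and radial: "r / 2 \<le> (x0 - s) \<bullet> Complex (\<phi> * A) (- \<phi> * B)"
    and quadrant: "c \<le> \<phi> * Re (x0 - s)" "c \<le> - \<phi> * Im (x0 - s)"
    and desc: "\<And>x. norm (site N x - x0) \<le> 3 * \<delta> \<Longrightarrow> descends \<sigma> x"
    and inside: "\<And>x. norm (site N x - x0) \<le> 3 * \<delta> \<Longrightarrow>
        A * Im (site N x - x0) + B * Re (site N x - x0) < - (k\<^sup>2 * \<delta>) \<Longrightarrow> \<sigma> x"
    and outside: "\<And>x. norm (site N x - x0) \<le> 3 * \<delta> \<Longrightarrow>
        A * Im (site N x - x0) + B * Re (site N x - x0) > k\<^sup>2 * \<delta> \<Longrightarrow> \<not> \<sigma> x"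
    and I: "\<And>x. norm (site N x - s) \<le> r \<Longrightarrow> x \<in> I"
        "\<And>x. x \<in> I \<Longrightarrow> norm (site N x - s) \<le> r + 1 / real N"
    and Q: "compact Q" "0 \<in> Q" "Q \<subseteq> cball 0 (1 / real N)"
    and w: "\<And>x. norm (site N x - x0) \<le> 3 * \<delta> \<Longrightarrow>
        w x = (if x \<in> I then 1 else ramp \<delta> (infdist (site N x - x0) Q))"
begin

definition u :: complex where "u = Complex (\<phi> * A) (- \<phi> * B)"

definition pos :: "int \<times> int \<Rightarrow> complex" where "pos x = site N x - x0"

text \<open>Coordinates along the tangent \<open>u\<close> and along its normal \<open>(B, A)\<close>, which points out of the droplet.\<close>
definition tng :: "int \<times> int \<Rightarrow> real" where "tng x = pos x \<bullet> u"

definition nrm :: "int \<times> int \<Rightarrow> real" where "nrm x = A * Im (pos x) + B * Re (pos x)"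

text \<open>The lattice spacing.\<close>
definition h :: real where "h = 1 / real N"

text \<open>The interface near the end, one vertical edge per row that it crosses.\<close>
definition H :: "(int \<times> int) set" where "H = {x. norm (pos x) < 2 * \<delta> \<and> vertical_edge \<sigma> x}"

lemma norm_u: "norm u = 1"
proof -
  have "(norm u)\<^sup>2 = 1" using \<phi> AB(3) by (auto simp: u_def cmod_power2 power_mult_distrib)
  thus ?thesis by (simp add: power2_eq_1_iff) (smt (verit) norm_ge_zero)
qed

lemma N_pos: "real N > 0" using N by simp

lemma h_pos: "0 < h" using N_pos by (simp add: h_def)

lemma k2: "k\<^sup>2 \<le> k / 100" "0 < k\<^sup>2"
  using k(1,2) by (simp_all add: power2_eq_square)

lemma h_le: "100 * h \<le> k\<^sup>2 * \<delta>"
  using N_large N_pos by (simp add: h_def field_simps)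

lemma k\<delta>: "100 * (k\<^sup>2 * \<delta>) \<le> k * \<delta>" "0 < k\<^sup>2 * \<delta>" "100 * (k * \<delta>) \<le> \<delta>" "0 < k * \<delta>"
  using mult_right_mono[OF k2(1), of \<delta>] mult_right_mono[OF k(2), of \<delta>] k2(2) k(1) \<delta>(1) by simp_all

lemmas scales = h_pos h_le k\<delta>

lemma A_le_1: "A \<le> 1" and B_le_1: "B \<le> 1"
proof -
  have "A\<^sup>2 \<le> 1\<^sup>2" "B\<^sup>2 \<le> 1\<^sup>2" using AB(3) zero_le_power2[of A] zero_le_power2[of B] by (simp_all, linarith+)
  from power2_le_imp_le[OF this(1)] power2_le_imp_le[OF this(2)] show "A \<le> 1" "B \<le> 1" by simp_all
qed

lemma \<phi>2: "\<phi> * \<phi> = 1" using \<phi> by auto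

lemma pos_decomp: "pos x = tng x *\<^sub>R u + nrm x *\<^sub>R Complex B A"
proof -
  have 1: "(\<phi> * A * Re z - \<phi> * B * Im z) * (\<phi> * A) + (A * Im z + B * Re z) * B = (\<phi> * \<phi>) * (A\<^sup>2 * Re z - A * B * Im z) + (A * B * Im z + B\<^sup>2 * Re z)" for z
    by (simp add: algebra_simps power2_eq_square)
  have 2: "(\<phi> * A * Re z - \<phi> * B * Im z) * (- \<phi> * B) + (A * Im z + B * Re z) * A = (\<phi> * \<phi>) * (- A * B * Re z + B\<^sup>2 * Im z) + (A\<^sup>2 * Im z + A * B * Re z)" for z
    by (simp add: algebra_simps power2_eq_square)
  have 3: "(A\<^sup>2 * y - A * B * z) + (A * B * z + B\<^sup>2 * y) = (A\<^sup>2 + B\<^sup>2) * y"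
    "(- A * B * y + B\<^sup>2 * z) + (A\<^sup>2 * z + A * B * y) = (A\<^sup>2 + B\<^sup>2) * z" for y z :: real
    by (simp_all add: algebra_simps)
  show ?thesis
    using 1[of "pos x"] 2[of "pos x"] unfolding 3 AB(3) \<phi>2 mult_1
    by (simp add: complex_eq_iff tng_def nrm_def u_def inner_complex_def mult.commute)
qed

lemma norm_BA: "norm (Complex B A) = 1"
  using AB(3) by (simp add: complex_norm add.commute)

lemma norm_pos_le: "norm (pos x) \<le> \<bar>tng x\<bar> + \<bar>nrm x\<bar>"
  using norm_triangle_ineq[of "tng x *\<^sub>R u" "nrm x *\<^sub>R Complex B A"] norm_u norm_BA
  by (simp add: pos_decomp[symmetric])

lemma tng_le: "\<bar>tng x\<bar> \<le> norm (pos x)"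
  using Cauchy_Schwarz_ineq2[of "pos x" u] norm_u by (simp add: tng_def)

lemma Im_pos: "Im (pos x) = - \<phi> * B * tng x + A * nrm x"
  by (subst pos_decomp) (simp add: u_def)

lemma pos_add: "pos (x + b) = pos x + site N b"
  by (simp add: pos_def site_add)

lemma norm_site_step:
  "norm (site N (1,0)) = h" "norm (site N (0,1)) = h" "norm (site N (1,1)) \<le> 3/2 * h"
proof -
  show "norm (site N (1,0)) = h" "norm (site N (0,1)) = h"
    using N_pos by (simp_all add: site_def cmod_def h_def)
  have "(norm (site N (1,1)))\<^sup>2 = 2 * h\<^sup>2" by (simp add: cmod_power2 power_divide h_def)
  also have "\<dots> \<le> (3/2 * h)\<^sup>2" by (simp add: power_mult_distrib power_divide)
  finally show "norm (site N (1,1)) \<le> 3/2 * h" by (rule power2_le_imp_le) (use h_pos in simp)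
qed

lemma H_strip:
  assumes "x \<in> H" shows "\<bar>nrm x\<bar> \<le> 2 * (k\<^sup>2 * \<delta>)"
proof -
  have x: "norm (pos x) < 2 * \<delta>" "\<sigma> x" "\<not> \<sigma> (x + (1,0))" using assms by (auto simp: H_def vertical_edge_def)
  have n: "norm (pos (x + (1,0))) \<le> 3 * \<delta>"
    unfolding pos_add using norm_triangle_ineq[of "pos x" "site N (1,0)"] x(1) norm_site_step(1) scales by linarith
  have "nrm x \<le> k\<^sup>2 * \<delta>" using outside[of x] x \<delta>(1) by (fastforce simp: pos_def nrm_def)
  moreover have "nrm (x + (1,0)) \<ge> - (k\<^sup>2 * \<delta>)" using inside[of "x + (1,0)"] x n by (fastforce simp: pos_def nrm_def)
  moreover have "nrm (x + (1,0)) = nrm x + B * h" by (simp add: nrm_def pos_add algebra_simps h_def)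
  moreover have "B * h \<le> 1 * h" using B_le_1 h_pos by (intro mult_right_mono) auto
  ultimately show ?thesis using scales by (simp only: abs_le_iff mult.assoc) linarith
qed

text \<open>The tangent makes a definite angle with the circle of radius \<open>r\<close>, since its radial component is
  at least \<open>1/2\<close>. So the interface leaves the disc within tangential distance \<open>k * \<delta>\<close> of \<open>x0\<close>.\<close>
lemma inner_in_disc:
  assumes "x \<in> H" "norm z \<le> 3 * h" "tng x \<le> - (k * \<delta>)"
  shows "norm (pos x + z + (x0 - s)) \<le> r"
proof -
  have n: "\<bar>nrm x\<bar> \<le> 2 * (k\<^sup>2 * \<delta>)" by (rule H_strip[OF assms(1)])
  have r0: "0 \<le> r" using r norm_ge_zero by blast
  have px: "norm (pos x) \<le> 2 * \<delta>" using assms(1) by (simp add: H_def)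
  have "(norm (pos x + (x0 - s)))\<^sup>2 = (norm (pos x))\<^sup>2 + 2 * (pos x \<bullet> (x0 - s)) + r\<^sup>2"
    by (simp add: power2_norm_eq_inner inner_add_left inner_add_right inner_commute flip: r)
  also have "pos x \<bullet> (x0 - s) = tng x * (u \<bullet> (x0 - s)) + nrm x * (Complex B A \<bullet> (x0 - s))"
    by (subst pos_decomp) (simp add: inner_add_left)
  also have "tng x * (u \<bullet> (x0 - s)) \<le> - (k * \<delta>) * (r / 2)"
  proof -
    have "u \<bullet> (x0 - s) \<ge> r / 2" using radial by (simp add: u_def inner_commute)
    hence "(k * \<delta>) * (r / 2) \<le> (- tng x) * (u \<bullet> (x0 - s))"
      using assms(3) k\<delta>(4) r0 by (intro mult_mono) auto
    thus ?thesis by simp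
  qed
  also have "nrm x * (Complex B A \<bullet> (x0 - s)) \<le> 2 * (k\<^sup>2 * \<delta>) * r"
  proof -
    have "\<bar>Complex B A \<bullet> (x0 - s)\<bar> \<le> r" using Cauchy_Schwarz_ineq2[of "Complex B A" "x0 - s"] norm_BA r by simp
    hence "\<bar>nrm x\<bar> * \<bar>Complex B A \<bullet> (x0 - s)\<bar> \<le> 2 * (k\<^sup>2 * \<delta>) * r" by (rule mult_mono[OF n]) (use scales in simp_all)
    thus ?thesis by (simp only: abs_mult[symmetric] abs_le_iff)
  qed
  also have "(norm (pos x))\<^sup>2 \<le> 2 * \<delta> * (2 * \<delta>)"
    unfolding power2_eq_square by (intro mult_mono) (use px \<delta> in auto)
  also have "2 * \<delta> * (2 * \<delta>) \<le> 2 * \<delta> * (2 * (k * r / 100))" using \<delta> by (intro mult_left_mono) auto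
  also have "2 * (k\<^sup>2 * \<delta>) * r \<le> 2 * (k * \<delta> / 100) * r" by (rule mult_right_mono) (use scales r0 in linarith)+
  finally have "(norm (pos x + (x0 - s)))\<^sup>2 \<le> r\<^sup>2 - 9/10 * (k * \<delta> * r)"
    using mult_nonneg_nonneg[OF less_imp_le[OF k\<delta>(4)] r0] by (simp add: algebra_simps)
  also have "\<dots> \<le> (r - 9/20 * (k * \<delta>))\<^sup>2" by (simp add: power2_diff algebra_simps)
  finally have "norm (pos x + (x0 - s)) \<le> r - 9/20 * (k * \<delta>)"
  proof (rule power2_le_imp_le)
    have "k * \<delta> \<le> 1 * (k * r / 100)" using \<delta> k by (intro mult_mono) auto
    also have "\<dots> \<le> r" using k r0 mult_right_mono[of k 1 r] by simp
    finally show "0 \<le> r - 9/20 * (k * \<delta>)" using scales by linarith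
  qed
  moreover have "norm (pos x + z + (x0 - s)) \<le> norm (pos x + (x0 - s)) + norm z"
    using norm_triangle_ineq[of "pos x + (x0 - s)" z] by (simp add: algebra_simps)
  ultimately show ?thesis using assms(2) scales by linarith
qed

lemma outer_off_disc:
  assumes "x \<in> H" "norm z \<le> 3 * h" "k * \<delta> \<le> tng x"
  shows "norm (pos x + z + (x0 - s)) > r + h"
proof -
  have n: "\<bar>nrm x\<bar> \<le> 2 * (k\<^sup>2 * \<delta>)" by (rule H_strip[OF assms(1)])
  have r0: "0 \<le> r" using r norm_ge_zero by blast
  define D where "D = k * \<delta> * r"
  define p where "p = tng x * (u \<bullet> (x0 - s))"
  define q where "q = nrm x * (Complex B A \<bullet> (x0 - s))"
  have "k * \<delta> * (r / 2) \<le> p"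
    unfolding p_def using radial assms(3) k\<delta>(4) r0 by (intro mult_mono) (auto simp: u_def inner_commute)
  hence p: "D / 2 \<le> p" by (simp add: D_def)
  have "\<bar>Complex B A \<bullet> (x0 - s)\<bar> \<le> r" using Cauchy_Schwarz_ineq2[of "Complex B A" "x0 - s"] norm_BA r by simp
  moreover have "\<bar>nrm x\<bar> \<le> 2 * (k * \<delta> / 100)" using n scales by linarith
  ultimately have "\<bar>nrm x\<bar> * \<bar>Complex B A \<bullet> (x0 - s)\<bar> \<le> 2 * (k * \<delta> / 100) * r"
    using scales by (intro mult_mono) auto
  hence q: "\<bar>q\<bar> \<le> D / 50" by (simp add: q_def D_def abs_mult mult.commute[of k \<delta>])
  have "pos x \<bullet> (x0 - s) = p + q"
    unfolding p_def q_def by (subst pos_decomp) (simp add: inner_add_left)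
  moreover have "0 \<le> D" using k\<delta>(4) r0 by (simp add: D_def)
  ultimately have "pos x \<bullet> (x0 - s) \<ge> 45/100 * (k * \<delta> * r)"
    using p q unfolding D_def[symmetric] by linarith
  moreover have "(norm (pos x + (x0 - s)))\<^sup>2 = (norm (pos x))\<^sup>2 + 2 * (pos x \<bullet> (x0 - s)) + r\<^sup>2"
    by (simp add: power2_norm_eq_inner inner_add_left inner_add_right inner_commute flip: r)
  ultimately have "(norm (pos x + (x0 - s)))\<^sup>2 \<ge> r\<^sup>2 + 9/10 * (k * \<delta> * r)"
    using zero_le_power2[of "norm (pos x)"] by linarith
  moreover have "(r + 3/10 * (k * \<delta>))\<^sup>2 \<le> r\<^sup>2 + 9/10 * (k * \<delta> * r)"
  proof -
    have "k * \<delta> \<le> 1 * (k * r / 100)" using \<delta> k by (intro mult_mono) auto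
    also have "\<dots> \<le> r" using k r0 mult_right_mono[of k 1 r] by simp
    finally have "k * \<delta> * (k * \<delta>) \<le> k * \<delta> * r" using k\<delta>(4) by (intro mult_left_mono) auto
    moreover have "(r + 3/10 * (k * \<delta>))\<^sup>2 = r\<^sup>2 + 6/10 * (k * \<delta> * r) + 9/100 * (k * \<delta> * (k * \<delta>))"
      by (simp add: power2_sum power2_eq_square algebra_simps)
    moreover have "0 \<le> k * \<delta> * r" using k\<delta>(4) r0 by simp
    ultimately show ?thesis by linarith
  qed
  ultimately have "r + 3/10 * (k * \<delta>) \<le> norm (pos x + (x0 - s))"
    by (intro power2_le_imp_le[of "r + 3/10 * (k * \<delta>)"]) auto
  moreover have "norm (pos x + (x0 - s)) \<le> norm (pos x + z + (x0 - s)) + norm z"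
    using norm_triangle_ineq4[of "pos x + z + (x0 - s)" z] by (simp add: algebra_simps)
  ultimately show ?thesis using assms(2) scales by linarith
qed

lemma site_pos: "site N x - s = pos x + (x0 - s)" by (simp add: pos_def)

lemma near_shift:
  assumes "x \<in> H" "norm (site N b) \<le> 3 * h"
  shows "norm (site N (x + b) - x0) \<le> 3 * \<delta>"
proof -
  have "norm (pos x + site N b) \<le> 2 * \<delta> + 3 * h"
    using norm_triangle_ineq[of "pos x" "site N b"] assms by (simp add: H_def)
  moreover have "norm (site N (x + b) - x0) = norm (pos x + site N b)" by (simp add: pos_def site_add algebra_simps)
  ultimately show ?thesis using scales by linarith
qed

lemma infdist_Q:
  obtains q where "q \<in> Q" "norm q \<le> h" "infdist y Q = norm (y - q)"
    "\<And>e. infdist (y + e) Q \<le> norm (y - q + e)"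
proof -
  obtain q where q: "q \<in> Q" "infdist y Q = dist y q"
    using infdist_attains_inf[OF compact_imp_closed[OF Q(1)], of y] Q(2) by blast
  have "infdist (y + e) Q \<le> norm (y - q + e)" for e
    using infdist_le[OF q(1), of "y + e"] by (simp add: dist_norm algebra_simps)
  moreover have "norm q \<le> h" using Q(3) q(1) by (auto simp: h_def)
  ultimately show thesis using that[of q] q by (simp add: dist_norm)
qed

lemma infdist_Q_lipschitz: "infdist (y + e) Q \<le> infdist y Q + norm e"
  using infdist_triangle[of "y + e" Q y] by (simp add: dist_norm)

lemma infdist_Q_bounds: "infdist y Q \<le> norm y" "norm y - h \<le> infdist y Q"
proof -
  show "infdist y Q \<le> norm y" using infdist_le[OF Q(2), of y] by simp
  obtain q where "norm q \<le> h" "infdist y Q = norm (y - q)" using infdist_Q[of y] by blast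
  thus "norm y - h \<le> infdist y Q" using norm_triangle_ineq2[of y q] by linarith
qed

text \<open>Beyond tangential distance \<open>k * \<delta>\<close>, the strip of width of order \<open>k\<^sup>2 * \<delta>\<close> is seen from \<open>x0\<close> under
  an angle of order \<open>k\<close>, so the distance grows like the tangential coordinate. The reverse
  inequality is the same statement for the opposite step.\<close>
lemma infdist_step_le:
  assumes x: "x \<in> H" "k * \<delta> \<le> tng x" and z: "norm z \<le> 2 * h" and e: "norm e \<le> 3/2 * h"
  shows "infdist (pos x + z + e) Q - infdist (pos x + z) Q \<le> e \<bullet> u + 20 * k * h"
proof -
  obtain q where q: "norm q \<le> h" "infdist (pos x + z) Q = norm (pos x + z - q)"
    "infdist (pos x + z + e) Q \<le> norm (pos x + z - q + e)"
    using infdist_Q[of "pos x + z"] by metis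
  define y where "y = z - q"
  have y: "norm y \<le> 3 * h" using norm_triangle_ineq4[of z q] z q(1) unfolding y_def by linarith
  have yu: "\<bar>y \<bullet> u\<bar> \<le> 3 * h" using Cauchy_Schwarz_ineq2[of y u] norm_u y by simp
  have "norm (pos x + y + e) - norm (pos x + y) \<le> e \<bullet> u + 2 * (3 * (k\<^sup>2 * \<delta>)) * norm e / (k * \<delta> / 2) + (norm e)\<^sup>2 / (2 * (k * \<delta> / 2))"
  proof (rule norm_step_le[OF norm_u])
    show "0 < k * \<delta> / 2" using scales by linarith
    show "k * \<delta> / 2 \<le> (pos x + y) \<bullet> u"
      using x(2) yu scales unfolding inner_add_left tng_def abs_le_iff by linarith
    have "pos x + y - ((pos x + y) \<bullet> u) *\<^sub>R u = nrm x *\<^sub>R Complex B A + (y - (y \<bullet> u) *\<^sub>R u)"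
      by (simp add: inner_add_left tng_def[symmetric] scaleR_left_distrib) (simp add: pos_decomp)
    note arg_cong[OF this, of norm]
    moreover have "norm (nrm x *\<^sub>R Complex B A) \<le> 2 * (k\<^sup>2 * \<delta>)" using H_strip[OF x(1)] norm_BA by simp
    moreover have "norm ((y \<bullet> u) *\<^sub>R u) \<le> 3 * h" using yu norm_u by simp
    ultimately show "norm (pos x + y - ((pos x + y) \<bullet> u) *\<^sub>R u) \<le> 3 * (k\<^sup>2 * \<delta>)"
      using norm_triangle_ineq[of "nrm x *\<^sub>R Complex B A" "y - (y \<bullet> u) *\<^sub>R u"] norm_triangle_ineq4[of y "(y \<bullet> u) *\<^sub>R u"] y scales
      by linarith
    show "norm e \<le> k * \<delta> / 2" using e scales by linarith
  qed
  also have "2 * (3 * (k\<^sup>2 * \<delta>)) * norm e / (k * \<delta> / 2) = 12 * k * norm e"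
    using k \<delta> by (simp add: power2_eq_square field_simps)
  also have "\<dots> \<le> 12 * k * (3/2 * h)" using e k by (intro mult_left_mono) auto
  also have "(norm e)\<^sup>2 / (2 * (k * \<delta> / 2)) \<le> (3/2 * h * (3/2 * h)) / (k * \<delta>)"
  proof -
    have "norm e * norm e \<le> 3/2 * h * (3/2 * h)" using e scales by (intro mult_mono) auto
    from divide_right_mono[OF this, of "k * \<delta>"] show ?thesis using scales by (simp add: power2_eq_square)
  qed
  also have "\<dots> \<le> (3/2 * h * (3/2 * (k\<^sup>2 * \<delta> / 100))) / (k * \<delta>)"
    by (intro divide_right_mono mult_left_mono) (use scales in linarith)+
  also have "\<dots> = 9/400 * k * h" using k \<delta> by (simp add: power2_eq_square field_simps)
  finally have "norm (pos x + y + e) - norm (pos x + y) \<le> e \<bullet> u + 18 * k * h + 9/400 * k * h"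
    by simp
  also have "\<dots> \<le> e \<bullet> u + 20 * k * h"
    using mult_pos_pos[OF k(1) h_pos] by simp
  finally show ?thesis using q by (simp add: y_def algebra_simps)
qed

lemma infdist_step:
  assumes x: "x \<in> H" "k * \<delta> \<le> tng x" and z: "norm z \<le> h" "norm (z + e) \<le> 3/2 * h" and e: "norm e \<le> 3/2 * h"
  shows "\<bar>infdist (pos x + z + e) Q - infdist (pos x + z) Q - e \<bullet> u\<bar> \<le> 20 * k * h"
proof -
  have z': "norm z \<le> 2 * h" "norm (z + e) \<le> 2 * h"
    using z h_pos by linarith+
  show ?thesis
    using infdist_step_le[OF x z'(1) e] infdist_step_le[OF x z'(2), of "- e"] e by (simp add: add.assoc)
qed

end

lemma ramp_lipschitz:
  assumes "\<delta> > 0" shows "\<bar>ramp \<delta> d - ramp \<delta> d'\<bar> \<le> \<bar>d - d'\<bar> / \<delta>"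
proof -
  have "\<bar>ramp \<delta> d - ramp \<delta> d'\<bar> \<le> \<bar>(1 - d / \<delta>) - (1 - d' / \<delta>)\<bar>" by (simp add: ramp_def max_def)
  also have "\<dots> = \<bar>d' - d\<bar> / \<delta>" using assms by (simp add: diff_divide_distrib[symmetric])
  finally show ?thesis by (simp add: abs_minus_commute)
qed

context staircase_end
begin

lemma pos_shift: "site N (x + b) - x0 = pos x + site N b"
  by (simp add: pos_def site_add algebra_simps)

lemma w_shift:
  assumes "x \<in> H" "norm (site N b) \<le> 3 * h"
  shows "w (x + b) = (if x + b \<in> I then 1 else ramp \<delta> (infdist (pos x + site N b) Q))"
  using w[OF near_shift[OF assms]] by (simp only: pos_shift)

lemma site_shift: "site N (x + b) - s = pos x + site N b + (x0 - s)"
  by (simp add: site_add pos_def)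

lemma w_in:
  assumes "x \<in> H" "norm (site N b) \<le> 3 * h" "tng x \<le> - (k * \<delta>)"
  shows "w (x + b) = 1"
  using w_shift[OF assms(1,2)] I(1)[of "x + b"] inner_in_disc[OF assms] by (simp add: site_shift)

lemma w_out:
  assumes "x \<in> H" "norm (site N b) \<le> 3 * h" "k * \<delta> \<le> tng x"
  shows "w (x + b) = ramp \<delta> (infdist (pos x + site N b) Q)"
proof -
  have "x + b \<notin> I" using I(2)[of "x + b"] outer_off_disc[OF assms] by (auto simp: site_shift h_def)
  thus ?thesis using w_shift[OF assms(1,2)] by simp
qed

lemma infdist_near:
  assumes "norm z \<le> 3 * h"
  shows "infdist (pos x + z) Q \<le> \<bar>tng x\<bar> + \<bar>nrm x\<bar> + 3 * h"
    and "\<bar>tng x\<bar> - 4 * h \<le> infdist (pos x + z) Q"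
proof -
  show "infdist (pos x + z) Q \<le> \<bar>tng x\<bar> + \<bar>nrm x\<bar> + 3 * h"
    using infdist_Q_bounds(1)[of "pos x + z"] norm_triangle_ineq[of "pos x" z] norm_pos_le[of x] assms by linarith
  have "norm (pos x) - norm z \<le> norm (pos x + z)"
    using norm_triangle_ineq2[of "pos x" "- z"] by simp
  thus "\<bar>tng x\<bar> - 4 * h \<le> infdist (pos x + z) Q"
    using infdist_Q_bounds(2)[of "pos x + z"] tng_le[of x] assms by linarith
qed

lemma w_beyond:
  assumes "x \<in> H" "norm (site N b) \<le> 3 * h" "\<delta> + k * \<delta> \<le> tng x"
  shows "w (x + b) = 0"
proof -
  have "\<delta> \<le> infdist (pos x + site N b) Q"
    using infdist_near(2)[OF assms(2), of x] assms(3) scales by linarith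
  thus ?thesis using w_out[OF assms(1,2)] assms(3) \<delta>(1) by (simp add: ramp_def)
qed

lemma w_end:
  assumes "x \<in> H" "norm (site N b) \<le> 3 * h" "\<bar>tng x\<bar> \<le> k * \<delta>"
  shows "1 - 3 * k \<le> w (x + b)" "w (x + b) \<le> 1"
proof -
  have "infdist (pos x + site N b) Q \<le> (3 * k) * \<delta>"
    using infdist_near(1)[OF assms(2), of x] assms(3) H_strip[OF assms(1)] scales by linarith
  hence "infdist (pos x + site N b) Q / \<delta> \<le> 3 * k" using \<delta>(1) by (simp only: pos_divide_le_eq)
  moreover have "0 \<le> infdist (pos x + site N b) Q / \<delta>" using \<delta>(1) infdist_nonneg[of "pos x + site N b" Q] by simp
  ultimately show "1 - 3 * k \<le> w (x + b)" "w (x + b) \<le> 1"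
    using w_shift[OF assms(1,2)] k by (auto simp: ramp_def)
qed

text \<open>The two steps that occur in the summation by parts, from \<open>x + b\<close> to \<open>x + (b + e)\<close>: the diagonal
  step at a corner and the upward step beyond a vertical edge.\<close>
definition step :: "int \<times> int \<Rightarrow> int \<times> int \<Rightarrow> bool" where
  "step b e \<longleftrightarrow> norm (site N b) \<le> h \<and> norm (site N e) \<le> 3/2 * h \<and> norm (site N (b + e)) \<le> 3/2 * h"

lemma stepD:
  assumes "step b e"
  shows "norm (site N b) \<le> h" "norm (site N e) \<le> 3/2 * h" "norm (site N (b + e)) \<le> 3/2 * h"
    "norm (site N b) \<le> 3 * h" "norm (site N (b + e)) \<le> 3 * h" "norm (site N b + site N e) \<le> 3/2 * h"
  using assms h_pos by (auto simp: step_def site_add)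

lemma step_corner: "step 0 (1,1)" and step_edge: "step (1,0) (0,1)"
  using norm_site_step h_pos by (auto simp: step_def site_def zero_prod_def complex_eq_iff cmod_def)

lemma diff_core:
  assumes x: "x \<in> H" "k * \<delta> \<le> tng x" "tng x \<le> (1 - k) * \<delta>" and st: "step b e"
  shows "\<bar>w (x + (b + e)) - w (x + b) + (site N e \<bullet> u) / \<delta>\<bar> \<le> 20 * k * h / \<delta>"
proof -
  let ?d = "infdist (pos x + site N b) Q" and ?d' = "infdist (pos x + site N (b + e)) Q"
  have n: "\<bar>nrm x\<bar> \<le> 2 * (k\<^sup>2 * \<delta>)" by (rule H_strip[OF x(1)])
  have "\<bar>tng x\<bar> \<le> \<delta> - k * \<delta>" using x(2,3) scales by (simp add: algebra_simps)
  hence le: "?d \<le> \<delta>" "?d' \<le> \<delta>"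
    using infdist_near(1)[OF stepD(4)[OF st], of x] infdist_near(1)[OF stepD(5)[OF st], of x] n scales by linarith+
  have "w (x + b) = 1 - ?d / \<delta>" "w (x + (b + e)) = 1 - ?d' / \<delta>"
    using w_out[OF x(1) stepD(4)[OF st] x(2)] w_out[OF x(1) stepD(5)[OF st] x(2)] le \<delta>(1)
    by (simp_all add: ramp_def)
  hence "w (x + (b + e)) - w (x + b) + (site N e \<bullet> u) / \<delta> = - (?d' - ?d - site N e \<bullet> u) / \<delta>"
    by (simp add: diff_divide_distrib add_divide_distrib)
  hence "\<bar>w (x + (b + e)) - w (x + b) + (site N e \<bullet> u) / \<delta>\<bar> = \<bar>?d' - ?d - site N e \<bullet> u\<bar> / \<delta>"
    using \<delta>(1) by (simp add: abs_minus_commute)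
  also have "\<bar>?d' - ?d - site N e \<bullet> u\<bar> \<le> 20 * k * h"
    using infdist_step[OF x(1,2) stepD(1)[OF st] stepD(6)[OF st] stepD(2)[OF st]] by (simp add: site_add add.assoc)
  hence "\<bar>?d' - ?d - site N e \<bullet> u\<bar> / \<delta> \<le> 20 * k * h / \<delta>" using \<delta>(1) by (simp add: divide_right_mono)
  finally show ?thesis by simp
qed

lemma ramp_step:
  assumes st: "step b e"
  shows "\<bar>ramp \<delta> (infdist (pos x + site N (b + e)) Q) - ramp \<delta> (infdist (pos x + site N b) Q)\<bar> \<le> 2 * h / \<delta>"
proof -
  let ?d = "infdist (pos x + site N b) Q" and ?d' = "infdist (pos x + site N (b + e)) Q"
  have "?d' \<le> ?d + norm (site N e)"
    using infdist_Q_lipschitz[of "pos x + site N b" "site N e"] by (simp add: site_add add.assoc)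
  moreover have "?d \<le> ?d' + norm (site N e)"
    using infdist_Q_lipschitz[of "pos x + site N b + site N e" "- site N e"] by (simp add: site_add add.assoc)
  ultimately have "\<bar>?d' - ?d\<bar> \<le> 2 * h" using stepD(2)[OF st] h_pos by linarith
  hence "\<bar>?d' - ?d\<bar> / \<delta> \<le> 2 * h / \<delta>" using \<delta>(1) by (simp add: divide_right_mono)
  thus ?thesis using ramp_lipschitz[OF \<delta>(1), of ?d' ?d] by linarith
qed

definition at_circle :: "int \<times> int \<Rightarrow> bool" where
  "at_circle x \<longleftrightarrow> \<bar>norm (site N x - s) - r\<bar> \<le> 4 * h"

lemma diff_off_circle:
  assumes x: "x \<in> H" "\<not> at_circle x" and st: "step b e"
  shows "\<bar>w (x + (b + e)) - w (x + b)\<bar> \<le> 2 * h / \<delta>"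
proof -
  have *: "x + b' \<in> I \<longleftrightarrow> norm (site N x - s) < r" if "norm (site N b') \<le> 3/2 * h" for b'
  proof -
    have e: "site N (x + b') - s = (site N x - s) + site N b'" by (simp add: site_add)
    have "norm (site N (x + b') - s) \<le> norm (site N x - s) + norm (site N b')"
      unfolding e by (rule norm_triangle_ineq)
    moreover have "norm (site N x - s) \<le> norm (site N (x + b') - s) + norm (site N b')"
      unfolding e using norm_triangle_ineq4[of "site N x - s + site N b'" "site N b'"] by simp
    moreover have "norm (site N x - s) < r - 4 * h \<or> norm (site N x - s) > r + 4 * h"
      using x(2) unfolding at_circle_def by linarith
    ultimately show ?thesis
      using I(1)[of "x + b'"] I(2)[of "x + b'", folded h_def] that h_pos by linarith
  qed
  have "norm (site N b) \<le> 3/2 * h" using stepD(1)[OF st] h_pos by linarith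
  from *[OF this] *[OF stepD(3)[OF st]] have "x + b \<in> I \<longleftrightarrow> x + (b + e) \<in> I" by blast
  thus ?thesis
    unfolding w_shift[OF x(1) stepD(4)[OF st]] w_shift[OF x(1) stepD(5)[OF st]]
    using ramp_step[OF st, of x] h_pos \<delta>(1) by simp
qed

text \<open>The tangential range in which the ramp is linear; its two margins of relative size \<open>k\<close>; and the
  part of the first margin where a step may enter or leave the disc around \<open>s\<close>.\<close>
definition core :: "(int \<times> int) set" where
  "core = {x. k * \<delta> < tng x \<and> tng x < (1 - k) * \<delta>}"

definition margin :: "(int \<times> int) set" where
  "margin = {x. \<bar>tng x\<bar> \<le> k * \<delta> \<or> \<bar>tng x - \<delta>\<bar> \<le> k * \<delta>}"

definition mixed :: "(int \<times> int) set" where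
  "mixed = {x. \<bar>tng x\<bar> \<le> k * \<delta> \<and> at_circle x}"

text \<open>In the core the increment of \<open>w\<close> is the linear one. In the margins the ramp is Lipschitz, which
  suffices because the margins hold few sites. A step across the circle of radius \<open>r\<close> replaces the
  ramp by \<open>1\<close>, an error of order \<open>k\<close> that is not small compared with \<open>h / \<delta>\<close>; \<open>card_mixed\<close> bounds the
  number of such steps.\<close>
lemma diff_bound:
  assumes x: "x \<in> H" and st: "step b e"
  shows "\<bar>w (x + (b + e)) - w (x + b) + (site N e \<bullet> u) / \<delta> * of_bool (x \<in> core)\<bar> \<le>
    20 * k * h / \<delta> * of_bool (x \<in> core) + 2 * h / \<delta> * of_bool (x \<in> margin) + 3 * k * of_bool (x \<in> mixed)"
proof -
  have pos: "0 \<le> 2 * h / \<delta>" "0 \<le> 3 * k" "0 \<le> 20 * k * h / \<delta>" using h_pos \<delta> k by simp_all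
  consider "tng x < - (k * \<delta>)" | "\<bar>tng x\<bar> \<le> k * \<delta>" | "k * \<delta> < tng x" "tng x < (1 - k) * \<delta>"
    | "k * \<delta> < tng x" "\<bar>tng x - \<delta>\<bar> \<le> k * \<delta>" | "\<delta> + k * \<delta> < tng x"
    by (force simp: abs_le_iff algebra_simps)
  thus ?thesis
  proof cases
    case 1
    hence "w (x + (b + e)) = 1" "w (x + b) = 1" using w_in[OF x] stepD[OF st] by simp_all
    moreover have "x \<notin> core" using 1 scales by (auto simp: core_def)
    ultimately show ?thesis using pos by simp
  next
    case 2
    hence c: "x \<notin> core" "x \<in> margin" by (auto simp: core_def margin_def)
    show ?thesis
    proof (cases "at_circle x")
      case True
      hence "x \<in> mixed" using 2 by (simp add: mixed_def)
      moreover have "\<bar>w (x + (b + e)) - w (x + b)\<bar> \<le> 3 * k"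
        using w_end[OF x stepD(4)[OF st] 2] w_end[OF x stepD(5)[OF st] 2] by (simp add: abs_le_iff)
      ultimately show ?thesis using c pos by simp
    next
      case False
      thus ?thesis using diff_off_circle[OF x False st] c pos by simp
    qed
  next
    case 3
    hence "x \<in> core" by (simp add: core_def)
    thus ?thesis using diff_core[OF x _ _ st] 3 pos by simp
  next
    case 4
    hence c: "x \<notin> core" "x \<in> margin" by (auto simp: core_def margin_def algebra_simps abs_le_iff)
    have "\<bar>w (x + (b + e)) - w (x + b)\<bar> \<le> 2 * h / \<delta>"
      using w_out[OF x stepD(4)[OF st]] w_out[OF x stepD(5)[OF st]] 4 ramp_step[OF st, of x] by simp
    thus ?thesis using c pos by simp
  next
    case 5
    hence "w (x + (b + e)) = 0" "w (x + b) = 0" using w_beyond[OF x] stepD[OF st] by simp_all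
    moreover have "x \<notin> core" using 5 scales by (auto simp: core_def algebra_simps)
    ultimately show ?thesis using pos by simp
  qed
qed

lemma finite_H: "finite H"
proof (rule finite_subset)
  show "H \<subseteq> touched N (cball x0 (2 * \<delta>))"
    using site_in_cell[OF N] by (fastforce simp: H_def touched_def pos_def dist_norm norm_minus_commute)
  show "finite (touched N (cball x0 (2 * \<delta>)))" by (rule finite_touched[OF N]) simp
qed

lemma sum_diff_bound:
  assumes P: "P \<subseteq> H" and st: "step b e"
  shows "\<bar>(\<Sum>x\<in>P. w (x + (b + e)) - w (x + b)) + (site N e \<bullet> u) / \<delta> * card (P \<inter> core)\<bar> \<le>
    20 * k * h / \<delta> * card (H \<inter> core) + 2 * h / \<delta> * card (H \<inter> margin) + 3 * k * card (H \<inter> mixed)"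
proof -
  have fin: "finite P" using P finite_H finite_subset by blast
  have pos: "0 \<le> 2 * h / \<delta>" "0 \<le> 3 * k" "0 \<le> 20 * k * h / \<delta>" using h_pos \<delta> k by simp_all
  have card: "(\<Sum>x\<in>A. of_bool (x \<in> M)) = real (card (A \<inter> M))" if "finite A" for A M :: "(int \<times> int) set"
    using sum.If_cases[OF that, of "\<lambda>x. x \<in> M" "\<lambda>_. 1 :: real" "\<lambda>_. 0"] by (simp add: of_bool_def)
  define F where "F x = 20 * k * h / \<delta> * of_bool (x \<in> core) + 2 * h / \<delta> * of_bool (x \<in> margin) + 3 * k * of_bool (x \<in> mixed)" for x
  have F_nonneg: "0 \<le> F x" for x
    unfolding F_def by (intro add_nonneg_nonneg mult_nonneg_nonneg pos(1) pos(2) pos(3)) simp_all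
  have eq: "(\<Sum>x\<in>P. w (x + (b + e)) - w (x + b)) + (site N e \<bullet> u) / \<delta> * card (P \<inter> core) =
      (\<Sum>x\<in>P. w (x + (b + e)) - w (x + b) + (site N e \<bullet> u) / \<delta> * of_bool (x \<in> core))"
    by (simp only: sum.distrib sum_distrib_left[symmetric] card[OF fin])
  have "\<bar>\<Sum>x\<in>P. w (x + (b + e)) - w (x + b) + (site N e \<bullet> u) / \<delta> * of_bool (x \<in> core)\<bar> \<le> sum F P"
  proof (rule order_trans[OF sum_abs], rule sum_mono)
    fix x assume "x \<in> P"
    hence "x \<in> H" using P by blast
    from diff_bound[OF this st]
    show "\<bar>w (x + (b + e)) - w (x + b) + (site N e \<bullet> u) / \<delta> * of_bool (x \<in> core)\<bar> \<le> F x"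
      unfolding F_def .
  qed
  also have "sum F P \<le> sum F H"
    by (rule sum_mono2[OF finite_H P F_nonneg])
  also have "sum F H = 20 * k * h / \<delta> * card (H \<inter> core) + 2 * h / \<delta> * card (H \<inter> margin) + 3 * k * card (H \<inter> mixed)"
    unfolding F_def by (simp only: sum.distrib sum_distrib_left[symmetric] card[OF finite_H])
  finally show ?thesis unfolding eq .
qed

lemma Re_pos: "Re (pos x) = h * real_of_int (fst x) - Re x0" and Im_pos': "Im (pos x) = h * real_of_int (snd x) - Im x0"
  by (simp_all add: pos_def h_def)

lemma near_box:
  assumes "\<bar>Re (pos x)\<bar> \<le> 2 * \<delta>" "\<bar>Im (pos x)\<bar> \<le> 2 * \<delta>"
  shows "norm (site N x - x0) \<le> 3 * \<delta>"
proof -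
  have sq: "y\<^sup>2 \<le> (2 * \<delta>)\<^sup>2" if "\<bar>y\<bar> \<le> 2 * \<delta>" for y :: real
    using that \<delta>(1) abs_le_square_iff[of y "2 * \<delta>"] by simp
  have "(norm (pos x))\<^sup>2 \<le> (2 * \<delta>)\<^sup>2 + (2 * \<delta>)\<^sup>2"
    unfolding cmod_power2 by (rule add_mono[OF sq[OF assms(1)] sq[OF assms(2)]])
  also have "\<dots> \<le> (3 * \<delta>)\<^sup>2" by (simp add: power_mult_distrib)
  finally have "norm (pos x) \<le> 3 * \<delta>" by (rule power2_le_imp_le) (use \<delta> in simp)
  thus ?thesis by (simp add: pos_def)
qed

lemma H_box:
  assumes "x \<in> H" shows "\<bar>Re (pos x)\<bar> \<le> 2 * \<delta>" "\<bar>Im (pos x)\<bar> \<le> 2 * \<delta>"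
  using assms abs_Re_le_cmod[of "pos x"] abs_Im_le_cmod[of "pos x"] by (auto simp: H_def)

text \<open>The interface runs down and to the right.\<close>
lemma H_order:
  assumes x: "x \<in> H" and y: "y \<in> H" and le: "snd x \<le> snd y"
  shows "fst y \<le> fst x"
proof (rule ccontr)
  assume "\<not> ?thesis"
  hence lt: "fst x + 1 \<le> fst y" by simp
  have mono: "h * real_of_int a \<le> h * real_of_int b" if "a \<le> b" for a b
    using that h_pos by (intro mult_left_mono) auto
  have box: "norm (site N (i, j) - x0) \<le> 3 * \<delta>" if "fst x \<le> i" "i \<le> fst y" "snd x \<le> j" "j \<le> snd y" for i j
  proof (rule near_box)
    show "\<bar>Re (pos (i, j))\<bar> \<le> 2 * \<delta>"
      using mono[OF that(1)] mono[OF that(2)] H_box(1)[OF x] H_box(1)[OF y] by (simp add: Re_pos abs_le_iff)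
    show "\<bar>Im (pos (i, j))\<bar> \<le> 2 * \<delta>"
      using mono[OF that(3)] mono[OF that(4)] H_box(2)[OF x] H_box(2)[OF y] by (simp add: Im_pos' abs_le_iff)
  qed
  have "\<sigma> (fst x + 1, snd x)"
  proof (rule descend_rectangle[where y = y])
    show "\<sigma> y" using y by (simp add: H_def vertical_edge_def)
    show "descends \<sigma> (i, j)" if "fst (fst x + 1, snd x) \<le> i" "i \<le> fst y" "snd (fst x + 1, snd x) \<le> j" "j \<le> snd y" for i j
      by (rule desc, rule box) (use that in auto)
  qed (use lt le in auto)
  moreover have "x + (1,0) = (fst x + 1, snd x)" by (cases x) simp
  ultimately show False using x by (simp add: H_def vertical_edge_def)
qed

lemma inj_snd_H: "inj_on snd H"
proof (rule inj_onI)
  fix x y assume xy: "x \<in> H" "y \<in> H" "snd x = snd y"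
  have "fst y \<le> fst x" "fst x \<le> fst y" by (rule H_order; use xy in simp)+
  thus "x = y" using xy(3) by (simp add: prod_eq_iff)
qed

text \<open>The interface meets each row in one vertical edge at most, so the number of its edges is
  bounded by its height.\<close>
lemma card_H_le:
  assumes P: "P \<subseteq> H" and L: "\<And>x y. x \<in> P \<Longrightarrow> y \<in> P \<Longrightarrow> \<bar>Im (pos x) - Im (pos y)\<bar> \<le> L" "0 \<le> L"
  shows "h * real (card P) \<le> L + h"
proof -
  have fin: "finite P" using P finite_H finite_subset by blast
  have "card P = card (snd ` P)" using inj_on_subset[OF inj_snd_H P] by (simp add: card_image)
  also have "real (card (snd ` P)) \<le> L / h + 1"
  proof (rule card_int_interval)
    fix i j assume "i \<in> snd ` P" "j \<in> snd ` P"
    then obtain x y where xy: "x \<in> P" "y \<in> P" "i = snd x" "j = snd y" by blast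
    have "h * real_of_int \<bar>i - j\<bar> = \<bar>h * (real_of_int i - real_of_int j)\<bar>" using h_pos by (simp add: abs_mult)
    also have "h * (real_of_int i - real_of_int j) = Im (pos x) - Im (pos y)" by (simp add: Im_pos' xy right_diff_distrib)
    finally have "h * real_of_int \<bar>i - j\<bar> \<le> L" using L(1)[OF xy(1,2)] by simp
    thus "real_of_int \<bar>i - j\<bar> \<le> L / h" using h_pos by (simp add: field_simps)
  qed (use fin L h_pos in auto)
  finally show ?thesis using h_pos by (simp add: field_simps)
qed

lemma card_window:
  assumes P: "P \<subseteq> H" and L: "\<And>x. x \<in> P \<Longrightarrow> a \<le> tng x \<and> tng x \<le> a + l" "0 \<le> l"
  shows "h * real (card P) \<le> B * l + 4 * (k\<^sup>2 * \<delta>) + h"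
proof (rule card_H_le[OF P])
  fix x y assume xy: "x \<in> P" "y \<in> P"
  have n: "\<bar>nrm x\<bar> \<le> 2 * (k\<^sup>2 * \<delta>)" "\<bar>nrm y\<bar> \<le> 2 * (k\<^sup>2 * \<delta>)" using H_strip P xy by blast+
  have "\<bar>Im (pos x) - Im (pos y)\<bar> = \<bar>- \<phi> * (B * (tng x - tng y)) + A * (nrm x - nrm y)\<bar>"
    by (simp add: Im_pos algebra_simps)
  also have "\<dots> \<le> \<bar>- \<phi> * (B * (tng x - tng y))\<bar> + \<bar>A * (nrm x - nrm y)\<bar>" by (rule abs_triangle_ineq)
  also have "\<bar>- \<phi> * (B * (tng x - tng y))\<bar> = B * \<bar>tng x - tng y\<bar>" using \<phi> AB by (auto simp: abs_mult)
  also have "\<dots> \<le> B * l" using L(1)[OF xy(1)] L(1)[OF xy(2)] AB by (intro mult_left_mono) auto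
  also have "\<bar>A * (nrm x - nrm y)\<bar> \<le> 1 * (4 * (k\<^sup>2 * \<delta>))"
    unfolding abs_mult using A_le_1 AB n by (intro mult_mono) auto
  finally show "\<bar>Im (pos x) - Im (pos y)\<bar> \<le> B * l + 4 * (k\<^sup>2 * \<delta>)" by simp
qed (use L(2) AB scales in auto)

lemma card_margin: "h * real (card (H \<inter> margin)) \<le> 5 * (k * \<delta>)"
proof -
  let ?P = "\<lambda>a. {x\<in>H. a - k * \<delta> \<le> tng x \<and> tng x \<le> (a - k * \<delta>) + 2 * (k * \<delta>)}"
  have "card (H \<inter> margin) \<le> card (?P 0 \<union> ?P \<delta>)"
  proof (rule card_mono)
    show "finite (?P 0 \<union> ?P \<delta>)" using finite_H by simp
    show "H \<inter> margin \<subseteq> ?P 0 \<union> ?P \<delta>"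
    proof
      fix x assume x: "x \<in> H \<inter> margin"
      hence "\<bar>tng x\<bar> \<le> k * \<delta> \<or> \<bar>tng x - \<delta>\<bar> \<le> k * \<delta>" by (simp add: margin_def)
      hence "(0 - k * \<delta> \<le> tng x \<and> tng x \<le> 0 - k * \<delta> + 2 * (k * \<delta>)) \<or>
        (\<delta> - k * \<delta> \<le> tng x \<and> tng x \<le> \<delta> - k * \<delta> + 2 * (k * \<delta>))" by linarith
      thus "x \<in> ?P 0 \<union> ?P \<delta>" using x by blast
    qed
  qed
  also have "\<dots> \<le> card (?P 0) + card (?P \<delta>)" by (rule card_Un_le)
  finally have "h * real (card (H \<inter> margin)) \<le> h * real (card (?P 0)) + h * real (card (?P \<delta>))"
    using h_pos by (simp add: distrib_left[symmetric] del: of_nat_add flip: of_nat_add)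
  moreover have win: "h * real (card (?P a)) \<le> B * (2 * (k * \<delta>)) + 4 * (k\<^sup>2 * \<delta>) + h" for a
    by (rule card_window) (use scales in auto)
  moreover have "B * (2 * (k * \<delta>)) \<le> 1 * (2 * (k * \<delta>))" using B_le_1 scales by (intro mult_right_mono) auto
  ultimately show ?thesis using scales win[of 0] win[of \<delta>] by linarith
qed

text \<open>Along the interface the horizontal and the vertical displacement change the distance to \<open>s\<close> in
  the same direction, because \<open>x0 - s\<close> lies in the quadrant of the tangent. The distance therefore
  varies at a rate at least of order \<open>c / r\<close>, and only boundedly many edges are within \<open>4 * h\<close> of the
  circle, uniformly in \<open>N\<close>.\<close>
lemma card_mixed: "real (card (H \<inter> mixed)) \<le> 32 * r / c + 1"
proof -
  have c: "c > 0" using \<delta> by linarith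
  have cr: "c \<le> r" using quadrant(1) \<phi> abs_Re_le_cmod[of "x0 - s"] r by auto
  have r: "r > 0" using c cr by linarith
  have main: "\<bar>Im (pos x) - Im (pos y)\<bar> \<le> 32 * r / c * h" if x: "x \<in> H \<inter> mixed" and y: "y \<in> H \<inter> mixed" and le: "snd x \<le> snd y" for x y
  proof -
    define zx where "zx = site N x - s"
    define zy where "zy = site N y - s"
    have ord: "fst y \<le> fst x" using H_order le x y by blast
    have Re: "Re (zx - zy) \<ge> 0" and Im: "Im (zy - zx) \<ge> 0"
      using ord le N_pos by (simp_all add: zx_def zy_def divide_right_mono)
    have near: "norm (pos x) \<le> c / 2" "norm (pos y) \<le> c / 2"
    proof -
      have "norm (pos x) \<le> 2 * \<delta>" "norm (pos y) \<le> 2 * \<delta>" using x y by (auto simp: H_def)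
      thus "norm (pos x) \<le> c / 2" "norm (pos y) \<le> c / 2" using \<delta> by linarith+
    qed
    have z: "zx = pos x + (x0 - s)" "zy = pos y + (x0 - s)" by (simp_all add: zx_def zy_def pos_def)
    have q: "c / 2 \<le> \<phi> * Re zx" "c / 2 \<le> \<phi> * Re zy" "c / 2 \<le> - \<phi> * Im zx" "c / 2 \<le> - \<phi> * Im zy"
      using near quadrant \<phi> abs_Re_le_cmod[of "pos x"] abs_Re_le_cmod[of "pos y"] abs_Im_le_cmod[of "pos x"] abs_Im_le_cmod[of "pos y"]
      unfolding z by auto
    have sq: "(norm zx)\<^sup>2 - (norm zy)\<^sup>2 = Re (zx - zy) * (Re zx + Re zy) - Im (zy - zx) * (Im zx + Im zy)"
      by (simp only: cmod_power2) (simp add: power2_eq_square algebra_simps)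
    have "\<phi> * ((norm zx)\<^sup>2 - (norm zy)\<^sup>2) = Re (zx - zy) * (\<phi> * Re zx + \<phi> * Re zy) + Im (zy - zx) * (- \<phi> * Im zx + - \<phi> * Im zy)"
      unfolding sq by (simp add: algebra_simps)
    moreover have "Re (zx - zy) * (\<phi> * Re zx + \<phi> * Re zy) \<ge> 0" using Re q c by (intro mult_nonneg_nonneg) auto
    moreover have "Im (zy - zx) * (- \<phi> * Im zx + - \<phi> * Im zy) \<ge> Im (zy - zx) * c" using Im q by (intro mult_left_mono) auto
    ultimately have "Im (zy - zx) * c \<le> \<phi> * ((norm zx)\<^sup>2 - (norm zy)\<^sup>2)" by linarith
    also have "\<dots> \<le> \<bar>(norm zx)\<^sup>2 - (norm zy)\<^sup>2\<bar>" using \<phi> by auto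
    also have "(norm zx)\<^sup>2 - (norm zy)\<^sup>2 = (norm zx - norm zy) * (norm zx + norm zy)"
      by (simp add: power2_eq_square algebra_simps)
    also have "\<bar>\<dots>\<bar> \<le> (8 * h) * (4 * r)"
      unfolding abs_mult
    proof (rule mult_mono)
      show "\<bar>norm zx - norm zy\<bar> \<le> 8 * h"
        using x y by (auto simp: mixed_def at_circle_def zx_def zy_def)
      have "norm zx \<le> 2 * r" "norm zy \<le> 2 * r"
        using norm_triangle_ineq[of "pos x" "x0 - s"] norm_triangle_ineq[of "pos y" "x0 - s"] near cr r
        unfolding z by (simp_all add: staircase_end.r[OF staircase_end_axioms])
      thus "\<bar>norm zx + norm zy\<bar> \<le> 4 * r" by simp
    qed (use h_pos in auto)
    finally have "Im (zy - zx) \<le> 32 * r / c * h" using c by (simp add: field_simps)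
    thus ?thesis using Im by (simp add: zx_def zy_def pos_def)
  qed
  have "h * real (card (H \<inter> mixed)) \<le> 32 * r / c * h + h"
  proof (rule card_H_le)
    fix x y assume "x \<in> H \<inter> mixed" "y \<in> H \<inter> mixed"
    thus "\<bar>Im (pos x) - Im (pos y)\<bar> \<le> 32 * r / c * h"
      using main[of x y] main[of y x] by (cases "snd x \<le> snd y") (auto simp: abs_minus_commute)
  qed (use r c h_pos in auto)
  hence "h * real (card (H \<inter> mixed)) \<le> h * (32 * r / c + 1)" by (simp add: algebra_simps)
  thus ?thesis using h_pos by (simp only: mult_le_cancel_left_pos)
qed

end

lemma discrete_crossing:
  fixes P :: "int \<Rightarrow> bool"
  assumes "P i" "\<not> P (i + int n)"
  obtains m where "i \<le> m" "m < i + int n" "P m" "\<not> P (m + 1)"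
  using assms
proof (induction n arbitrary: thesis)
  case (Suc n)
  show thesis
  proof (cases "P (i + int n)")
    case True
    thus ?thesis using Suc.prems(1)[of "i + int n"] Suc.prems(3) by (simp add: algebra_simps)
  next
    case False
    show ?thesis
    proof (rule Suc.IH[OF _ Suc.prems(2) False])
      fix m assume "i \<le> m" "m < i + int n" "P m" "\<not> P (m + 1)"
      thus thesis using Suc.prems(1)[of m] by simp
    qed
  qed
qed simp

lemma card_ints_ge:
  fixes a b :: real
  assumes "finite S" "\<And>j :: int. a < real_of_int j \<Longrightarrow> real_of_int j < b \<Longrightarrow> j \<in> S"
  shows "b - a - 1 \<le> real (card S)"
proof -
  have "{\<lfloor>a\<rfloor> + 1 .. \<lceil>b\<rceil> - 1} \<subseteq> S"
  proof
    fix j assume "j \<in> {\<lfloor>a\<rfloor> + 1 .. \<lceil>b\<rceil> - 1}"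
    hence "\<lfloor>a\<rfloor> < j" "j < \<lceil>b\<rceil>" by auto
    thus "j \<in> S" using assms(2)[of j] by (simp add: floor_less_iff less_ceiling_iff)
  qed
  from card_mono[OF assms(1) this] have "nat (\<lceil>b\<rceil> - 1 - \<lfloor>a\<rfloor>) \<le> card S" by simp
  hence "real_of_int (\<lceil>b\<rceil> - 1 - \<lfloor>a\<rfloor>) \<le> real (card S)" by linarith
  moreover have "b - a - 1 \<le> real_of_int (\<lceil>b\<rceil> - 1 - \<lfloor>a\<rfloor>)" by simp linarith
  ultimately show ?thesis by linarith
qed

lemma abs_add_trans:
  fixes a b c :: real
  shows "\<bar>a + b\<bar> \<le> e \<Longrightarrow> \<bar>c - b\<bar> \<le> e' \<Longrightarrow> \<bar>a + c\<bar> \<le> e + e'"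
  by linarith

lemma abs_diff_trans:
  fixes a b c :: real
  shows "\<bar>a - b\<bar> \<le> e \<Longrightarrow> \<bar>b - c\<bar> \<le> e' \<Longrightarrow> \<bar>a - c\<bar> \<le> e + e'"
  by linarith

context staircase_end
begin

text \<open>A row at height at most \<open>B * \<delta>\<close> from \<open>x0\<close> meets the tangent within distance \<open>\<delta>\<close> of \<open>x0\<close>. It passes from the
  plus side of the strip to the minus side and contains a vertical edge in between.\<close>
lemma crossing_in_row:
  assumes "\<bar>real_of_int j * h - Im x0\<bar> \<le> B * \<delta>"
  obtains x where "x \<in> H" "snd x = j"
proof -
  define Y where "Y = real_of_int j * h - Im x0"
  define X where "X = - A * Y / B"
  define d where "d = 3/2 * (k\<^sup>2 * \<delta>) / B"
  have Y: "\<bar>Y\<bar> \<le> B * \<delta>" using assms by (simp add: Y_def)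
  have XY: "A * Y + B * X = 0" using AB by (simp add: X_def)
  have "(norm (Complex X Y))\<^sup>2 = (Y / B)\<^sup>2 * (A\<^sup>2 + B\<^sup>2)"
    using AB(2) by (simp only: cmod_power2) (simp add: X_def field_simps power2_eq_square)
  also have "\<dots> = (Y / B)\<^sup>2" using AB by simp
  also have "\<dots> \<le> \<delta>\<^sup>2"
  proof -
    have "\<bar>Y / B\<bar> \<le> \<delta>" using Y AB by (simp add: field_simps)
    thus ?thesis using \<delta>(1) abs_le_square_iff[of "Y / B" \<delta>] by simp
  qed
  finally have nXY: "norm (Complex X Y) \<le> \<delta>" by (rule power2_le_imp_le) (use \<delta> in simp)
  have Bd: "B * d = 3/2 * (k\<^sup>2 * \<delta>)" using AB by (simp add: d_def)
  have d: "0 < d" "d \<le> k * \<delta>"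
  proof -
    show "0 < d" using AB scales by (simp add: d_def)
    have "k * (k * \<delta>) \<le> B / 100 * (k * \<delta>)" using k scales by (intro mult_right_mono) auto
    hence "k\<^sup>2 * \<delta> \<le> B * (k * \<delta>) / 100" by (simp add: power2_eq_square algebra_simps)
    hence "3/2 * (k\<^sup>2 * \<delta>) \<le> (k * \<delta>) * B" using mult_pos_pos[OF AB(2) scales(6)] by (simp add: algebra_simps)
    thus "d \<le> k * \<delta>" using AB(2) by (simp only: d_def pos_divide_le_eq)
  qed
  define i where "i = \<lfloor>(Re x0 + X - d) / h\<rfloor>"
  define i' where "i' = \<lceil>(Re x0 + X + d) / h\<rceil>"
  have i: "h * real_of_int i \<le> Re x0 + X - d" "Re x0 + X - d < h * real_of_int i + h"
  proof -
    have "real_of_int i \<le> (Re x0 + X - d) / h" "(Re x0 + X - d) / h < real_of_int i + 1" by (simp_all add: i_def)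
    thus "h * real_of_int i \<le> Re x0 + X - d" "Re x0 + X - d < h * real_of_int i + h"
      using h_pos by (simp_all add: field_simps)
  qed
  have i': "Re x0 + X + d \<le> h * real_of_int i'" "h * real_of_int i' < Re x0 + X + d + h"
  proof -
    have "(Re x0 + X + d) / h \<le> real_of_int i'" "real_of_int i' < (Re x0 + X + d) / h + 1" unfolding i'_def by linarith+
    thus "Re x0 + X + d \<le> h * real_of_int i'" "h * real_of_int i' < Re x0 + X + d + h"
      using h_pos by (simp_all add: field_simps)
  qed
  have near: "norm (pos (m, j)) < 2 * \<delta>" if "i \<le> m" "m \<le> i'" for m
  proof -
    have "h * real_of_int i \<le> h * real_of_int m" "h * real_of_int m \<le> h * real_of_int i'" using that h_pos by simp_all
    hence "\<bar>h * real_of_int m - Re x0 - X\<bar> \<le> d + h" using i i' by linarith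
    moreover have "pos (m, j) = Complex X Y + of_real (h * real_of_int m - Re x0 - X)"
      by (simp add: complex_eq_iff Re_pos Im_pos' Y_def mult.commute)
    ultimately have "norm (pos (m, j)) \<le> \<delta> + (d + h)"
      using norm_triangle_ineq[of "Complex X Y" "of_real (h * real_of_int m - Re x0 - X)"] nXY norm_of_real[of "h * real_of_int m - Re x0 - X", where ?'a = complex] by simp
    thus ?thesis using d scales by linarith
  qed
  have lt: "h * real_of_int i < h * real_of_int i'" using i i' d by linarith
  hence ii': "i < i'" using h_pos by simp
  have "\<sigma> (i, j)"
  proof (rule inside)
    show "norm (site N (i, j) - x0) \<le> 3 * \<delta>" using near[of i] ii' \<delta> by (simp add: pos_def)
    have "B * (h * real_of_int i - Re x0) \<le> B * (X - d)" using i AB by (intro mult_left_mono) auto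
    hence "A * Y + B * (h * real_of_int i - Re x0) < - (k\<^sup>2 * \<delta>)" using XY Bd scales by (simp add: right_diff_distrib)
    thus "A * Im (site N (i, j) - x0) + B * Re (site N (i, j) - x0) < - (k\<^sup>2 * \<delta>)" by (simp add: Y_def h_def)
  qed
  moreover have "\<not> \<sigma> (i', j)"
  proof (rule outside)
    show "norm (site N (i', j) - x0) \<le> 3 * \<delta>" using near[of i'] ii' \<delta> by (simp add: pos_def)
    have "B * (X + d) \<le> B * (h * real_of_int i' - Re x0)" using i' AB by (intro mult_left_mono) auto
    hence "k\<^sup>2 * \<delta> < A * Y + B * (h * real_of_int i' - Re x0)" using XY Bd scales by (simp add: distrib_left)
    thus "k\<^sup>2 * \<delta> < A * Im (site N (i', j) - x0) + B * Re (site N (i', j) - x0)" by (simp add: Y_def h_def)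
  qed
  ultimately obtain m where m: "i \<le> m" "m < i'" "\<sigma> (m, j)" "\<not> \<sigma> (m + 1, j)"
    using discrete_crossing[of "\<lambda>m. \<sigma> (m, j)" i "nat (i' - i)"] ii' by auto
  hence "(m, j) \<in> H" using near[of m] by (simp add: H_def vertical_edge_def)
  thus thesis using that by simp
qed

text \<open>The core has height nearly \<open>B * \<delta>\<close> and contains one vertical edge in each of its rows.\<close>
lemma card_core: "\<bar>h / \<delta> * card (H \<inter> core) - B\<bar> \<le> 3 * k"
proof -
  have "h * real (card (H \<inter> core)) \<le> B * ((1 - 2 * k) * \<delta>) + 4 * (k\<^sup>2 * \<delta>) + h"
  proof (rule card_window)
    show "k * \<delta> \<le> tng x \<and> tng x \<le> k * \<delta> + (1 - 2 * k) * \<delta>" if "x \<in> H \<inter> core" for x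
      using that by (auto simp: core_def algebra_simps)
  qed (use k \<delta> in auto)
  moreover have "B * ((1 - 2 * k) * \<delta>) \<le> B * \<delta>" using k AB \<delta> by (intro mult_left_mono) auto
  ultimately have up: "h * real (card (H \<inter> core)) \<le> B * \<delta> + 3 * (k * \<delta>)" using scales by linarith
  \<comment> \<open>Rows with heights between \<open>a\<close> and \<open>b\<close> cross the interface in the core.\<close>
  define a where "a = B * (k * \<delta>) + 3 * (k\<^sup>2 * \<delta>)"
  define b where "b = B * ((1 - k) * \<delta>) - 3 * (k\<^sup>2 * \<delta>)"
  have Bk: "0 \<le> B * (k * \<delta>)" "B * (k * \<delta>) \<le> k * \<delta>" "B * ((1 - k) * \<delta>) = B * \<delta> - B * (k * \<delta>)"
    using AB B_le_1 scales mult_right_mono[OF B_le_1, of "k * \<delta>"] by (simp_all add: algebra_simps)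
  have row: "j \<in> snd ` (H \<inter> core)" if j: "a < - \<phi> * (h * real_of_int j - Im x0)" "- \<phi> * (h * real_of_int j - Im x0) < b" for j
  proof -
    define Y where "Y = h * real_of_int j - Im x0"
    have "\<bar>Y\<bar> = \<bar>- \<phi> * Y\<bar>" using \<phi> by auto
    also have "\<dots> \<le> B * \<delta>" using j Bk scales unfolding Y_def[symmetric] a_def b_def by linarith
    finally obtain x where x: "x \<in> H" "snd x = j" using crossing_in_row[of j] by (auto simp: Y_def mult.commute)
    have n: "\<bar>nrm x\<bar> \<le> 2 * (k\<^sup>2 * \<delta>)" by (rule H_strip[OF x(1)])
    have Yeq: "Y = - \<phi> * B * tng x + A * nrm x"
      using Im_pos[of x] x(2) by (simp add: Im_pos' Y_def)
    have "- \<phi> * Y = (\<phi> * \<phi>) * (B * tng x) - \<phi> * (A * nrm x)"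
      unfolding Yeq by (simp add: algebra_simps)
    moreover have "\<bar>\<phi> * (A * nrm x)\<bar> \<le> 1 * (2 * (k\<^sup>2 * \<delta>))"
    proof -
      have "\<bar>\<phi> * (A * nrm x)\<bar> = A * \<bar>nrm x\<bar>" using \<phi> AB by (auto simp: abs_mult)
      also have "\<dots> \<le> 1 * (2 * (k\<^sup>2 * \<delta>))" using n A_le_1 AB by (intro mult_mono) auto
      finally show ?thesis .
    qed
    ultimately have "B * (k * \<delta>) < B * tng x" "B * tng x < B * ((1 - k) * \<delta>)"
      using j scales unfolding Y_def[symmetric] a_def b_def \<phi>2 by linarith+
    hence "x \<in> core" using AB(2) by (simp add: core_def)
    thus ?thesis using x by blast
  qed
  have lo: "b / h - a / h - 1 \<le> real (card (snd ` (H \<inter> core)))"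
  proof (cases "\<phi> = 1")
    case True
    have "(Im x0 - a) / h - (Im x0 - b) / h - 1 \<le> real (card (snd ` (H \<inter> core)))"
    proof (rule card_ints_ge)
      show "finite (snd ` (H \<inter> core))" using finite_H by simp
      fix j :: int assume "(Im x0 - b) / h < real_of_int j" "real_of_int j < (Im x0 - a) / h"
      thus "j \<in> snd ` (H \<inter> core)" using h_pos True by (intro row) (simp_all add: field_simps)
    qed
    thus ?thesis by (simp add: diff_divide_distrib)
  next
    case False
    hence f: "\<phi> = -1" using \<phi> by simp
    have "(Im x0 + b) / h - (Im x0 + a) / h - 1 \<le> real (card (snd ` (H \<inter> core)))"
    proof (rule card_ints_ge)
      show "finite (snd ` (H \<inter> core))" using finite_H by simp
      fix j :: int assume "(Im x0 + a) / h < real_of_int j" "real_of_int j < (Im x0 + b) / h"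
      thus "j \<in> snd ` (H \<inter> core)" using h_pos f by (intro row) (simp_all add: field_simps)
    qed
    thus ?thesis by (simp add: add_divide_distrib)
  qed
  also have "card (snd ` (H \<inter> core)) = card (H \<inter> core)"
    using inj_on_subset[OF inj_snd_H, of "H \<inter> core"] by (simp add: card_image)
  finally have "b - a - h \<le> h * real (card (H \<inter> core))" using h_pos by (simp add: field_simps)
  hence lo': "B * \<delta> - 3 * (k * \<delta>) \<le> h * real (card (H \<inter> core))"
    unfolding a_def b_def using Bk scales by linarith
  have "h / \<delta> * card (H \<inter> core) \<le> B + 3 * k" "B - 3 * k \<le> h / \<delta> * card (H \<inter> core)"
    using up lo' \<delta>(1) by (simp_all add: field_simps)
  thus ?thesis by (simp add: abs_le_iff)
qed

text \<open>The error in the sums over one end of the arc: the second summand comes from the steps across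
  the circle, and \<open>err'\<close> leaves room for the error in the number of edges or corners.\<close>
definition err :: real where "err = 100 * k + 3 * k * (32 * r / c + 1)"

definition err' :: real where "err' = 90 * k + 3 * k * (32 * r / c + 1)"

lemma err': "err' + 10 * k = err" by (simp add: err_def err'_def)

lemma card_margin': "h / \<delta> * card (H \<inter> margin) \<le> 5 * k"
  using card_margin \<delta>(1) by (simp add: field_simps)

lemma sum_diff_bound':
  assumes P: "P \<subseteq> H" and st: "step b e"
  shows "\<bar>(\<Sum>x\<in>P. w (x + (b + e)) - w (x + b)) + (site N e \<bullet> u) / \<delta> * card (P \<inter> core)\<bar> \<le> err'"
proof -
  have "20 * k * h / \<delta> * card (H \<inter> core) \<le> 40 * k"
  proof -
    have "h / \<delta> * card (H \<inter> core) \<le> 2" using card_core B_le_1 k by linarith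
    from mult_left_mono[OF this, of "20 * k"] show ?thesis using k by simp
  qed
  moreover have "2 * h / \<delta> * card (H \<inter> margin) \<le> 10 * k" using card_margin' by simp
  moreover have "3 * k * card (H \<inter> mixed) \<le> 3 * k * (32 * r / c + 1)"
    using card_mixed k by (intro mult_left_mono) auto
  ultimately show ?thesis using sum_diff_bound[OF P st] k unfolding err'_def by linarith
qed

text \<open>Each of the about \<open>B * \<delta> / h\<close> upward steps changes \<open>w\<close> by nearly \<open>\<phi> * B * h / \<delta>\<close>.\<close>
lemma edge_sum: "\<bar>(\<Sum>x\<in>H. w (x + (1,1)) - w (x + (1,0))) - \<phi> * B\<^sup>2\<bar> \<le> err"
proof -
  have "site N (0,1) \<bullet> u = - \<phi> * B * h" by (simp add: inner_complex_def u_def site_def h_def)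
  hence e: "(site N (0,1) \<bullet> u) / \<delta> * card (H \<inter> core) = - (\<phi> * B) * (h / \<delta> * card (H \<inter> core))" by simp
  have 1: "\<bar>(\<Sum>x\<in>H. w (x + (1,1)) - w (x + (1,0))) - (\<phi> * B) * (h / \<delta> * card (H \<inter> core))\<bar> \<le> err'"
    using sum_diff_bound'[OF subset_refl step_edge] unfolding e by simp
  have 2: "\<bar>(\<phi> * B) * (h / \<delta> * card (H \<inter> core)) - \<phi> * B\<^sup>2\<bar> \<le> 3 * k"
  proof -
    have "(\<phi> * B) * (h / \<delta> * card (H \<inter> core)) - \<phi> * B\<^sup>2 = (\<phi> * B) * (h / \<delta> * card (H \<inter> core) - B)"
      by (simp add: power2_eq_square algebra_simps)
    also have "\<bar>\<dots>\<bar> = B * \<bar>h / \<delta> * card (H \<inter> core) - B\<bar>" using \<phi> AB by (auto simp: abs_mult)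
    also have "\<dots> \<le> 1 * (3 * k)" using card_core B_le_1 AB by (intro mult_mono) auto
    finally show ?thesis by simp
  qed
  show ?thesis using abs_diff_trans[OF 1 2] k err' by linarith
qed

text \<open>Each diagonal step changes \<open>w\<close> by nearly \<open>- \<phi> * (A - B) * h / \<delta>\<close>. The set \<open>K\<close> contains the sites
  counted by \<^const>\<open>corners\<close>, where \<open>J\<close> is the discretization of the disc around \<open>x0\<close>; it differs from
  the convex corners in the core only in the margins.\<close>
lemma corner_sum:
  assumes J: "\<And>y. norm (site N y - x0) \<le> \<delta> \<Longrightarrow> y \<in> J" "\<And>y. y \<in> J \<Longrightarrow> norm (site N y - x0) \<le> \<delta> + 1 / real N"
  defines "K \<equiv> {y \<in> J. norm (site N y - s) > r \<and> \<sigma> y \<and> opposite \<sigma> y = 2}"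
  shows "\<bar>(\<Sum>x | x \<in> H \<and> convex_corner \<sigma> x. w (x + (1,1)) - w x) + \<phi> * (A - B) * (card K / (\<delta> * real N))\<bar> \<le> err"
proof -
  let ?P = "{x. x \<in> H \<and> convex_corner \<sigma> x}"
  have conv: "opposite \<sigma> x = 2 \<longleftrightarrow> convex_corner \<sigma> x" if "norm (pos x) < 2 * \<delta>" "\<sigma> x" for x
  proof (rule opposite_two_iff[where \<sigma> = \<sigma> and x = x, OF _ _ that(2)])
    have n: "norm (site N (- (1,0))) = h" "norm (site N (- (0,1))) = h"
      using norm_site_step(1,2) by (simp_all add: site_def cmod_def)
    have "norm (site N (x + a) - x0) \<le> 3 * \<delta>" if "norm (site N a) = h" for a
      using norm_triangle_ineq[of "pos x" "site N a"] that \<open>norm (pos x) < 2 * \<delta>\<close> scales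
      unfolding pos_shift by linarith
    from desc[OF this[OF n(1)]] desc[OF this[OF n(2)]]
    show "descends \<sigma> (x - (1,0))" "descends \<sigma> (x - (0,1))" by (simp_all only: add_uminus_conv_diff)
  qed
  have sub1: "?P \<inter> core \<subseteq> K"
  proof
    fix x assume x: "x \<in> ?P \<inter> core"
    have xH: "x \<in> H" and c: "k * \<delta> < tng x" "tng x < (1 - k) * \<delta>" using x by (auto simp: core_def)
    have "\<bar>tng x\<bar> \<le> \<delta> - k * \<delta>" using c scales by (simp add: left_diff_distrib)
    hence "norm (pos x) \<le> \<delta>" using norm_pos_le[of x] H_strip[OF xH] scales by linarith
    hence "x \<in> J" using J(1) by (simp add: pos_def)
    moreover have "norm (site N x - s) > r"
      using outer_off_disc[OF xH, of 0] c h_pos by (simp add: site_pos)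
    moreover have "\<sigma> x" "convex_corner \<sigma> x" "norm (pos x) < 2 * \<delta>" using x by (auto simp: H_def vertical_edge_def)
    ultimately show "x \<in> K" using conv by (simp add: K_def)
  qed
  have sub2: "K \<subseteq> (?P \<inter> core) \<union> (H \<inter> margin)"
  proof
    fix x assume x: "x \<in> K"
    have "norm (pos x) \<le> \<delta> + h" using J(2)[of x] x by (simp add: K_def pos_def h_def)
    hence p: "norm (pos x) < 2 * \<delta>" "\<bar>tng x\<bar> \<le> \<delta> + h" using scales tng_le[of x] by linarith+
    have cx: "convex_corner \<sigma> x" using conv[OF p(1)] x by (simp add: K_def)
    hence xH: "x \<in> H" using p(1) by (simp add: H_def vertical_edge_def convex_corner_def)
    have "\<not> tng x \<le> - (k * \<delta>)"
      using inner_in_disc[OF xH, of 0] x h_pos by (auto simp: K_def site_pos)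
    hence "\<bar>tng x\<bar> \<le> k * \<delta> \<or> \<bar>tng x - \<delta>\<bar> \<le> k * \<delta> \<or> (k * \<delta> < tng x \<and> tng x < (1 - k) * \<delta>)"
      using p(2) scales unfolding left_diff_distrib by linarith
    thus "x \<in> (?P \<inter> core) \<union> (H \<inter> margin)" using xH cx by (auto simp: core_def margin_def)
  qed
  have finP: "finite (?P \<inter> core)" "finite ((?P \<inter> core) \<union> (H \<inter> margin))" using finite_H by simp_all
  have finK: "finite K" using finite_subset[OF sub2 finP(2)] .
  have "card (?P \<inter> core) \<le> card K" by (rule card_mono[OF finK sub1])
  moreover have "card K \<le> card (?P \<inter> core) + card (H \<inter> margin)"
    using card_mono[OF finP(2) sub2] card_Un_le[of "?P \<inter> core" "H \<inter> margin"] by linarith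
  ultimately have "\<bar>real (card K) - real (card (?P \<inter> core))\<bar> \<le> real (card (H \<inter> margin))" by linarith
  hence "h / \<delta> * \<bar>real (card K) - real (card (?P \<inter> core))\<bar> \<le> h / \<delta> * real (card (H \<inter> margin))"
    using h_pos \<delta> by (intro mult_left_mono) auto
  also have "\<dots> \<le> 5 * k" by (rule card_margin')
  finally have kk: "\<bar>h / \<delta> * (real (card K) - real (card (?P \<inter> core)))\<bar> \<le> 5 * k"
    using h_pos \<delta> by (simp add: abs_mult)
  have "site N (1,1) \<bullet> u = \<phi> * (A - B) * h" by (simp add: inner_complex_def u_def site_def h_def algebra_simps)
  hence e: "(site N (1,1) \<bullet> u) / \<delta> * card (?P \<inter> core) = \<phi> * (A - B) * (h / \<delta> * card (?P \<inter> core))" by simp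
  have 1: "\<bar>(\<Sum>x\<in>?P. w (x + (1,1)) - w x) + \<phi> * (A - B) * (h / \<delta> * card (?P \<inter> core))\<bar> \<le> err'"
    using sum_diff_bound'[OF _ step_corner, of ?P] unfolding e by auto
  have 2: "\<bar>\<phi> * (A - B) * (h / \<delta> * card K) - \<phi> * (A - B) * (h / \<delta> * card (?P \<inter> core))\<bar> \<le> 5 * k"
  proof -
    have "\<phi> * (A - B) * (h / \<delta> * card K) - \<phi> * (A - B) * (h / \<delta> * card (?P \<inter> core)) =
        \<phi> * (A - B) * (h / \<delta> * (real (card K) - real (card (?P \<inter> core))))" by (simp only: right_diff_distrib)
    also have "\<bar>\<dots>\<bar> = \<bar>A - B\<bar> * \<bar>h / \<delta> * (real (card K) - real (card (?P \<inter> core)))\<bar>" using \<phi> by (auto simp: abs_mult)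
    also have "\<dots> \<le> 1 * (5 * k)" using kk A_le_1 B_le_1 AB by (intro mult_mono) (auto simp: abs_le_iff)
    finally show ?thesis by simp
  qed
  have 3: "h / \<delta> * card K = card K / (\<delta> * real N)" by (simp add: h_def field_simps)
  show ?thesis unfolding 3[symmetric] using abs_add_trans[OF 1 2] k err' by linarith
qed

end

section \<open>A staircase that crosses the disc\<close>

text \<open>A vertical edge that is not near the circle around \<open>s\<close> and not near an end has constant weight \<open>1\<close>
  or \<open>0\<close> around it, so only the two ends contribute. Their tangents point in opposite directions
  along the staircase, whence the sign of \<open>\<phi>\<close> at the second end.\<close>
lemma staircase_total:
  fixes \<phi> :: real
  assumes E0: "staircase_end N \<sigma> x0 s r \<delta> k A0 B0 \<phi> c I Q w"
    and E1: "staircase_end N \<sigma> x1 s r \<delta> k A1 B1 (- \<phi>) c I Q w"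
    and sep: "8 * \<delta> \<le> norm (x0 - x1)"
    and desc: "\<And>x. norm (site N x - s) \<le> 3 * r \<Longrightarrow> descends \<sigma> x"
    and w: "\<And>x. w x = 1 - (1 - of_bool (x \<in> I)) * (1 - ramp \<delta> (infdist (site N x - x0) Q))
        * (1 - ramp \<delta> (infdist (site N x - x1) Q))"
    and circle: "\<And>x. vertical_edge \<sigma> x \<Longrightarrow> \<bar>norm (site N x - s) - r\<bar> \<le> 4 / real N \<Longrightarrow>
        norm (site N x - x0) < 2 * \<delta> \<or> norm (site N x - x1) < 2 * \<delta>"
    and J0: "\<And>y. norm (site N y - x0) \<le> \<delta> \<Longrightarrow> y \<in> J0" "\<And>y. y \<in> J0 \<Longrightarrow> norm (site N y - x0) \<le> \<delta> + 1 / real N"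
    and J1: "\<And>y. norm (site N y - x1) \<le> \<delta> \<Longrightarrow> y \<in> J1" "\<And>y. y \<in> J1 \<Longrightarrow> norm (site N y - x1) \<le> \<delta> + 1 / real N"
  defines "\<kappa>0 \<equiv> card {y \<in> J0. norm (site N y - s) > r \<and> \<sigma> y \<and> opposite \<sigma> y = 2} / (\<delta> * real N)"
    and "\<kappa>1 \<equiv> card {y \<in> J1. norm (site N y - s) > r \<and> \<sigma> y \<and> opposite \<sigma> y = 2} / (\<delta> * real N)"
    and "T \<equiv> {x. norm (site N x - s) \<le> 2 * r}"
  shows "\<And>x. w x \<noteq> 0 \<Longrightarrow> x \<in> T"
    and "\<bar>2 * (\<Sum>x\<in>T. w x * spin_drift \<sigma> x) -
      \<phi> * ((A1 - B1) * \<kappa>1 + B1\<^sup>2 - (A0 - B0) * \<kappa>0 - B0\<^sup>2)\<bar> \<le>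
      4 * (100 * k + 3 * k * (32 * r / c + 1))"
proof -
  interpret E0: staircase_end N \<sigma> x0 s r \<delta> k A0 B0 \<phi> c I Q w by (rule E0)
  interpret E1: staircase_end N \<sigma> x1 s r \<delta> k A1 B1 "- \<phi>" c I Q w by (rule E1)
  define h where "h = 1 / real N"
  have hh: "E0.h = h" "E1.h = h" by (simp_all add: E0.h_def E1.h_def h_def)
  note sc = E0.scales[unfolded hh]
  have \<delta>r: "100 * \<delta> \<le> k * r" "k * r \<le> r / 100" "0 < r"
  proof -
    show "100 * \<delta> \<le> k * r" using E0.\<delta>(2) by simp
    hence "0 < k * r" using E0.\<delta>(1) by linarith
    thus "0 < r" using E0.k(1) by (simp add: zero_less_mult_iff)
    thus "k * r \<le> r / 100" using mult_right_mono[OF E0.k(2), of r] by simp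
  qed
  have hr: "100 * h \<le> r" using sc \<delta>r by linarith
  have ramp0: "ramp \<delta> (infdist y Q) = 0" if "\<delta> + h \<le> norm y" for y
    using E0.infdist_Q_bounds(2)[of y] that E0.\<delta>(1) by (simp add: hh ramp_def)
  have shift: "norm (site N (x + b) - z) \<le> norm (site N x - z) + norm (site N b)"
    "norm (site N x - z) \<le> norm (site N (x + b) - z) + norm (site N b)" for x b z
    using norm_triangle_ineq[of "site N x - z" "site N b"] norm_triangle_ineq4[of "site N x - z + site N b" "site N b"]
    by (simp_all add: site_add algebra_simps)
  have tri: "norm (site N x - s) \<le> norm (site N x - z) + r" if "norm (z - s) = r" for x z
    using norm_triangle_ineq[of "site N x - z" "z - s"] that by simp
  have supp: "norm (site N x - s) \<le> 3/2 * r" if "w x \<noteq> 0" for x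
  proof (rule ccontr)
    assume far: "\<not> ?thesis"
    have "x \<notin> I" using E0.I(2)[of x] far sc \<delta>r unfolding h_def[symmetric] by linarith
    moreover have "\<delta> + h \<le> norm (site N x - x0)" "\<delta> + h \<le> norm (site N x - x1)"
      using tri[OF E0.r, of x] tri[OF E1.r, of x] far sc \<delta>r by linarith+
    ultimately have "w x = 0" using w[of x] ramp0[of "site N x - x0"] ramp0[of "site N x - x1"] by simp
    thus False using that by simp
  qed
  have T_supp: "x \<in> T" if "w x \<noteq> 0" for x using supp[OF that] \<delta>r by (simp add: T_def)
  thus "\<And>x. w x \<noteq> 0 \<Longrightarrow> x \<in> T" .
  have fin: "finite T"
  proof (rule finite_subset)
    show "T \<subseteq> touched N (cball s (2 * r))"
      using site_in_cell[OF E0.N] by (fastforce simp: T_def touched_def dist_norm norm_minus_commute)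
    show "finite (touched N (cball s (2 * r)))" by (rule finite_touched[OF E0.N]) simp
  qed
  have nb: "norm (site N b) \<le> 3/2 * h" if "b \<in> {0, (1,0), (0,1), (1,1)}" for b
  proof -
    have "site N 0 = 0" by (simp add: site_def complex_eq_iff)
    thus ?thesis using that E0.norm_site_step[unfolded hh] sc by auto
  qed
  have neg: "norm (site N (- b)) = norm (site N b)" for b :: "int \<times> int"
  proof -
    have "site N (- b) = - site N b" by (simp add: site_def complex_eq_iff)
    thus ?thesis by simp
  qed
  have sum: "2 * (\<Sum>x\<in>T. w x * spin_drift \<sigma> x) =
    (\<Sum>x | x \<in> T \<and> convex_corner \<sigma> x. w (x + (1,1)) - w x)
    - (\<Sum>x | x \<in> T \<and> vertical_edge \<sigma> x. w (x + (1,1)) - w (x + (1,0)))"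
  proof (rule staircase_sum[OF fin])
    fix x b :: "int \<times> int" assume "w x \<noteq> 0" and b: "b \<in> {0, (1,0), (0,1), (1,1)}"
    from supp[OF this(1)] nb[OF b] shift(1)[of x "- b" s] show "x - b \<in> T"
      using hr \<delta>r(3) by (simp add: T_def neg)
  next
    fix x b :: "int \<times> int" assume x: "x \<in> T" and b: "b \<in> {0, (1,0), (0,1), - (1,0), - (0,1)}"
    have "norm (site N b) \<le> 3/2 * h"
      using b nb[of 0] nb[of "(1,0)"] nb[of "(0,1)"] neg[of "(1,0)"] neg[of "(0,1)"] by auto
    thus "descends \<sigma> (x + b)"
      using x shift(1)[of x b s] hr \<delta>r(3) by (intro desc) (simp add: T_def)
  qed
  have flat: "w (x + b) = w (x + b')"
    if x: "vertical_edge \<sigma> x" "x \<notin> E0.H" "x \<notin> E1.H"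
      and b: "b \<in> {0, (1,0), (0,1), (1,1)}" "b' \<in> {0, (1,0), (0,1), (1,1)}" for x b b'
  proof -
    have far: "2 * \<delta> \<le> norm (site N x - x0)" "2 * \<delta> \<le> norm (site N x - x1)"
      using x by (auto simp: E0.H_def E1.H_def E0.pos_def E1.pos_def)
    have "\<not> \<bar>norm (site N x - s) - r\<bar> \<le> 4 / real N"
    proof
      assume "\<bar>norm (site N x - s) - r\<bar> \<le> 4 / real N"
      from circle[OF x(1) this] far show False by linarith
    qed
    hence "\<bar>norm (site N x - s) - r\<bar> > 4 * h" by (simp add: h_def)
    then consider "norm (site N x - s) < r - 4 * h" | "norm (site N x - s) > r + 4 * h" by linarith
    hence "\<exists>v. \<forall>b\<in>{0, (1,0), (0,1), (1,1)}. w (x + b) = v"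
    proof cases
      case 1
      have "w (x + b) = 1" if "b \<in> {0, (1,0), (0,1), (1,1)}" for b
      proof -
        have "norm (site N (x + b) - s) \<le> r" using shift(1)[of x b s] nb[OF that] 1 sc by linarith
        thus ?thesis using E0.I(1) w by simp
      qed
      thus ?thesis by blast
    next
      case 2
      have "w (x + b) = 0" if "b \<in> {0, (1,0), (0,1), (1,1)}" for b
      proof -
        have "x + b \<notin> I"
          using shift(2)[of x s b] nb[OF that] 2 sc E0.I(2)[of "x + b"] unfolding h_def[symmetric] by linarith
        moreover have "\<delta> + h \<le> norm (site N (x + b) - x0)" "\<delta> + h \<le> norm (site N (x + b) - x1)"
          using shift(2)[of x x0 b] shift(2)[of x x1 b] nb[OF that] far sc by linarith+
        ultimately show ?thesis using w[of "x + b"] ramp0 by simp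
      qed
      thus ?thesis by blast
    qed
    then obtain v where "\<forall>b\<in>{0, (1,0), (0,1), (1,1)}. w (x + b) = v" ..
    thus ?thesis using b by metis
  qed
  have disj: "E0.H \<inter> E1.H = {}"
  proof -
    have False if "x \<in> E0.H" "x \<in> E1.H" for x
    proof -
      have "norm (site N x - x0) < 2 * \<delta>" "norm (site N x - x1) < 2 * \<delta>"
        using that by (auto simp: E0.H_def E1.H_def E0.pos_def E1.pos_def)
      thus False using norm_triangle_ineq4[of "site N x - x1" "site N x - x0"] sep E0.\<delta>(1) by simp
    qed
    thus ?thesis by blast
  qed
  have \<delta>r': "2 * \<delta> \<le> r" using \<delta>r by linarith
  have HT: "E0.H \<subseteq> T" "E1.H \<subseteq> T"
  proof -
    have "x \<in> T" if "x \<in> E0.H" for x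
      using tri[OF E0.r, of x] \<delta>r' that by (simp add: E0.H_def E0.pos_def T_def)
    moreover have "x \<in> T" if "x \<in> E1.H" for x
      using tri[OF E1.r, of x] \<delta>r' that by (simp add: E1.H_def E1.pos_def T_def)
    ultimately show "E0.H \<subseteq> T" "E1.H \<subseteq> T" by blast+
  qed
  have edge_H: "vertical_edge \<sigma> x" if "x \<in> E0.H \<or> x \<in> E1.H" for x using that by (auto simp: E0.H_def E1.H_def)
  have conv_edge: "vertical_edge \<sigma> x" if "convex_corner \<sigma> x" for x using that by (simp add: convex_corner_def vertical_edge_def)
  have split: "(\<Sum>x | x \<in> T \<and> P x. f x) = (\<Sum>x | x \<in> E0.H \<and> P x. f x) + (\<Sum>x | x \<in> E1.H \<and> P x. f x)"
    if "\<And>x. P x \<Longrightarrow> x \<notin> E0.H \<Longrightarrow> x \<notin> E1.H \<Longrightarrow> f x = 0" for P and f :: "int \<times> int \<Rightarrow> real"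
  proof -
    have "(\<Sum>x | x \<in> T \<and> P x. f x) = sum f ({x. x \<in> E0.H \<and> P x} \<union> {x. x \<in> E1.H \<and> P x})"
      using that HT fin by (intro sum.mono_neutral_right) auto
    also have "\<dots> = (\<Sum>x | x \<in> E0.H \<and> P x. f x) + (\<Sum>x | x \<in> E1.H \<and> P x. f x)"
      using disj E0.finite_H E1.finite_H by (intro sum.union_disjoint) auto
    finally show ?thesis .
  qed
  have H_edge: "{x. x \<in> E0.H \<and> vertical_edge \<sigma> x} = E0.H" "{x. x \<in> E1.H \<and> vertical_edge \<sigma> x} = E1.H"
    using edge_H by blast+
  have s1: "(\<Sum>x | x \<in> T \<and> convex_corner \<sigma> x. w (x + (1,1)) - w x) =
      (\<Sum>x | x \<in> E0.H \<and> convex_corner \<sigma> x. w (x + (1,1)) - w x) + (\<Sum>x | x \<in> E1.H \<and> convex_corner \<sigma> x. w (x + (1,1)) - w x)"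
    by (rule split) (use flat[OF conv_edge, of _ "(1,1)" 0] in simp)
  have s2: "(\<Sum>x | x \<in> T \<and> vertical_edge \<sigma> x. w (x + (1,1)) - w (x + (1,0))) =
      (\<Sum>x\<in>E0.H. w (x + (1,1)) - w (x + (1,0))) + (\<Sum>x\<in>E1.H. w (x + (1,1)) - w (x + (1,0)))"
    using split[of "vertical_edge \<sigma>" "\<lambda>x. w (x + (1,1)) - w (x + (1,0))"] flat[of _ "(1,1)" "(1,0)"]
    unfolding H_edge by simp
  define e where "e = 100 * k + 3 * k * (32 * r / c + 1)"
  define c0 where "c0 = (\<Sum>x | x \<in> E0.H \<and> convex_corner \<sigma> x. w (x + (1,1)) - w x)"
  define c1 where "c1 = (\<Sum>x | x \<in> E1.H \<and> convex_corner \<sigma> x. w (x + (1,1)) - w x)"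
  define d0 where "d0 = (\<Sum>x\<in>E0.H. w (x + (1,1)) - w (x + (1,0)))"
  define d1 where "d1 = (\<Sum>x\<in>E1.H. w (x + (1,1)) - w (x + (1,0)))"
  have "\<bar>c0 + \<phi> * (A0 - B0) * \<kappa>0\<bar> \<le> e" "\<bar>c1 + - \<phi> * (A1 - B1) * \<kappa>1\<bar> \<le> e"
    "\<bar>d0 - \<phi> * B0\<^sup>2\<bar> \<le> e" "\<bar>d1 - - \<phi> * B1\<^sup>2\<bar> \<le> e"
    unfolding c0_def c1_def d0_def d1_def \<kappa>0_def \<kappa>1_def
    using E0.corner_sum[of J0, OF J0] E1.corner_sum[of J1, OF J1] E0.edge_sum E1.edge_sum
    unfolding E0.err_def E1.err_def e_def by blast+
  moreover have "2 * (\<Sum>x\<in>T. w x * spin_drift \<sigma> x) - \<phi> * ((A1 - B1) * \<kappa>1 + B1\<^sup>2 - (A0 - B0) * \<kappa>0 - B0\<^sup>2)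
      = (c0 + \<phi> * (A0 - B0) * \<kappa>0) + (c1 + - \<phi> * (A1 - B1) * \<kappa>1) - (d0 - \<phi> * B0\<^sup>2) - (d1 - - \<phi> * B1\<^sup>2)"
    unfolding sum s1 s2 c0_def[symmetric] c1_def[symmetric] d0_def[symmetric] d1_def[symmetric]
    by (simp add: algebra_simps)
  ultimately show "\<bar>2 * (\<Sum>x\<in>T. w x * spin_drift \<sigma> x) -
      \<phi> * ((A1 - B1) * \<kappa>1 + B1\<^sup>2 - (A0 - B0) * \<kappa>0 - B0\<^sup>2)\<bar> \<le> 4 * (100 * k + 3 * k * (32 * r / c + 1))"
    unfolding e_def[symmetric] by linarith
qed

section \<open>The sides of a regular Jordan curve\<close>

locale jordan_curve_param =
  fixes g :: "real \<Rightarrow> complex"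
  assumes param: "C1_jordan_param g"
begin

definition g' :: "real \<Rightarrow> complex" where "g' t = vector_derivative g (at t)"

lemma per: "g (t + 1) = g t" and inj: "inj_on g {0..<1}" and C1: "g C1_differentiable_on UNIV"
  and nz: "g' t \<noteq> 0" and wind: "z \<in> inside (range g) \<Longrightarrow> winding_number g z = 1"
  using param unfolding C1_jordan_param_def g'_def by auto

lemma deriv: "(g has_vector_derivative g' t) (at t)"
  using C1 unfolding C1_differentiable_on_eq g'_def by (auto simp: vector_derivative_works)

lemma cont': "continuous_on UNIV g'"
  using C1 unfolding C1_differentiable_on_eq g'_def[abs_def] by simp

lemma cont: "continuous_on S g"
  by (rule continuous_on_subset[of UNIV])
     (auto intro!: continuous_at_imp_continuous_on has_vector_derivative_continuous[OF deriv])

lemma per_nat: "g (t + real n) = g t"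
proof (induction n)
  case (Suc n)
  have "g (t + real (Suc n)) = g (t + real n + 1)" by (simp add: algebra_simps)
  thus ?case using Suc per by simp
qed simp

lemma per_int: "g (t + of_int n) = g t"
proof (cases "n \<ge> 0")
  case True thus ?thesis using per_nat[of t "nat n"] by simp
next
  case False thus ?thesis using per_nat[of "t + of_int n" "nat (- n)"] by simp
qed

lemma frac_eq: "g (frac t) = g t"
  using per_int[of t "- \<lfloor>t\<rfloor>"] by (simp add: frac_def)

lemma g_eq_imp:
  assumes "g t = g t'" shows "\<exists>n::int. t' = t + of_int n"
proof -
  have "g (frac t) = g (frac t')" using assms by (simp add: frac_eq)
  hence "frac t = frac t'" using inj by (auto dest!: inj_onD simp: frac_lt_1)
  hence "t' = t + of_int (\<lfloor>t'\<rfloor> - \<lfloor>t\<rfloor>)" by (simp add: frac_def algebra_simps)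
  thus ?thesis by blast
qed

lemma range_param:
  assumes "z \<in> range g" obtains t where "a - 1/2 \<le> t" "t < a + 1/2" "z = g t"
proof -
  obtain t0 where t0: "z = g t0" using assms by blast
  define t where "t = a - 1/2 + frac (t0 - (a - 1/2))"
  have "t = t0 + of_int (- \<lfloor>t0 - (a - 1/2)\<rfloor>)" by (simp add: t_def frac_def)
  hence "g t = z" using per_int[of t0 "- \<lfloor>t0 - (a - 1/2)\<rfloor>"] t0 by (simp only:)
  moreover have "a - 1/2 \<le> t" "t < a + 1/2"
    using frac_lt_1[of "t0 - (a - 1/2)"] frac_ge_0[of "t0 - (a - 1/2)"] by (auto simp: t_def)
  ultimately show thesis using that by blast
qed

lemma away:
  assumes "0 < \<tau>" "\<tau> \<le> 1/2"
  obtains m where "m > 0" "\<And>t. a + \<tau> \<le> t \<Longrightarrow> t \<le> a + 1 - \<tau> \<Longrightarrow> m \<le> norm (g t - g a)"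
    "\<And>t. a - 1 + \<tau> \<le> t \<Longrightarrow> t \<le> a - \<tau> \<Longrightarrow> m \<le> norm (g t - g a)"
proof -
  have "continuous_on {a + \<tau>..a + 1 - \<tau>} (\<lambda>t. norm (g t - g a))" by (intro continuous_intros cont)
  moreover have "{a + \<tau>..a + 1 - \<tau>} \<noteq> {}" using assms by simp
  ultimately obtain t0 where t0: "t0 \<in> {a + \<tau>..a + 1 - \<tau>}"
    "\<And>t. t \<in> {a + \<tau>..a + 1 - \<tau>} \<Longrightarrow> norm (g t0 - g a) \<le> norm (g t - g a)"
    using continuous_attains_inf[OF compact_Icc] by metis
  have "g t0 \<noteq> g a"
  proof
    assume "g t0 = g a"
    then obtain n :: int where n: "a = t0 + of_int n" using g_eq_imp by blast
    have "0 < - real_of_int n" "- real_of_int n < 1" using t0(1) assms unfolding n by auto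
    hence "0 < - n" "- n < 1" by (simp_all only: of_int_minus[symmetric] of_int_0_less_iff of_int_less_1_iff)
    thus False by simp
  qed
  hence m: "norm (g t0 - g a) > 0" by simp
  have 1: "norm (g t0 - g a) \<le> norm (g t - g a)" if "a + \<tau> \<le> t" "t \<le> a + 1 - \<tau>" for t using t0(2) that by simp
  have 2: "norm (g t0 - g a) \<le> norm (g t - g a)" if "a - 1 + \<tau> \<le> t" "t \<le> a - \<tau>" for t
    using 1[of "t + 1"] that per[of t] by simp
  show thesis using that[OF m 1 2] by blast
qed

lemma linear_approx:
  assumes "\<epsilon> > 0"
  obtains \<tau> where "0 < \<tau>" "\<tau> < 1/2" "\<And>t. \<bar>t - a\<bar> \<le> \<tau> \<Longrightarrow> norm (g t - g a - (t - a) *\<^sub>R g' a) \<le> \<epsilon> * \<bar>t - a\<bar>"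
    "\<And>t. \<bar>t - a\<bar> \<le> \<tau> \<Longrightarrow> norm (g' t - g' a) \<le> \<epsilon>"
proof -
  have "\<forall>e>0. \<exists>d>0. \<forall>y. norm (y - a) < d \<longrightarrow> norm (g y - g a - (y - a) *\<^sub>R g' a) \<le> e * norm (y - a)"
    using deriv[of a] unfolding has_vector_derivative_def has_derivative_at_alt by blast
  then obtain d where d: "d > 0" "\<And>t. \<bar>t - a\<bar> < d \<Longrightarrow> norm (g t - g a - (t - a) *\<^sub>R g' a) \<le> \<epsilon> * \<bar>t - a\<bar>"
    using assms by (metis real_norm_def)
  have "isCont g' a" using cont' by (simp add: continuous_on_eq_continuous_at)
  then obtain d' where d': "d' > 0" "\<And>t. \<bar>t - a\<bar> < d' \<Longrightarrow> norm (g' t - g' a) < \<epsilon>"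
    using assms unfolding continuous_at_eps_delta dist_norm by (metis real_norm_def)
  define \<tau> where "\<tau> = min (min d d') (1/2) / 2"
  show thesis
  proof (rule that)
    show "0 < \<tau>" "\<tau> < 1/2" using d d' by (auto simp: \<tau>_def)
    fix t assume "\<bar>t - a\<bar> \<le> \<tau>"
    hence "\<bar>t - a\<bar> < d" "\<bar>t - a\<bar> < d'" using d(1) d'(1) by (auto simp: \<tau>_def)
    thus "norm (g t - g a - (t - a) *\<^sub>R g' a) \<le> \<epsilon> * \<bar>t - a\<bar>" "norm (g' t - g' a) \<le> \<epsilon>"
      using d(2) d'(2) less_imp_le by blast+
  qed
qed

text \<open>Near a point, the curve stays in a thin double cone around its tangent.\<close>
lemma cone:
  assumes "\<kappa> > 0"
  obtains \<rho> where "\<rho> > 0" "\<And>z. z \<in> range g \<Longrightarrow> norm (z - g a) < \<rho> \<Longrightarrow>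
    \<bar>Im ((z - g a) * cnj (g' a))\<bar> \<le> \<kappa> * norm (z - g a) * norm (g' a)"
proof -
  define c where "c = g' a"
  have c: "norm c > 0" using nz by (simp add: c_def)
  define \<epsilon> where "\<epsilon> = min (\<kappa> / 2) (1/2) * norm c"
  have "\<epsilon> > 0" using c assms by (simp add: \<epsilon>_def)
  then obtain \<tau> where \<tau>: "0 < \<tau>" "\<tau> < 1/2" "\<And>t. \<bar>t - a\<bar> \<le> \<tau> \<Longrightarrow> norm (g t - g a - (t - a) *\<^sub>R c) \<le> \<epsilon> * \<bar>t - a\<bar>"
    using linear_approx[of \<epsilon> a] unfolding c_def by metis
  obtain m where m: "m > 0" "\<And>t. a + \<tau> \<le> t \<Longrightarrow> t \<le> a + 1 - \<tau> \<Longrightarrow> m \<le> norm (g t - g a)"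
    "\<And>t. a - 1 + \<tau> \<le> t \<Longrightarrow> t \<le> a - \<tau> \<Longrightarrow> m \<le> norm (g t - g a)"
    using away[of \<tau> a] \<tau>(1,2) by (metis less_imp_le)
  have "\<bar>Im ((z - g a) * cnj c)\<bar> \<le> \<kappa> * norm (z - g a) * norm c" if z: "z \<in> range g" "norm (z - g a) < m" for z
  proof -
    obtain t where t: "a - 1/2 \<le> t" "t < a + 1/2" "z = g t" using range_param[OF z(1)] by metis
    have "\<bar>t - a\<bar> \<le> \<tau>"
    proof (rule ccontr)
      assume "\<not> ?thesis"
      hence "(a + \<tau> \<le> t \<and> t \<le> a + 1 - \<tau>) \<or> (a - 1 + \<tau> \<le> t \<and> t \<le> a - \<tau>)" using t \<tau> by linarith
      thus False using m(2,3)[of t] z(2) t(3) by auto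
    qed
    note ap = \<tau>(3)[OF this]
    define E where "E = z - g a - (t - a) *\<^sub>R c"
    have E: "norm E \<le> \<epsilon> * \<bar>t - a\<bar>" using ap by (simp add: E_def t(3))
    have z': "z - g a = (t - a) *\<^sub>R c + E" by (simp add: E_def)
    have "\<epsilon> \<le> norm c / 2" "\<epsilon> \<le> \<kappa> / 2 * norm c" using c by (auto simp: \<epsilon>_def intro!: mult_right_mono min.cobounded1)
    have "norm ((t - a) *\<^sub>R c) \<le> norm (z - g a) + norm E"
      using norm_triangle_ineq4[of "z - g a" E] by (simp add: z')
    moreover have "\<epsilon> * \<bar>t - a\<bar> \<le> norm c / 2 * \<bar>t - a\<bar>" using \<open>\<epsilon> \<le> norm c / 2\<close> by (rule mult_right_mono) simp
    ultimately have n: "\<bar>t - a\<bar> * norm c \<le> 2 * norm (z - g a)" using E by (simp add: mult.commute)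
    have "Im ((z - g a) * cnj c) = Im (E * cnj c)" by (simp add: z' algebra_simps)
    also have "\<bar>\<dots>\<bar> \<le> norm E * norm c" using abs_Im_le_cmod[of "E * cnj c"] by (simp add: norm_mult)
    also have "\<dots> \<le> (\<kappa> / 2 * norm c * \<bar>t - a\<bar>) * norm c"
    proof (rule mult_right_mono)
      have "\<epsilon> * \<bar>t - a\<bar> \<le> \<kappa> / 2 * norm c * \<bar>t - a\<bar>" using \<open>\<epsilon> \<le> \<kappa> / 2 * norm c\<close> by (rule mult_right_mono) simp
      thus "norm E \<le> \<kappa> / 2 * norm c * \<bar>t - a\<bar>" using E by linarith
    qed simp
    also have "\<dots> = \<kappa> / 2 * norm c * (\<bar>t - a\<bar> * norm c)" by simp
    also have "\<dots> \<le> \<kappa> / 2 * norm c * (2 * norm (z - g a))" using n assms c by (intro mult_left_mono) auto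
    finally show ?thesis by (simp add: mult.commute mult.left_commute)
  qed
  thus thesis using that[of m] m(1) unfolding c_def by blast
qed

lemma continuous_path: "path g" and loop: "pathfinish g = pathstart g"
  and path_image_eq: "path_image g = range g" and valid: "valid_path g"
proof -
  show "path g" unfolding path_def by (rule cont)
  show "pathfinish g = pathstart g" using per[of 0] by (simp add: pathfinish_def pathstart_def)
  show "path_image g = range g"
  proof
    show "range g \<subseteq> path_image g"
    proof
      fix z assume "z \<in> range g"
      then obtain t where "z = g t" by blast
      hence "z = g (frac t)" by (simp add: frac_eq)
      thus "z \<in> path_image g" using frac_lt_1[of t] frac_ge_0[of t] by (auto simp: path_image_def intro: less_imp_le)
    qed
  qed (auto simp: path_image_def)
  show "valid_path g"
    unfolding valid_path_def
    by (rule C1_differentiable_imp_piecewise, rule C1_differentiable_on_subset[OF C1]) simp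
qed

lemma range_shift: "range (\<lambda>x. g (x + b)) = range g"
proof
  show "range g \<subseteq> range (\<lambda>x. g (x + b))"
  proof
    fix z assume "z \<in> range g"
    then obtain t where "z = g ((t - b) + b)" by auto
    thus "z \<in> range (\<lambda>x. g (x + b))" by blast
  qed
qed auto

lemma shift_param: "C1_jordan_param (\<lambda>x. g (x + b))" and shift_deriv: "vector_derivative (\<lambda>x. g (x + b)) (at t) = g' (t + b)"
proof -
  have d: "((\<lambda>x. g (x + b)) has_vector_derivative g' (t + b)) (at t)" for t
  proof -
    have "((\<lambda>x. x + b) has_real_derivative 1) (at t)" by (auto intro!: derivative_eq_intros)
    from vector_diff_chain_at[OF this[unfolded has_real_derivative_iff_has_vector_derivative] deriv[of "t + b"]]
    show ?thesis by (simp add: o_def)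
  qed
  show sd: "vector_derivative (\<lambda>x. g (x + b)) (at t) = g' (t + b)" for t
    by (rule vector_derivative_at[OF d])
  show "C1_jordan_param (\<lambda>x. g (x + b))"
    unfolding C1_jordan_param_def
  proof (intro conjI allI ballI)
    show "g (t + 1 + b) = g (t + b)" for t using per[of "t + b"] by (simp add: algebra_simps)
    show "inj_on (\<lambda>x. g (x + b)) {0..<1}"
    proof (rule inj_onI)
      fix x y assume xy: "x \<in> {0..<1}" "y \<in> {0..<1}" "g (x + b) = g (y + b)"
      then obtain n :: int where "y + b = x + b + of_int n" using g_eq_imp by blast
      hence n: "y = x + of_int n" by simp
      have "- 1 < real_of_int n" "real_of_int n < 1" using xy(1,2) n by auto
      hence "n = 0" by linarith
      thus "x = y" using n by simp
    qed
    have "continuous_on UNIV (\<lambda>x. g' (x + b))"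
      by (rule continuous_on_compose2[OF cont']) (auto intro!: continuous_intros)
    thus "(\<lambda>x. g (x + b)) C1_differentiable_on UNIV"
      unfolding C1_differentiable_on_def using d by (intro exI[of _ "\<lambda>x. g' (x + b)"]) simp
    show "vector_derivative (\<lambda>x. g (x + b)) (at t) \<noteq> 0" for t unfolding sd by (rule nz)
    show "winding_number (\<lambda>x. g (x + b)) z = 1" if z: "z \<in> inside (range (\<lambda>x. g (x + b)))" for z
    proof -
      have "shiftpath (frac b) g = (\<lambda>x. g (x + b))"
      proof
        fix x
        have "g (frac b + x) = g (x + b)" using per_int[of "x + b" "- \<lfloor>b\<rfloor>"] by (simp add: frac_def algebra_simps)
        moreover have "g (frac b + x - 1) = g (frac b + x)" using per[of "frac b + x - 1"] by simp
        ultimately show "shiftpath (frac b) g x = g (x + b)" by (simp add: shiftpath_def)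
      qed
      moreover have "z \<notin> path_image g" using z inside_no_overlap[of "range g"] unfolding range_shift path_image_eq by blast
      ultimately have "winding_number (\<lambda>x. g (x + b)) z = winding_number g z"
        using winding_number_shiftpath[OF continuous_path _ loop, of z "frac b"] frac_lt_1[of b] frac_ge_0[of b] by (simp add: less_imp_le)
      thus ?thesis using wind z unfolding range_shift by simp
    qed
  qed
qed

end

text \<open>Both \<open>w\<close> and \<open>z / q\<close> are close to \<open>1\<close>.\<close>
lemma Re_divide_ge:
  fixes w z :: complex and q :: real
  assumes "q > 0" "norm (z - of_real q) \<le> 21/100 * q" "norm (w - 1) \<le> 1/10"
  shows "Re (w / z) \<ge> 4/10 / q"
proof -
  define e where "e = w - 1"
  define d where "d = z - of_real q"
  have e: "norm e \<le> 1/10" and d: "norm d \<le> 21/100 * q" using assms by (simp_all add: e_def d_def)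
  have zn: "norm z \<le> 121/100 * q" "z \<noteq> 0"
  proof -
    show "norm z \<le> 121/100 * q" using norm_triangle_ineq[of "of_real q" d] d assms(1) by (simp add: d_def)
    show "z \<noteq> 0" using d assms(1) by (auto simp: d_def)
  qed
  have "w * cnj z = of_real q + of_real q * e + cnj d + e * cnj d" by (simp add: e_def d_def algebra_simps)
  hence R: "Re (w * cnj z) = q + Re (of_real q * e) + Re (cnj d) + Re (e * cnj d)" by simp
  have "Re (w * cnj z) \<ge> q - q / 10 - 21/100 * q - 21/1000 * q"
  proof -
    have "norm (of_real q * e) \<le> q / 10"
      using assms(1) mult_left_mono[OF e, of q] by (simp add: norm_mult)
    hence "\<bar>Re (of_real q * e)\<bar> \<le> q / 10"
      using abs_Re_le_cmod[of "of_real q * e"] by linarith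
    moreover have "\<bar>Re (cnj d)\<bar> \<le> 21/100 * q" using abs_Re_le_cmod[of "cnj d"] d by simp
    moreover have "\<bar>Re (e * cnj d)\<bar> \<le> 21/1000 * q"
      using abs_Re_le_cmod[of "e * cnj d"] mult_mono[OF e d] by (simp add: norm_mult)
    ultimately show ?thesis unfolding R by linarith
  qed
  hence wz: "Re (w * cnj z) \<ge> 669/1000 * q" by simp
  have "(norm z)\<^sup>2 \<le> (121/100 * q)\<^sup>2" using zn by (intro power_mono) auto
  hence z2: "(norm z)\<^sup>2 \<le> 14641/10000 * q * q" by (simp add: power2_eq_square)
  have "4/10 / q * (norm z)\<^sup>2 \<le> 4/10 / q * (14641/10000 * q * q)" using z2 assms(1) by (intro mult_left_mono) auto
  also have "\<dots> \<le> 669/1000 * q" using assms(1) by simp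
  finally have "4/10 / q * (norm z)\<^sup>2 \<le> Re (w * cnj z)" using wz by linarith
  moreover have "(norm z)\<^sup>2 > 0" using zn(2) by simp
  ultimately have "4/10 / q \<le> Re (w * cnj z) / (norm z)\<^sup>2" by (simp only: pos_le_divide_eq)
  also have "\<dots> = Re (w / z)" by (simp only: complex_div_cnj[of w z] Re_divide_of_real)
  finally show ?thesis .
qed

context jordan_curve_param
begin

text \<open>The winding number jumps up from the right to the left of the curve: near the point, the
  difference of the two integrands is nearly a Poisson kernel, whose integral is bounded below,
  and elsewhere it is of the order of the distance to the curve.\<close>
lemma winding_jump:
  assumes s: "s = g (1/2)" and c: "c = g' (1/2)"
  obtains \<eta>0 where "\<eta>0 > 0" "\<And>\<eta>. 0 < \<eta> \<Longrightarrow> \<eta> < \<eta>0 \<Longrightarrow>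
    s + \<i> * of_real \<eta> * c \<notin> range g \<Longrightarrow> s - \<i> * of_real \<eta> * c \<notin> range g \<Longrightarrow>
    0 < Re (winding_number g (s + \<i> * of_real \<eta> * c) - winding_number g (s - \<i> * of_real \<eta> * c))"
proof -
  have c0: "norm c > 0" "c \<noteq> 0" using nz by (auto simp: c)
  have "1/10 * norm c > 0" using c0 by simp
  then obtain \<tau> where \<tau>: "0 < \<tau>" "\<tau> < 1/2"
    "\<And>t. \<bar>t - 1/2\<bar> \<le> \<tau> \<Longrightarrow> norm (g t - s - (t - 1/2) *\<^sub>R c) \<le> 1/10 * norm c * \<bar>t - 1/2\<bar>"
    "\<And>t. \<bar>t - 1/2\<bar> \<le> \<tau> \<Longrightarrow> norm (g' t - c) \<le> 1/10 * norm c"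
    using linear_approx[of "1/10 * norm c" "1/2"] unfolding s c by metis
  obtain m where m: "m > 0" "\<And>t. 1/2 + \<tau> \<le> t \<Longrightarrow> t \<le> 1/2 + 1 - \<tau> \<Longrightarrow> m \<le> norm (g t - s)"
    "\<And>t. 1/2 - 1 + \<tau> \<le> t \<Longrightarrow> t \<le> 1/2 - \<tau> \<Longrightarrow> m \<le> norm (g t - s)"
    using away[of \<tau> "1/2"] \<tau>(1,2) unfolding s by (metis less_imp_le)
  have "bounded (g' ` {0..1})"
    by (rule compact_imp_bounded, rule compact_continuous_image) (auto intro: continuous_on_subset[OF cont'])
  then obtain G where G: "G > 0" "\<And>t. t \<in> {0..1} \<Longrightarrow> norm (g' t) \<le> G" unfolding bounded_pos by auto
  define M where "M = 2 * G * norm c / m\<^sup>2"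
  have M: "M > 0" using G m c0 by (simp add: M_def)
  define \<eta>0 where "\<eta>0 = min \<tau> (min (m / (2 * norm c)) (4/10 / M))"
  have \<eta>0: "\<eta>0 > 0" using \<tau> m c0 M by (simp add: \<eta>0_def)
  have main: "0 < Re (winding_number g (s + \<i> * of_real \<eta> * c) - winding_number g (s - \<i> * of_real \<eta> * c))"
    if \<eta>: "0 < \<eta>" "\<eta> < \<eta>0" and off: "s + \<i> * of_real \<eta> * c \<notin> range g" "s - \<i> * of_real \<eta> * c \<notin> range g" for \<eta>
  proof -
    define z1 where "z1 = s + \<i> * of_real \<eta> * c"
    define z2 where "z2 = s - \<i> * of_real \<eta> * c"
    have \<eta>': "\<eta> < \<tau>" "\<eta> * norm c \<le> m / 2" "M * \<eta> < 4/10"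
    proof -
      show "\<eta> < \<tau>" using \<eta> by (simp add: \<eta>0_def)
      have "\<eta> \<le> m / (2 * norm c)" using \<eta> by (simp add: \<eta>0_def)
      thus "\<eta> * norm c \<le> m / 2" using c0 by (simp add: field_simps)
      have "\<eta> < 4/10 / M" using \<eta> by (simp add: \<eta>0_def)
      thus "M * \<eta> < 4/10" using M by (simp add: field_simps)
    qed
    \<comment> \<open>The difference of the two integrands is \<open>2 * \<i> * F t\<close>.\<close>
    define F where "F t = g' t * (of_real \<eta> * c) / ((g t - s)\<^sup>2 + (of_real \<eta> * c)\<^sup>2)" for t
    have wn: "((\<lambda>t. 1 / (g t - z) * g' t) has_integral 2 * pi * \<i> * winding_number g z) {0..1}" if "z \<notin> range g" for z
    proof -
      have "((\<lambda>w. 1 / (w - z)) has_contour_integral 2 * pi * \<i> * winding_number g z) g"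
        by (rule has_contour_integral_winding_number[OF valid]) (use that path_image_eq in simp)
      thus ?thesis unfolding has_contour_integral g'_def .
    qed
    have diff: "((\<lambda>t. 1 / (g t - z1) * g' t - 1 / (g t - z2) * g' t) has_integral
        2 * pi * \<i> * (winding_number g z1 - winding_number g z2)) {0..1}"
      using has_integral_diff[OF wn[of z1] wn[of z2]] off by (simp add: z1_def z2_def right_diff_distrib)
    have F: "1 / (g t - z1) * g' t - 1 / (g t - z2) * g' t = 2 * \<i> * F t" for t
    proof -
      define A where "A = g t - s"
      define D where "D = of_real \<eta> * c"
      have "g t \<noteq> z1" "g t \<noteq> z2" using off rangeI[of g t] unfolding z1_def z2_def by metis+
      moreover have "A - \<i> * D = g t - z1" "A + \<i> * D = g t - z2"
        by (simp_all add: A_def D_def z1_def z2_def algebra_simps)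
      ultimately have ne: "A - \<i> * D \<noteq> 0" "A + \<i> * D \<noteq> 0" by simp_all
      have "1 / (A - \<i> * D) * g' t - 1 / (A + \<i> * D) * g' t = ((A + \<i> * D) - (A - \<i> * D)) * g' t / ((A - \<i> * D) * (A + \<i> * D))"
        using ne by (simp add: field_simps)
      also have "(A - \<i> * D) * (A + \<i> * D) = A\<^sup>2 + D\<^sup>2" by (simp add: algebra_simps power2_eq_square)
      finally have "1 / (A - \<i> * D) * g' t - 1 / (A + \<i> * D) * g' t = 2 * \<i> * (g' t * D / (A\<^sup>2 + D\<^sup>2))" by simp
      thus ?thesis unfolding F_def A_def D_def z1_def z2_def by (simp add: algebra_simps)
    qed
    have "((\<lambda>t. (2 * \<i> * F t) / (2 * \<i>)) has_integral
        (2 * pi * \<i> * (winding_number g z1 - winding_number g z2)) / (2 * \<i>)) {0..1}"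
      using has_integral_divide[OF diff[unfolded F], of "2 * \<i>"] .
    moreover have "(2 * \<i> * x) / (2 * \<i>) = x" "(2 * pi * \<i> * x) / (2 * \<i>) = pi * x" for x :: complex by (simp_all add: field_simps)
    ultimately have "(F has_integral pi * (winding_number g z1 - winding_number g z2)) {0..1}" by (simp only:)
    from has_integral_Re[OF this]
    have ReF: "((\<lambda>t. Re (F t)) has_integral pi * Re (winding_number g z1 - winding_number g z2)) {0..1}" by simp
    define J where "J = {1/2 - \<eta>..1/2 + \<eta>}"
    have "J \<subseteq> {0..1}" using \<eta>' \<tau> by (auto simp: J_def)
    hence "((\<lambda>t. if t \<in> J then 2/10 / \<eta> else 0) has_integral (2 * \<eta>) * (2/10 / \<eta>)) {0..1}"
      using has_integral_const_real[of "2/10 / \<eta>" "1/2 - \<eta>" "1/2 + \<eta>"] \<eta> by (subst has_integral_restrict) (auto simp: J_def)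
    from has_integral_diff[OF this has_integral_const_real[of "M * \<eta>" 0 1]]
    have lower: "((\<lambda>t. (if t \<in> J then 2/10 / \<eta> else 0) - M * \<eta>) has_integral 4/10 - M * \<eta>) {0..1}" using \<eta> by simp
    have "4/10 - M * \<eta> \<le> pi * Re (winding_number g z1 - winding_number g z2)"
    proof (rule has_integral_le[OF lower ReF])
      fix t :: real assume t: "t \<in> {0..1}"
      show "(if t \<in> J then 2/10 / \<eta> else 0) - M * \<eta> \<le> Re (F t)"
      proof (cases "\<bar>t - 1/2\<bar> \<le> \<tau>")
        case True
        define y where "y = t - 1/2"
        define q where "q = y\<^sup>2 + \<eta>\<^sup>2"
        define \<alpha> where "\<alpha> = (g t - s) / c"
        define \<beta> where "\<beta> = g' t / c"
        have q: "q > 0" using \<eta> by (simp add: q_def add_nonneg_pos)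
        have \<alpha>: "norm (\<alpha> - of_real y) \<le> 1/10 * \<bar>y\<bar>"
        proof -
          have "\<alpha> - of_real y = (g t - s - y *\<^sub>R c) / c" using c0 by (simp add: \<alpha>_def diff_divide_distrib scaleR_conv_of_real)
          hence "norm (\<alpha> - of_real y) = norm (g t - s - y *\<^sub>R c) / norm c" by (simp only: norm_divide)
          also have "\<dots> \<le> (1/10 * norm c * \<bar>y\<bar>) / norm c"
            using \<tau>(3)[OF True] unfolding y_def by (rule divide_right_mono) simp
          also have "\<dots> = 1/10 * \<bar>y\<bar>" using c0 by simp
          finally show ?thesis .
        qed
        have \<beta>: "norm (\<beta> - 1) \<le> 1/10"
        proof -
          have "\<beta> - 1 = (g' t - c) / c" using c0 by (simp add: \<beta>_def diff_divide_distrib)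
          hence "norm (\<beta> - 1) = norm (g' t - c) / norm c" by (simp only: norm_divide)
          also have "\<dots> \<le> (1/10 * norm c) / norm c"
            using \<tau>(4)[OF True] by (rule divide_right_mono) simp
          also have "\<dots> = 1/10" using c0 by simp
          finally show ?thesis .
        qed
        have "(\<alpha>\<^sup>2 + of_real (\<eta>\<^sup>2)) - of_real q = (\<alpha> - of_real y) * (\<alpha> - of_real y + 2 * of_real y)"
          by (simp add: q_def algebra_simps power2_eq_square)
        hence "norm ((\<alpha>\<^sup>2 + of_real (\<eta>\<^sup>2)) - of_real q) = norm (\<alpha> - of_real y) * norm (\<alpha> - of_real y + 2 * of_real y)"
          by (simp only: norm_mult)
        also have "\<dots> \<le> (1/10 * \<bar>y\<bar>) * (21/10 * \<bar>y\<bar>)"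
          using \<alpha> norm_triangle_ineq[of "\<alpha> - of_real y" "2 * of_real y"] by (intro mult_mono) (auto simp: norm_mult)
        also have "\<dots> \<le> 21/100 * q" by (simp add: q_def power2_eq_square)
        finally have near: "norm ((\<alpha>\<^sup>2 + of_real (\<eta>\<^sup>2)) - of_real q) \<le> 21/100 * q" .
        have "F t = of_real \<eta> * (\<beta> / (\<alpha>\<^sup>2 + of_real (\<eta>\<^sup>2)))"
        proof -
          have "g t - s = c * \<alpha>" "g' t = c * \<beta>" using c0 by (simp_all add: \<alpha>_def \<beta>_def)
          hence "F t = (c * \<beta>) * (of_real \<eta> * c) / ((c * \<alpha>)\<^sup>2 + (of_real \<eta> * c)\<^sup>2)"
            unfolding F_def by (simp only:)
          also have "(c * \<beta>) * (of_real \<eta> * c) = c\<^sup>2 * (of_real \<eta> * \<beta>)" by (simp add: power2_eq_square)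
          also have "(c * \<alpha>)\<^sup>2 + (of_real \<eta> * c)\<^sup>2 = c\<^sup>2 * (\<alpha>\<^sup>2 + of_real (\<eta>\<^sup>2))"
            by (simp add: power_mult_distrib distrib_left mult.commute)
          also have "(c\<^sup>2 * (of_real \<eta> * \<beta>)) / (c\<^sup>2 * (\<alpha>\<^sup>2 + of_real (\<eta>\<^sup>2))) = (of_real \<eta> * \<beta>) / (\<alpha>\<^sup>2 + of_real (\<eta>\<^sup>2))"
            using c0 by (intro mult_divide_mult_cancel_left) simp
          finally show ?thesis by simp
        qed
        moreover have "Re (of_real \<eta> * x) = \<eta> * Re x" for x :: complex by simp
        ultimately have "Re (F t) = \<eta> * Re (\<beta> / (\<alpha>\<^sup>2 + of_real (\<eta>\<^sup>2)))" by (simp only:)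
        hence ge: "Re (F t) \<ge> \<eta> * (4/10 / q)" using mult_left_mono[OF Re_divide_ge[OF q near \<beta>], of \<eta>] \<eta>(1) by (simp only: less_imp_le)
        show ?thesis
        proof (cases "t \<in> J")
          case True
          hence "\<bar>y\<bar> \<le> \<eta>" by (auto simp: J_def y_def)
          hence "y\<^sup>2 \<le> \<eta>\<^sup>2" using abs_le_square_iff[of y \<eta>] \<eta> by simp
          hence "q \<le> 2 * \<eta>\<^sup>2" by (simp add: q_def)
          hence "2/10 / \<eta> \<le> \<eta> * (4/10 / q)" using q \<eta> by (simp add: field_simps power2_eq_square)
          thus ?thesis using True ge mult_pos_pos[OF M \<eta>(1)] by simp
        next
          case False
          have "0 \<le> \<eta> * (4/10 / q)" using q \<eta> by simp
          thus ?thesis using False ge mult_pos_pos[OF M \<eta>(1)] by simp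
        qed
      next
        case False
        hence "t \<notin> J" using \<eta>' by (auto simp: J_def abs_le_iff)
        have "(1/2 + \<tau> \<le> t \<and> t \<le> 1/2 + 1 - \<tau>) \<or> (1/2 - 1 + \<tau> \<le> t \<and> t \<le> 1/2 - \<tau>)" using False t \<tau>(2) by auto
        hence far: "m \<le> norm (g t - s)" using m(2,3) by blast
        define D where "D = of_real \<eta> * c"
        have nD: "norm D = \<eta> * norm c" using \<eta> by (simp add: D_def norm_mult)
        have "(norm (g t - s))\<^sup>2 \<ge> m\<^sup>2" using far m by (intro power_mono) auto
        moreover have "(norm D)\<^sup>2 \<le> (m / 2)\<^sup>2" using \<eta>'(2) unfolding nD[symmetric] by (rule power_mono) simp
        moreover have "norm ((g t - s)\<^sup>2) - norm (D\<^sup>2) \<le> norm ((g t - s)\<^sup>2 + D\<^sup>2)"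
          using norm_triangle_ineq4[of "(g t - s)\<^sup>2 + D\<^sup>2" "D\<^sup>2"] by simp
        moreover have "(m / 2)\<^sup>2 \<le> m\<^sup>2 / 2" by (simp add: power_divide)
        ultimately have den: "m\<^sup>2 / 2 \<le> norm ((g t - s)\<^sup>2 + D\<^sup>2)" unfolding norm_power by linarith
        have "norm (F t) = norm (g' t) * (\<eta> * norm c) / norm ((g t - s)\<^sup>2 + D\<^sup>2)"
          unfolding F_def D_def[symmetric] norm_divide norm_mult nD ..
        also have "\<dots> \<le> G * (\<eta> * norm c) / (m\<^sup>2 / 2)"
          using G t den m \<eta> by (intro frac_le mult_right_mono mult_nonneg_nonneg) auto
        also have "\<dots> = M * \<eta>" by (simp add: M_def)
        finally have "norm (F t) \<le> M * \<eta>" .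
        thus ?thesis using \<open>t \<notin> J\<close> abs_Re_le_cmod[of "F t"] by simp
      qed
    qed
    hence "0 < pi * Re (winding_number g z1 - winding_number g z2)" using \<eta>'(3) by linarith
    thus ?thesis unfolding z1_def z2_def by (simp add: zero_less_mult_iff)
  qed
  thus thesis using that[OF \<eta>0] by blast
qed

end

lemma (in jordan_curve_param) shift_locale: "jordan_curve_param (\<lambda>x. g (x + b))"
  by unfold_locales (rule shift_param)

context jordan_curve_param
begin

definition left_cone :: "real \<Rightarrow> real \<Rightarrow> real \<Rightarrow> complex set" where
  "left_cone a \<kappa> \<rho> = {v. norm v < \<rho> \<and> Im (v * cnj (g' a)) > \<kappa> * norm v * norm (g' a)}"

lemma convex_left_cone: assumes "\<kappa> \<ge> 0" shows "convex (left_cone a \<kappa> \<rho>)"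
proof (rule convexI)
  fix v w :: complex and x y :: real
  assume v: "v \<in> left_cone a \<kappa> \<rho>" and w: "w \<in> left_cone a \<kappa> \<rho>" and xy: "0 \<le> x" "0 \<le> y" "x + y = 1"
  have n: "norm (x *\<^sub>R v + y *\<^sub>R w) \<le> x * norm v + y * norm w"
    using norm_triangle_ineq[of "x *\<^sub>R v" "y *\<^sub>R w"] xy by simp
  have "x * norm v + y * norm w < \<rho>"
    by (rule convex_bound_lt) (use v w xy in \<open>auto simp: left_cone_def\<close>)
  moreover have "\<kappa> * norm (x *\<^sub>R v + y *\<^sub>R w) * norm (g' a) < Im ((x *\<^sub>R v + y *\<^sub>R w) * cnj (g' a))"
  proof -
    have "\<kappa> * norm (x *\<^sub>R v + y *\<^sub>R w) * norm (g' a) \<le> \<kappa> * (x * norm v + y * norm w) * norm (g' a)"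
      using n assms by (intro mult_right_mono mult_left_mono) auto
    moreover have "0 < x * (Im (v * cnj (g' a)) - \<kappa> * norm v * norm (g' a)) + y * (Im (w * cnj (g' a)) - \<kappa> * norm w * norm (g' a))"
    proof (cases "x = 0")
      case True thus ?thesis using xy w by (simp add: left_cone_def)
    next
      case False
      hence "0 < x * (Im (v * cnj (g' a)) - \<kappa> * norm v * norm (g' a))" using xy v by (simp add: left_cone_def)
      moreover have "0 \<le> y * (Im (w * cnj (g' a)) - \<kappa> * norm w * norm (g' a))" using xy w by (simp add: left_cone_def)
      ultimately show ?thesis by linarith
    qed
    moreover have "Im ((x *\<^sub>R v + y *\<^sub>R w) * cnj (g' a)) = x * Im (v * cnj (g' a)) + y * Im (w * cnj (g' a))"
      by (simp add: algebra_simps)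
    ultimately show ?thesis by (simp add: algebra_simps)
  qed
  ultimately show "x *\<^sub>R v + y *\<^sub>R w \<in> left_cone a \<kappa> \<rho>" using n by (simp add: left_cone_def)
qed

text \<open>The winding number is \<open>1\<close> inside and \<open>0\<close> outside, so by the jump the inside is on the left and
  the outside on the right for points on the normal. Each half of the complement of the double cone
  is convex and avoids the curve, hence lies in one component.\<close>
lemma local_sides:
  assumes "\<kappa> > 0"
  obtains \<rho> where "\<rho> > 0"
    "\<And>v. norm v < \<rho> \<Longrightarrow> Im (v * cnj (g' a)) > \<kappa> * norm v * norm (g' a) \<Longrightarrow> g a + v \<in> inside (range g)"
    "\<And>v. norm v < \<rho> \<Longrightarrow> Im (v * cnj (g' a)) < - (\<kappa> * norm v * norm (g' a)) \<Longrightarrow> g a + v \<in> outside (range g)"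
proof -
  define c where "c = g' a"
  have c: "norm c > 0" using nz by (simp add: c_def)
  \<comment> \<open>The cone has to leave out the normal direction.\<close>
  define \<kappa>' where "\<kappa>' = min \<kappa> (1/2)"
  have \<kappa>': "0 < \<kappa>'" "\<kappa>' \<le> \<kappa>" "\<kappa>' \<le> 1/2" using assms by (auto simp: \<kappa>'_def)
  obtain \<rho> where \<rho>: "\<rho> > 0" "\<And>z. z \<in> range g \<Longrightarrow> norm (z - g a) < \<rho> \<Longrightarrow>
    \<bar>Im ((z - g a) * cnj c)\<bar> \<le> \<kappa>' * norm (z - g a) * norm c"
    using cone[OF \<kappa>'(1), of a] unfolding c_def by blast
  interpret sh: jordan_curve_param "\<lambda>x. g (x + (a - 1/2))" by (rule shift_locale)
  have sc: "sh.g' (1/2) = c" unfolding sh.g'_def shift_deriv by (simp add: c_def)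
  have same: "winding_number (\<lambda>x. g (x + (a - 1/2))) z = (if z \<in> inside (range g) then 1 else 0)" if "z \<notin> range g" for z
  proof (cases "z \<in> inside (range g)")
    case True
    thus ?thesis using sh.wind[of z] by (simp add: range_shift)
  next
    case False
    hence "z \<in> outside (range g)" using that inside_Un_outside[of "range g"] by blast
    hence "z \<in> outside (path_image (\<lambda>x. g (x + (a - 1/2))))" by (simp add: sh.path_image_eq range_shift)
    thus ?thesis using winding_number_zero_in_outside[OF sh.continuous_path sh.loop, of z] False by simp
  qed
  obtain \<eta>0 where \<eta>0: "\<eta>0 > 0" "\<And>\<eta>. 0 < \<eta> \<Longrightarrow> \<eta> < \<eta>0 \<Longrightarrow>
    g a + \<i> * of_real \<eta> * c \<notin> range g \<Longrightarrow> g a - \<i> * of_real \<eta> * c \<notin> range g \<Longrightarrow>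
    0 < Re (winding_number (\<lambda>x. g (x + (a - 1/2))) (g a + \<i> * of_real \<eta> * c) - winding_number (\<lambda>x. g (x + (a - 1/2))) (g a - \<i> * of_real \<eta> * c))"
    using sh.winding_jump[of "g a" c] sc by (auto simp: range_shift)
  define d where "d = \<rho> / norm c"
  have d: "0 < d" "d * norm c = \<rho>" using \<rho>(1) c by (simp_all add: d_def)
  define \<eta> where "\<eta> = min \<eta>0 d / 2"
  have \<eta>: "0 < \<eta>" "\<eta> < \<eta>0" "\<eta> < d" using \<eta>0(1) d(1) unfolding \<eta>_def by linarith+
  have \<eta>c: "\<eta> * norm c < \<rho>" using mult_strict_right_mono[OF \<eta>(3) c] d(2) by simp
  define v where "v = \<i> * of_real \<eta> * c"
  have nv: "norm v = \<eta> * norm c" using \<eta> by (simp add: v_def norm_mult)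
  have "v * cnj c = of_real (\<eta> * (norm c)\<^sup>2) * \<i>" by (simp add: v_def mult.assoc complex_norm_square[symmetric])
  hence Iv: "Im (v * cnj c) = \<eta> * (norm c)\<^sup>2" by simp
  have big: "\<kappa>' * norm v * norm c < \<eta> * (norm c)\<^sup>2"
  proof -
    have "\<kappa>' * norm v * norm c \<le> 1/2 * (\<eta> * (norm c)\<^sup>2)"
      unfolding nv using mult_right_mono[OF \<kappa>'(3), of "\<eta> * (norm c)\<^sup>2"] \<eta>(1) by (simp add: power2_eq_square algebra_simps)
    also have "\<dots> < \<eta> * (norm c)\<^sup>2" using \<eta> c by simp
    finally show ?thesis .
  qed
  have v_left: "v \<in> left_cone a \<kappa>' \<rho>" unfolding left_cone_def c_def[symmetric] mem_Collect_eq Iv using big \<eta>c nv by simp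
  have offL: "g a + v \<notin> range g" if "v \<in> left_cone a \<kappa>' \<rho>" for v
    using \<rho>(2)[of "g a + v"] that by (auto simp: left_cone_def c_def[symmetric])
  have offR: "g a - v \<notin> range g" if "v \<in> left_cone a \<kappa>' \<rho>" for v
    using \<rho>(2)[of "g a - v"] that by (auto simp: left_cone_def c_def[symmetric])
  have "0 < Re (winding_number (\<lambda>x. g (x + (a - 1/2))) (g a + v) - winding_number (\<lambda>x. g (x + (a - 1/2))) (g a - v))"
    using \<eta>0(2)[OF \<eta>(1,2)] offL[OF v_left] offR[OF v_left] unfolding v_def by blast
  hence L0: "g a + v \<in> inside (range g)" and R0: "g a - v \<notin> inside (range g)"
    unfolding same[OF offL[OF v_left]] same[OF offR[OF v_left]] by (auto split: if_splits)
  have R0': "g a - v \<in> outside (range g)" using R0 offR[OF v_left] inside_Un_outside[of "range g"] by blast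
  have conv: "convex (left_cone a \<kappa>' \<rho>)" using \<kappa>' by (intro convex_left_cone) simp
  have conL: "connected_component (- range g) (g a + v) (g a + w)" if "w \<in> left_cone a \<kappa>' \<rho>" for w
    unfolding connected_component_def
  proof (intro exI conjI)
    show "connected ((\<lambda>v. g a + v) ` left_cone a \<kappa>' \<rho>)"
      by (intro connected_continuous_image continuous_intros convex_connected conv)
    show "(\<lambda>v. g a + v) ` left_cone a \<kappa>' \<rho> \<subseteq> - range g"
    proof (rule image_subsetI)
      fix v assume "v \<in> left_cone a \<kappa>' \<rho>"
      from offL[OF this] show "g a + v \<in> - range g" unfolding Compl_iff .
    qed
  qed (use v_left that in auto)
  have conR: "connected_component (- range g) (g a - v) (g a - w)" if "w \<in> left_cone a \<kappa>' \<rho>" for w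
    unfolding connected_component_def
  proof (intro exI conjI)
    show "connected ((\<lambda>v. g a - v) ` left_cone a \<kappa>' \<rho>)"
      by (intro connected_continuous_image continuous_intros convex_connected conv)
    show "(\<lambda>v. g a - v) ` left_cone a \<kappa>' \<rho> \<subseteq> - range g"
    proof (rule image_subsetI)
      fix v assume "v \<in> left_cone a \<kappa>' \<rho>"
      from offR[OF this] show "g a - v \<in> - range g" unfolding Compl_iff .
    qed
  qed (use v_left that in auto)
  have mono: "\<kappa>' * norm w * norm c \<le> \<kappa> * norm w * norm c" for w :: complex
    using \<kappa>' by (intro mult_right_mono) auto
  show thesis
  proof (rule that[OF \<rho>(1)])
    fix w assume "norm w < \<rho>" "Im (w * cnj (g' a)) > \<kappa> * norm w * norm (g' a)"
    hence "w \<in> left_cone a \<kappa>' \<rho>" using mono[of w] by (simp add: left_cone_def c_def)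
    from inside_same_component[OF conL[OF this] L0] show "g a + w \<in> inside (range g)" .
  next
    fix w assume "norm w < \<rho>" "Im (w * cnj (g' a)) < - (\<kappa> * norm w * norm (g' a))"
    hence "- w \<in> left_cone a \<kappa>' \<rho>" using mono[of w] by (simp add: left_cone_def c_def)
    from outside_same_component[OF conR[OF this] R0'] show "g a + w \<in> outside (range g)" by simp
  qed
qed

end

section \<open>Curves with a monotone image\<close>

text \<open>Nonincreasing for \<open>k = 1\<close>, nondecreasing for \<open>k = -1\<close>.\<close>
definition sloped :: "real \<Rightarrow> complex set \<Rightarrow> complex set \<Rightarrow> bool" where
  "sloped k V S \<longleftrightarrow> (\<forall>p\<in>S \<inter> V. \<forall>q\<in>S \<inter> V. Re p < Re q \<longrightarrow> k * Im q \<le> k * Im p)"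

lemma sloped_1: "sloped 1 V S = nonincreasing_in V S"
  and sloped_minus_1: "sloped (-1) V S = nondecreasing_in V S"
  by (auto simp: sloped_def nonincreasing_in_def nondecreasing_in_def)

text \<open>After the reflection by the signs \<open>p\<close> and \<open>q\<close> the set is nonincreasing.\<close>
lemma sloped_signs:
  assumes "sloped (p * q) V S" "p = 1 \<or> p = -1" "q = 1 \<or> q = -1"
    and "f \<in> S \<inter> V" "e \<in> S \<inter> V" "p * Re f < p * Re e"
  shows "q * Im e \<le> q * Im f"
proof (cases "p = 1")
  case True
  thus ?thesis using assms unfolding sloped_def by auto
next
  case False
  hence p: "p = -1" using assms(2) by simp
  hence "Re e < Re f" using assms(6) by simp
  hence "p * q * Im f \<le> p * q * Im e" using assms(1,4,5) unfolding sloped_def by blast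
  thus ?thesis using p by simp
qed

context jordan_curve_param
begin

lemma deriv_slope:
  assumes sl: "sloped k V (range g)" and k: "k = 1 \<or> k = -1" and V: "g t \<in> interior V"
  shows "k * Re (g' t) * Im (g' t) \<le> 0"
proof (rule ccontr)
  assume "\<not> ?thesis"
  hence pos: "k * Re (g' t) * Im (g' t) > 0" by simp
  hence ne: "Re (g' t) \<noteq> 0" "Im (g' t) \<noteq> 0" by auto
  define \<epsilon> where "\<epsilon> = min \<bar>Re (g' t)\<bar> \<bar>Im (g' t)\<bar> / 2"
  have \<epsilon>: "\<epsilon> > 0" "\<epsilon> < \<bar>Re (g' t)\<bar>" "\<epsilon> < \<bar>Im (g' t)\<bar>" using ne by (auto simp: \<epsilon>_def)
  obtain \<tau> where \<tau>: "0 < \<tau>" "\<And>y. \<bar>y - t\<bar> \<le> \<tau> \<Longrightarrow> norm (g y - g t - (y - t) *\<^sub>R g' t) \<le> \<epsilon> * \<bar>y - t\<bar>"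
    using linear_approx[OF \<epsilon>(1), of t] by metis
  obtain R where R: "R > 0" "ball (g t) R \<subseteq> V" using V by (auto simp: mem_interior)
  have "isCont g t" using cont[of UNIV] by (simp add: continuous_on_eq_continuous_at)
  then obtain d where d: "d > 0" "\<And>y. dist y t < d \<Longrightarrow> dist (g y) (g t) < R"
    using R(1) unfolding continuous_at_eps_delta by metis
  define h where "h = min \<tau> (d / 2)"
  have h: "0 < h" "h \<le> \<tau>" "h < d" using \<tau> d by (auto simp: h_def)
  have inV: "g (t + h) \<in> V" "g t \<in> V"
    using d(2)[of "t + h"] R h by (auto simp: dist_norm norm_minus_commute subset_iff)
  define E where "E = g (t + h) - g t - h *\<^sub>R g' t"
  have E: "norm E \<le> \<epsilon> * h" using \<tau>(2)[of "t + h"] h by (simp add: E_def)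
  have Re: "Re (g (t + h)) - Re (g t) = h * Re (g' t) + Re E" and Im: "Im (g (t + h)) - Im (g t) = h * Im (g' t) + Im E"
    by (simp_all add: E_def)
  have eh: "\<epsilon> * h < \<bar>h * Re (g' t)\<bar>" "\<epsilon> * h < \<bar>h * Im (g' t)\<bar>"
    using \<epsilon> h mult_strict_right_mono[OF \<epsilon>(2) h(1)] mult_strict_right_mono[OF \<epsilon>(3) h(1)] by (simp_all add: abs_mult mult.commute)
  have small: "\<bar>Re E\<bar> < \<bar>h * Re (g' t)\<bar>" "\<bar>Im E\<bar> < \<bar>h * Im (g' t)\<bar>"
    using abs_Re_le_cmod[of E] abs_Im_le_cmod[of E] E eh by linarith+
  have sgn_Re: "Re (g (t + h)) > Re (g t) \<longleftrightarrow> Re (g' t) > 0" "Re (g (t + h)) < Re (g t) \<longleftrightarrow> Re (g' t) < 0"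
    using small(1) Re h zero_less_mult_iff[of h "Re (g' t)"] mult_less_0_iff[of h "Re (g' t)"] by linarith+
  have sgn_Im: "Im (g (t + h)) > Im (g t) \<longleftrightarrow> Im (g' t) > 0" "Im (g (t + h)) < Im (g t) \<longleftrightarrow> Im (g' t) < 0"
    using small(2) Im h zero_less_mult_iff[of h "Im (g' t)"] mult_less_0_iff[of h "Im (g' t)"] by linarith+
  have mem: "g (t + h) \<in> range g \<inter> V" "g t \<in> range g \<inter> V" using inV by auto
  show False
  proof (cases "Re (g' t) > 0")
    case True
    hence "k * Im (g (t + h)) \<le> k * Im (g t)" using sl mem sgn_Re(1) unfolding sloped_def by blast
    moreover have "k * Im (g' t) > 0" using pos True k by (auto simp: zero_less_mult_iff mult_less_0_iff)
    ultimately show False using k sgn_Im by auto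
  next
    case False
    hence neg: "Re (g' t) < 0" using ne by simp
    hence "k * Im (g t) \<le> k * Im (g (t + h))" using sl mem sgn_Re(2) unfolding sloped_def by blast
    moreover have "k * Im (g' t) < 0" using pos neg k by (auto simp: zero_less_mult_iff mult_less_0_iff)
    ultimately show False using k sgn_Im by auto
  qed
qed

text \<open>The signs \<open>p, q\<close> tell the quadrant of the tangent at \<open>g a\<close>; the inside lies in the direction \<open>(- p, - q)\<close>.\<close>
lemma quadrant_signs:
  assumes "sloped k V (range g)" "k = 1 \<or> k = -1" "g a \<in> interior V"
  obtains p q where "p = 1 \<or> p = -1" "q = 1 \<or> q = -1" "p * q = k" "0 \<le> p * Im (g' a)" "0 \<le> - q * Re (g' a)"
proof -
  have sl: "k * Re (g' a) * Im (g' a) \<le> 0" by (rule deriv_slope[OF assms])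
  show thesis
  proof (cases "Im (g' a) = 0")
    case True
    hence "Re (g' a) \<noteq> 0" using nz[of a] by (auto simp: complex_eq_iff)
    define q :: real where "q = (if Re (g' a) > 0 then -1 else 1)"
    show thesis by (rule that[of "k * q" q]) (use assms(2) True in \<open>auto simp: q_def\<close>)
  next
    case False
    define p :: real where "p = (if Im (g' a) > 0 then 1 else -1)"
    have "0 \<le> - (k * p) * Re (g' a)"
    proof (cases "Im (g' a) > 0")
      case True
      hence "k * Re (g' a) \<le> 0" using sl by (simp add: mult_le_0_iff)
      thus ?thesis using True by (simp add: p_def)
    next
      case f: False
      hence "k * Re (g' a) \<ge> 0" using sl False by (simp add: mult_le_0_iff)
      thus ?thesis using f by (simp add: p_def)
    qed
    thus thesis using that[of p "k * p"] assms(2) by (auto simp: p_def)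
  qed
qed

lemma strict_mono_from_deriv:
  fixes f f' :: "real \<Rightarrow> real"
  assumes d: "\<And>x. \<bar>x - a\<bar> \<le> \<tau> \<Longrightarrow> (f has_real_derivative f' x) (at x) \<and> 0 \<le> f' x" and t: "\<bar>t - a\<bar> \<le> \<tau>" "t \<noteq> a"
  shows "0 \<le> sgn (t - a) * (f t - f a)" "f' t \<noteq> 0 \<Longrightarrow> 0 < sgn (t - a) * (f t - f a)"
proof -
  have mono: "f x \<le> f y" if "a - \<tau> \<le> x" "x \<le> y" "y \<le> a + \<tau>" for x y
    using that(2)
  proof (rule DERIV_nonneg_imp_nondecreasing)
    fix z assume "x \<le> z" "z \<le> y"
    hence "\<bar>z - a\<bar> \<le> \<tau>" using that by (auto simp: abs_le_iff)
    thus "\<exists>y. DERIV f z :> y \<and> 0 \<le> y" using d by blast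
  qed
  have tb: "a - \<tau> \<le> t" "t \<le> a + \<tau>" "0 \<le> \<tau>" using t by auto
  show "0 \<le> sgn (t - a) * (f t - f a)"
    using mono[of t a] mono[of a t] tb t(2) by (cases "t < a") (auto simp: sgn_if)
  assume "f' t \<noteq> 0"
  hence pos: "0 < f' t" and dt: "(f has_real_derivative f' t) (at t)" using d[OF t(1)] by (simp_all add: less_le)
  show "0 < sgn (t - a) * (f t - f a)"
  proof (cases "t < a")
    case True
    obtain e where e: "e > 0" "\<And>h. h > 0 \<Longrightarrow> h < e \<Longrightarrow> f t < f (t + h)" using DERIV_pos_inc_right[OF dt pos] by blast
    define h where "h = min (e / 2) (a - t)"
    have h: "0 < h" "h < e" "t + h \<le> a" using e True by (auto simp: h_def)
    have "f t < f (t + h)" using e(2) h by blast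
    also have "\<dots> \<le> f a" using mono[of "t + h" a] h tb by simp
    finally show ?thesis using True by (simp add: sgn_if)
  next
    case False
    hence ta: "a < t" using t(2) by simp
    obtain e where e: "e > 0" "\<And>h. h > 0 \<Longrightarrow> h < e \<Longrightarrow> f (t - h) < f t" using DERIV_pos_inc_left[OF dt pos] by blast
    define h where "h = min (e / 2) (t - a)"
    have h: "0 < h" "h < e" "a \<le> t - h" using e ta by (auto simp: h_def)
    have "f a \<le> f (t - h)" using mono[of a "t - h"] h tb by simp
    also have "\<dots> < f t" using e(2) h by blast
    finally show ?thesis using ta by (simp add: sgn_if)
  qed
qed

text \<open>The tangent varies little, and by monotonicity of the curve it stays in the closed quadrant given
  by the signs. So both coordinates are monotone in the parameter, strictly at a parameter where the
  derivative does not vanish.\<close>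
lemma near_param:
  assumes sl: "sloped (p * q) V (range g)" and pq: "p = 1 \<or> p = -1" "q = 1 \<or> q = -1" and V: "g a \<in> interior V"
    and quad: "0 \<le> p * Im (g' a)" "0 \<le> - q * Re (g' a)"
  obtains \<tau> where "0 < \<tau>" "\<tau> < 1/2"
    "\<And>t. \<bar>t - a\<bar> \<le> \<tau> \<Longrightarrow> t \<noteq> a \<Longrightarrow>
      0 \<le> p * Im (g' t) \<and> 0 \<le> - q * Re (g' t) \<and>
      norm (g t - g a) / 2 * norm (g' t) \<le> sgn (t - a) * Re ((g t - g a) * cnj (g' t)) \<and>
      (Re (g' t) \<noteq> 0 \<longrightarrow> 0 < - sgn (t - a) * q * Re (g t - g a)) \<and>
      (Im (g' t) \<noteq> 0 \<longrightarrow> 0 < sgn (t - a) * p * Im (g t - g a))"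
proof -
  define c where "c = g' a"
  have c: "norm c > 0" using nz by (simp add: c_def)
  have "norm c / 10 > 0" using c by simp
  then obtain \<tau>1 where \<tau>1: "0 < \<tau>1" "\<tau>1 < 1/2"
    "\<And>t. \<bar>t - a\<bar> \<le> \<tau>1 \<Longrightarrow> norm (g t - g a - (t - a) *\<^sub>R c) \<le> norm c / 10 * \<bar>t - a\<bar>"
    "\<And>t. \<bar>t - a\<bar> \<le> \<tau>1 \<Longrightarrow> norm (g' t - c) \<le> norm c / 10"
    using linear_approx[of "norm c / 10" a] unfolding c_def by metis
  have "open (g -` interior V)" by (rule open_vimage[OF open_interior cont])
  moreover have "a \<in> g -` interior V" using V by simp
  ultimately obtain d where d: "d > 0" "ball a d \<subseteq> g -` interior V" by (rule openE)
  define \<tau> where "\<tau> = min \<tau>1 (d / 2)"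
  have \<tau>: "0 < \<tau>" "\<tau> < 1/2" "\<tau> \<le> \<tau>1" "\<tau> < d" using \<tau>1 d by (auto simp: \<tau>_def)
  have inV: "g t \<in> interior V" if "\<bar>t - a\<bar> \<le> \<tau>" for t
    using d(2) that \<tau>(4) by (force simp: dist_real_def subset_iff abs_minus_commute)
  have quad_t: "0 \<le> p * Im (g' t)" "0 \<le> - q * Re (g' t)" if t: "\<bar>t - a\<bar> \<le> \<tau>" for t
  proof -
    define x where "x = - q * Re (g' t)"
    define y where "y = p * Im (g' t)"
    have "(p * q) * Re (g' t) * Im (g' t) \<le> 0"
      by (rule deriv_slope[OF sl _ inV[OF t]]) (use pq in auto)
    hence xy: "0 \<le> x * y" by (simp add: x_def y_def algebra_simps)
    have "Re (g' t * cnj c) = (- q * Re c) * x + (p * Im c) * y"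
      using pq by (auto simp: x_def y_def)
    moreover have "Re (g' t * cnj c) > 0"
    proof -
      define R where "R = Re ((g' t - c) * cnj c)"
      have "Re (g' t * cnj c) = (norm c)\<^sup>2 + R" unfolding R_def
        by (simp add: cmod_power2) (simp add: power2_eq_square algebra_simps)
      moreover have "\<bar>R\<bar> \<le> norm c / 10 * norm c" unfolding R_def
        using abs_Re_le_cmod[of "(g' t - c) * cnj c"] mult_right_mono[OF \<tau>1(4)[of t], of "norm c"] t \<tau>(3) by (simp add: norm_mult)
      moreover have "0 < (norm c)\<^sup>2" "norm c / 10 * norm c = (norm c)\<^sup>2 / 10" using c by (simp_all add: power2_eq_square)
      ultimately show ?thesis by linarith
    qed
    ultimately have pos: "(- q * Re c) * x + (p * Im c) * y > 0" by simp
    have "\<not> (x \<le> 0 \<and> y \<le> 0)"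
    proof
      assume "x \<le> 0 \<and> y \<le> 0"
      hence "(- q * Re c) * x \<le> 0" "(p * Im c) * y \<le> 0"
        using mult_nonneg_nonpos[OF quad(2), of x] mult_nonneg_nonpos[OF quad(1), of y] by (simp_all add: c_def)
      thus False using pos by linarith
    qed
    hence "0 \<le> x \<and> 0 \<le> y" using xy by (auto simp: zero_le_mult_iff)
    thus "0 \<le> p * Im (g' t)" "0 \<le> - q * Re (g' t)" by (simp_all add: x_def y_def)
  qed
  have dRe: "((\<lambda>t. - q * Re (g t)) has_real_derivative - q * Re (g' t)) (at t)"
    and dIm: "((\<lambda>t. p * Im (g t)) has_real_derivative p * Im (g' t)) (at t)" for t
  proof -
    have d: "((\<lambda>t. Re (g t)) has_real_derivative Re (g' t)) (at t)" "((\<lambda>t. Im (g t)) has_real_derivative Im (g' t)) (at t)"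
      using bounded_linear.has_vector_derivative[OF bounded_linear_Re deriv[of t]]
        bounded_linear.has_vector_derivative[OF bounded_linear_Im deriv[of t]]
      by (simp_all add: has_real_derivative_iff_has_vector_derivative)
    from DERIV_cmult[OF d(1), of "- q"] DERIV_cmult[OF d(2), of p]
    show "((\<lambda>t. - q * Re (g t)) has_real_derivative - q * Re (g' t)) (at t)"
      "((\<lambda>t. p * Im (g t)) has_real_derivative p * Im (g' t)) (at t)"
      .
  qed
  have radial: "norm (g t - g a) / 2 * norm (g' t) \<le> sgn (t - a) * Re ((g t - g a) * cnj (g' t))"
    if t: "\<bar>t - a\<bar> \<le> \<tau>" "t \<noteq> a" for t
  proof -
    define y where "y = t - a"
    define Y where "Y = \<bar>y\<bar> * norm c"
    define E where "E = g t - g a - y *\<^sub>R c"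
    define E' where "E' = g' t - c"
    have E: "norm E \<le> Y / 10" "norm E' \<le> norm c / 10"
      using \<tau>1(3)[of t] \<tau>1(4)[of t] t \<tau>(3) by (simp_all add: E_def E'_def y_def Y_def mult.commute)
    have x: "g t - g a = y *\<^sub>R c + E" and g't: "g' t = c + E'" by (simp_all add: E_def E'_def)
    have nyc: "norm (y *\<^sub>R c) = Y" by (simp add: Y_def)
    have "norm (g t - g a) \<le> 11/10 * Y" using norm_triangle_ineq[of "y *\<^sub>R c" E] E(1) nyc unfolding x by simp
    moreover have "norm (g' t) \<le> 11/10 * norm c" using norm_triangle_ineq[of c E'] E(2) unfolding g't by simp
    ultimately have "norm (g t - g a) * norm (g' t) \<le> (11/10 * Y) * (11/10 * norm c)"
      by (intro mult_mono) (auto simp: Y_def)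
    hence up: "norm (g t - g a) / 2 * norm (g' t) \<le> 605/1000 * (Y * norm c)" by linarith
    have "(g t - g a) * cnj (g' t) = y *\<^sub>R (c * cnj c) + ((y *\<^sub>R c) * cnj E' + E * cnj c + E * cnj E')"
      unfolding x g't by (simp add: algebra_simps)
    moreover have "Re (y *\<^sub>R (c * cnj c)) = y * (norm c)\<^sup>2" by (simp add: complex_mult_cnj cmod_power2)
    ultimately have "Re ((g t - g a) * cnj (g' t)) = y * (norm c)\<^sup>2 + Re ((y *\<^sub>R c) * cnj E' + E * cnj c + E * cnj E')" by simp
    moreover have "\<bar>Re ((y *\<^sub>R c) * cnj E' + E * cnj c + E * cnj E')\<bar> \<le> 21/100 * (Y * norm c)"
    proof -
      have "norm ((y *\<^sub>R c) * cnj E') \<le> Y * (norm c / 10)" "norm (E * cnj c) \<le> Y / 10 * norm c" "norm (E * cnj E') \<le> Y / 10 * (norm c / 10)"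
        unfolding norm_mult complex_mod_cnj nyc
        by (intro mult_left_mono mult_right_mono mult_mono E; simp add: Y_def)+
      moreover have "norm ((y *\<^sub>R c) * cnj E' + E * cnj c + E * cnj E') \<le> norm ((y *\<^sub>R c) * cnj E') + norm (E * cnj c) + norm (E * cnj E')"
        by (meson norm_triangle_ineq order_trans add_right_mono)
      ultimately show ?thesis using abs_Re_le_cmod[of "(y *\<^sub>R c) * cnj E' + E * cnj c + E * cnj E'"] by simp
    qed
    moreover have "sgn y * (y * (norm c)\<^sup>2) = Y * norm c"
      by (simp add: Y_def power2_eq_square sgn_if)
    moreover have "\<bar>sgn y * Re ((y *\<^sub>R c) * cnj E' + E * cnj c + E * cnj E')\<bar> = \<bar>Re ((y *\<^sub>R c) * cnj E' + E * cnj c + E * cnj E')\<bar>" using t(2) unfolding abs_mult by (simp add: y_def abs_sgn_eq)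
    moreover have "0 \<le> Y * norm c" by (simp add: Y_def)
    ultimately have "sgn y * Re ((g t - g a) * cnj (g' t)) \<ge> 79/100 * (Y * norm c)"
      by (simp only: distrib_left)
    thus ?thesis using up \<open>0 \<le> Y * norm c\<close> unfolding y_def by linarith
  qed
  show thesis
  proof (rule that[OF \<tau>(1,2)], intro conjI impI)
    fix t assume t: "\<bar>t - a\<bar> \<le> \<tau>" "t \<noteq> a"
    show "0 \<le> p * Im (g' t)" "0 \<le> - q * Re (g' t)" by (fact quad_t[OF t(1)])+
    show "norm (g t - g a) / 2 * norm (g' t) \<le> sgn (t - a) * Re ((g t - g a) * cnj (g' t))" by (rule radial[OF t])
    show "0 < - sgn (t - a) * q * Re (g t - g a)" if "Re (g' t) \<noteq> 0"
    proof -
      have "- q * Re (g' t) \<noteq> 0" using that pq by auto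
      from strict_mono_from_deriv(2)[of a \<tau> "\<lambda>t. - q * Re (g t)" "\<lambda>t. - q * Re (g' t)" t, OF _ t this]
      have "0 < sgn (t - a) * (- q * Re (g t) - - q * Re (g a))" using dRe quad_t by blast
      thus ?thesis by (simp add: algebra_simps)
    qed
    show "0 < sgn (t - a) * p * Im (g t - g a)" if "Im (g' t) \<noteq> 0"
    proof -
      have "p * Im (g' t) \<noteq> 0" using that pq by auto
      from strict_mono_from_deriv(2)[of a \<tau> "\<lambda>t. p * Im (g t)" "\<lambda>t. p * Im (g' t)" t, OF _ t this]
      have "0 < sgn (t - a) * (p * Im (g t) - p * Im (g a))" using dIm quad_t by blast
      thus ?thesis by (simp add: algebra_simps)
    qed
  qed
qed

text \<open>For small radii, the two points on the circle are those at which the curve first leaves the disc.\<close>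
lemma arc_ends_near:
  assumes "0 < \<tau>" "\<tau> < 1/2"
  obtains r0 where "r0 > 0" "\<And>r t0 t1. 0 < r \<Longrightarrow> r < r0 \<Longrightarrow> arc_ends g a r t0 t1 \<Longrightarrow>
    a - \<tau> < t0 \<and> t1 < a + \<tau> \<and> norm (g t0 - g a) = r \<and> norm (g t1 - g a) = r \<and> g t0 \<noteq> g t1"
proof -
  obtain m where m: "m > 0" "\<And>t. a + \<tau> \<le> t \<Longrightarrow> t \<le> a + 1 - \<tau> \<Longrightarrow> m \<le> norm (g t - g a)"
    "\<And>t. a - 1 + \<tau> \<le> t \<Longrightarrow> t \<le> a - \<tau> \<Longrightarrow> m \<le> norm (g t - g a)"
    using away[of \<tau> a] assms by (metis less_imp_le)
  have neq: "g t \<noteq> g t'" if "0 < t' - t" "t' - t < 1" for t t'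
  proof
    assume "g t = g t'"
    then obtain n :: int where "t' = t + of_int n" using g_eq_imp by blast
    thus False using that by simp
  qed
  have "a - \<tau> < t0 \<and> t1 < a + \<tau> \<and> norm (g t0 - g a) = r \<and> norm (g t1 - g a) = r \<and> g t0 \<noteq> g t1"
    if r: "0 < r" "r < m" and arc: "arc_ends g a r t0 t1" for r t0 t1
  proof -
    have t: "t0 < a" "a < t1" "t1 < t0 + 1" and sph: "sphere (g a) r \<inter> range g = {g t0, g t1}"
      using arc by (simp_all add: arc_ends_def)
    have n: "norm (g t0 - g a) = r" "norm (g t1 - g a) = r"
    proof -
      have "g t0 \<in> sphere (g a) r" "g t1 \<in> sphere (g a) r" using sph by blast+
      thus "norm (g t0 - g a) = r" "norm (g t1 - g a) = r" by (simp_all add: dist_norm norm_minus_commute)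
    qed
    have only: "g t = g t0 \<or> g t = g t1" if "norm (g t - g a) = r" for t
    proof -
      have "g t \<in> sphere (g a) r \<inter> range g" using that by (simp add: dist_norm norm_minus_commute)
      thus ?thesis unfolding sph by simp
    qed
    have cn: "continuous_on S (\<lambda>t. norm (g t - g a))" for S by (intro continuous_intros cont)
    have c0: "a - \<tau> < t0 \<or> t0 < a - 1 + \<tau>" using m(3)[of t0] n(1) r(2) by force
    have c1: "t1 < a + \<tau> \<or> a + 1 - \<tau> < t1" using m(2)[of t1] n(2) r(2) by force
    have "a - \<tau> < t0"
    proof (rule ccontr)
      assume "\<not> ?thesis"
      hence t0: "t0 < a - 1 + \<tau>" using c0 by simp
      have "\<exists>t\<ge>a - \<tau>. t \<le> a \<and> norm (g t - g a) = r"
        by (rule IVT2'[OF _ _ _ cn]) (use m(3)[of "a - \<tau>"] r assms in auto)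
      then obtain t where tt: "a - \<tau> \<le> t" "t \<le> a" "norm (g t - g a) = r" by blast
      have "g t0 \<noteq> g t" by (rule neq) (use tt t0 t assms in linarith)+
      moreover have "g t \<noteq> g t1" by (rule neq) (use tt t0 t assms in linarith)+
      ultimately show False using only[OF tt(3)] by simp
    qed
    moreover have "t1 < a + \<tau>"
    proof (rule ccontr)
      assume "\<not> ?thesis"
      hence t1: "a + 1 - \<tau> < t1" using c1 by simp
      have "\<exists>t\<ge>a. t \<le> a + \<tau> \<and> norm (g t - g a) = r"
        by (rule IVT'[OF _ _ _ cn]) (use m(2)[of "a + \<tau>"] r assms in auto)
      then obtain t where tt: "a \<le> t" "t \<le> a + \<tau>" "norm (g t - g a) = r" by blast
      have "g t0 \<noteq> g t" by (rule neq) (use tt t1 t assms in linarith)+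
      moreover have "g t \<noteq> g t1" by (rule neq) (use tt t1 t assms in linarith)+
      ultimately show False using only[OF tt(3)] by simp
    qed
    moreover have "g t0 \<noteq> g t1" by (rule neq) (use t in linarith)+
    ultimately show ?thesis using n by simp
  qed
  thus thesis using that[OF m(1)] by blast
qed

text \<open>The direction \<open>(- p, - q)\<close> makes an angle of at most 45 degrees with the left normal.\<close>
lemma inside_direction:
  assumes pq: "p = 1 \<or> p = -1" "q = 1 \<or> q = -1" and quad: "0 \<le> p * Im (g' a)" "0 \<le> - q * Re (g' a)"
  obtains \<eta>0 where "\<eta>0 > 0" "\<And>\<eta>. 0 < \<eta> \<Longrightarrow> \<eta> < \<eta>0 \<Longrightarrow> g a - \<eta> *\<^sub>R Complex p q \<in> inside (range g)"
proof -
  obtain \<rho> where \<rho>: "\<rho> > 0"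
    "\<And>v. norm v < \<rho> \<Longrightarrow> Im (v * cnj (g' a)) > 1/3 * norm v * norm (g' a) \<Longrightarrow> g a + v \<in> inside (range g)"
    using local_sides[of "1/3" a] by (metis zero_less_divide_1_iff zero_less_numeral)
  have "g a - \<eta> *\<^sub>R Complex p q \<in> inside (range g)" if \<eta>: "0 < \<eta>" "\<eta> < \<rho> / 2" for \<eta>
  proof -
    define v where "v = - (\<eta> *\<^sub>R Complex p q)"
    have "norm (Complex p q) \<le> 2"
      using norm_complex_def[of "Complex p q"] pq by (auto simp: complex_norm intro!: real_le_lsqrt)
    hence nv: "norm v \<le> 2 * \<eta>" using \<eta> mult_left_mono[of "norm (Complex p q)" 2 \<eta>] by (simp add: v_def)
    have "Im (v * cnj (g' a)) = \<eta> * (p * Im (g' a) + - q * Re (g' a))" by (simp add: v_def algebra_simps)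
    also have "p * Im (g' a) + - q * Re (g' a) = \<bar>Re (g' a)\<bar> + \<bar>Im (g' a)\<bar>" using pq quad by auto
    finally have "Im (v * cnj (g' a)) \<ge> \<eta> * norm (g' a)" using cmod_le[of "g' a"] \<eta> by simp
    moreover have "1/3 * norm v * norm (g' a) < \<eta> * norm (g' a)"
      using nv \<eta> nz[of a] by (intro mult_strict_right_mono) auto
    ultimately have "g a + v \<in> inside (range g)" using nv \<eta> by (intro \<rho>(2)) auto
    thus ?thesis by (simp add: v_def)
  qed
  thus thesis using that[of "\<rho> / 2"] \<rho>(1) by simp
qed

end

section \<open>Orientation of the interface\<close>

lemma hausdorff_distD:
  assumes "hausdorff_dist A B < ennreal \<epsilon>"
  shows "a \<in> A \<Longrightarrow> \<exists>b\<in>B. dist a b < \<epsilon>" "b \<in> B \<Longrightarrow> \<exists>a\<in>A. dist b a < \<epsilon>"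
proof -
  have *: "\<exists>y\<in>Y. dist x y < \<epsilon>" if "(SUP x\<in>X. INF y\<in>Y. ennreal (dist x y)) < ennreal \<epsilon>" "x \<in> X" for X Y :: "complex set" and x
  proof -
    have "(INF y\<in>Y. ennreal (dist x y)) \<le> (SUP x\<in>X. INF y\<in>Y. ennreal (dist x y))"
      using that(2) by (rule SUP_upper)
    hence "(INF y\<in>Y. ennreal (dist x y)) < ennreal \<epsilon>" using that(1) by (rule le_less_trans)
    then obtain y where "y \<in> Y" "ennreal (dist x y) < ennreal \<epsilon>" by (auto simp: INF_less_iff)
    thus ?thesis by (auto simp: ennreal_less_iff)
  qed
  have "(SUP a\<in>A. INF b\<in>B. ennreal (dist a b)) < ennreal \<epsilon>" "(SUP b\<in>B. INF a\<in>A. ennreal (dist b a)) < ennreal \<epsilon>"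
    using assms by (simp_all add: hausdorff_dist_def)
  thus "a \<in> A \<Longrightarrow> \<exists>b\<in>B. dist a b < \<epsilon>" "b \<in> B \<Longrightarrow> \<exists>a\<in>A. dist b a < \<epsilon>"
    using * by blast+
qed

lemma site_of_eqI:
  assumes "N \<ge> 1" "\<bar>Re u - Re (site N x)\<bar> < 1 / (2 * real N)" "\<bar>Im u - Im (site N x)\<bar> < 1 / (2 * real N)"
  shows "site_of N u = x"
proof -
  have "u \<in> cell N x" using assms(2,3) unfolding cell_def by (auto simp: abs_less_iff)
  thus ?thesis using mem_cell_iff[OF assms(1)] by simp
qed

lemma site_of_near:
  assumes "N \<ge> 1"
  shows "\<bar>Re u - Re (site N (site_of N u))\<bar> \<le> 1 / (2 * real N)" "\<bar>Im u - Im (site N (site_of N u))\<bar> \<le> 1 / (2 * real N)"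
proof -
  have "u \<in> cell N (site_of N u)" using mem_cell_iff[OF assms] by simp
  thus "\<bar>Re u - Re (site N (site_of N u))\<bar> \<le> 1 / (2 * real N)" "\<bar>Im u - Im (site N (site_of N u))\<bar> \<le> 1 / (2 * real N)"
    unfolding cell_def by (auto simp: abs_le_iff)
qed

lemma frontier_between_cells:
  assumes N: "N \<ge> 1" and ne: "\<sigma> x \<noteq> \<sigma> y"
    and near: "\<And>t. 0 < t \<Longrightarrow> t < 1 / (2 * real N) \<Longrightarrow> site_of N (e + t *\<^sub>R d) = y \<and> site_of N (e - t *\<^sub>R d) = x"
    and d: "norm d \<le> 1"
  shows "e \<in> frontier (droplet N \<sigma>)"
  unfolding frontier_straddle
proof (intro allI impI)
  fix \<epsilon> :: real assume \<epsilon>: "\<epsilon> > 0"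
  define t where "t = min (\<epsilon> / 2) (1 / (4 * real N))"
  have "0 < 1 / (4 * real N)" "1 / (4 * real N) < 1 / (2 * real N)" using N by (simp_all add: field_simps)
  hence t: "0 < t" "t < 1 / (2 * real N)" "t < \<epsilon>" using \<epsilon> by (auto simp: t_def min_def)
  have "t * norm d \<le> t * 1" using d t by (intro mult_left_mono) auto
  hence "t * norm d < \<epsilon>" using t(3) by linarith
  hence "\<bar>t\<bar> * norm d < \<epsilon>" using t(1) by simp
  hence dist: "dist e (e + t *\<^sub>R d) < \<epsilon>" "dist e (e - t *\<^sub>R d) < \<epsilon>" by (simp_all add: dist_norm)
  have s: "site_of N (e + t *\<^sub>R d) = y" "site_of N (e - t *\<^sub>R d) = x" using near[OF t(1,2)] by simp_all
  show "(\<exists>z\<in>droplet N \<sigma>. dist e z < \<epsilon>) \<and> (\<exists>z. z \<notin> droplet N \<sigma> \<and> dist e z < \<epsilon>)"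
  proof (cases "\<sigma> x")
    case True
    hence "e - t *\<^sub>R d \<in> droplet N \<sigma>" "e + t *\<^sub>R d \<notin> droplet N \<sigma>" using ne s by (simp_all add: droplet_eq[OF N])
    thus ?thesis using dist by blast
  next
    case False
    hence "e + t *\<^sub>R d \<in> droplet N \<sigma>" "e - t *\<^sub>R d \<notin> droplet N \<sigma>" using ne s by (simp_all add: droplet_eq[OF N])
    thus ?thesis using dist by blast
  qed
qed

text \<open>The open edge between two cells of opposite spins belongs to the frontier.\<close>
lemma vertical_frontier:
  fixes p :: int
  assumes N: "N \<ge> 1" and p: "p = 1 \<or> p = -1" and ne: "\<sigma> x \<noteq> \<sigma> (x + (p, 0))"
    and e: "Re e = Re (site N x) + real_of_int p / (2 * real N)" "\<bar>Im e - Im (site N x)\<bar> < 1 / (2 * real N)"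
  shows "e \<in> frontier (droplet N \<sigma>)"
proof (rule frontier_between_cells[OF N ne, where d = "of_int p"])
  fix t assume t: "0 < t" "t < 1 / (2 * real N)"
  have s: "Re (site N (x + (p, 0))) = Re (site N x) + real_of_int p / real N" "Im (site N (x + (p, 0))) = Im (site N x)"
    by (simp_all add: add_divide_distrib)
  have half: "real_of_int p / real N = 2 * (real_of_int p / (2 * real N))" by simp
  have "0 < 1 / (2 * real N)" using N by simp
  moreover have "real_of_int p / (2 * real N) = (if p = 1 then 1 / (2 * real N) else - (1 / (2 * real N)))" using p by auto
  moreover have "Re (t *\<^sub>R of_int p :: complex) = (if p = 1 then t else - t)" "Im (t *\<^sub>R of_int p :: complex) = 0" using p by auto
  ultimately show "site_of N (e + t *\<^sub>R of_int p) = x + (p, 0) \<and> site_of N (e - t *\<^sub>R of_int p) = x"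
    by (intro conjI site_of_eqI[OF N]; unfold s half plus_complex.sel minus_complex.sel e(1))
       (use e(2) t in \<open>auto simp: abs_less_iff split: if_splits\<close>)
qed (use p in auto)

lemma horizontal_frontier:
  fixes p :: int
  assumes N: "N \<ge> 1" and p: "p = 1 \<or> p = -1" and ne: "\<sigma> x \<noteq> \<sigma> (x + (0, p))"
    and e: "Im e = Im (site N x) + real_of_int p / (2 * real N)" "\<bar>Re e - Re (site N x)\<bar> < 1 / (2 * real N)"
  shows "e \<in> frontier (droplet N \<sigma>)"
proof (rule frontier_between_cells[OF N ne, where d = "\<i> * of_int p"])
  fix t assume t: "0 < t" "t < 1 / (2 * real N)"
  have s: "Im (site N (x + (0, p))) = Im (site N x) + real_of_int p / real N" "Re (site N (x + (0, p))) = Re (site N x)"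
    by (simp_all add: add_divide_distrib)
  have half: "real_of_int p / real N = 2 * (real_of_int p / (2 * real N))" by simp
  have "0 < 1 / (2 * real N)" using N by simp
  moreover have "real_of_int p / (2 * real N) = (if p = 1 then 1 / (2 * real N) else - (1 / (2 * real N)))" using p by auto
  moreover have "Im (t *\<^sub>R (\<i> * of_int p) :: complex) = (if p = 1 then t else - t)" "Re (t *\<^sub>R (\<i> * of_int p) :: complex) = 0" using p by auto
  ultimately show "site_of N (e + t *\<^sub>R (\<i> * of_int p)) = x + (0, p) \<and> site_of N (e - t *\<^sub>R (\<i> * of_int p)) = x"
    by (intro conjI site_of_eqI[OF N]; unfold s half plus_complex.sel minus_complex.sel e(1))
       (use e(2) t in \<open>auto simp: abs_less_iff split: if_splits\<close>)
qed (use p in \<open>auto simp: norm_mult\<close>)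

text \<open>Reflections reduce the four orientations of the droplet to one.\<close>
definition reflect :: "int \<Rightarrow> int \<Rightarrow> int \<times> int \<Rightarrow> int \<times> int" where
  "reflect p q x = (p * fst x, q * snd x)"

definition mirrored :: "int \<Rightarrow> int \<Rightarrow> complex \<Rightarrow> complex" where
  "mirrored p q z = Complex (p * Re z) (q * Im z)"

text \<open>A cell around the origin, up to its boundary; the closed box is invariant under reflections.\<close>
definition half_box :: "nat \<Rightarrow> complex set" where
  "half_box N = cbox (Complex (- 1 / (2 * real N)) (- 1 / (2 * real N))) (Complex (1 / (2 * real N)) (1 / (2 * real N)))"

locale signs =
  fixes p q :: int
  assumes p: "p = 1 \<or> p = -1" and q: "q = 1 \<or> q = -1"
begin

lemma pp: "p * p = 1" "q * q = 1" "real_of_int p * real_of_int p = 1" "real_of_int q * real_of_int q = 1"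
  using p q by auto

lemma reflect_reflect [simp]: "reflect p q (reflect p q x) = x"
  using p q by (cases x) (auto simp: reflect_def)

lemma mirrored_mirrored [simp]: "mirrored p q (mirrored p q z) = z"
  using p q by (auto simp: mirrored_def complex_eq_iff)

lemma site_reflect: "site N (reflect p q x) = mirrored p q (site N x)"
  by (simp add: mirrored_def reflect_def complex_eq_iff)

lemma mirrored_diff: "mirrored p q z - mirrored p q z' = mirrored p q (z - z')"
  by (simp add: mirrored_def complex_eq_iff algebra_simps)

lemma norm_mirrored [simp]: "norm (mirrored p q z) = norm z"
  using p q by (auto simp: mirrored_def cmod_def)

lemma norm_site_mirrored: "norm (site N x - mirrored p q z) = norm (site N (reflect p q x) - z)"
  by (metis site_reflect mirrored_diff mirrored_mirrored norm_mirrored)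

lemma reflect_add: "reflect p q (x + y) = reflect p q x + reflect p q y"
  by (simp add: reflect_def algebra_simps)

lemma bij_reflect: "bij (reflect p q)"
  by (rule o_bij[of "reflect p q"]) (auto simp: fun_eq_iff)

lemma opposite_reflect: "opposite (\<sigma> \<circ> reflect p q) x = opposite \<sigma> (reflect p q x)"
proof -
  have r: "reflect p q (x + (1,0)) = reflect p q x + (p, 0)" "reflect p q (x - (1,0)) = reflect p q x - (p, 0)"
    "reflect p q (x + (0,1)) = reflect p q x + (0, q)" "reflect p q (x - (0,1)) = reflect p q x - (0, q)"
    by (simp_all add: reflect_def algebra_simps)
  have m: "y + (- 1, 0) = y - (1, 0)" "y - (- 1, 0) = y + (1, 0)" "y + (0, - 1) = y - (0, 1)" "y - (0, - 1) = y + (0, 1)" for y :: "int \<times> int"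
    by (simp_all add: prod_eq_iff)
  show ?thesis
    using p q unfolding opposite_explicit o_apply r by (elim disjE; simp only: m; linarith?)
qed

lemma spin_drift_reflect: "spin_drift (\<sigma> \<circ> reflect p q) x = spin_drift \<sigma> (reflect p q x)"
  by (simp add: spin_drift_def rate_def opposite_reflect)

lemma infdist_cell_reflect:
  assumes N: "N \<ge> 1"
  defines "Q \<equiv> half_box N"
  shows "infdist (mirrored p q z) (cell N (reflect p q x)) = infdist (site N x - z) Q"
proof -
  define h where "h = 1 / (2 * real N)"
  have h: "h > 0" using N by (simp add: h_def)
  define y where "y = reflect p q x"
  define l where "l = site N y - Complex h h"
  define u where "u = site N y + Complex h h"
  have B: "Basis = {1, \<i>}" by (simp add: Basis_complex_def)
  have sub: "box l u \<subseteq> cell N y" "cell N y \<subseteq> cbox l u"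
    unfolding cell_def l_def u_def h_def by (auto simp: box_def cbox_def B inner_complex_def)
  have "box l u \<noteq> {}" using h by (auto simp: box_ne_empty l_def u_def B inner_complex_def)
  hence "closure (box l u) = cbox l u" by (rule closure_box)
  hence "closure (cell N y) = cbox l u"
    using closure_mono[OF sub(1)] closure_minimal[OF sub(2) closed_cbox] by simp
  hence "infdist (mirrored p q z) (cell N y) = infdist (mirrored p q z) (cbox l u)"
    unfolding infdist_eq_setdist using setdist_closure_2[of "{mirrored p q z}" "cell N y"] by simp
  also have "cbox l u = (\<lambda>w. mirrored p q (site N x - w)) ` Q"
  proof
    have mem: "w \<in> Q \<longleftrightarrow> \<bar>Re w\<bar> \<le> h \<and> \<bar>Im w\<bar> \<le> h" for w
      by (auto simp: Q_def half_box_def h_def cbox_def B inner_complex_def abs_le_iff)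
    have mem': "w \<in> cbox l u \<longleftrightarrow> \<bar>Re w - Re (site N y)\<bar> \<le> h \<and> \<bar>Im w - Im (site N y)\<bar> \<le> h" for w
      by (auto simp: l_def u_def cbox_def B inner_complex_def abs_le_iff)
    have m: "mirrored p q (site N x - w) \<in> cbox l u \<longleftrightarrow> w \<in> Q" for w
      unfolding mem mem' y_def site_reflect using p q by (auto simp: mirrored_def abs_minus_commute)
    show "(\<lambda>w. mirrored p q (site N x - w)) ` Q \<subseteq> cbox l u" using m by blast
    show "cbox l u \<subseteq> (\<lambda>w. mirrored p q (site N x - w)) ` Q"
    proof
      fix v assume "v \<in> cbox l u"
      hence "site N x - mirrored p q v \<in> Q" using m[of "site N x - mirrored p q v"] by simp
      thus "v \<in> (\<lambda>w. mirrored p q (site N x - w)) ` Q" by (rule rev_image_eqI) simp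
    qed
  qed
  also have "infdist (mirrored p q z) \<dots> = infdist (site N x - z) Q"
  proof -
    have "dist (mirrored p q z) (mirrored p q (site N x - w)) = dist (site N x - z) w" for w
      unfolding dist_norm mirrored_diff norm_mirrored by (simp add: norm_minus_commute algebra_simps)
    moreover have "Q \<noteq> {}"
    proof -
      have "0 \<in> Q" by (simp add: Q_def half_box_def cbox_def B inner_complex_def)
      thus ?thesis by blast
    qed
    ultimately show ?thesis by (simp add: infdist_notempty image_image)
  qed
  finally show ?thesis by (simp add: y_def)
qed

text \<open>The inside of the curve is in the direction \<open>(- p, - q)\<close>, and there are plus spins close to the
  point \<open>s - \<eta> *\<^sub>R Complex p q\<close> of \<open>\<Omega>\<close>. If a minus spin is followed by a plus spin in the direction
  \<open>p\<close> or \<open>q\<close>, the edge between them is in the frontier. The quadrant behind the minus spin contains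
  this minus spin and some plus spin, hence by connectedness a point of the frontier. The two points
  are ordered against the monotonicity.\<close>
lemma descends_reflect:
  assumes N: "N \<ge> 1" and V: "ball s R \<subseteq> V" and sl: "sloped (real_of_int (p * q)) V (frontier (droplet N \<sigma>))"
    and dense: "\<And>b. b \<in> \<Omega> \<inter> V \<Longrightarrow> \<exists>a\<in>droplet N \<sigma> \<inter> V. dist b a < \<epsilon>"
    and z: "s - \<eta> *\<^sub>R Complex p q \<in> \<Omega>" and \<eta>: "0 < \<eta>" "2 * \<eta> \<le> R" "1 / real N \<le> \<eta> / 4" "\<epsilon> \<le> \<eta> / 4"
    and x: "norm (site N x - mirrored p q s) \<le> \<eta> / 4"
  shows "descends (\<sigma> \<circ> reflect p q) x"
proof -
  define y where "y = reflect p q x"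
  define h where "h = 1 / (2 * real N)"
  have h: "0 < h" "2 * h \<le> \<eta> / 4" using N \<eta> by (simp_all add: h_def)
  have y: "norm (site N y - s) \<le> \<eta> / 4" using x by (simp add: norm_site_mirrored y_def)
  have abs_p: "\<bar>real_of_int p * v\<bar> = \<bar>v\<bar>" "\<bar>real_of_int q * v\<bar> = \<bar>v\<bar>" for v using p q by auto
  have comp: "\<bar>p * Re v\<bar> \<le> norm v" "\<bar>q * Im v\<bar> \<le> norm v" for v
    unfolding abs_p using abs_Re_le_cmod abs_Im_le_cmod by auto
  have "(norm (Complex p q))\<^sup>2 \<le> (3/2)\<^sup>2" unfolding cmod_power2 using p q by (auto simp: power2_eq_square)
  hence npq: "norm (Complex p q) \<le> 3/2" by (rule power2_le_imp_le) simp
  have behind: "\<exists>f\<in>frontier (droplet N \<sigma>). f \<in> V \<and> p * Re f < X \<and> q * Im f < Y"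
    if minus: "\<not> \<sigma> y" and XY: "p * Re (site N y) < X" "q * Im (site N y) < Y" for X Y
  proof -
    define D where "D = ball s R \<inter> {z. p * Re z < X} \<inter> {z. q * Im z < Y}"
    have "convex {z. p * Re z < X}" "convex {z. q * Im z < Y}"
      using convex_halfspace_lt[of "Complex p 0" X] convex_halfspace_lt[of "Complex 0 q" Y] by (simp_all add: inner_complex_def)
    hence "convex D" unfolding D_def by (intro convex_Int convex_ball)
    hence con: "connected D" by (rule convex_connected)
    have "site N y \<in> D" using y \<eta> XY by (simp add: D_def dist_norm norm_minus_commute)
    moreover have "site N y \<notin> droplet N \<sigma>" using minus by (simp add: droplet_eq[OF N] site_of_site[OF N])
    ultimately have ne1: "D - droplet N \<sigma> \<noteq> {}" by blast
    have nz: "norm (\<eta> *\<^sub>R Complex p q) \<le> 3/2 * \<eta>" using mult_left_mono[OF npq, of \<eta>] \<eta>(1) by simp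
    hence "norm (\<eta> *\<^sub>R Complex p q) < R" using \<eta>(1,2) by linarith
    hence "s - \<eta> *\<^sub>R Complex p q \<in> ball s R" unfolding mem_ball dist_norm by simp
    hence "s - \<eta> *\<^sub>R Complex p q \<in> \<Omega> \<inter> V" using z V by blast
    then obtain a where a: "a \<in> droplet N \<sigma>" "dist (s - \<eta> *\<^sub>R Complex p q) a < \<epsilon>" using dense by blast
    define d where "d = a - (s - \<eta> *\<^sub>R Complex p q)"
    have d: "norm d < \<eta> / 4" using a(2) \<eta>(4) by (simp add: d_def dist_norm norm_minus_commute)
    have ad: "a = s - \<eta> *\<^sub>R Complex p q + d" by (simp add: d_def)
    define v where "v = site N y - s"
    have sv: "site N y = s + v" and v: "norm v \<le> \<eta> / 4" using y by (simp_all add: v_def)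
    have "p * Re a = p * Re s - \<eta> + p * Re d" "q * Im a = q * Im s - \<eta> + q * Im d"
      unfolding ad using pp(3,4) by (simp_all add: algebra_simps)
    moreover have "p * Re (site N y) = p * Re s + p * Re v" "q * Im (site N y) = q * Im s + q * Im v"
      unfolding sv by (simp_all add: algebra_simps)
    ultimately have "p * Re a < p * Re (site N y)" "q * Im a < q * Im (site N y)"
      using comp[of d] comp[of v] d v \<eta>(1) by linarith+
    moreover have "a \<in> ball s R"
    proof -
      have "dist s a = norm (\<eta> *\<^sub>R Complex p q - d)" unfolding ad by (simp add: dist_norm)
      also have "\<dots> \<le> norm (\<eta> *\<^sub>R Complex p q) + norm d" by (rule norm_triangle_ineq4)
      finally have "dist s a < 2 * \<eta>" using nz d \<eta>(1) by linarith
      thus ?thesis using \<eta>(2) by simp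
    qed
    ultimately have "a \<in> D" using XY by (simp add: D_def)
    hence "D \<inter> droplet N \<sigma> \<noteq> {}" using a(1) by blast
    from connected_Int_frontier[OF con this ne1] obtain f where "f \<in> D" "f \<in> frontier (droplet N \<sigma>)" by blast
    thus ?thesis using V unfolding D_def by blast
  qed
  have site_V: "e \<in> V" if "\<bar>Re e - Re (site N y)\<bar> \<le> h" "\<bar>Im e - Im (site N y)\<bar> \<le> h" for e
  proof -
    have "norm (e - site N y) \<le> 2 * h" using cmod_le[of "e - site N y"] that by simp
    hence "norm (e - s) \<le> 2 * h + \<eta> / 4" using norm_triangle_ineq[of "e - site N y" "site N y - s"] y by simp
    hence "e \<in> ball s R" using h \<eta> by (simp add: dist_norm norm_minus_commute)
    thus ?thesis using V by blast
  qed
  have between: "\<exists>t. a < t \<and> t < b + h \<and> b - h < t" if "a < b + h" for a b :: real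
    by (rule exI[of _ "(max a (b - h) + (b + h)) / 2"]) (use that h in \<open>auto simp: max_def field_simps\<close>)
  have row: "\<sigma> y" if plus: "\<sigma> (y + (p, 0))"
  proof (rule ccontr)
    assume minus: "\<not> \<sigma> y"
    obtain f where f: "f \<in> frontier (droplet N \<sigma>)" "f \<in> V" "p * Re f < p * Re (site N y) + h" "q * Im f < q * Im (site N y) + h"
      using behind[OF minus, of "p * Re (site N y) + h" "q * Im (site N y) + h"] h by auto
    obtain t where t: "q * Im f < t" "t < q * Im (site N y) + h" "q * Im (site N y) - h < t" using between[OF f(4)] by blast
    define e where "e = Complex (Re (site N y) + p * h) (q * t)"
    have eIm: "\<bar>Im e - Im (site N y)\<bar> < h" using t q by (auto simp: e_def abs_less_iff)
    have ef: "e \<in> frontier (droplet N \<sigma>)"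
      by (rule vertical_frontier[OF N p, of \<sigma> y]) (use plus minus eIm in \<open>auto simp: e_def h_def\<close>)
    have eV: "e \<in> V" by (rule site_V) (use eIm p h in \<open>auto simp: e_def\<close>)
    have "p * Re f < p * Re e" using f(3) pp(3) by (simp add: e_def algebra_simps)
    moreover have "sloped (real_of_int p * real_of_int q) V (frontier (droplet N \<sigma>))" using sl by simp
    ultimately have "q * Im e \<le> q * Im f"
      using sloped_signs[of "real_of_int p" "real_of_int q"] p q f ef eV by auto
    moreover have "q * Im e = t" using pp(4) by (simp add: e_def)
    ultimately show False using t by simp
  qed
  have column: "\<sigma> y" if plus: "\<sigma> (y + (0, q))"
  proof (rule ccontr)
    assume minus: "\<not> \<sigma> y"
    obtain f where f: "f \<in> frontier (droplet N \<sigma>)" "f \<in> V" "p * Re f < p * Re (site N y) + h" "q * Im f < q * Im (site N y) + h"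
      using behind[OF minus, of "p * Re (site N y) + h" "q * Im (site N y) + h"] h by auto
    obtain t where t: "p * Re f < t" "t < p * Re (site N y) + h" "p * Re (site N y) - h < t" using between[OF f(3)] by blast
    define e where "e = Complex (p * t) (Im (site N y) + q * h)"
    have eRe: "\<bar>Re e - Re (site N y)\<bar> < h" using t p by (auto simp: e_def abs_less_iff)
    have ef: "e \<in> frontier (droplet N \<sigma>)"
      by (rule horizontal_frontier[OF N q, of \<sigma> y]) (use plus minus eRe in \<open>auto simp: e_def h_def\<close>)
    have eV: "e \<in> V" by (rule site_V) (use eRe q h in \<open>auto simp: e_def\<close>)
    have "p * Re f < p * Re e" using t(1) pp(3) by (simp add: e_def algebra_simps)
    moreover have "sloped (real_of_int p * real_of_int q) V (frontier (droplet N \<sigma>))" using sl by simp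
    ultimately have "q * Im e \<le> q * Im f"
      using sloped_signs[of "real_of_int p" "real_of_int q"] p q f ef eV by auto
    moreover have "q * Im e = q * Im (site N y) + h" using pp(4) by (simp add: e_def algebra_simps)
    ultimately show False using f(4) by simp
  qed
  have "reflect p q (x + (1,0)) = y + (p, 0)" "reflect p q (x + (0,1)) = y + (0, q)"
    by (simp_all add: y_def reflect_add) (simp_all add: reflect_def)
  thus ?thesis using row column by (simp add: descends_def y_def)
qed

text \<open>There is a plus spin within \<open>\<epsilon>\<close> of the given point of \<open>\<Omega>\<close>. That point is \<open>2 * \<epsilon>\<close> ahead of the
  site in both coordinates, so the plus spin is ahead of the site and of its right neighbour, and
  plus spins propagate backwards.\<close>
lemma plus_behind_Omega:
  assumes N: "N \<ge> 1" and dense: "\<And>b. b \<in> \<Omega> \<inter> V \<Longrightarrow> \<exists>a\<in>droplet N \<sigma> \<inter> V. dist b a < \<epsilon>"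
    and \<epsilon>: "1 / real N \<le> \<epsilon>" and desc: "\<And>y. norm (site N y - site N x) \<le> 8 * \<epsilon> \<Longrightarrow> descends (\<sigma> \<circ> reflect p q) y"
    and b: "mirrored p q (site N x) + (2 * \<epsilon>) *\<^sub>R Complex p q \<in> \<Omega> \<inter> V"
  shows "\<sigma> (reflect p q x)" "\<sigma> (reflect p q (x + (1,0)))"
proof -
  define h where "h = 1 / (2 * real N)"
  have h: "0 < h" "2 * h \<le> \<epsilon>" using N \<epsilon> by (simp_all add: h_def)
  obtain a where a: "a \<in> droplet N \<sigma>" "dist (mirrored p q (site N x) + (2 * \<epsilon>) *\<^sub>R Complex p q) a < \<epsilon>" using dense[OF b] by blast
  define y where "y = reflect p q (site_of N a)"
  have "reflect p q y = site_of N a" by (simp add: y_def)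
  hence \<sigma>y: "(\<sigma> \<circ> reflect p q) y" using a(1) by (simp add: droplet_eq[OF N])
  have sy: "site N y = mirrored p q (site N (site_of N a))" by (simp add: y_def site_reflect)
  define a' where "a' = mirrored p q a"
  have near: "\<bar>Re a' - Re (site N y)\<bar> \<le> h" "\<bar>Im a' - Im (site N y)\<bar> \<le> h"
    using site_of_near[OF N, of a] p q unfolding sy a'_def h_def[symmetric] by (auto simp: mirrored_def)
  have "dist (mirrored p q (site N x) + (2 * \<epsilon>) *\<^sub>R Complex p q) a = norm (site N x + (2 * \<epsilon>) *\<^sub>R Complex 1 1 - a')"
  proof -
    have "site N x + (2 * \<epsilon>) *\<^sub>R Complex 1 1 - a' = mirrored p q (mirrored p q (site N x) + (2 * \<epsilon>) *\<^sub>R Complex p q - a)"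
      using p q by (auto simp: mirrored_def a'_def complex_eq_iff algebra_simps)
    thus ?thesis by (simp add: dist_norm)
  qed
  hence "norm (site N x + (2 * \<epsilon>) *\<^sub>R Complex 1 1 - a') < \<epsilon>" using a(2) by simp
  hence ax: "\<bar>Re (site N x) + 2 * \<epsilon> - Re a'\<bar> < \<epsilon>" "\<bar>Im (site N x) + 2 * \<epsilon> - Im a'\<bar> < \<epsilon>"
    using abs_Re_le_cmod[of "site N x + (2 * \<epsilon>) *\<^sub>R Complex 1 1 - a'"] abs_Im_le_cmod[of "site N x + (2 * \<epsilon>) *\<^sub>R Complex 1 1 - a'"] by auto
  have lo: "Re (site N x) < Re (site N y)" "Im (site N x) < Im (site N y)" and
    hi: "Re (site N y) \<le> Re (site N x) + 4 * \<epsilon>" "Im (site N y) \<le> Im (site N x) + 4 * \<epsilon>"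
    using near ax h by linarith+
  have ge: "fst x + 1 \<le> fst y" "snd x + 1 \<le> snd y" using lo N by (simp_all add: divide_less_cancel)
  have rect: "descends (\<sigma> \<circ> reflect p q) (i, j)" if ij: "fst x \<le> i" "i \<le> fst y" "snd x \<le> j" "j \<le> snd y" for i j
  proof (rule desc)
    have m: "real_of_int u / real N \<le> real_of_int v / real N" if "u \<le> v" for u v using that by (simp add: divide_right_mono)
    have "\<bar>Re (site N (i, j) - site N x)\<bar> \<le> 4 * \<epsilon>" using m[OF ij(1)] m[OF ij(2)] hi(1) by simp
    moreover have "\<bar>Im (site N (i, j) - site N x)\<bar> \<le> 4 * \<epsilon>" using m[OF ij(3)] m[OF ij(4)] hi(2) by simp
    ultimately show "norm (site N (i, j) - site N x) \<le> 8 * \<epsilon>" using cmod_le[of "site N (i, j) - site N x"] by linarith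
  qed
  have "(\<sigma> \<circ> reflect p q) (x + (1,0))"
    by (rule descend_rectangle[where \<sigma> = "\<sigma> \<circ> reflect p q", OF \<sigma>y]) (use ge rect in auto)
  moreover have "(\<sigma> \<circ> reflect p q) x"
    by (rule descend_rectangle[where \<sigma> = "\<sigma> \<circ> reflect p q", OF \<sigma>y]) (use ge rect in auto)
  ultimately show "\<sigma> (reflect p q x)" "\<sigma> (reflect p q (x + (1,0)))" by simp_all
qed

end

section \<open>Measurability of the distance and number of corners\<close>

text \<open>The supremum over the cells and the infimum over the cells depend on one spin each, and there
  are countably many cells.\<close>
lemma hausdorff_dist_measurable:
  assumes N: "N \<ge> 1"
  shows "(\<lambda>\<sigma>. hausdorff_dist (droplet N \<sigma> \<inter> V) W) \<in> borel_measurable config_M"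
proof -
  have D: "a \<in> droplet N \<sigma> \<inter> V \<longleftrightarrow> (\<exists>x. \<sigma> x \<and> a \<in> cell N x \<inter> V)" for a \<sigma>
    by (auto simp: droplet_def)
  define f where "f a = (INF b\<in>W. ennreal (dist a b))" for a
  define c where "c x = (SUP a\<in>cell N x \<inter> V. f a)" for x
  have 1: "(SUP a\<in>droplet N \<sigma> \<inter> V. f a) = (SUP x. if \<sigma> x then c x else 0)" for \<sigma>
  proof (rule antisym)
    show "(SUP a\<in>droplet N \<sigma> \<inter> V. f a) \<le> (SUP x. if \<sigma> x then c x else 0)"
    proof (rule SUP_least)
      fix a assume "a \<in> droplet N \<sigma> \<inter> V"
      then obtain x where x: "\<sigma> x" "a \<in> cell N x \<inter> V" unfolding D by blast
      have "f a \<le> c x" unfolding c_def by (rule SUP_upper[OF x(2)])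
      also have "c x = (if \<sigma> x then c x else 0)" using x by simp
      also have "\<dots> \<le> (SUP x. if \<sigma> x then c x else 0)" by (rule SUP_upper) simp
      finally show "f a \<le> (SUP x. if \<sigma> x then c x else 0)" .
    qed
    show "(SUP x. if \<sigma> x then c x else 0) \<le> (SUP a\<in>droplet N \<sigma> \<inter> V. f a)"
    proof (rule SUP_least)
      fix x
      show "(if \<sigma> x then c x else 0) \<le> (SUP a\<in>droplet N \<sigma> \<inter> V. f a)"
      proof (cases "\<sigma> x")
        case True
        have "c x \<le> (SUP a\<in>droplet N \<sigma> \<inter> V. f a)" unfolding c_def
          by (rule SUP_subset_mono) (use True in \<open>auto simp: droplet_def\<close>)
        thus ?thesis using True by simp
      qed simp
    qed
  qed
  have m1: "(\<lambda>\<sigma>. SUP a\<in>droplet N \<sigma> \<inter> V. f a) \<in> borel_measurable config_M"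
    unfolding 1 by measurable
  define F where "F \<sigma> b = (INF a\<in>droplet N \<sigma> \<inter> V. ennreal (dist b a))" for \<sigma> b
  define e where "e b x = (INF a\<in>cell N x \<inter> V. ennreal (dist b a))" for b x
  have 2: "F \<sigma> b = (INF x. if \<sigma> x then e b x else \<top>)" for \<sigma> b
  proof (rule antisym)
    show "(INF x. if \<sigma> x then e b x else \<top>) \<le> F \<sigma> b"
      unfolding F_def
    proof (rule INF_greatest)
      fix a assume "a \<in> droplet N \<sigma> \<inter> V"
      then obtain x where x: "\<sigma> x" "a \<in> cell N x \<inter> V" unfolding D by blast
      have "(INF x. if \<sigma> x then e b x else \<top>) \<le> (if \<sigma> x then e b x else \<top>)" by (rule INF_lower) simp
      also have "\<dots> = e b x" using x by simp
      also have "\<dots> \<le> ennreal (dist b a)" unfolding e_def by (rule INF_lower[OF x(2)])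
      finally show "(INF x. if \<sigma> x then e b x else \<top>) \<le> ennreal (dist b a)" .
    qed
    show "F \<sigma> b \<le> (INF x. if \<sigma> x then e b x else \<top>)"
    proof (rule INF_greatest)
      fix x
      show "F \<sigma> b \<le> (if \<sigma> x then e b x else \<top>)"
      proof (cases "\<sigma> x")
        case True
        have "F \<sigma> b \<le> e b x" unfolding F_def e_def
          by (rule INF_superset_mono) (use True in \<open>auto simp: droplet_def\<close>)
        thus ?thesis using True by simp
      qed simp
    qed
  qed
  have mF: "(\<lambda>\<sigma>. F \<sigma> b) \<in> borel_measurable config_M" for b
    unfolding 2 by measurable
  obtain W' where W': "countable W'" "W' \<subseteq> W" "W \<subseteq> closure W'" by (rule separable)
  \<comment> \<open>A countable dense subset suffices, because \<open>F \<sigma>\<close> is 1-Lipschitz.\<close>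
  have lip: "F \<sigma> b \<le> F \<sigma> b' + ennreal (dist b b')" for \<sigma> b b'
  proof -
    have "F \<sigma> b - ennreal (dist b b') \<le> F \<sigma> b'"
      unfolding F_def[of \<sigma> b']
    proof (rule INF_greatest)
      fix a assume a: "a \<in> droplet N \<sigma> \<inter> V"
      have "F \<sigma> b \<le> ennreal (dist b a)" unfolding F_def by (rule INF_lower[OF a])
      also have "\<dots> \<le> ennreal (dist b b' + dist b' a)" by (intro ennreal_leI dist_triangle)
      also have "\<dots> = ennreal (dist b b') + ennreal (dist b' a)" by simp
      finally show "F \<sigma> b - ennreal (dist b b') \<le> ennreal (dist b' a)" by (simp add: ennreal_minus_le_iff)
    qed
    thus ?thesis by (simp add: ennreal_minus_le_iff add.commute)
  qed
  have 3: "(SUP b\<in>W. F \<sigma> b) = (SUP b\<in>W'. F \<sigma> b)" for \<sigma>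
  proof (rule antisym)
    show "(SUP b\<in>W. F \<sigma> b) \<le> (SUP b\<in>W'. F \<sigma> b)"
    proof (rule SUP_least)
      fix b assume "b \<in> W"
      hence bc: "b \<in> closure W'" using W'(3) by blast
      show "F \<sigma> b \<le> (SUP b\<in>W'. F \<sigma> b)"
      proof (rule ennreal_le_epsilon)
        fix d :: real assume "0 < d"
        then obtain b' where b': "b' \<in> W'" "dist b' b < d" using bc unfolding closure_approachable by blast
        have "F \<sigma> b \<le> F \<sigma> b' + ennreal (dist b b')" by (rule lip)
        also have "\<dots> \<le> (SUP b\<in>W'. F \<sigma> b) + ennreal d"
          using b' by (intro add_mono SUP_upper ennreal_leI) (auto simp: dist_commute)
        finally show "F \<sigma> b \<le> (SUP b\<in>W'. F \<sigma> b) + ennreal d" .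
      qed
    qed
    show "(SUP b\<in>W'. F \<sigma> b) \<le> (SUP b\<in>W. F \<sigma> b)" by (rule SUP_subset_mono[OF W'(2)]) simp
  qed
  have m2: "(\<lambda>\<sigma>. SUP b\<in>W. F \<sigma> b) \<in> borel_measurable config_M"
    unfolding 3 by (rule borel_measurable_SUP[OF W'(1)]) (rule mF)
  show ?thesis
    using borel_measurable_max[OF m2 m1] unfolding hausdorff_dist_def f_def F_def .
qed

text \<open>A monotone interface crosses each row of sites at most once from plus to minus and at most once
  from minus to plus, and a plus spin with two opposite
  neighbours has a neighbour of opposite sign in its row.\<close>
lemma corners_bound:
  assumes N: "N \<ge> 1" and k: "k = 1 \<or> k = -1" and sl: "sloped k V (frontier (droplet N \<sigma>))"
    and V: "cball x (2 * \<delta>) \<subseteq> V" and \<delta>: "3 / real N \<le> \<delta>"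
  shows "real (corners s x \<delta> N \<sigma>) \<le> 6 * (\<delta> * real N)"
proof -
  define h where "h = 1 / (2 * real N)"
  have h: "0 < h" "6 * h \<le> \<delta>" "2 * h * real N = 1" using N \<delta> by (simp_all add: h_def)
  define Y where "Y = {y. norm (site N y - x) \<le> \<delta> + 2 * h \<and> \<sigma> y \<and> opposite \<sigma> y = 2}"
  have inV: "e \<in> V" if "norm (site N y - x) \<le> \<delta> + 2 * h" "\<bar>Re e - Re (site N y)\<bar> \<le> h" "\<bar>Im e - Im (site N y)\<bar> \<le> h" for e y
  proof -
    have "norm (e - site N y) \<le> 2 * h" using cmod_le[of "e - site N y"] that by simp
    hence "norm (e - x) \<le> 2 * \<delta>" using norm_triangle_ineq[of "e - site N y" "site N y - x"] that(1) h by simp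
    thus ?thesis using V by (auto simp: dist_norm norm_minus_commute)
  qed
  have fin: "finite Y"
  proof (rule finite_subset)
    show "Y \<subseteq> touched N (cball x (\<delta> + 2 * h))"
      using site_in_cell[OF N] by (fastforce simp: Y_def touched_def dist_norm norm_minus_commute)
    show "finite (touched N (cball x (\<delta> + 2 * h)))" by (rule finite_touched[OF N]) simp
  qed
  have row: "y = z"
    if ab: "a = 1 \<or> a = -1" and y: "y \<in> Y" "\<sigma> y \<noteq> \<sigma> (y + (a, 0))" and z: "z \<in> Y" "\<sigma> z \<noteq> \<sigma> (z + (a, 0))"
      and eq: "snd y = snd z" and le: "fst y \<le> fst z" for a :: int and y z
  proof (rule ccontr)
    assume "y \<noteq> z"
    hence lt: "fst y < fst z" using eq le by (auto simp: prod_eq_iff)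
    define e where "e = Complex (Re (site N y) + a * h) (Im (site N y) - k * h / 2)"
    define e' where "e' = Complex (Re (site N z) + a * h) (Im (site N z) + k * h / 2)"
    have s: "Im (site N z) = Im (site N y)" using eq by simp
    have kk: "\<bar>k * h / 2\<bar> < h" using k h by auto
    have "e \<in> frontier (droplet N \<sigma>)" "e' \<in> frontier (droplet N \<sigma>)"
      using vertical_frontier[OF N ab y(2), of e] vertical_frontier[OF N ab z(2), of e'] kk
      by (simp_all add: e_def e'_def h_def)
    moreover have "e \<in> V" "e' \<in> V"
      using inV[of y e] inV[of z e'] y(1) z(1) kk ab h by (auto simp: e_def e'_def Y_def)
    moreover have "Re e < Re e'" using lt N by (simp add: e_def e'_def divide_strict_right_mono)
    ultimately have "k * Im e' \<le> k * Im e" using sl unfolding sloped_def by blast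
    moreover have "k * Im e' - k * Im e = h" using k s unfolding e_def e'_def complex.sel by auto
    ultimately show False using h by simp
  qed
  have opp: "\<sigma> y \<noteq> \<sigma> (y + (1, 0)) \<or> \<sigma> y \<noteq> \<sigma> (y + (-1, 0))" if y: "y \<in> Y" for y
  proof (rule ccontr)
    assume no: "\<not> ?thesis"
    have m: "y - (1,0) = y + (-1, 0)" "y - (0,1) = y + (0, -1)" by (simp_all add: prod_eq_iff)
    have o: "\<sigma> y \<noteq> \<sigma> (y + (0, 1))" "\<sigma> y \<noteq> \<sigma> (y + (0, -1))"
    proof -
      have "opposite \<sigma> y = 2" using y by (simp add: Y_def)
      thus "\<sigma> y \<noteq> \<sigma> (y + (0, 1))" "\<sigma> y \<noteq> \<sigma> (y + (0, -1))"
        using no unfolding opposite_explicit m by (auto simp: of_bool_def split: if_splits)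
    qed
    define e where "e = Complex (Re (site N y) + k * h / 2) (Im (site N y) + h)"
    define e' where "e' = Complex (Re (site N y) - k * h / 2) (Im (site N y) - h)"
    have kk: "\<bar>k * h / 2\<bar> < h" using k h by auto
    have mem: "e \<in> frontier (droplet N \<sigma>)" "e' \<in> frontier (droplet N \<sigma>)"
      using horizontal_frontier[OF N _ o(1), of e] horizontal_frontier[OF N _ o(2), of e'] kk
      by (simp_all add: e_def e'_def h_def)
    have inv: "e \<in> V" "e' \<in> V"
      using inV[of y e] inV[of y e'] y kk h by (auto simp: e_def e'_def Y_def)
    show False
    proof (cases "k = 1")
      case True
      hence "Re e' < Re e" using h by (simp add: e_def e'_def)
      hence "k * Im e \<le> k * Im e'" using sl mem inv unfolding sloped_def by blast
      thus False using True h by (simp add: e_def e'_def)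
    next
      case False
      hence k: "k = -1" using k by simp
      hence "Re e < Re e'" using h by (simp add: e_def e'_def)
      hence "k * Im e' \<le> k * Im e" using sl mem inv unfolding sloped_def by blast
      thus False using k h by (simp add: e_def e'_def)
    qed
  qed
  have count: "real (card {y\<in>Y. \<sigma> y \<noteq> \<sigma> (y + (a, 0))}) \<le> 2 * (\<delta> * real N) + 3" if ab: "a = 1 \<or> a = -1" for a :: int
  proof -
    let ?Z = "{y\<in>Y. \<sigma> y \<noteq> \<sigma> (y + (a, 0))}"
    have "inj_on snd ?Z"
    proof (rule inj_onI)
      fix y z assume "y \<in> ?Z" "z \<in> ?Z" "snd y = snd z"
      thus "y = z" using row[OF ab, of y z] row[OF ab, of z y] by (cases "fst y \<le> fst z") auto
    qed
    hence "card ?Z = card (snd ` ?Z)" by (simp add: card_image)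
    also have "real \<dots> \<le> (2 * (\<delta> * real N) + 2) + 1"
    proof (rule card_int_interval)
      show "finite (snd ` ?Z)" using fin by simp
      fix i j assume "i \<in> snd ` ?Z" "j \<in> snd ` ?Z"
      then obtain y z where yz: "y \<in> Y" "z \<in> Y" "i = snd y" "j = snd z" by blast
      have "\<bar>Im (site N y - x)\<bar> \<le> \<delta> + 2 * h" "\<bar>Im (site N z - x)\<bar> \<le> \<delta> + 2 * h"
        using abs_Im_le_cmod[of "site N y - x"] abs_Im_le_cmod[of "site N z - x"] yz(1,2) by (auto simp: Y_def)
      hence "\<bar>real_of_int i / real N - real_of_int j / real N\<bar> \<le> 2 * (\<delta> + 2 * h)" by (simp add: yz)
      hence "\<bar>real_of_int i / real N - real_of_int j / real N\<bar> * real N \<le> 2 * (\<delta> + 2 * h) * real N"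
        by (rule mult_right_mono) simp
      also have "\<bar>real_of_int i / real N - real_of_int j / real N\<bar> * real N = real_of_int \<bar>i - j\<bar>"
        using N by (simp add: diff_divide_distrib[symmetric])
      also have "2 * (\<delta> + 2 * h) * real N = 2 * (\<delta> * real N) + 2" using h(3) by (simp add: algebra_simps)
      finally show "real_of_int \<bar>i - j\<bar> \<le> 2 * (\<delta> * real N) + 2" .
    qed (use \<delta> h in simp)
    finally show ?thesis by simp
  qed
  have "{y. site N y \<in> cover N (cball x \<delta>) - cball s (dist x s) \<and> \<sigma> y \<and> opposite \<sigma> y = 2} \<subseteq> Y"
  proof
    fix y assume y: "y \<in> {y. site N y \<in> cover N (cball x \<delta>) - cball s (dist x s) \<and> \<sigma> y \<and> opposite \<sigma> y = 2}"
    hence "y \<in> touched N (cball x \<delta>)" by (simp add: cover_eq[OF N] site_of_site[OF N])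
    then obtain u where u: "u \<in> cell N y" "dist x u \<le> \<delta>" by (auto simp: touched_def)
    have "site_of N u = y" using u(1) mem_cell_iff[OF N] by simp
    hence "norm (site N y - u) \<le> 2 * h"
      using site_of_near[OF N, of u] cmod_le[of "site N y - u"] unfolding h_def by (simp add: abs_minus_commute)
    hence "norm (site N y - x) \<le> \<delta> + 2 * h"
      using norm_triangle_ineq[of "site N y - u" "u - x"] u(2) by (simp add: dist_norm norm_minus_commute)
    thus "y \<in> Y" using y by (simp add: Y_def)
  qed
  also have "Y \<subseteq> {y\<in>Y. \<sigma> y \<noteq> \<sigma> (y + (1, 0))} \<union> {y\<in>Y. \<sigma> y \<noteq> \<sigma> (y + (-1, 0))}" using opp by blast
  finally have "corners s x \<delta> N \<sigma> \<le> card ({y\<in>Y. \<sigma> y \<noteq> \<sigma> (y + (1, 0))} \<union> {y\<in>Y. \<sigma> y \<noteq> \<sigma> (y + (-1, 0))})"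
    unfolding corners_def by (rule card_mono[rotated]) (use fin in simp)
  also have "\<dots> \<le> card {y\<in>Y. \<sigma> y \<noteq> \<sigma> (y + (1, 0))} + card {y\<in>Y. \<sigma> y \<noteq> \<sigma> (y + (-1, 0))}" by (rule card_Un_le)
  finally have "real (corners s x \<delta> N \<sigma>) \<le> 4 * (\<delta> * real N) + 6" using count[of 1] count[of "-1"] by simp
  moreover have "3 \<le> \<delta> * real N" using \<delta> N by (simp add: field_simps)
  ultimately show ?thesis by linarith
qed

section \<open>The drift of a configuration close to the curve\<close>

lemma touched_cball:
  assumes N: "N \<ge> 1"
  shows "norm (site N y - z) \<le> \<alpha> \<Longrightarrow> y \<in> touched N (cball z \<alpha>)"
    and "y \<in> touched N (cball z \<alpha>) \<Longrightarrow> norm (site N y - z) \<le> \<alpha> + 1 / real N"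
proof -
  assume "norm (site N y - z) \<le> \<alpha>"
  hence "site N y \<in> cball z \<alpha>" by (simp add: dist_norm norm_minus_commute)
  thus "y \<in> touched N (cball z \<alpha>)" using site_in_cell[OF N, of y] by (auto simp: touched_def)
next
  assume "y \<in> touched N (cball z \<alpha>)"
  then obtain u where u: "u \<in> cell N y" "dist z u \<le> \<alpha>" by (auto simp: touched_def)
  have "site_of N u = y" using u(1) mem_cell_iff[OF N] by simp
  hence "norm (site N y - u) \<le> 1 / real N"
    using site_of_near[OF N, of u] cmod_le[of "site N y - u"] by (simp add: abs_minus_commute)
  thus "norm (site N y - z) \<le> \<alpha> + 1 / real N"
    using norm_triangle_ineq[of "site N y - u" "u - z"] u(2) by (simp add: dist_norm norm_minus_commute)
qed

lemma half_box:
  assumes "N \<ge> 1"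
  shows "compact (half_box N)" "0 \<in> half_box N" "half_box N \<subseteq> cball 0 (1 / real N)"
proof -
  have mem: "z \<in> half_box N \<longleftrightarrow> \<bar>Re z\<bar> \<le> 1 / (2 * real N) \<and> \<bar>Im z\<bar> \<le> 1 / (2 * real N)" for z
    by (auto simp: half_box_def cbox_def Basis_complex_def inner_complex_def abs_le_iff)
  show "compact (half_box N)" by (simp add: half_box_def compact_cbox)
  show "0 \<in> half_box N" using assms by (simp add: mem)
  show "half_box N \<subseteq> cball 0 (1 / real N)"
  proof
    fix z assume "z \<in> half_box N"
    hence "norm z \<le> 1 / (2 * real N) + 1 / (2 * real N)" using cmod_le[of z] unfolding mem by linarith
    thus "z \<in> cball 0 (1 / real N)" by simp
  qed
qed

locale oriented_curve = jordan_curve_param + signs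
begin

abbreviation \<Omega> :: "complex set" where "\<Omega> \<equiv> range g \<union> inside (range g)"

lemma weight_reflect:
  assumes N: "N \<ge> 1"
  shows "weight s x0 x1 r \<delta> N (reflect p q x) =
    1 - (1 - of_bool (x \<in> {x. reflect p q x \<in> touched N (cball s r)})) *
      (1 - ramp \<delta> (infdist (site N x - mirrored p q x0) (half_box N))) *
      (1 - ramp \<delta> (infdist (site N x - mirrored p q x1) (half_box N)))"
  using infdist_cell_reflect[OF N, of "mirrored p q x0" x] infdist_cell_reflect[OF N, of "mirrored p q x1" x]
  by (simp add: weight_def)

lemma outside_not_\<Omega>: "b \<in> outside (range g) \<Longrightarrow> b \<notin> \<Omega>"
  using inside_Int_outside[of "range g"] outside_no_overlap[of "range g"] by blast

text \<open>The assumptions on \<open>\<sigma>\<close> say that plus spins are close to \<open>\<Omega>\<close> and that sites slightly behind a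
  point of \<open>\<Omega>\<close> are plus. Outside the double cone of the tangent the side of the curve is known, so
  the spins are known outside a strip of width \<open>k\<^sup>2 * \<delta>\<close>. The sign \<open>\<omega>\<close> is \<open>1\<close> if the tangent directed
  away from \<open>s\<close> is \<open>g' t\<close>, as at the end \<open>x1\<close>, and \<open>-1\<close> if it is \<open>- g' t\<close>, as at \<open>x0\<close>.\<close>
lemma end_instance:
  fixes \<omega> :: real
  assumes N: "N \<ge> 1" "100 \<le> k\<^sup>2 * \<delta> * real N"
    and quad: "0 < - q * Re (g' t)" "0 < p * Im (g' t)" and \<omega>: "\<omega> = 1 \<or> \<omega> = -1"
    and k: "0 < k" "k \<le> 1/100" "k \<le> \<bar>Im (g' t)\<bar> / norm (g' t) / 100"
    and \<delta>: "0 < \<delta>" "\<delta> \<le> k * r / 100" "8 * \<delta> \<le> c" "4 * \<delta> < \<rho>"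
    and \<epsilon>: "0 < \<epsilon>" "8 * \<epsilon> \<le> k\<^sup>2 * \<delta>"
    and r: "norm (g t - s) = r" and radial: "r / 2 * norm (g' t) \<le> \<omega> * Re ((g t - s) * cnj (g' t))"
    and c: "c \<le> - \<omega> * q * Re (g t - s)" "c \<le> \<omega> * p * Im (g t - s)"
    and left: "\<And>v. norm v < \<rho> \<Longrightarrow> Im (v * cnj (g' t)) > k\<^sup>2/8 * norm v * norm (g' t) \<Longrightarrow> g t + v \<in> inside (range g)"
    and right: "\<And>v. norm v < \<rho> \<Longrightarrow> Im (v * cnj (g' t)) < - (k\<^sup>2/8 * norm v * norm (g' t)) \<Longrightarrow> g t + v \<in> outside (range g)"
    and G1: "\<And>x. \<sigma> (reflect p q x) \<Longrightarrow> norm (site N x - mirrored p q s) \<le> 2 * r \<Longrightarrow> \<exists>b\<in>\<Omega>. norm (mirrored p q (site N x) - b) < \<epsilon>"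
    and G2: "\<And>x. norm (site N x - mirrored p q s) \<le> 2 * r \<Longrightarrow> mirrored p q (site N x) + (2 * \<epsilon>) *\<^sub>R Complex p q \<in> \<Omega> \<Longrightarrow> \<sigma> (reflect p q x)"
    and G3: "\<And>x. norm (site N x - mirrored p q s) \<le> 2 * r \<Longrightarrow> descends (\<sigma> \<circ> reflect p q) x"
    and w: "\<And>x. norm (site N x - mirrored p q (g t)) \<le> 3 * \<delta> \<Longrightarrow>
        w x = (if reflect p q x \<in> touched N (cball s r) then 1 else ramp \<delta> (infdist (site N x - mirrored p q (g t)) (half_box N)))"
  shows "staircase_end N (\<sigma> \<circ> reflect p q) (mirrored p q (g t)) (mirrored p q s) r \<delta> k
    (\<bar>Re (g' t)\<bar> / norm (g' t)) (\<bar>Im (g' t)\<bar> / norm (g' t)) (- \<omega> * p * q) c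
    {x. reflect p q x \<in> touched N (cball s r)} (half_box N) w"
proof -
  define n where "n = norm (g' t)"
  define A where "A = \<bar>Re (g' t)\<bar> / n"
  define B where "B = \<bar>Im (g' t)\<bar> / n"
  have n: "n > 0" using nz by (simp add: n_def)
  have AB: "Re (g' t) = - q * A * n" "Im (g' t) = p * B * n" "A > 0" "B > 0"
    using p q quad n by (auto simp: A_def B_def divide_neg_pos)
  have AB2: "A\<^sup>2 + B\<^sup>2 = 1"
    using n by (simp add: A_def B_def power_divide add_divide_distrib[symmetric] n_def cmod_power2[symmetric])
  have AB1: "A \<le> 1" "B \<le> 1"
    using abs_Re_le_cmod[of "g' t"] abs_Im_le_cmod[of "g' t"] n by (simp_all add: A_def B_def n_def)
  have near: "norm (site N x - mirrored p q s) \<le> 2 * r" if "norm (site N x - mirrored p q (g t)) \<le> 3 * \<delta>" for x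
  proof -
    have "norm (mirrored p q (g t) - mirrored p q s) = r" by (simp add: mirrored_diff r)
    moreover have "norm (site N x - mirrored p q s) \<le> norm (site N x - mirrored p q (g t)) + norm (mirrored p q (g t) - mirrored p q s)"
      using norm_triangle_ineq[of "site N x - mirrored p q (g t)" "mirrored p q (g t) - mirrored p q s"] by simp
    moreover have "3 * \<delta> \<le> r"
    proof -
      have "0 \<le> r" using r norm_ge_zero by blast
      hence "k * r \<le> 1/100 * r" using k(2) by (rule mult_right_mono[rotated])
      thus ?thesis using \<delta>(2) \<open>0 \<le> r\<close> by linarith
    qed
    ultimately show ?thesis using that by linarith
  qed
  have cross: "Im (mirrored p q z * cnj (g' t)) = - n * (A * Im z + B * Re z)" for z
  proof -
    have "Im (mirrored p q z * cnj (g' t)) = q * Im z * (- q * A * n) - p * Re z * (p * B * n)"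
      by (simp add: mirrored_def AB(1,2))
    also have "\<dots> = - n * ((real_of_int q * real_of_int q) * (A * Im z) + (real_of_int p * real_of_int p) * (B * Re z))"
      by (simp add: algebra_simps)
    finally show ?thesis unfolding pp by simp
  qed
  have shape: "mirrored p q (site N x) = g t + mirrored p q (site N x - mirrored p q (g t))" for x
    unfolding mirrored_diff[symmetric] by simp
  have k2: "0 < k\<^sup>2" "k\<^sup>2 \<le> 1" using k by (simp_all add: power_le_one)
  have \<epsilon>\<delta>: "8 * \<epsilon> \<le> \<delta>" using \<epsilon>(2) \<delta>(1) mult_right_mono[OF k2(2), of \<delta>] by linarith
  have small: "k\<^sup>2/8 * norm v * n \<le> k\<^sup>2 * \<delta> / 2 * n" if "norm v \<le> 4 * \<delta>" for v :: complex
  proof -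
    have "k\<^sup>2/8 * norm v \<le> k\<^sup>2/8 * (4 * \<delta>)" using that k2 by (intro mult_left_mono) auto
    also have "\<dots> = k\<^sup>2 * \<delta> / 2" by simp
    finally show ?thesis using n by (intro mult_right_mono) auto
  qed
  have kB: "k \<le> B / 100" using k(3) by (simp add: B_def n_def)
  show ?thesis
    unfolding n_def[symmetric] A_def[symmetric] B_def[symmetric]
  proof
    show "(\<sigma> \<circ> reflect p q) x" if x: "norm (site N x - mirrored p q (g t)) \<le> 3 * \<delta>"
      "A * Im (site N x - mirrored p q (g t)) + B * Re (site N x - mirrored p q (g t)) < - (k\<^sup>2 * \<delta>)" for x
    proof -
      define v where "v = site N x - mirrored p q (g t)"
      define v' where "v' = v + (2 * \<epsilon>) *\<^sub>R Complex 1 1"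
      have "norm (Complex 1 1) \<le> 2" using cmod_le[of "Complex 1 1"] by simp
      hence "norm ((2 * \<epsilon>) *\<^sub>R Complex 1 1) \<le> 4 * \<epsilon>" using \<epsilon>(1) by simp
      hence nv: "norm v' \<le> 4 * \<delta>"
        using norm_triangle_ineq[of v "(2 * \<epsilon>) *\<^sub>R Complex 1 1"] x(1) \<epsilon>\<delta> \<delta>(1) unfolding v'_def v_def by linarith
      have "A * Im v' + B * Re v' = (A * Im v + B * Re v) + 2 * \<epsilon> * (A + B)" by (simp add: v'_def algebra_simps)
      also have "2 * \<epsilon> * (A + B) \<le> 2 * \<epsilon> * 2" using AB1 \<epsilon>(1) by (intro mult_left_mono) auto
      finally have "A * Im v' + B * Re v' < - (k\<^sup>2 * \<delta> / 2)" using x(2) \<epsilon>(2) unfolding v_def[symmetric] by linarith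
      hence "n * (A * Im v' + B * Re v') < n * - (k\<^sup>2 * \<delta> / 2)" using n by (rule mult_strict_left_mono)
      hence "k\<^sup>2/8 * norm (mirrored p q v') * n < Im (mirrored p q v' * cnj (g' t))"
        using small[OF nv] unfolding cross norm_mirrored by (simp add: algebra_simps)
      hence "g t + mirrored p q v' \<in> inside (range g)"
        using left[of "mirrored p q v'"] nv \<delta>(4) by (simp add: n_def)
      moreover have "g t + mirrored p q v' = mirrored p q (site N x) + (2 * \<epsilon>) *\<^sub>R Complex p q"
        unfolding shape[of x] v'_def v_def by (simp add: mirrored_def complex_eq_iff algebra_simps)
      ultimately show "(\<sigma> \<circ> reflect p q) x" using G2[OF near[OF x(1)]] by simp
    qed
    show "\<not> (\<sigma> \<circ> reflect p q) x" if x: "norm (site N x - mirrored p q (g t)) \<le> 3 * \<delta>"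
      "k\<^sup>2 * \<delta> < A * Im (site N x - mirrored p q (g t)) + B * Re (site N x - mirrored p q (g t))" for x
    proof
      assume "(\<sigma> \<circ> reflect p q) x"
      hence "\<sigma> (reflect p q x)" by simp
      from G1[OF this near[OF x(1)]] obtain b where b: "b \<in> \<Omega>" "norm (mirrored p q (site N x) - b) < \<epsilon>" by blast
      define v where "v = site N x - mirrored p q (g t)"
      define v' where "v' = mirrored p q (b - g t)"
      have bv: "b = g t + mirrored p q v'" by (simp add: v'_def)
      have "norm (v - v') = norm (mirrored p q (site N x) - b)"
      proof -
        have "mirrored p q (v - v') = mirrored p q (site N x) - b"
          by (simp add: v_def v'_def mirrored_diff[symmetric])
        thus ?thesis by (metis norm_mirrored)
      qed
      hence d: "norm (v - v') < \<epsilon>" using b(2) by simp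
      have nv: "norm v' \<le> 4 * \<delta>"
        using norm_triangle_ineq4[of v "v - v'"] d x(1) \<epsilon>\<delta> \<delta>(1) unfolding v_def[symmetric] by simp
      have "A * Im v' + B * Re v' = (A * Im v + B * Re v) - (A * Im (v - v') + B * Re (v - v'))" by (simp add: algebra_simps)
      moreover have "\<bar>A * Im (v - v')\<bar> \<le> 1 * \<epsilon>" "\<bar>B * Re (v - v')\<bar> \<le> 1 * \<epsilon>"
        unfolding abs_mult using AB AB1 d abs_Im_le_cmod[of "v - v'"] abs_Re_le_cmod[of "v - v'"] by (intro mult_mono; simp)+
      ultimately have "A * Im v' + B * Re v' > k\<^sup>2 * \<delta> / 2"
        using x(2) \<epsilon> unfolding v_def[symmetric] by linarith
      hence "n * (k\<^sup>2 * \<delta> / 2) < n * (A * Im v' + B * Re v')" using n by (rule mult_strict_left_mono)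
      hence "Im (mirrored p q v' * cnj (g' t)) < - (k\<^sup>2/8 * norm (mirrored p q v') * n)"
        using small[OF nv] unfolding cross norm_mirrored by (simp add: algebra_simps)
      hence "b \<in> outside (range g)"
        using right[of "mirrored p q v'"] nv \<delta>(4) unfolding bv by (simp add: n_def)
      thus False using b(1) outside_not_\<Omega> by blast
    qed
    show "r / 2 \<le> (mirrored p q (g t) - mirrored p q s) \<bullet> Complex (- \<omega> * p * q * A) (- (- \<omega> * p * q) * B)"
    proof -
      define D where "D = g t - s"
      have "(mirrored p q (g t) - mirrored p q s) \<bullet> Complex (- \<omega> * p * q * A) (- (- \<omega> * p * q) * B) =
          \<omega> * ((real_of_int p * real_of_int p) * (Re D * (- q * A)) + (real_of_int q * real_of_int q) * (Im D * (p * B)))"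
        unfolding mirrored_diff D_def[symmetric] by (simp add: mirrored_def inner_complex_def algebra_simps)
      also have "\<dots> = \<omega> * (Re D * (- q * A) + Im D * (p * B))" unfolding pp by simp
      also have "\<dots> = \<omega> * Re (D * cnj (g' t)) / n" using n by (simp add: AB(1,2) field_simps)
      also have "\<dots> \<ge> r / 2" using radial n unfolding D_def[symmetric] n_def[symmetric] by (simp add: field_simps)
      finally show ?thesis .
    qed
    have m: "Re (mirrored p q (g t) - mirrored p q s) = p * Re (g t - s)" "Im (mirrored p q (g t) - mirrored p q s) = q * Im (g t - s)"
      by (simp_all add: mirrored_def algebra_simps)
    have e1: "- \<omega> * p * q * (p * Re (g t - s)) = (real_of_int p * real_of_int p) * (- \<omega> * q * Re (g t - s))" by (simp only: algebra_simps)
    show "c \<le> - \<omega> * p * q * Re (mirrored p q (g t) - mirrored p q s)" unfolding m e1 pp mult_1 by (rule c(1))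
    have e2: "- (- \<omega> * p * q) * (q * Im (g t - s)) = (real_of_int q * real_of_int q) * (\<omega> * p * Im (g t - s))" by (simp only: algebra_simps) simp
    show "c \<le> - (- \<omega> * p * q) * Im (mirrored p q (g t) - mirrored p q s)" unfolding m e2 pp mult_1 by (rule c(2))
    show "norm (mirrored p q (g t) - mirrored p q s) = r" by (simp add: mirrored_diff r)
    show "- \<omega> * p * q = 1 \<or> - \<omega> * p * q = -1" using p q \<omega> by auto
    show "x \<in> {x. reflect p q x \<in> touched N (cball s r)}" if "norm (site N x - mirrored p q s) \<le> r" for x
      using touched_cball(1)[OF N(1), of "reflect p q x" s r] that by (simp add: norm_site_mirrored)
    show "norm (site N x - mirrored p q s) \<le> r + 1 / real N" if "x \<in> {x. reflect p q x \<in> touched N (cball s r)}" for x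
      using touched_cball(2)[OF N(1), of "reflect p q x" s r] that by (simp add: norm_site_mirrored)
    show "w x = (if x \<in> {x. reflect p q x \<in> touched N (cball s r)} then 1 else ramp \<delta> (infdist (site N x - mirrored p q (g t)) (half_box N)))"
      if "norm (site N x - mirrored p q (g t)) \<le> 3 * \<delta>" for x using w[OF that] by simp
    show "descends (\<sigma> \<circ> reflect p q) x" if "norm (site N x - mirrored p q (g t)) \<le> 3 * \<delta>" for x
      by (rule G3[OF near[OF that]])
  qed (rule N k(1,2) kB \<delta>(1-3) AB(3,4) AB2 half_box[OF N(1)])+
qed

lemma corners_reflect:
  assumes N: "N \<ge> 1" and r: "norm (x - s) = r"
  shows "card {y \<in> {y. reflect p q y \<in> touched N (cball x \<delta>)}. norm (site N y - mirrored p q s) > r \<and> (\<sigma> \<circ> reflect p q) y \<and> opposite (\<sigma> \<circ> reflect p q) y = 2}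
    = corners s x \<delta> N \<sigma>"
proof -
  have "{y. site N y \<in> cover N (cball x \<delta>) - cball s (dist x s) \<and> \<sigma> y \<and> opposite \<sigma> y = 2} =
    reflect p q ` {y \<in> {y. reflect p q y \<in> touched N (cball x \<delta>)}. norm (site N y - mirrored p q s) > r \<and> (\<sigma> \<circ> reflect p q) y \<and> opposite (\<sigma> \<circ> reflect p q) y = 2}"
    (is "?L = reflect p q ` ?R")
  proof -
    have m: "y \<in> ?L \<longleftrightarrow> reflect p q y \<in> ?R" for y
      using r by (auto simp: cover_eq[OF N] site_of_site[OF N] norm_site_mirrored opposite_reflect dist_norm norm_minus_commute)
    have "y \<in> ?L \<longleftrightarrow> y \<in> reflect p q ` ?R" for y
    proof
      assume "y \<in> ?L"
      hence "reflect p q y \<in> ?R" using m by blast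
      hence "reflect p q (reflect p q y) \<in> reflect p q ` ?R" by (rule imageI)
      thus "y \<in> reflect p q ` ?R" by simp
    next
      assume "y \<in> reflect p q ` ?R"
      then obtain y' where "y' \<in> ?R" "y = reflect p q y'" by blast
      thus "y \<in> ?L" using m[of y] by simp
    qed
    thus ?thesis by blast
  qed
  moreover have "inj_on (reflect p q) A" for A using bij_reflect by (auto simp: bij_def inj_on_def)
  ultimately show ?thesis unfolding corners_def by (simp add: card_image)
qed

lemma weight_touched:
  assumes N: "N \<ge> 1" and \<delta>: "\<delta> > 0" and w: "weight s x0 x1 r \<delta> N x \<noteq> 0"
  shows "x \<in> touched N (region s x0 x1 r \<delta> \<delta>)"
proof -
  have *: "x \<in> touched N (cball y \<delta>)" if "ramp \<delta> (infdist y (cell N x)) \<noteq> 0" for y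
  proof -
    have "infdist y (cell N x) < \<delta>" using that \<delta> by (auto simp: ramp_def max_def field_simps split: if_splits)
    hence "\<delta> \<in> {infdist y (cell N x)<..}" "\<delta> \<in> {infdist y (cell N x)..}" by simp_all
    hence "\<delta> \<in> {\<alpha>. x \<in> touched N (cball y \<alpha>)}" using touched_cball_ray[OF N, of x y] by metis
    thus ?thesis by simp
  qed
  have "x \<in> touched N (cball s r) \<or> ramp \<delta> (infdist x0 (cell N x)) \<noteq> 0 \<or> ramp \<delta> (infdist x1 (cell N x)) \<noteq> 0"
    using w by (auto simp: weight_def)
  thus ?thesis using *[of x0] *[of x1] by (auto simp: region_def touched_Un)
qed

text \<open>Away from the two ends the circle around \<open>s\<close> keeps a distance \<open>\<rho>'\<close> from the curve, so an interface
  that is close to the curve meets the circle near the ends only. The factor \<open>24\<close> makes the staircase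
  property of \<open>descends_reflect\<close> hold up to distance \<open>6 * r\<close> from \<open>s\<close>.\<close>
lemma pathwise_bound:
  assumes V: "ball (g a) R \<subseteq> V" and \<eta>: "0 < \<eta>" "2 * \<eta> \<le> R" "24 * r \<le> \<eta>" "g a - \<eta> *\<^sub>R Complex p q \<in> \<Omega>" and r: "0 < r"
    and ends: "norm (g t0 - g a) = r" "norm (g t1 - g a) = r"
    and quad0: "0 < - q * Re (g' t0)" "0 < p * Im (g' t0)" and quad1: "0 < - q * Re (g' t1)" "0 < p * Im (g' t1)"
    and radial0: "r / 2 * norm (g' t0) \<le> - Re ((g t0 - g a) * cnj (g' t0))"
    and radial1: "r / 2 * norm (g' t1) \<le> Re ((g t1 - g a) * cnj (g' t1))"
    and k: "0 < k" "k \<le> 1/100" "k \<le> \<bar>Im (g' t0)\<bar> / norm (g' t0) / 100" "k \<le> \<bar>Im (g' t1)\<bar> / norm (g' t1) / 100"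
    and c: "c \<le> q * Re (g t0 - g a)" "c \<le> - p * Im (g t0 - g a)" "c \<le> - q * Re (g t1 - g a)" "c \<le> p * Im (g t1 - g a)"
    and \<delta>: "0 < \<delta>" "\<delta> \<le> k * r / 100" "8 * \<delta> \<le> c" "4 * \<delta> < \<rho>" "8 * \<delta> \<le> norm (g t0 - g t1)"
    and sides: "\<And>t v. t \<in> {t0, t1} \<Longrightarrow> norm v < \<rho> \<Longrightarrow> Im (v * cnj (g' t)) > k\<^sup>2/8 * norm v * norm (g' t) \<Longrightarrow> g t + v \<in> inside (range g)"
      "\<And>t v. t \<in> {t0, t1} \<Longrightarrow> norm v < \<rho> \<Longrightarrow> Im (v * cnj (g' t)) < - (k\<^sup>2/8 * norm v * norm (g' t)) \<Longrightarrow> g t + v \<in> outside (range g)"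
    and gap: "\<And>z. norm (z - g a) = r \<Longrightarrow> \<delta> \<le> norm (z - g t0) \<Longrightarrow> \<delta> \<le> norm (z - g t1) \<Longrightarrow> ball z \<rho>' \<inter> range g = {}"
    and \<epsilon>: "0 < \<epsilon>" "8 * \<epsilon> \<le> k\<^sup>2 * \<delta>" "16 * \<epsilon> \<le> \<rho>'"
    and N: "1 \<le> N" "100 \<le> k\<^sup>2 * \<delta> * real N" "1 / real N \<le> \<epsilon>"
    and sl: "sloped (real_of_int (p * q)) V (frontier (droplet N \<sigma>))"
    and hd: "hausdorff_dist (droplet N \<sigma> \<inter> V) (\<Omega> \<inter> V) < ennreal \<epsilon>"
  defines "A0 \<equiv> \<bar>Re (g' t0)\<bar> / norm (g' t0)" and "B0 \<equiv> \<bar>Im (g' t0)\<bar> / norm (g' t0)"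
    and "A1 \<equiv> \<bar>Re (g' t1)\<bar> / norm (g' t1)" and "B1 \<equiv> \<bar>Im (g' t1)\<bar> / norm (g' t1)"
    and "\<kappa>0 \<equiv> real (corners (g a) (g t0) \<delta> N \<sigma>) / (\<delta> * real N)" and "\<kappa>1 \<equiv> real (corners (g a) (g t1) \<delta> N \<sigma>) / (\<delta> * real N)"
  shows "\<bar>2 * (\<Sum>x\<in>touched N (region (g a) (g t0) (g t1) r \<delta> \<delta>). weight (g a) (g t0) (g t1) r \<delta> N x * spin_drift \<sigma> x)
    - real_of_int (p * q) * ((A1 - B1) * \<kappa>1 + B1\<^sup>2 - (A0 - B0) * \<kappa>0 - B0\<^sup>2)\<bar> \<le> 4 * (100 * k + 3 * k * (32 * r / c + 1))"
proof -
  define s where "s = g a"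
  define x0 where "x0 = g t0"
  define x1 where "x1 = g t1"
  define \<sigma>' where "\<sigma>' = \<sigma> \<circ> reflect p q"
  define s' where "s' = mirrored p q s"
  define w where "w x = weight s x0 x1 r \<delta> N (reflect p q x)" for x
  define I where "I = {x. reflect p q x \<in> touched N (cball s r)}"
  note h = N(3)
  have kr: "k * r \<le> r / 100" using mult_right_mono[OF k(2), of r] r by simp
  have \<delta>r: "10000 * \<delta> \<le> r" using kr \<delta>(2) by linarith
  have "k\<^sup>2 * \<delta> \<le> 1 * \<delta>" using k(1,2) \<delta>(1) by (intro mult_right_mono) (auto simp: power_le_one)
  hence \<epsilon>\<delta>: "8 * \<epsilon> \<le> \<delta>" using \<epsilon>(2) by linarith
  have dense: "\<exists>d\<in>droplet N \<sigma> \<inter> V. dist b d < \<epsilon>" if "b \<in> \<Omega> \<inter> V" for b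
    using hausdorff_distD(2)[OF hd that] .
  have \<Omega>\<epsilon>: "\<exists>b\<in>\<Omega> \<inter> V. dist d b < \<epsilon>" if "d \<in> droplet N \<sigma> \<inter> V" for d
    using hausdorff_distD(1)[OF hd that] .
  have inV: "z \<in> V" if "norm (z - s) \<le> 6 * r" for z
  proof -
    have "norm (z - s) < R" using that \<eta> r by linarith
    hence "z \<in> ball s R" by (simp add: dist_norm norm_minus_commute)
    thus ?thesis using V by (auto simp: s_def)
  qed
  have G3: "descends \<sigma>' x" if "norm (site N x - s') \<le> 6 * r" for x
    unfolding \<sigma>'_def
  proof (rule descends_reflect[OF N(1) _ sl])
    show "ball s R \<subseteq> V" using V by (simp add: s_def)
    show "\<exists>d\<in>droplet N \<sigma> \<inter> V. dist b d < \<epsilon>" if "b \<in> \<Omega> \<inter> V" for b by (rule dense[OF that])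
    show "s - \<eta> *\<^sub>R Complex p q \<in> \<Omega>" using \<eta>(4) by (simp add: s_def)
    show "norm (site N x - mirrored p q s) \<le> \<eta> / 4" using that \<eta>(3) by (simp add: s'_def)
  qed (use \<eta> h \<epsilon>\<delta> \<delta>r r in linarith)+
  have G1: "\<exists>b\<in>\<Omega>. norm (mirrored p q (site N x) - b) < \<epsilon>"
    if "\<sigma> (reflect p q x)" "norm (site N x - s') \<le> 2 * r" for x
  proof -
    have "norm (site N (reflect p q x) - s) \<le> 2 * r" using that(2) by (simp add: s'_def norm_site_mirrored)
    hence "site N (reflect p q x) \<in> V" using r by (intro inV) linarith
    moreover have "site N (reflect p q x) \<in> droplet N \<sigma>" using that(1) by (simp add: droplet_eq[OF N(1)] site_of_site[OF N(1)])
    ultimately show ?thesis using \<Omega>\<epsilon>[of "site N (reflect p q x)"] by (auto simp: dist_norm site_reflect)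
  qed
  have G2: "\<sigma> (reflect p q x) \<and> \<sigma> (reflect p q (x + (1,0)))"
    if x: "norm (site N x - s') \<le> 2 * r" and b: "mirrored p q (site N x) + (2 * \<epsilon>) *\<^sub>R Complex p q \<in> \<Omega>" for x
  proof -
    have near: "descends (\<sigma> \<circ> reflect p q) y" if "norm (site N y - site N x) \<le> 8 * \<epsilon>" for y
    proof -
      have "norm (site N y - s') \<le> 8 * \<epsilon> + 2 * r"
        using norm_triangle_ineq[of "site N y - site N x" "site N x - s'"] that x by simp
      thus ?thesis using \<epsilon>\<delta> \<delta>r r by (intro G3[unfolded \<sigma>'_def]) linarith
    qed
    have "norm (Complex p q) \<le> 2" using cmod_le[of "Complex p q"] p q by auto
    hence "norm ((2 * \<epsilon>) *\<^sub>R Complex p q) \<le> 4 * \<epsilon>" using \<epsilon>(1) by simp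
    moreover have "norm (mirrored p q (site N x) - s) \<le> 2 * r"
      using x by (simp add: s'_def norm_site_mirrored site_reflect)
    ultimately have "norm (mirrored p q (site N x) + (2 * \<epsilon>) *\<^sub>R Complex p q - s) \<le> 2 * r + 4 * \<epsilon>"
      using norm_triangle_ineq[of "mirrored p q (site N x) - s" "(2 * \<epsilon>) *\<^sub>R Complex p q"] by (simp add: algebra_simps)
    hence "mirrored p q (site N x) + (2 * \<epsilon>) *\<^sub>R Complex p q \<in> V" using \<epsilon>\<delta> \<delta>r r by (intro inV) linarith
    hence b': "mirrored p q (site N x) + (2 * \<epsilon>) *\<^sub>R Complex p q \<in> \<Omega> \<inter> V" using b by blast
    show ?thesis using plus_behind_Omega[OF N(1) dense h near b'] by blast
  qed
  have sep: "8 * \<delta> \<le> norm (mirrored p q x0 - mirrored p q x1)" using \<delta>(5) by (simp add: mirrored_diff x0_def x1_def)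
  have w: "w x = 1 - (1 - of_bool (x \<in> I)) * (1 - ramp \<delta> (infdist (site N x - mirrored p q x0) (half_box N)))
        * (1 - ramp \<delta> (infdist (site N x - mirrored p q x1) (half_box N)))" for x
    unfolding w_def I_def by (rule weight_reflect[OF N(1)])
  have ramp0: "ramp \<delta> (infdist y (half_box N)) = 0" if "2 * \<delta> \<le> norm y" for y
  proof -
    obtain z where z: "z \<in> half_box N" "infdist y (half_box N) = dist y z"
      using infdist_attains_inf[OF compact_imp_closed[OF half_box(1)[OF N(1)]], of y] half_box(2)[OF N(1)] by blast
    have "norm z \<le> 1 / real N" using half_box(3)[OF N(1)] z(1) by auto
    hence "\<delta> \<le> infdist y (half_box N)"
      using norm_triangle_ineq2[of y z] that h \<epsilon>\<delta> \<delta>(1) unfolding z(2) dist_norm by linarith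
    thus ?thesis using \<delta>(1) by (simp add: ramp_def)
  qed
  have w0: "w x = (if reflect p q x \<in> touched N (cball s r) then 1 else ramp \<delta> (infdist (site N x - mirrored p q x0) (half_box N)))"
    if "norm (site N x - mirrored p q x0) \<le> 3 * \<delta>" for x
  proof -
    have "2 * \<delta> \<le> norm (site N x - mirrored p q x1)"
      using norm_triangle_ineq4[of "site N x - mirrored p q x1" "site N x - mirrored p q x0"] that sep \<delta>(1) by simp
    from ramp0[OF this] show ?thesis unfolding w by (simp add: I_def)
  qed
  have w1: "w x = (if reflect p q x \<in> touched N (cball s r) then 1 else ramp \<delta> (infdist (site N x - mirrored p q x1) (half_box N)))"
    if "norm (site N x - mirrored p q x1) \<le> 3 * \<delta>" for x
  proof -
    have "2 * \<delta> \<le> norm (site N x - mirrored p q x0)"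
      using norm_triangle_ineq4[of "site N x - mirrored p q x1" "site N x - mirrored p q x0"] that sep \<delta>(1) by simp
    from ramp0[OF this] show ?thesis unfolding w by (simp add: I_def)
  qed
  have G3': "descends (\<sigma> \<circ> reflect p q) x" if "norm (site N x - mirrored p q s) \<le> 2 * r" for x
    using G3[of x] that r by (simp add: \<sigma>'_def s'_def)
  have E0: "staircase_end N \<sigma>' (mirrored p q x0) s' r \<delta> k A0 B0 (real_of_int (p * q)) c I (half_box N) w"
  proof -
    have "staircase_end N (\<sigma> \<circ> reflect p q) (mirrored p q (g t0)) (mirrored p q s) r \<delta> k
      (\<bar>Re (g' t0)\<bar> / norm (g' t0)) (\<bar>Im (g' t0)\<bar> / norm (g' t0)) (- (-1::real) * p * q) c
      {x. reflect p q x \<in> touched N (cball s r)} (half_box N) w"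
    proof (rule end_instance[where \<rho> = \<rho> and \<epsilon> = \<epsilon>])
      show "norm (g t0 - s) = r" using ends by (simp add: s_def)
      show "r / 2 * norm (g' t0) \<le> - 1 * Re ((g t0 - s) * cnj (g' t0))" using radial0 unfolding s_def by linarith
      show "c \<le> - (- 1 :: real) * q * Re (g t0 - s)" "c \<le> (- 1 :: real) * p * Im (g t0 - s)" using c(1,2) by (simp_all add: s_def)
      show "\<exists>b\<in>\<Omega>. norm (mirrored p q (site N x) - b) < \<epsilon>" if "\<sigma> (reflect p q x)" "norm (site N x - mirrored p q s) \<le> 2 * r" for x
        using G1[OF that(1)] that(2) unfolding s'_def by blast
      show "\<sigma> (reflect p q x)" if "norm (site N x - mirrored p q s) \<le> 2 * r" "mirrored p q (site N x) + (2 * \<epsilon>) *\<^sub>R Complex p q \<in> \<Omega>" for x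
        using G2[OF _ that(2)] that(1) unfolding s'_def by blast
      show "w x = (if reflect p q x \<in> touched N (cball s r) then 1 else ramp \<delta> (infdist (site N x - mirrored p q (g t0)) (half_box N)))"
        if "norm (site N x - mirrored p q (g t0)) \<le> 3 * \<delta>" for x using w0 that unfolding x0_def by blast
      show "(-1::real) = 1 \<or> (-1::real) = -1" by simp
      show "g t0 + v \<in> inside (range g)" if "norm v < \<rho>" "Im (v * cnj (g' t0)) > k\<^sup>2/8 * norm v * norm (g' t0)" for v
        by (rule sides(1)[OF _ that]) simp
      show "g t0 + v \<in> outside (range g)" if "norm v < \<rho>" "Im (v * cnj (g' t0)) < - (k\<^sup>2/8 * norm v * norm (g' t0))" for v
        by (rule sides(2)[OF _ that]) simp
      show "descends (\<sigma> \<circ> reflect p q) x" if "norm (site N x - mirrored p q s) \<le> 2 * r" for x by (rule G3'[OF that])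
    qed (rule N(1,2) quad0 k(1-3) \<delta>(1-4) \<epsilon>(1,2))+
    thus ?thesis unfolding \<sigma>'_def x0_def s'_def A0_def B0_def I_def by simp
  qed
  have E1: "staircase_end N \<sigma>' (mirrored p q x1) s' r \<delta> k A1 B1 (- real_of_int (p * q)) c I (half_box N) w"
  proof -
    have "staircase_end N (\<sigma> \<circ> reflect p q) (mirrored p q (g t1)) (mirrored p q s) r \<delta> k
      (\<bar>Re (g' t1)\<bar> / norm (g' t1)) (\<bar>Im (g' t1)\<bar> / norm (g' t1)) (- (1::real) * p * q) c
      {x. reflect p q x \<in> touched N (cball s r)} (half_box N) w"
    proof (rule end_instance[where \<rho> = \<rho> and \<epsilon> = \<epsilon>])
      show "norm (g t1 - s) = r" using ends by (simp add: s_def)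
      show "r / 2 * norm (g' t1) \<le> 1 * Re ((g t1 - s) * cnj (g' t1))" using radial1 unfolding s_def by linarith
      show "c \<le> - (1 :: real) * q * Re (g t1 - s)" "c \<le> (1 :: real) * p * Im (g t1 - s)" using c(3,4) by (simp_all add: s_def)
      show "\<exists>b\<in>\<Omega>. norm (mirrored p q (site N x) - b) < \<epsilon>" if "\<sigma> (reflect p q x)" "norm (site N x - mirrored p q s) \<le> 2 * r" for x
        using G1[OF that(1)] that(2) unfolding s'_def by blast
      show "\<sigma> (reflect p q x)" if "norm (site N x - mirrored p q s) \<le> 2 * r" "mirrored p q (site N x) + (2 * \<epsilon>) *\<^sub>R Complex p q \<in> \<Omega>" for x
        using G2[OF _ that(2)] that(1) unfolding s'_def by blast
      show "w x = (if reflect p q x \<in> touched N (cball s r) then 1 else ramp \<delta> (infdist (site N x - mirrored p q (g t1)) (half_box N)))"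
        if "norm (site N x - mirrored p q (g t1)) \<le> 3 * \<delta>" for x using w1 that unfolding x1_def by blast
      show "(1::real) = 1 \<or> (1::real) = -1" by simp
      show "g t1 + v \<in> inside (range g)" if "norm v < \<rho>" "Im (v * cnj (g' t1)) > k\<^sup>2/8 * norm v * norm (g' t1)" for v
        by (rule sides(1)[OF _ that]) simp
      show "g t1 + v \<in> outside (range g)" if "norm v < \<rho>" "Im (v * cnj (g' t1)) < - (k\<^sup>2/8 * norm v * norm (g' t1))" for v
        by (rule sides(2)[OF _ that]) simp
      show "descends (\<sigma> \<circ> reflect p q) x" if "norm (site N x - mirrored p q s) \<le> 2 * r" for x by (rule G3'[OF that])
    qed (rule N(1,2) quad1 k(1,2,4) \<delta>(1-4) \<epsilon>(1,2))+
    thus ?thesis unfolding \<sigma>'_def x1_def s'_def A1_def B1_def I_def by simp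
  qed
  have circle: "norm (site N x - mirrored p q x0) < 2 * \<delta> \<or> norm (site N x - mirrored p q x1) < 2 * \<delta>"
    if edge: "vertical_edge \<sigma>' x" and near: "\<bar>norm (site N x - s') - r\<bar> \<le> 4 / real N" for x
  proof (rule ccontr)
    assume "\<not> ?thesis"
    hence far: "2 * \<delta> \<le> norm (site N x - mirrored p q x0)" "2 * \<delta> \<le> norm (site N x - mirrored p q x1)" by auto
    define z where "z = mirrored p q (site N x)"
    have z: "norm (z - g t0) \<ge> 2 * \<delta>" "norm (z - g t1) \<ge> 2 * \<delta>" "\<bar>norm (z - s) - r\<bar> \<le> 4 / real N"
      using far near by (simp_all add: z_def x0_def x1_def s'_def norm_site_mirrored site_reflect)
    have four: "4 / real N \<le> 4 * \<epsilon>" using h by simp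
    have nz: "norm (z - s) > 0" using z(3) four \<epsilon>\<delta> \<delta>r r \<delta>(1) by linarith
    \<comment> \<open>The radial projection of \<open>z\<close> to the circle: the curve does not meet a ball around it, which
      is then inside, against the minus spin, or outside, against the plus spin.\<close>
    define y where "y = s + (r / norm (z - s)) *\<^sub>R (z - s)"
    have yr: "norm (y - g a) = r" using nz r by (simp add: y_def s_def)
    have "z - y = (1 - r / norm (z - s)) *\<^sub>R (z - s)" by (simp add: y_def algebra_simps)
    hence "norm (z - y) = \<bar>(1 - r / norm (z - s)) * norm (z - s)\<bar>" by (simp add: abs_mult)
    also have "(1 - r / norm (z - s)) * norm (z - s) = norm (z - s) - r" using nz by (simp add: left_diff_distrib)
    finally have zy: "norm (z - y) \<le> 4 * \<epsilon>" using z(3) four by linarith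
    have "\<delta> \<le> norm (y - g t0)" "\<delta> \<le> norm (y - g t1)"
      using norm_triangle_ineq[of "z - y" "y - g t0"] norm_triangle_ineq[of "z - y" "y - g t1"] z(1,2) zy \<epsilon>\<delta> \<delta>(1) by simp_all
    from gap[OF yr this] have disj: "ball y \<rho>' \<inter> range g = {}" .
    have comp: "connected_component (- range g) u v" if "u \<in> ball y \<rho>'" "v \<in> ball y \<rho>'" for u v
      unfolding connected_component_def
      by (rule exI[of _ "ball y \<rho>'"]) (use that disj in auto)
    have inb: "v \<in> ball y \<rho>'" if "norm (v - z) \<le> 4 * \<epsilon>" for v
      using norm_triangle_ineq[of "v - z" "z - y"] that zy \<epsilon> by (simp add: dist_norm norm_minus_commute)
    have zb: "z \<in> ball y \<rho>'" by (rule inb) (use \<epsilon> in simp)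
    have near2: "norm (site N x - s') \<le> 2 * r" using near four \<epsilon>\<delta> \<delta>r r by linarith
    have plus: "\<sigma> (reflect p q x)" and minus: "\<not> \<sigma> (reflect p q (x + (1,0)))"
      using edge by (simp_all add: vertical_edge_def \<sigma>'_def)
    have "z \<in> inside (range g) \<or> z \<in> outside (range g)"
      using zb disj inside_Un_outside[of "range g"] by blast
    thus False
    proof
      assume "z \<in> inside (range g)"
      have "norm (Complex p q) \<le> 2" using cmod_le[of "Complex p q"] p q by auto
      hence "norm ((2 * \<epsilon>) *\<^sub>R Complex p q) \<le> 4 * \<epsilon>" using \<epsilon>(1) by simp
      hence "z + (2 * \<epsilon>) *\<^sub>R Complex p q \<in> ball y \<rho>'" by (intro inb) simp
      from inside_same_component[OF comp[OF zb this] \<open>z \<in> inside (range g)\<close>]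
      have "mirrored p q (site N x) + (2 * \<epsilon>) *\<^sub>R Complex p q \<in> \<Omega>" by (simp add: z_def)
      from G2[OF near2 this] minus show False by blast
    next
      assume out: "z \<in> outside (range g)"
      obtain b where b: "b \<in> \<Omega>" "norm (z - b) < \<epsilon>" using G1[OF plus near2] by (auto simp: z_def)
      have "b \<in> ball y \<rho>'" using b(2) \<epsilon>(1) by (intro inb) (simp add: norm_minus_commute)
      from outside_same_component[OF comp[OF zb this] out] show False using b(1) outside_not_\<Omega> by blast
    qed
  qed
  define T where "T = {x. norm (site N x - s') \<le> 2 * r}"
  have J: "norm (site N y - mirrored p q x) \<le> \<delta> \<Longrightarrow> y \<in> {y. reflect p q y \<in> touched N (cball x \<delta>)}"
    "y \<in> {y. reflect p q y \<in> touched N (cball x \<delta>)} \<Longrightarrow> norm (site N y - mirrored p q x) \<le> \<delta> + 1 / real N" for x y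
    using touched_cball[OF N(1), of "reflect p q y" x \<delta>] by (simp_all add: norm_site_mirrored)
  have desc3: "descends \<sigma>' x" if "norm (site N x - s') \<le> 3 * r" for x using G3[of x] that r by simp
  note total = staircase_total[OF E0 E1 sep desc3 w circle J[of _ x0] J[of _ x1], folded T_def]
  have corn: "card {y \<in> {y. reflect p q y \<in> touched N (cball x \<delta>)}. norm (site N y - s') > r \<and> \<sigma>' y \<and> opposite \<sigma>' y = 2} = corners s x \<delta> N \<sigma>"
    if "norm (x - s) = r" for x unfolding s'_def \<sigma>'_def by (rule corners_reflect[OF N(1) that])
  have main: "\<bar>2 * (\<Sum>x\<in>T. w x * spin_drift \<sigma>' x) - real_of_int (p * q) * ((A1 - B1) * \<kappa>1 + B1\<^sup>2 - (A0 - B0) * \<kappa>0 - B0\<^sup>2)\<bar>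
     \<le> 4 * (100 * k + 3 * k * (32 * r / c + 1))"
    using total(2) ends unfolding s_def[symmetric] x0_def[symmetric] x1_def[symmetric]
    by (simp only: corn \<kappa>0_def \<kappa>1_def s_def[symmetric] x0_def[symmetric] x1_def[symmetric])
  let ?f = "\<lambda>x. weight s x0 x1 r \<delta> N x * spin_drift \<sigma> x"
  have inj: "inj_on (reflect p q) T" using bij_reflect by (auto simp: bij_def inj_on_def)
  have finT: "finite T"
  proof (rule finite_subset)
    show "T \<subseteq> touched N (cball s' (2 * r))" using touched_cball(1)[OF N(1)] by (auto simp: T_def)
    show "finite (touched N (cball s' (2 * r)))" by (rule finite_touched[OF N(1)]) simp
  qed
  have fin: "finite (touched N (region s x0 x1 r \<delta> \<delta>))" by (rule finite_touched[OF N(1) bounded_region])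
  have "(\<Sum>x\<in>T. w x * spin_drift \<sigma>' x) = (\<Sum>x\<in>T. ?f (reflect p q x))"
    by (simp add: w_def \<sigma>'_def spin_drift_reflect)
  also have "\<dots> = sum ?f (reflect p q ` T)" by (simp add: sum.reindex[OF inj] o_def)
  also have "\<dots> = sum ?f (reflect p q ` T \<union> touched N (region s x0 x1 r \<delta> \<delta>))"
  proof (rule sum.mono_neutral_left)
    show "\<forall>x\<in>reflect p q ` T \<union> touched N (region s x0 x1 r \<delta> \<delta>) - reflect p q ` T. ?f x = 0"
    proof
      fix x assume x: "x \<in> reflect p q ` T \<union> touched N (region s x0 x1 r \<delta> \<delta>) - reflect p q ` T"
      have "reflect p q x \<notin> T"
      proof
        assume "reflect p q x \<in> T"
        hence "reflect p q (reflect p q x) \<in> reflect p q ` T" by (rule imageI)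
        thus False using x by simp
      qed
      hence "w (reflect p q x) = 0" using total(1)[of "reflect p q x"] by blast
      thus "?f x = 0" by (simp add: w_def)
    qed
  qed (use finT fin in auto)
  also have "\<dots> = sum ?f (touched N (region s x0 x1 r \<delta> \<delta>))"
  proof (rule sum.mono_neutral_right)
    show "\<forall>x\<in>reflect p q ` T \<union> touched N (region s x0 x1 r \<delta> \<delta>) - touched N (region s x0 x1 r \<delta> \<delta>). ?f x = 0"
    proof
      fix x assume "x \<in> reflect p q ` T \<union> touched N (region s x0 x1 r \<delta> \<delta>) - touched N (region s x0 x1 r \<delta> \<delta>)"
      hence "x \<notin> touched N (region s x0 x1 r \<delta> \<delta>)" by simp
      hence "weight s x0 x1 r \<delta> N x = 0" using weight_touched[OF N(1) \<delta>(1), of s x0 x1 r x] by blast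
      thus "?f x = 0" by simp
    qed
  qed (use finT fin in auto)
  finally show ?thesis using main unfolding s_def x0_def x1_def by simp
qed

text \<open>The parameters are chosen in the order \<open>k\<close>, \<open>\<delta>\<close>, \<open>\<epsilon>\<close>, \<open>N\<close>: first \<open>k\<close> so small that the error of
  \<open>pathwise_bound\<close> is below \<open>e\<close>, then \<open>\<delta>\<close> for which the curve is within its cones, then \<open>\<epsilon>\<close> below the
  distance between the curve and the rest of the circle.\<close>
lemma pathwise:
  assumes V: "ball (g a) R \<subseteq> V" and \<eta>: "0 < \<eta>" "2 * \<eta> \<le> R" "24 * r \<le> \<eta>" "g a - \<eta> *\<^sub>R Complex p q \<in> \<Omega>" and r: "0 < r"
    and ends: "norm (g t0 - g a) = r" "norm (g t1 - g a) = r" "g t0 \<noteq> g t1" "sphere (g a) r \<inter> range g = {g t0, g t1}"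
    and quad0: "0 < - q * Re (g' t0)" "0 < p * Im (g' t0)" and quad1: "0 < - q * Re (g' t1)" "0 < p * Im (g' t1)"
    and radial0: "r / 2 * norm (g' t0) \<le> - Re ((g t0 - g a) * cnj (g' t0))"
    and radial1: "r / 2 * norm (g' t1) \<le> Re ((g t1 - g a) * cnj (g' t1))"
    and dir: "0 < q * Re (g t0 - g a)" "0 < - p * Im (g t0 - g a)" "0 < - q * Re (g t1 - g a)" "0 < p * Im (g t1 - g a)"
    and e: "0 < e"
  defines "A0 \<equiv> \<bar>Re (g' t0)\<bar> / norm (g' t0)" and "B0 \<equiv> \<bar>Im (g' t0)\<bar> / norm (g' t0)"
    and "A1 \<equiv> \<bar>Re (g' t1)\<bar> / norm (g' t1)" and "B1 \<equiv> \<bar>Im (g' t1)\<bar> / norm (g' t1)"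
  obtains \<delta>0 where "\<delta>0 > 0" "\<And>\<delta>. 0 < \<delta> \<Longrightarrow> \<delta> < \<delta>0 \<Longrightarrow> \<exists>\<epsilon>>0. \<exists>N0. \<forall>N\<ge>N0. \<forall>\<sigma>.
      sloped (real_of_int (p * q)) V (frontier (droplet N \<sigma>)) \<longrightarrow>
      hausdorff_dist (droplet N \<sigma> \<inter> V) (\<Omega> \<inter> V) < ennreal \<epsilon> \<longrightarrow>
      \<bar>(\<Sum>x\<in>touched N (region (g a) (g t0) (g t1) r \<delta> \<delta>). weight (g a) (g t0) (g t1) r \<delta> N x * spin_drift \<sigma> x)
        - real_of_int (p * q) / 2 * ((A1 - B1) * (real (corners (g a) (g t1) \<delta> N \<sigma>) / (\<delta> * real N)) + B1\<^sup>2
            - (A0 - B0) * (real (corners (g a) (g t0) \<delta> N \<sigma>) / (\<delta> * real N)) - B0\<^sup>2)\<bar> \<le> e"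
proof -
  define c where "c = min (min (q * Re (g t0 - g a)) (- p * Im (g t0 - g a))) (min (- q * Re (g t1 - g a)) (p * Im (g t1 - g a)))"
  have c0: "0 < c" using dir by (simp add: c_def)
  have c: "c \<le> q * Re (g t0 - g a)" "c \<le> - p * Im (g t0 - g a)" "c \<le> - q * Re (g t1 - g a)" "c \<le> p * Im (g t1 - g a)"
    unfolding c_def by linarith+
  define K where "K = 32 * r / c + 1"
  have K: "K > 0" using r c0 by (simp add: K_def add_pos_pos)
  define k where "k = min (min (1/100) (e / (2 * (100 + 3 * K)))) (min (B0 / 100) (B1 / 100))"
  have "B0 > 0" "B1 > 0" using quad0(2) quad1(2) nz[of t0] nz[of t1] by (auto simp: B0_def B1_def intro!: divide_pos_pos)
  hence k0: "0 < k" using e K by (simp add: k_def)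
  have k: "k \<le> 1/100" "k \<le> e / (2 * (100 + 3 * K))" "k \<le> B0 / 100" "k \<le> B1 / 100" unfolding k_def by linarith+
  have kK: "4 * (100 * k + 3 * k * K) \<le> 2 * e"
  proof -
    have "k * (2 * (100 + 3 * K)) \<le> e" using k(2) K by (simp add: pos_le_divide_eq)
    thus ?thesis by (simp add: algebra_simps)
  qed
  have "k\<^sup>2/8 > 0" using k0 by simp
  from local_sides[OF this, of t0] obtain \<rho>0 where \<rho>0: "\<rho>0 > 0"
    "\<And>v. norm v < \<rho>0 \<Longrightarrow> Im (v * cnj (g' t0)) > k\<^sup>2/8 * norm v * norm (g' t0) \<Longrightarrow> g t0 + v \<in> inside (range g)"
    "\<And>v. norm v < \<rho>0 \<Longrightarrow> Im (v * cnj (g' t0)) < - (k\<^sup>2/8 * norm v * norm (g' t0)) \<Longrightarrow> g t0 + v \<in> outside (range g)" by metis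
  from local_sides[OF \<open>k\<^sup>2/8 > 0\<close>, of t1] obtain \<rho>1 where \<rho>1: "\<rho>1 > 0"
    "\<And>v. norm v < \<rho>1 \<Longrightarrow> Im (v * cnj (g' t1)) > k\<^sup>2/8 * norm v * norm (g' t1) \<Longrightarrow> g t1 + v \<in> inside (range g)"
    "\<And>v. norm v < \<rho>1 \<Longrightarrow> Im (v * cnj (g' t1)) < - (k\<^sup>2/8 * norm v * norm (g' t1)) \<Longrightarrow> g t1 + v \<in> outside (range g)" by metis
  define \<rho> where "\<rho> = min \<rho>0 \<rho>1"
  have \<rho>: "\<rho> > 0" "\<rho> \<le> \<rho>0" "\<rho> \<le> \<rho>1" using \<rho>0(1) \<rho>1(1) by (simp_all add: \<rho>_def)
  have sides: "g t + v \<in> inside (range g)" if "t \<in> {t0, t1}" "norm v < \<rho>" "Im (v * cnj (g' t)) > k\<^sup>2/8 * norm v * norm (g' t)" for t v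
    using that(1)
  proof (elim insertE emptyE)
    assume t: "t = t0"
    have "norm v < \<rho>0" using that(2) \<rho> by linarith
    from \<rho>0(2)[OF this that(3)[unfolded t]] show ?thesis unfolding t .
  next
    assume t: "t = t1"
    have "norm v < \<rho>1" using that(2) \<rho> by linarith
    from \<rho>1(2)[OF this that(3)[unfolded t]] show ?thesis unfolding t .
  qed
  have sides': "g t + v \<in> outside (range g)" if "t \<in> {t0, t1}" "norm v < \<rho>" "Im (v * cnj (g' t)) < - (k\<^sup>2/8 * norm v * norm (g' t))" for t v
    using that(1)
  proof (elim insertE emptyE)
    assume t: "t = t0"
    have "norm v < \<rho>0" using that(2) \<rho> by linarith
    from \<rho>0(3)[OF this that(3)[unfolded t]] show ?thesis unfolding t .
  next
    assume t: "t = t1"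
    have "norm v < \<rho>1" using that(2) \<rho> by linarith
    from \<rho>1(3)[OF this that(3)[unfolded t]] show ?thesis unfolding t .
  qed
  define \<delta>0 where "\<delta>0 = min (min (k * r / 100) (c / 8)) (min (\<rho> / 4) (norm (g t0 - g t1) / 8))"
  have n01: "norm (g t0 - g t1) > 0" using ends(3) by simp
  have \<delta>0: "\<delta>0 > 0" using k0 r c0 \<rho>(1) n01 by (simp add: \<delta>0_def)
  have main: "\<exists>\<epsilon>>0. \<exists>N0. \<forall>N\<ge>N0. \<forall>\<sigma>.
      sloped (real_of_int (p * q)) V (frontier (droplet N \<sigma>)) \<longrightarrow>
      hausdorff_dist (droplet N \<sigma> \<inter> V) (\<Omega> \<inter> V) < ennreal \<epsilon> \<longrightarrow>
      \<bar>(\<Sum>x\<in>touched N (region (g a) (g t0) (g t1) r \<delta> \<delta>). weight (g a) (g t0) (g t1) r \<delta> N x * spin_drift \<sigma> x)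
        - real_of_int (p * q) / 2 * ((A1 - B1) * (real (corners (g a) (g t1) \<delta> N \<sigma>) / (\<delta> * real N)) + B1\<^sup>2
            - (A0 - B0) * (real (corners (g a) (g t0) \<delta> N \<sigma>) / (\<delta> * real N)) - B0\<^sup>2)\<bar> \<le> e"
    if \<delta>: "0 < \<delta>" "\<delta> < \<delta>0" for \<delta>
  proof -
    have \<delta>': "\<delta> \<le> k * r / 100" "8 * \<delta> \<le> c" "4 * \<delta> < \<rho>" "8 * \<delta> \<le> norm (g t0 - g t1)"
      using \<delta>(2) unfolding \<delta>0_def by linarith+
    define S where "S = sphere (g a) r \<inter> {z. \<delta> \<le> norm (z - g t0)} \<inter> {z. \<delta> \<le> norm (z - g t1)}"
    have "closed {z. \<delta> \<le> norm (z - u)}" for u :: complex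
      by (intro closed_Collect_le continuous_intros)
    hence "compact S" unfolding S_def by (intro compact_Int_closed compact_sphere)
    moreover have "closed (range g)"
      using compact_path_image[OF continuous_path] unfolding path_image_eq by (rule compact_imp_closed)
    moreover have "S \<inter> range g = {}"
    proof -
      have "z \<notin> range g" if "z \<in> S" for z
      proof
        assume "z \<in> range g"
        hence "z \<in> {g t0, g t1}" using that unfolding S_def ends(4)[symmetric] by blast
        thus False using that \<delta>(1) by (auto simp: S_def)
      qed
      thus ?thesis by blast
    qed
    ultimately obtain \<rho>' where \<rho>': "\<rho>' > 0" "\<And>x y. x \<in> S \<Longrightarrow> y \<in> range g \<Longrightarrow> \<rho>' \<le> dist x y"
      using separate_compact_closed[of S "range g"] by metis
    have gap: "ball z \<rho>' \<inter> range g = {}" if "norm (z - g a) = r" "\<delta> \<le> norm (z - g t0)" "\<delta> \<le> norm (z - g t1)" for z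
    proof -
      have "z \<in> S" using that by (simp add: S_def dist_norm norm_minus_commute)
      thus ?thesis using \<rho>'(2)[of z] by (force simp: not_le[symmetric])
    qed
    define \<epsilon> where "\<epsilon> = min (k\<^sup>2 * \<delta> / 8) (\<rho>' / 16)"
    have \<epsilon>: "0 < \<epsilon>" "8 * \<epsilon> \<le> k\<^sup>2 * \<delta>" "16 * \<epsilon> \<le> \<rho>'"
    proof -
      show "0 < \<epsilon>" using k0 \<delta>(1) \<rho>'(1) by (simp add: \<epsilon>_def)
      show "8 * \<epsilon> \<le> k\<^sup>2 * \<delta>" "16 * \<epsilon> \<le> \<rho>'" unfolding \<epsilon>_def by linarith+
    qed
    define N0 where "N0 = nat \<lceil>1 / \<epsilon>\<rceil> + nat \<lceil>100 / (k\<^sup>2 * \<delta>)\<rceil> + 1"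
    have N: "1 \<le> N" "100 \<le> k\<^sup>2 * \<delta> * real N" "1 / real N \<le> \<epsilon>" if "N \<ge> N0" for N
    proof -
      show N1: "1 \<le> N" using that by (simp add: N0_def)
      have kd: "0 < k\<^sup>2 * \<delta>" using k0 \<delta>(1) by simp
      have "100 / (k\<^sup>2 * \<delta>) \<le> real N" using that unfolding N0_def by linarith
      thus "100 \<le> k\<^sup>2 * \<delta> * real N" using kd by (simp add: pos_divide_le_eq mult.commute)
      have "1 / \<epsilon> \<le> real N" using that unfolding N0_def by linarith
      thus "1 / real N \<le> \<epsilon>" using \<epsilon>(1) N1 by (simp add: field_simps)
    qed
    show ?thesis
    proof (intro exI[of _ \<epsilon>] conjI \<epsilon>(1) exI[of _ N0] allI impI)
      fix N \<sigma>
      assume N0: "N0 \<le> N" and sl: "sloped (real_of_int (p * q)) V (frontier (droplet N \<sigma>))"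
        and hd: "hausdorff_dist (droplet N \<sigma> \<inter> V) (\<Omega> \<inter> V) < ennreal \<epsilon>"
      note b = pathwise_bound[OF V \<eta> r ends(1,2) quad0 quad1 radial0 radial1 k0 k(1) k(3)[unfolded B0_def] k(4)[unfolded B1_def] c
        \<delta>(1) \<delta>' sides sides' gap \<epsilon> N[OF N0] sl hd]
      define S where "S = (\<Sum>x\<in>touched N (region (g a) (g t0) (g t1) r \<delta> \<delta>). weight (g a) (g t0) (g t1) r \<delta> N x * spin_drift \<sigma> x)"
      define Z where "Z = (A1 - B1) * (real (corners (g a) (g t1) \<delta> N \<sigma>) / (\<delta> * real N)) + B1\<^sup>2
            - (A0 - B0) * (real (corners (g a) (g t0) \<delta> N \<sigma>) / (\<delta> * real N)) - B0\<^sup>2"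
      have "\<bar>2 * S - real_of_int (p * q) * Z\<bar> \<le> 4 * (100 * k + 3 * k * (32 * r / c + 1))"
        using b unfolding S_def Z_def A0_def A1_def B0_def B1_def .
      also have "\<dots> \<le> 2 * e" using kK unfolding K_def .
      finally have "\<bar>S - real_of_int (p * q) / 2 * Z\<bar> \<le> e" by linarith
      thus "\<bar>(\<Sum>x\<in>touched N (region (g a) (g t0) (g t1) r \<delta> \<delta>). weight (g a) (g t0) (g t1) r \<delta> N x * spin_drift \<sigma> x)
        - real_of_int (p * q) / 2 * ((A1 - B1) * (real (corners (g a) (g t1) \<delta> N \<sigma>) / (\<delta> * real N)) + B1\<^sup>2
            - (A0 - B0) * (real (corners (g a) (g t0) \<delta> N \<sigma>) / (\<delta> * real N)) - B0\<^sup>2)\<bar> \<le> e"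
        unfolding S_def Z_def .
    qed
  qed
  show thesis by (rule that[OF \<delta>0 main])
qed

end

section \<open>Expectations and limits\<close>

text \<open>On the bad event \<open>Z\<close> is bounded, and \<open>Y\<close> is split at the level \<open>K\<close>: the part above \<open>K\<close> is controlled
  by uniform integrability, the part below by the probability of the event.\<close>
lemma expectation_close:
  fixes Y Z :: "'a \<Rightarrow> real"
  assumes M: "prob_space M" and int: "integrable M Y" "integrable M Z" and bad: "bad \<in> sets M"
    and Z: "AE x in M. \<bar>Z x\<bar> \<le> B" and close: "AE x in M. x \<notin> bad \<longrightarrow> \<bar>Y x - Z x\<bar> \<le> e" and e: "0 \<le> e"
    and ui: "(\<integral>\<^sup>+x. ennreal (\<bar>Y x\<bar> * indicator {x. \<bar>Y x\<bar> > K} x) \<partial>M) \<le> ennreal e"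
    and small: "(max K 0 + B) * measure M bad \<le> e"
  shows "\<bar>(\<integral>x. Y x \<partial>M) - (\<integral>x. Z x \<partial>M)\<bar> \<le> 3 * e"
proof -
  interpret prob_space M by fact
  define W where "W x = \<bar>Y x\<bar> * indicator {x. \<bar>Y x\<bar> > K} x" for x
  have Y: "Y \<in> borel_measurable M" using int(1) by simp
  have mW: "W \<in> borel_measurable M" unfolding W_def[abs_def] indicator_def using Y by measurable
  have intW: "integrable M W"
    by (rule Bochner_Integration.integrable_bound[OF int(1) mW]) (auto simp: W_def indicator_def)
  have "ennreal (\<integral>x. W x \<partial>M) = (\<integral>\<^sup>+x. ennreal (W x) \<partial>M)"
    by (rule nn_integral_eq_integral[symmetric, OF intW]) (simp add: W_def)
  also have "\<dots> \<le> ennreal e" using ui unfolding W_def .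
  finally have W: "(\<integral>x. W x \<partial>M) \<le> e" using e by (simp add: ennreal_le_iff)
  have intb: "integrable M (\<lambda>x. (max K 0 + B) * indicator bad x)" using bad by (simp add: integrable_real_indicator emeasure_eq_measure)
  have "\<bar>(\<integral>x. Y x \<partial>M) - (\<integral>x. Z x \<partial>M)\<bar> = \<bar>\<integral>x. Y x - Z x \<partial>M\<bar>"
    using int by simp
  also have "\<dots> \<le> (\<integral>x. \<bar>Y x - Z x\<bar> \<partial>M)" by (rule integral_abs_bound)
  also have "\<dots> \<le> (\<integral>x. e + W x + (max K 0 + B) * indicator bad x \<partial>M)"
  proof (rule integral_mono_AE)
    show "integrable M (\<lambda>x. \<bar>Y x - Z x\<bar>)" using int by simp
    show "integrable M (\<lambda>x. e + W x + (max K 0 + B) * indicator bad x)" using intW intb by simp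
    show "AE x in M. \<bar>Y x - Z x\<bar> \<le> e + W x + (max K 0 + B) * indicator bad x"
      using Z close
    proof eventually_elim
      case (elim x)
      show ?case
      proof (cases "x \<in> bad")
        case True
        have "\<bar>Y x - Z x\<bar> \<le> \<bar>Y x\<bar> + \<bar>Z x\<bar>" by (rule abs_triangle_ineq4)
        moreover have "\<bar>Y x\<bar> \<le> W x + max K 0" by (auto simp: W_def indicator_def)
        ultimately show ?thesis using True elim(1) e by simp
      next
        case False
        have "0 \<le> W x" by (simp add: W_def)
        thus ?thesis using False elim(2) by simp
      qed
    qed
  qed
  also have "\<dots> = e + (\<integral>x. W x \<partial>M) + (max K 0 + B) * measure M bad"
    using intW intb bad by (simp add: prob_space)
  finally show ?thesis using W small by linarith
qed

lemma tendsto_liminf_limsup: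
  fixes f :: "real \<Rightarrow> nat \<Rightarrow> real"
  assumes "\<And>e. e > 0 \<Longrightarrow> \<forall>\<^sub>F \<delta> in at_right 0. \<forall>\<^sub>F N in sequentially. \<bar>f \<delta> N - L\<bar> \<le> e"
  shows "((\<lambda>\<delta>. liminf (\<lambda>N. ereal (f \<delta> N))) \<longlongrightarrow> ereal L) (at_right 0)"
    and "((\<lambda>\<delta>. limsup (\<lambda>N. ereal (f \<delta> N))) \<longlongrightarrow> ereal L) (at_right 0)"
proof -
  have both: "\<forall>\<^sub>F \<delta> in at_right 0. ereal (L - e) \<le> liminf (\<lambda>N. ereal (f \<delta> N)) \<and> limsup (\<lambda>N. ereal (f \<delta> N)) \<le> ereal (L + e)"
    if "e > 0" for e
    using assms[OF that]
  proof eventually_elim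
    case (elim \<delta>)
    have "ereal (L - e) \<le> liminf (\<lambda>N. ereal (f \<delta> N))"
      by (rule Liminf_bounded) (use elim in \<open>auto elim!: eventually_mono simp: abs_le_iff\<close>)
    moreover have "limsup (\<lambda>N. ereal (f \<delta> N)) \<le> ereal (L + e)"
      by (rule Limsup_bounded) (use elim in \<open>auto elim!: eventually_mono simp: abs_le_iff\<close>)
    ultimately show ?case ..
  qed
  have le: "liminf (\<lambda>N. ereal (f \<delta> N)) \<le> limsup (\<lambda>N. ereal (f \<delta> N))" for \<delta>
    by (rule Liminf_le_Limsup) simp
  have lo: "\<forall>\<^sub>F \<delta> in at_right 0. y < liminf (\<lambda>N. ereal (f \<delta> N))" if y: "y < ereal L" for y
  proof -
    obtain z where z: "y < ereal z" "ereal z < ereal L" using ereal_dense2[OF y] by blast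
    hence "L - z > 0" by simp
    from both[OF this] show ?thesis
    proof eventually_elim
      case (elim \<delta>)
      have "y < ereal (L - (L - z))" using z by simp
      thus ?case using elim by (meson less_le_trans)
    qed
  qed
  have hi: "\<forall>\<^sub>F \<delta> in at_right 0. limsup (\<lambda>N. ereal (f \<delta> N)) < y" if y: "ereal L < y" for y
  proof -
    obtain z where z: "ereal L < ereal z" "ereal z < y" using ereal_dense2[OF y] by blast
    hence "z - L > 0" by simp
    from both[OF this] show ?thesis
    proof eventually_elim
      case (elim \<delta>)
      have "ereal (L + (z - L)) < y" using z by simp
      thus ?case using elim by (meson le_less_trans)
    qed
  qed
  show "((\<lambda>\<delta>. liminf (\<lambda>N. ereal (f \<delta> N))) \<longlongrightarrow> ereal L) (at_right 0)"
  proof (rule order_tendstoI)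
    show "\<forall>\<^sub>F \<delta> in at_right 0. liminf (\<lambda>N. ereal (f \<delta> N)) < y" if "ereal L < y" for y
      using hi[OF that] by (rule eventually_mono) (rule le_less_trans[OF le])
  qed (rule lo)
  show "((\<lambda>\<delta>. limsup (\<lambda>N. ereal (f \<delta> N))) \<longlongrightarrow> ereal L) (at_right 0)"
  proof (rule order_tendstoI)
    show "\<forall>\<^sub>F \<delta> in at_right 0. y < limsup (\<lambda>N. ereal (f \<delta> N))" if "y < ereal L" for y
      using lo[OF that] by (rule eventually_mono) (rule less_le_trans[OF _ le])
  qed (rule hi)
qed

lemma eventually_near_liminf_limsup:
  fixes f :: "real \<Rightarrow> nat \<Rightarrow> real"
  assumes "((\<lambda>\<delta>. liminf (\<lambda>N. ereal (f \<delta> N))) \<longlongrightarrow> ereal L) (at_right 0)"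
    and "((\<lambda>\<delta>. limsup (\<lambda>N. ereal (f \<delta> N))) \<longlongrightarrow> ereal L) (at_right 0)" and "e > 0"
  shows "\<forall>\<^sub>F \<delta> in at_right 0. \<forall>\<^sub>F N in sequentially. \<bar>f \<delta> N - L\<bar> \<le> e"
proof -
  have "\<forall>\<^sub>F \<delta> in at_right 0. ereal (L - e) < liminf (\<lambda>N. ereal (f \<delta> N))"
    by (rule order_tendstoD(1)[OF assms(1)]) (use assms(3) in simp)
  moreover have "\<forall>\<^sub>F \<delta> in at_right 0. limsup (\<lambda>N. ereal (f \<delta> N)) < ereal (L + e)"
    by (rule order_tendstoD(2)[OF assms(2)]) (use assms(3) in simp)
  ultimately show ?thesis
  proof eventually_elim
    case (elim \<delta>)
    have "\<forall>\<^sub>F N in sequentially. ereal (L - e) < ereal (f \<delta> N)" by (rule less_LiminfD[OF elim(1)])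
    moreover have "\<forall>\<^sub>F N in sequentially. ereal (f \<delta> N) < ereal (L + e)" by (rule Limsup_lessD[OF elim(2)])
    ultimately show ?case by eventually_elim (simp add: abs_le_iff)
  qed
qed

lemma sgn_tan_eq:
  fixes \<theta> n x y :: real
  assumes "n > 0" "n * cos \<theta> = x" "n * sin \<theta> = y"
  shows "sgn (tan \<theta>) = sgn x * sgn y" "\<bar>cos \<theta>\<bar> = \<bar>x\<bar> / n" "\<bar>sin \<theta>\<bar> = \<bar>y\<bar> / n"
proof -
  have xy: "cos \<theta> = x / n" "sin \<theta> = y / n" unfolding assms(2,3)[symmetric] using assms(1) by (simp_all add: less_imp_neq[THEN not_sym])
  show "\<bar>cos \<theta>\<bar> = \<bar>x\<bar> / n" "\<bar>sin \<theta>\<bar> = \<bar>y\<bar> / n" using assms(1) by (simp_all add: xy)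
  show "sgn (tan \<theta>) = sgn x * sgn y"
    using assms(1) by (auto simp: tan_def xy sgn_if zero_less_divide_iff divide_less_0_iff)
qed

text \<open>The sine changes sign between the two tangents, so the last term of the limit vanishes, while
  the tangent function has the same sign at both angles, so the two constants in
  \<open>cos\<^sup>2 = 1 - sin\<^sup>2\<close> cancel.\<close>
lemma limit_drift_opposite:
  assumes n: "n0 > 0" "n1 > 0"
    and \<theta>0: "n0 * cos \<theta>0 = - x0" "n0 * sin \<theta>0 = - y0" and \<theta>1: "n1 * cos \<theta>1 = x1" "n1 * sin \<theta>1 = y1"
    and m: "m = 1 \<or> m = -1" "q = 1 \<or> q = (-1::real)"
    and quad: "0 < - q * x0" "0 < m * y0" "0 < - q * x1" "0 < m * y1"
  defines "A0 \<equiv> \<bar>x0\<bar> / n0" and "B0 \<equiv> \<bar>y0\<bar> / n0" and "A1 \<equiv> \<bar>x1\<bar> / n1" and "B1 \<equiv> \<bar>y1\<bar> / n1"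
  shows "limit_drift C \<theta>0 \<theta>1 = m * q / 2 * ((A1 - B1) * C \<theta>1 + B1\<^sup>2 - (A0 - B0) * C \<theta>0 - B0\<^sup>2)"
proof -
  note s0 = sgn_tan_eq[OF n(1) \<theta>0] and s1 = sgn_tan_eq[OF n(2) \<theta>1]
  have sg: "sgn (tan \<theta>0) = - (m * q)" "sgn (tan \<theta>1) = - (m * q)"
    using m quad by (auto simp: s0(1) s1(1))
  have nn: "\<not> 0 < sin \<theta>0 * sin \<theta>1"
  proof -
    have "n0 * n1 * (sin \<theta>0 * sin \<theta>1) = (n0 * sin \<theta>0) * (n1 * sin \<theta>1)" by simp
    also have "\<dots> = - ((m * y0) * (m * y1))" unfolding \<theta>0 \<theta>1 using m by auto
    also have "\<dots> < 0" using mult_pos_pos[OF quad(2,4)] by simp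
    finally show ?thesis using mult_pos_pos[OF mult_pos_pos[OF n]] by (meson less_asym)
  qed
  have abs: "\<bar>cos \<theta>0\<bar> = A0" "\<bar>sin \<theta>0\<bar> = B0" "\<bar>cos \<theta>1\<bar> = A1" "\<bar>sin \<theta>1\<bar> = B1"
    using s0(2,3) s1(2,3) by (simp_all add: A0_def B0_def A1_def B1_def)
  have sq: "(cos \<theta>0)\<^sup>2 = 1 - B0\<^sup>2" "(cos \<theta>1)\<^sup>2 = 1 - B1\<^sup>2"
    unfolding abs(2,4)[symmetric] by (simp_all add: cos_squared_eq)
  show ?thesis unfolding limit_drift_def sg abs sq by (simp add: nn algebra_simps add_divide_distrib diff_divide_distrib)
qed

theorem theorem2:
  fixes P :: "config \<Rightarrow> 'w measure" and X :: "real \<Rightarrow> 'w \<Rightarrow> config"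
    and g :: "real \<Rightarrow> complex" and a :: real and \<gamma> \<Omega> V :: "complex set" and s :: complex
    and \<nu> :: "nat \<Rightarrow> config measure" and C :: "real \<Rightarrow> real"
  assumes dynamics: "zero_temp_ising P X"
    and curve: "C1_jordan_param g" "\<gamma> = range g" "\<Omega> = \<gamma> \<union> inside \<gamma>" "s = g a"
    and initial_law: "\<And>N. N \<ge> 1 \<Longrightarrow> prob_space (\<nu> N) \<and> sets (\<nu> N) = sets config_M"
    and neighbourhood: "s \<in> interior V"
    and hausdorff: "\<And>\<epsilon>::real. \<epsilon> > 0 \<Longrightarrow>
      (\<lambda>N. measure (\<nu> N) {\<sigma> \<in> space (\<nu> N). hausdorff_dist (droplet N \<sigma> \<inter> V) (\<Omega> \<inter> V) \<ge> ennreal \<epsilon>})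
        \<longlonglongrightarrow> 0"
    and monotone: "\<And>N. N \<ge> 1 \<Longrightarrow> AE \<sigma> in \<nu> N.
      (nonincreasing_in V \<gamma> \<and> nonincreasing_in V (frontier (droplet N \<sigma>))) \<or>
      (nondecreasing_in V \<gamma> \<and> nondecreasing_in V (frontier (droplet N \<sigma>)))"
    and corner_limits: "\<forall>\<^sub>F r in at_right 0. \<forall>t0 t1. arc_ends g a r t0 t1 \<longrightarrow>
      corner_density \<nu> s (g t0) (C (angle0 g t0)) \<and> corner_density \<nu> s (g t1) (C (angle1 g t1))"
    and uniform_integrability: "\<forall>\<^sub>F r in at_right 0. \<forall>t0 t1. arc_ends g a r t0 t1 \<longrightarrow>
      (\<forall>\<^sub>F \<delta> in at_right 0. uniformly_integrable_seq \<nu> (avg_drift P X s (g t0) (g t1) r \<delta>))"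
  shows "\<forall>\<^sub>F r in at_right 0. \<forall>t0 t1. arc_ends g a r t0 t1 \<longrightarrow>
      oblique (angle0 g t0) \<longrightarrow> oblique (angle1 g t1) \<longrightarrow>
      ((\<lambda>\<delta>. liminf (\<lambda>N. ereal (\<integral>\<sigma>. avg_drift P X s (g t0) (g t1) r \<delta> N \<sigma> \<partial>\<nu> N)))
         \<longlongrightarrow> ereal (limit_drift C (angle0 g t0) (angle1 g t1))) (at_right 0) \<and>
      ((\<lambda>\<delta>. limsup (\<lambda>N. ereal (\<integral>\<sigma>. avg_drift P X s (g t0) (g t1) r \<delta> N \<sigma> \<partial>\<nu> N)))
         \<longlongrightarrow> ereal (limit_drift C (angle0 g t0) (angle1 g t1))) (at_right 0)"
proof -
  interpret J: jordan_curve_param g by unfold_locales (rule curve(1))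
  have \<Omega>: "\<Omega> = range g \<union> inside (range g)" using curve by simp
  have "nonincreasing_in V \<gamma> \<or> nondecreasing_in V \<gamma>"
  proof -
    interpret M: prob_space "\<nu> 1" using initial_law[of 1] by simp
    have "AE \<sigma> in \<nu> 1. nonincreasing_in V \<gamma> \<or> nondecreasing_in V \<gamma>"
      using monotone[OF order_refl[of "1::nat"]]
    proof eventually_elim
      case (elim \<sigma>)
      thus ?case by blast
    qed
    thus ?thesis by simp
  qed
  then obtain \<kappa> :: real where \<kappa>: "\<kappa> = 1 \<or> \<kappa> = -1" "sloped \<kappa> V (range g)"
    using sloped_1[of V "range g"] sloped_minus_1[of V "range g"] unfolding curve(2) by blast
  have V: "g a \<in> interior V" using neighbourhood curve(4) by simp
  obtain m' q' :: real where mq': "m' = 1 \<or> m' = -1" "q' = 1 \<or> q' = -1" "m' * q' = \<kappa>" "0 \<le> m' * Im (J.g' a)" "0 \<le> - q' * Re (J.g' a)"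
    using J.quadrant_signs[OF \<kappa>(2,1) V] by blast
  define m :: int where "m = (if m' = 1 then 1 else -1)"
  define q :: int where "q = (if q' = 1 then 1 else -1)"
  have mq: "real_of_int m = m'" "real_of_int q = q'" using mq' by (auto simp: m_def q_def)
  interpret oriented_curve g m q by unfold_locales (simp_all add: m_def q_def)
  have mq\<kappa>: "real_of_int (m * q) = \<kappa>" using mq mq'(3) by simp
  obtain R where R: "R > 0" "ball (g a) R \<subseteq> V" using V by (auto simp: mem_interior)
  obtain \<eta>0 where \<eta>0: "\<eta>0 > 0" "\<And>\<eta>. 0 < \<eta> \<Longrightarrow> \<eta> < \<eta>0 \<Longrightarrow> g a - \<eta> *\<^sub>R Complex m' q' \<in> inside (range g)"
    using J.inside_direction[OF mq'(1,2,4,5)] by blast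
  \<comment> \<open>A point of the inside at a distance that does not depend on \<open>r\<close>; it orients the interface.\<close>
  define \<eta> where "\<eta> = min (R / 2) (\<eta>0 / 2)"
  have \<eta>: "0 < \<eta>" "2 * \<eta> \<le> R" "\<eta> < \<eta>0" using R(1) \<eta>0(1) unfolding \<eta>_def by linarith+
  have z: "g a - \<eta> *\<^sub>R Complex m q \<in> range g \<union> inside (range g)" using \<eta>0(2)[OF \<eta>(1,3)] unfolding mq by blast
  obtain \<tau> where \<tau>: "0 < \<tau>" "\<tau> < 1/2" and near: "\<And>t. \<bar>t - a\<bar> \<le> \<tau> \<Longrightarrow> t \<noteq> a \<Longrightarrow>
      0 \<le> m' * Im (J.g' t) \<and> 0 \<le> - q' * Re (J.g' t) \<and>
      norm (g t - g a) / 2 * norm (J.g' t) \<le> sgn (t - a) * Re ((g t - g a) * cnj (J.g' t)) \<and>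
      (Re (J.g' t) \<noteq> 0 \<longrightarrow> 0 < - sgn (t - a) * q' * Re (g t - g a)) \<and>
      (Im (J.g' t) \<noteq> 0 \<longrightarrow> 0 < sgn (t - a) * m' * Im (g t - g a))"
    using J.near_param[OF _ mq'(1,2) V mq'(4,5)] \<kappa>(2) mq'(3) by blast
  obtain r1 where r1: "r1 > 0" and arcs: "\<And>r t0 t1. 0 < r \<Longrightarrow> r < r1 \<Longrightarrow> arc_ends g a r t0 t1 \<Longrightarrow>
    a - \<tau> < t0 \<and> t1 < a + \<tau> \<and> norm (g t0 - g a) = r \<and> norm (g t1 - g a) = r \<and> g t0 \<noteq> g t1"
    using J.arc_ends_near[OF \<tau>] by blast
  have "0 < min r1 (\<eta> / 24)" using r1 \<eta>(1) by simp
  from eventually_at_right_real[OF this] corner_limits uniform_integrability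
  show ?thesis
  proof eventually_elim
    case (elim r)
    have r: "0 < r" "r < r1" "24 * r \<le> \<eta>" using elim(1) by auto
    show ?case
    proof (intro allI impI)
      fix t0 t1
      assume arc: "arc_ends g a r t0 t1" and ob: "oblique (angle0 g t0)" "oblique (angle1 g t1)"
      define \<theta>0 where "\<theta>0 = angle0 g t0"
      define \<theta>1 where "\<theta>1 = angle1 g t1"
      define n0 where "n0 = norm (J.g' t0)"
      define n1 where "n1 = norm (J.g' t1)"
      have n: "n0 > 0" "n1 > 0" using J.nz by (simp_all add: n0_def n1_def)
      have ang: "n0 * cos \<theta>0 = - Re (J.g' t0)" "n0 * sin \<theta>0 = - Im (J.g' t0)"
        "n1 * cos \<theta>1 = Re (J.g' t1)" "n1 * sin \<theta>1 = Im (J.g' t1)"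
        using cos_Arg2pi[of "- J.g' t0"] sin_Arg2pi[of "- J.g' t0"] cos_Arg2pi[of "J.g' t1"] sin_Arg2pi[of "J.g' t1"]
        by (simp_all add: \<theta>0_def \<theta>1_def n0_def n1_def angle0_def angle1_def J.g'_def)
      have ne: "Re (J.g' t0) \<noteq> 0" "Im (J.g' t0) \<noteq> 0" "Re (J.g' t1) \<noteq> 0" "Im (J.g' t1) \<noteq> 0"
        using ob ang n unfolding oblique_def \<theta>0_def[symmetric] \<theta>1_def[symmetric] by (metis mult_eq_0_iff neg_equal_0_iff_equal less_irrefl)+
      have t: "t0 < a" "a < t1" "sphere (g a) r \<inter> range g = {g t0, g t1}" using arc by (simp_all add: arc_ends_def)
      have ar: "a - \<tau> < t0" "t1 < a + \<tau>" "norm (g t0 - g a) = r" "norm (g t1 - g a) = r" "g t0 \<noteq> g t1"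
        using arcs[OF r(1,2) arc] by simp_all
      have np0: "\<bar>t0 - a\<bar> \<le> \<tau>" "t0 \<noteq> a" "sgn (t0 - a) = -1" and np1: "\<bar>t1 - a\<bar> \<le> \<tau>" "t1 \<noteq> a" "sgn (t1 - a) = 1"
        using t ar by auto
      have quad0: "0 < real_of_int (- q) * Re (J.g' t0)" "0 < real_of_int m * Im (J.g' t0)"
        and quad1: "0 < real_of_int (- q) * Re (J.g' t1)" "0 < real_of_int m * Im (J.g' t1)"
        using near[OF np0(1,2)] near[OF np1(1,2)] ne mq'(1,2) unfolding of_int_minus mq by (auto simp: less_le)
      have radial0: "r / 2 * norm (J.g' t0) \<le> - Re ((g t0 - g a) * cnj (J.g' t0))"
        and radial1: "r / 2 * norm (J.g' t1) \<le> Re ((g t1 - g a) * cnj (J.g' t1))"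
        using near[OF np0(1,2)] near[OF np1(1,2)] unfolding np0(3) np1(3) ar(3,4) by linarith+
      have dir: "0 < real_of_int q * Re (g t0 - g a)" "0 < real_of_int (- m) * Im (g t0 - g a)"
        "0 < real_of_int (- q) * Re (g t1 - g a)" "0 < real_of_int m * Im (g t1 - g a)"
        using near[OF np0(1,2)] near[OF np1(1,2)] ne unfolding np0(3) np1(3) of_int_minus mq by auto
      define A0 where "A0 = \<bar>Re (J.g' t0)\<bar> / n0"
      define B0 where "B0 = \<bar>Im (J.g' t0)\<bar> / n0"
      define A1 where "A1 = \<bar>Re (J.g' t1)\<bar> / n1"
      define B1 where "B1 = \<bar>Im (J.g' t1)\<bar> / n1"
      have AB: "0 \<le> A0" "A0 \<le> 1" "0 \<le> B0" "B0 \<le> 1" "0 \<le> A1" "A1 \<le> 1" "0 \<le> B1" "B1 \<le> 1"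
        using n abs_Re_le_cmod[of "J.g' t0"] abs_Im_le_cmod[of "J.g' t0"] abs_Re_le_cmod[of "J.g' t1"] abs_Im_le_cmod[of "J.g' t1"]
        by (simp_all add: A0_def B0_def A1_def B1_def n0_def n1_def)
      define L where "L = limit_drift C \<theta>0 \<theta>1"
      have L: "L = \<kappa> / 2 * ((A1 - B1) * C \<theta>1 + B1\<^sup>2 - (A0 - B0) * C \<theta>0 - B0\<^sup>2)"
        using limit_drift_opposite[OF n ang, of m' q' C] mq'(1-3) quad0 quad1
        unfolding L_def A0_def B0_def A1_def B1_def of_int_minus mq by simp
      \<comment> \<open>At an oblique point the curve is monotone in one direction only, which decides the alternative
        for the droplets.\<close>
      have slopedN: "AE \<sigma> in \<nu> N. sloped \<kappa> V (frontier (droplet N \<sigma>))" if N: "N \<ge> 1" for N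
      proof -
        have "g t0 \<in> ball (g a) R" using ar(3) r \<eta> by (simp add: dist_norm norm_minus_commute)
        hence inV: "g t0 \<in> interior V" using interior_maximal[OF R(2) open_ball] by blast
        have "\<not> sloped (- \<kappa>) V (range g)"
        proof
          assume sl: "sloped (- \<kappa>) V (range g)"
          have "- \<kappa> * Re (J.g' t0) * Im (J.g' t0) \<le> 0" by (rule J.deriv_slope[OF sl _ inV]) (use \<kappa>(1) in auto)
          moreover have "\<kappa> * Re (J.g' t0) * Im (J.g' t0) \<le> 0" by (rule J.deriv_slope[OF \<kappa>(2,1) inV])
          ultimately have "\<kappa> * Re (J.g' t0) * Im (J.g' t0) = 0" by linarith
          thus False using \<kappa>(1) ne by auto
        qed
        hence no: "\<kappa> = 1 \<Longrightarrow> \<not> nondecreasing_in V \<gamma>" "\<kappa> = -1 \<Longrightarrow> \<not> nonincreasing_in V \<gamma>"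
          using sloped_1[of V "range g"] sloped_minus_1[of V "range g"] unfolding curve(2) by auto
        show ?thesis
          using monotone[OF N]
        proof eventually_elim
          case (elim \<sigma>)
          thus ?case using \<kappa>(1) no sloped_1[of V] sloped_minus_1[of V] by auto
        qed
      qed
      define Y where "Y \<delta> = avg_drift P X s (g t0) (g t1) r \<delta>" for \<delta>
      define k0 where "k0 \<delta> N \<sigma> = real (corners s (g t0) \<delta> N \<sigma>)" for \<delta> N \<sigma>
      define k1 where "k1 \<delta> N \<sigma> = real (corners s (g t1) \<delta> N \<sigma>)" for \<delta> N \<sigma>
      have "\<forall>\<^sub>F \<delta> in at_right 0. \<forall>\<^sub>F N in sequentially. \<bar>(\<integral>\<sigma>. Y \<delta> N \<sigma> \<partial>\<nu> N) - L\<bar> \<le> e" if e: "e > 0" for e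
      proof -
        define d where "d = e / 4"
        have d: "d > 0" using e by (simp add: d_def)
        obtain \<delta>0 where \<delta>0: "\<delta>0 > 0" and path: "\<And>\<delta>. 0 < \<delta> \<Longrightarrow> \<delta> < \<delta>0 \<Longrightarrow> \<exists>\<epsilon>>0. \<exists>N0. \<forall>N\<ge>N0. \<forall>\<sigma>.
          sloped (real_of_int (m * q)) V (frontier (droplet N \<sigma>)) \<longrightarrow>
          hausdorff_dist (droplet N \<sigma> \<inter> V) ((range g \<union> inside (range g)) \<inter> V) < ennreal \<epsilon> \<longrightarrow>
          \<bar>(\<Sum>x\<in>touched N (region (g a) (g t0) (g t1) r \<delta> \<delta>). weight (g a) (g t0) (g t1) r \<delta> N x * spin_drift \<sigma> x)
            - real_of_int (m * q) / 2 * ((A1 - B1) * (real (corners (g a) (g t1) \<delta> N \<sigma>) / (\<delta> * real N)) + B1\<^sup>2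
            - (A0 - B0) * (real (corners (g a) (g t0) \<delta> N \<sigma>) / (\<delta> * real N)) - B0\<^sup>2)\<bar> \<le> d"
          using pathwise[OF R(2) \<eta>(1,2) r(3) z r(1) ar(3,4,5) t(3) quad0 quad1 radial0 radial1 dir d]
          unfolding A0_def B0_def A1_def B1_def n0_def n1_def by blast
        have cd: "corner_density \<nu> s (g t0) (C \<theta>0)" "corner_density \<nu> s (g t1) (C \<theta>1)"
          using elim(2) arc by (auto simp: \<theta>0_def \<theta>1_def)
        have c0: "\<forall>\<^sub>F \<delta> in at_right 0. \<forall>\<^sub>F N in sequentially. \<bar>1 / (\<delta> * real N) * (\<integral>\<sigma>. k0 \<delta> N \<sigma> \<partial>\<nu> N) - C \<theta>0\<bar> \<le> d"
          by (rule eventually_near_liminf_limsup[OF _ _ d]) (use cd(1) in \<open>simp_all add: corner_density_def k0_def\<close>)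
        have c1: "\<forall>\<^sub>F \<delta> in at_right 0. \<forall>\<^sub>F N in sequentially. \<bar>1 / (\<delta> * real N) * (\<integral>\<sigma>. k1 \<delta> N \<sigma> \<partial>\<nu> N) - C \<theta>1\<bar> \<le> d"
          by (rule eventually_near_liminf_limsup[OF _ _ d]) (use cd(2) in \<open>simp_all add: corner_density_def k1_def\<close>)
        have ui: "\<forall>\<^sub>F \<delta> in at_right 0. uniformly_integrable_seq \<nu> (Y \<delta>)" using elim(3) arc by (simp add: Y_def)
        have "0 < min \<delta>0 r" using \<delta>0 r by simp
        from eventually_at_right_real[OF this] c0 c1 ui show ?thesis
        proof eventually_elim
          case (elim \<delta>)
          have \<delta>: "0 < \<delta>" "\<delta> < \<delta>0" "\<delta> < r" using elim(1) by auto
          obtain \<epsilon> N0 where \<epsilon>: "\<epsilon> > 0" and path': "\<And>N \<sigma>. N0 \<le> N \<Longrightarrow> sloped \<kappa> V (frontier (droplet N \<sigma>)) \<Longrightarrow>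
            hausdorff_dist (droplet N \<sigma> \<inter> V) (\<Omega> \<inter> V) < ennreal \<epsilon> \<Longrightarrow>
            \<bar>(\<Sum>x\<in>touched N (region s (g t0) (g t1) r \<delta> \<delta>). weight s (g t0) (g t1) r \<delta> N x * spin_drift \<sigma> x)
            - \<kappa> / 2 * ((A1 - B1) * (k1 \<delta> N \<sigma> / (\<delta> * real N)) + B1\<^sup>2 - (A0 - B0) * (k0 \<delta> N \<sigma> / (\<delta> * real N)) - B0\<^sup>2)\<bar> \<le> d"
            using path[OF \<delta>(1,2)] unfolding mq\<kappa> \<Omega> k0_def k1_def curve(4) by blast
          obtain K where K: "\<And>N. N \<ge> 1 \<Longrightarrow> (\<integral>\<^sup>+\<sigma>. ennreal (\<bar>Y \<delta> N \<sigma>\<bar> * indicator {\<sigma>. \<bar>Y \<delta> N \<sigma>\<bar> > K} \<sigma>) \<partial>\<nu> N) \<le> ennreal d"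
            using elim(4) d unfolding uniformly_integrable_seq_def by blast
          define bad where "bad N = {\<sigma> \<in> space (\<nu> N). hausdorff_dist (droplet N \<sigma> \<inter> V) (\<Omega> \<inter> V) \<ge> ennreal \<epsilon>}" for N
          have "(\<lambda>N. (max K 0 + 7) * measure (\<nu> N) (bad N)) \<longlonglongrightarrow> (max K 0 + 7) * 0"
            unfolding bad_def by (intro tendsto_mult tendsto_const hausdorff[OF \<epsilon>])
          hence small: "\<forall>\<^sub>F N in sequentially. (max K 0 + 7) * measure (\<nu> N) (bad N) < d"
            using order_tendstoD(2)[of _ 0 sequentially d] d by simp
          have "\<forall>\<^sub>F N in sequentially. N \<ge> N0 + nat \<lceil>3 / \<delta>\<rceil> + 1" by (rule eventually_ge_at_top)
          with elim(2,3) small show ?case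
          proof eventually_elim
            case (elim N)
            have N: "N \<ge> 1" "N \<ge> N0" "3 / real N \<le> \<delta>"
            proof -
              show N1: "N \<ge> 1" "N \<ge> N0" using elim(4) by simp_all
              have "3 / \<delta> \<le> real N" using elim(4) by linarith
              thus "3 / real N \<le> \<delta>" using \<delta>(1) N1(1) by (simp add: field_simps)
            qed
            have prob: "prob_space (\<nu> N)" and sets: "sets (\<nu> N) = sets config_M" using initial_law[OF N(1)] by simp_all
            interpret prob_space "\<nu> N" by (rule prob)
            define Z where "Z \<sigma> = \<kappa> / 2 * ((A1 - B1) * (k1 \<delta> N \<sigma> / (\<delta> * real N)) + B1\<^sup>2 - (A0 - B0) * (k0 \<delta> N \<sigma> / (\<delta> * real N)) - B0\<^sup>2)" for \<sigma>
            have intY: "integrable (\<nu> N) (Y \<delta> N)"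
              unfolding Y_def by (rule local_fun_integrable[OF local_fun_avg_drift[OF dynamics N(1) \<delta>(1)] prob sets])
            have intk: "integrable (\<nu> N) (k0 \<delta> N)" "integrable (\<nu> N) (k1 \<delta> N)"
              unfolding k0_def k1_def by (rule local_fun_integrable[OF local_fun_corners[OF N(1)] prob sets])+
            have intZ: "integrable (\<nu> N) Z" unfolding Z_def[abs_def] using intk by simp
            have badM: "bad N \<in> sets (\<nu> N)"
            proof -
              have "(\<lambda>\<sigma>. hausdorff_dist (droplet N \<sigma> \<inter> V) (\<Omega> \<inter> V)) \<in> borel_measurable (\<nu> N)"
                using hausdorff_dist_measurable[OF N(1)] measurable_cong_sets[OF sets refl] by blast
              thus ?thesis unfolding bad_def by measurable
            qed
            have sp: "space (\<nu> N) = UNIV" using sets_eq_imp_space_eq[OF sets] by simp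
            have close: "AE \<sigma> in \<nu> N. \<sigma> \<notin> bad N \<longrightarrow> \<bar>Y \<delta> N \<sigma> - Z \<sigma>\<bar> \<le> d"
              using slopedN[OF N(1)]
            proof eventually_elim
              case (elim \<sigma>)
              show ?case
              proof
                assume "\<sigma> \<notin> bad N"
                hence "hausdorff_dist (droplet N \<sigma> \<inter> V) (\<Omega> \<inter> V) < ennreal \<epsilon>" by (simp add: bad_def sp not_le)
                from path'[OF N(2) elim this] show "\<bar>Y \<delta> N \<sigma> - Z \<sigma>\<bar> \<le> d"
                  unfolding Y_def Z_def avg_drift_eq_sum[OF dynamics N(1) \<delta>(1)] .
              qed
            qed
            have cb: "cball (g t0) (2 * \<delta>) \<subseteq> V" "cball (g t1) (2 * \<delta>) \<subseteq> V"
            proof -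
              have "y \<in> V" if "norm (y - x) \<le> 2 * \<delta>" "norm (x - g a) = r" for x y
              proof -
                have "norm (y - g a) < R" using norm_triangle_ineq[of "y - x" "x - g a"] that \<delta>(3) r \<eta> by simp
                hence "y \<in> ball (g a) R" by (simp add: dist_norm norm_minus_commute)
                thus ?thesis using R(2) by blast
              qed
              thus "cball (g t0) (2 * \<delta>) \<subseteq> V" "cball (g t1) (2 * \<delta>) \<subseteq> V"
                using ar(3,4) by (auto simp: dist_norm norm_minus_commute)
            qed
            have dN: "0 < \<delta> * real N" using \<delta>(1) N(1) by simp
            have Zb: "AE \<sigma> in \<nu> N. \<bar>Z \<sigma>\<bar> \<le> 7"
              using slopedN[OF N(1)]
            proof eventually_elim
              case (elim \<sigma>)
              have u: "0 \<le> k / (\<delta> * real N)" "k / (\<delta> * real N) \<le> 6" if "0 \<le> k" "k \<le> 6 * (\<delta> * real N)" for k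
                using that dN by (simp_all add: pos_divide_le_eq)
              \<comment> \<open>With \<open>\<bar>A - B\<bar> \<le> 1\<close> and at most \<open>6 * \<delta> * N\<close> corners, \<open>Z\<close> is at most \<open>(6 + 6 + 2) / 2\<close>.\<close>
              have "0 \<le> k0 \<delta> N \<sigma>" "k0 \<delta> N \<sigma> \<le> 6 * (\<delta> * real N)" "0 \<le> k1 \<delta> N \<sigma>" "k1 \<delta> N \<sigma> \<le> 6 * (\<delta> * real N)"
                using corners_bound[OF N(1) \<kappa>(1) elim cb(1) N(3)] corners_bound[OF N(1) \<kappa>(1) elim cb(2) N(3)]
                by (simp_all add: k0_def k1_def)
              note u0 = u[OF this(1,2)] and u1 = u[OF this(3,4)]
              have "\<bar>(A1 - B1) * (k1 \<delta> N \<sigma> / (\<delta> * real N))\<bar> \<le> 1 * 6" "\<bar>(A0 - B0) * (k0 \<delta> N \<sigma> / (\<delta> * real N))\<bar> \<le> 1 * 6"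
                unfolding abs_mult by (intro mult_mono; use AB u0 u1 in \<open>simp add: abs_le_iff\<close>)+
              moreover have "0 \<le> B0\<^sup>2" "B0\<^sup>2 \<le> 1" "0 \<le> B1\<^sup>2" "B1\<^sup>2 \<le> 1" using AB by (simp_all add: power_le_one)
              ultimately have "\<bar>(A1 - B1) * (k1 \<delta> N \<sigma> / (\<delta> * real N)) + B1\<^sup>2 - (A0 - B0) * (k0 \<delta> N \<sigma> / (\<delta> * real N)) - B0\<^sup>2\<bar> \<le> 14"
                by linarith
              moreover have "\<bar>\<kappa> / 2\<bar> = 1 / 2" using \<kappa>(1) by auto
              ultimately show ?case unfolding Z_def abs_mult by simp
            qed
            have 1: "\<bar>(\<integral>\<sigma>. Y \<delta> N \<sigma> \<partial>\<nu> N) - (\<integral>\<sigma>. Z \<sigma> \<partial>\<nu> N)\<bar> \<le> 3 * d"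
              by (rule expectation_close[OF prob intY intZ badM Zb close _ K[OF N(1)]]) (use d elim(3) in simp_all)
            define c0 where "c0 = 1 / (\<delta> * real N) * (\<integral>\<sigma>. k0 \<delta> N \<sigma> \<partial>\<nu> N)"
            define c1 where "c1 = 1 / (\<delta> * real N) * (\<integral>\<sigma>. k1 \<delta> N \<sigma> \<partial>\<nu> N)"
            have EZ: "(\<integral>\<sigma>. Z \<sigma> \<partial>\<nu> N) = \<kappa> / 2 * ((A1 - B1) * c1 + B1\<^sup>2 - (A0 - B0) * c0 - B0\<^sup>2)"
              unfolding Z_def c0_def c1_def using intk by (simp add: prob_space)
            have 2: "\<bar>(\<integral>\<sigma>. Z \<sigma> \<partial>\<nu> N) - L\<bar> \<le> d"
            proof -
              have "(\<integral>\<sigma>. Z \<sigma> \<partial>\<nu> N) - L = \<kappa> / 2 * ((A1 - B1) * (c1 - C \<theta>1) - (A0 - B0) * (c0 - C \<theta>0))"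
                unfolding EZ L by (simp add: algebra_simps)
              moreover have "\<bar>(A1 - B1) * (c1 - C \<theta>1)\<bar> \<le> 1 * d" "\<bar>(A0 - B0) * (c0 - C \<theta>0)\<bar> \<le> 1 * d"
                unfolding abs_mult using elim(1,2) AB d by (intro mult_mono; simp add: c0_def c1_def abs_le_iff)+
              moreover have "\<bar>\<kappa> / 2 * (u - v)\<bar> \<le> d" if "\<bar>u\<bar> \<le> 1 * d" "\<bar>v\<bar> \<le> 1 * d" for u v :: real
                using \<kappa>(1) that by auto
              ultimately show ?thesis by presburger
            qed
            show ?case using 1 2 unfolding d_def by linarith
          qed
        qed
      qed
      from tendsto_liminf_limsup[of "\<lambda>\<delta> N. \<integral>\<sigma>. Y \<delta> N \<sigma> \<partial>\<nu> N", OF this]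
      show "((\<lambda>\<delta>. liminf (\<lambda>N. ereal (\<integral>\<sigma>. avg_drift P X s (g t0) (g t1) r \<delta> N \<sigma> \<partial>\<nu> N)))
         \<longlongrightarrow> ereal (limit_drift C (angle0 g t0) (angle1 g t1))) (at_right 0) \<and>
        ((\<lambda>\<delta>. limsup (\<lambda>N. ereal (\<integral>\<sigma>. avg_drift P X s (g t0) (g t1) r \<delta> N \<sigma> \<partial>\<nu> N)))
         \<longlongrightarrow> ereal (limit_drift C (angle0 g t0) (angle1 g t1))) (at_right 0)"
        unfolding Y_def L_def \<theta>0_def \<theta>1_def by blast
    qed
  qed
qed

end
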